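(* Let $K$ be a field of characteristic zero, $\delta\in K$, $\mathbf r=(r_1,r_2)$ and $\mathbf p=(p_1,p_2)$ with $r_i\ge p_i\ge0$, and assume that the walled Brauer algebra $D_{\mathbf r}$ with parameter $\delta$ is semisimple. For a pair of partitions $\boldsymbol\lambda=(\lambda_1,\lambda_2)$ with $\lambda_i\vdash p_i$ put $U(\mathbf r,\boldsymbol\lambda)=\mathrm{Inf}_{\mathbf p}^{\mathbf r}(S^{\lambda_1}\otimes S^{\lambda_2})$. Then $$U\big((r_1,r_2+1),\boldsymbol\lambda\big)\downarrow^{D_{(r_1,r_2+1)}}_{D_{\mathbf r}}\cong\bigoplus_{\boldsymbol\mu}U(\mathbf r,\boldsymbol\mu),$$ where the sum is over all pairs of partitions $\boldsymbol\mu=(\mu_1,\mu_2)$ such that either $\boldsymbol\mu=(\lambda_1+\square,\lambda_2)$ or $\boldsymbol\lambda=(\mu_1,\mu_2+\square)$; here $\nu+\square$ stands for any partition obtained from $\nu$ by adding one cell.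
   Context: Walled Brauer diagrams: for $\mathbf r=(r_1,r_2)$, $\mathbf s=(s_1,s_2)$, $D(\mathbf r,\mathbf s)$ is the set of perfect matchings of the $r_1+r_2$ points on the top edge and $s_1+s_2$ points on the bottom edge of a rectangle, with a wall separating the first $r_1$ (resp. $s_1$) points from the last $r_2$ (resp. $s_2$) points, such that strands joining top to bottom do not cross the wall while strands joining two points of the same edge do. Multiplication is $x\cdot y=\delta^{c(x,y)}x\circ y$, by stacking $x$ on top of $y$, $c(x,y)$ being the number of closed loops, which are deleted. $D_{\mathbf r}$ is the algebra with basis $D(\mathbf r,\mathbf r)$; $D_{(r_1,r_2)}\subset D_{(r_1,r_2+1)}$ by adding a vertical strand at the right end. The propagating numbers $\mathbf p=(p_1,p_2)$ of a diagram are the numbers of top-to-bottom strands left and right of the wall; $D(\mathbf r,\mathbf s;\mathbf p)$ is the set of diagrams with propagating numbers $\mathbf p$. $KD(\mathbf p,\mathbf r;\mathbf p)$ is a $K(\mathfrak S_{p_1}\times\mathfrak S_{p_2})$-$D_{\mathbf r}$ bimodule (products with smaller propagating numbers are set to zero), and $\mathrm{Inf}_{\mathbf p}^{\mathbf r}V=V\otimes_{K(\mathfrak S_{p_1}\times\mathfrak S_{p_2})}KD(\mathbf p,\mathbf r;\mathbf p)$ (zero if this set of diagrams is empty). $S^\lambda$ is the irreducible representation of $\mathfrak S_{|\lambda|}$ indexed by $\lambda$. *)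

theory Defs
  imports
    "HOL-Algebra.Sym_Groups"
    "HOL-Algebra.Module"
    "HOL-Algebra.Free_Abelian_Groups"
    "HOL-Algebra.Algebraic_Closure_Type"
    "HOL-Library.Disjoint_Sets"
begin

section \<open>Right modules over rings\<close>

text \<open>
  The locale \<open>module\<close> of the library requires a commutative ring.  The record type is reused
  here for one-sided modules over an arbitrary ring \<open>A\<close>: for a right module \<open>M\<close>, the term
  \<open>a \<odot>\<^bsub>M\<^esub> m\<close> denotes \<open>m \<cdot> a\<close>, and for a left module it denotes \<open>a \<cdot> m\<close>.  The ring
  multiplication and unit fields of such a record are not used.  Modules over a unital
  \<open>K\<close>-algebra get their \<open>K\<close>-structure from the unit, so homomorphisms of modules over the
  underlying ring are automatically \<open>K\<close>-linear.
\<close>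

definition module_iso :: "('a, 'c) ring_scheme \<Rightarrow> ('a, 'm) module \<Rightarrow> ('a, 'n) module \<Rightarrow> bool"
  where "module_iso A M N \<longleftrightarrow>
    (\<exists>f \<in> iso (add_monoid M) (add_monoid N).
       \<forall>a \<in> carrier A. \<forall>m \<in> carrier M. f (a \<odot>\<^bsub>M\<^esub> m) = a \<odot>\<^bsub>N\<^esub> f m)"

definition restrict_scalars :: "('b \<Rightarrow> 'a) \<Rightarrow> ('a, 'm) module \<Rightarrow> ('b, 'm) module"
  where "restrict_scalars h M =
    \<lparr>carrier = carrier M, mult = undefined, one = undefined,
     zero = \<zero>\<^bsub>M\<^esub>, add = (\<oplus>\<^bsub>M\<^esub>), module.smult = (\<lambda>b m. h b \<odot>\<^bsub>M\<^esub> m)\<rparr>"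

definition direct_sum :: "'i set \<Rightarrow> ('i \<Rightarrow> ('a, 'm) module) \<Rightarrow> ('a, 'i \<Rightarrow> 'm) module"
  where "direct_sum I M =
    \<lparr>carrier = {f \<in> (\<Pi>\<^sub>E i\<in>I. carrier (M i)). finite {i \<in> I. f i \<noteq> \<zero>\<^bsub>M i\<^esub>}},
     mult = undefined, one = undefined,
     zero = (\<lambda>i\<in>I. \<zero>\<^bsub>M i\<^esub>),
     add = (\<lambda>f g. \<lambda>i\<in>I. f i \<oplus>\<^bsub>M i\<^esub> g i),
     module.smult = (\<lambda>a f. \<lambda>i\<in>I. a \<odot>\<^bsub>M i\<^esub> f i)\<rparr>"

text \<open>
  The library locale \<open>submodule\<close> only asks for an additive subgroup closed under the scalar
  operation; it does not presuppose commutativity of the ring.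
\<close>

definition simple_submodule :: "('a, 'c) ring_scheme \<Rightarrow> ('a, 'm) module \<Rightarrow> 'm set \<Rightarrow> bool"
  where "simple_submodule A M S \<longleftrightarrow>
    submodule S A M \<and> S \<noteq> {\<zero>\<^bsub>M\<^esub>} \<and>
    (\<forall>N. submodule N A M \<and> N \<subseteq> S \<longrightarrow> N = {\<zero>\<^bsub>M\<^esub>} \<or> N = S)"

definition semisimple_module :: "('a, 'c) ring_scheme \<Rightarrow> ('a, 'm) module \<Rightarrow> bool"
  where "semisimple_module A M \<longleftrightarrow>
    generate (add_monoid M) (\<Union>{S. simple_submodule A M S}) = carrier M"

definition right_regular :: "('a, 'c) ring_scheme \<Rightarrow> ('a, 'a) module"
  where "right_regular A =
    \<lparr>carrier = carrier A, mult = undefined, one = undefined,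
     zero = \<zero>\<^bsub>A\<^esub>, add = (\<oplus>\<^bsub>A\<^esub>), module.smult = (\<lambda>a m. m \<otimes>\<^bsub>A\<^esub> a)\<rparr>"

definition semisimple_ring :: "('a, 'c) ring_scheme \<Rightarrow> bool"
  where "semisimple_ring A \<longleftrightarrow> semisimple_module A (right_regular A)"


section \<open>Tensor products\<close>

text \<open>
  \<open>M\<close> is a right and \<open>N\<close> a left \<open>A\<close>-module; \<open>M \<otimes>\<^sub>A N\<close> is the free abelian group on the pairs
  \<open>(m, n)\<close> modulo the subgroup generated by the usual relations.
\<close>

definition tensor_relations ::
  "('a, 'c) ring_scheme \<Rightarrow> ('a, 'm) module \<Rightarrow> ('a, 'n) module \<Rightarrow> ('m \<times> 'n \<Rightarrow>\<^sub>0 int) set"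
  where "tensor_relations A M N =
    {frag_of (m \<oplus>\<^bsub>M\<^esub> m', n) - frag_of (m, n) - frag_of (m', n) |m m' n.
        m \<in> carrier M \<and> m' \<in> carrier M \<and> n \<in> carrier N} \<union>
    {frag_of (m, n \<oplus>\<^bsub>N\<^esub> n') - frag_of (m, n) - frag_of (m, n') |m n n'.
        m \<in> carrier M \<and> n \<in> carrier N \<and> n' \<in> carrier N} \<union>
    {frag_of (a \<odot>\<^bsub>M\<^esub> m, n) - frag_of (m, a \<odot>\<^bsub>N\<^esub> n) |a m n.
        a \<in> carrier A \<and> m \<in> carrier M \<and> n \<in> carrier N}"

text \<open>
  The argument \<open>act\<close> describes the scalar operation on \<open>M \<otimes>\<^sub>A N\<close>: the element \<open>b\<close> sends
  \<open>m \<otimes> n\<close> to the class of \<open>act b (m, n)\<close>.  If the additive extension of \<open>act b\<close> maps the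
  subgroup \<open>R\<close> of relations into itself, then \<open>smult b\<close> maps the coset of \<open>x\<close> to the coset of
  the image of \<open>x\<close>.
\<close>

definition tensor_product ::
  "('a, 'c) ring_scheme \<Rightarrow> ('a, 'm) module \<Rightarrow> ('a, 'n) module \<Rightarrow>
   ('b \<Rightarrow> 'm \<times> 'n \<Rightarrow> ('m \<times> 'n \<Rightarrow>\<^sub>0 int)) \<Rightarrow> ('b, ('m \<times> 'n \<Rightarrow>\<^sub>0 int) set) module"
  where "tensor_product A M N act =
    (let F = free_Abelian_group (carrier M \<times> carrier N);
         R = generate F (tensor_relations A M N)
     in \<lparr>carrier = carrier (F Mod R), mult = undefined, one = undefined,
         zero = \<one>\<^bsub>F Mod R\<^esub>, add = (\<otimes>\<^bsub>F Mod R\<^esub>),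
         module.smult = (\<lambda>b C. set_mult F R (frag_extend (act b) ` C))\<rparr>)"

text \<open>
  For an \<open>A\<close>-\<open>B\<close> bimodule, given by a left \<open>A\<close>-module \<open>N\<close> and a right \<open>B\<close>-module \<open>N'\<close> with the
  same additive group, \<open>M \<otimes>\<^sub>A N\<close> is a right \<open>B\<close>-module.
\<close>

definition bimodule_tensor ::
  "('a, 'c) ring_scheme \<Rightarrow> ('a, 'm) module \<Rightarrow> ('a, 'n) module \<Rightarrow> ('b, 'n) module \<Rightarrow>
   ('b, ('m \<times> 'n \<Rightarrow>\<^sub>0 int) set) module"
  where "bimodule_tensor A M N N' =
    tensor_product A M N (\<lambda>b (m, n). frag_of (m, b \<odot>\<^bsub>N'\<^esub> n))"


section \<open>Group algebras and outer tensor products\<close>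

text \<open>
  The vector space \<open>KB\<close> with basis a finite set \<open>B\<close> is represented by the functions to \<open>K\<close>
  vanishing outside \<open>B\<close>.
\<close>

definition free_space :: "'x set \<Rightarrow> ('x \<Rightarrow> 'k::zero) set"
  where "free_space B = {f. \<forall>x. x \<notin> B \<longrightarrow> f x = 0}"

definition single :: "'x \<Rightarrow> 'k::zero \<Rightarrow> 'x \<Rightarrow> 'k"
  where "single x c = (\<lambda>y. if y = x then c else 0)"

definition linear_extension :: "'x set \<Rightarrow> ('x \<Rightarrow> 'y) \<Rightarrow> ('x \<Rightarrow> 'k::comm_monoid_add) \<Rightarrow> 'y \<Rightarrow> 'k"
  where "linear_extension B h f = (\<lambda>y. \<Sum>x\<in>B. if h x = y then f x else 0)"

definition group_algebra :: "('g, 'c) monoid_scheme \<Rightarrow> ('g \<Rightarrow> 'k::field) ring"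
  where "group_algebra G =
    \<lparr>carrier = free_space (carrier G),
     mult = (\<lambda>a b z. \<Sum>x\<in>carrier G. \<Sum>y\<in>carrier G. if x \<otimes>\<^bsub>G\<^esub> y = z then a x * b y else 0),
     one = single \<one>\<^bsub>G\<^esub> 1,
     zero = (\<lambda>_. 0), add = (\<lambda>a b z. a z + b z)\<rparr>"

text \<open>
  For right modules \<open>M\<close> over \<open>KG\<close> and \<open>N\<close> over \<open>KH\<close>, the right \<open>K(G \<times> H)\<close>-module \<open>M \<otimes>\<^sub>K N\<close>
  with \<open>(m \<otimes> n) \<cdot> (g, h) = m g \<otimes> n h\<close>.
\<close>

definition outer_tensor ::
  "('g, 'c) monoid_scheme \<Rightarrow> ('g \<Rightarrow> 'k::field, 'm) module \<Rightarrow>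
   ('h, 'd) monoid_scheme \<Rightarrow> ('h \<Rightarrow> 'k, 'n) module \<Rightarrow>
   ('g \<times> 'h \<Rightarrow> 'k, ('m \<times> 'n \<Rightarrow>\<^sub>0 int) set) module"
  where "outer_tensor G M H N =
    tensor_product (ring_of_type_algebra :: 'k ring)
      (restrict_scalars (single \<one>\<^bsub>G\<^esub>) M) (restrict_scalars (single \<one>\<^bsub>H\<^esub>) N)
      (\<lambda>a (m, n). \<Sum>(g, h) \<in> carrier G \<times> carrier H.
         frag_of (single g (a (g, h)) \<odot>\<^bsub>M\<^esub> m, single h 1 \<odot>\<^bsub>N\<^esub> n))"


section \<open>Partitions and Specht modules\<close>

definition is_partition :: "nat list \<Rightarrow> bool"
  where "is_partition lam \<longleftrightarrow> sorted_wrt (\<ge>) lam \<and> 0 \<notin> set lam"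

definition partition_of :: "nat list \<Rightarrow> nat \<Rightarrow> bool"
  where "partition_of lam n \<longleftrightarrow> is_partition lam \<and> sum_list lam = n"

definition cells :: "nat list \<Rightarrow> (nat \<times> nat) set"
  where "cells lam = {(i, j). i < length lam \<and> j < lam ! i}"

definition adds_cell :: "nat list \<Rightarrow> nat list \<Rightarrow> bool"
  where "adds_cell nu mu \<longleftrightarrow> (\<exists>c. c \<notin> cells nu \<and> cells mu = insert c (cells nu))"

definition tableaux :: "nat list \<Rightarrow> (nat \<times> nat \<Rightarrow> nat) set"
  where "tableaux lam =
    {t \<in> extensional (cells lam). bij_betw t (cells lam) {1..sum_list lam}}"

text \<open>A tabloid is recorded as the function sending the index of a row to its set of entries.\<close>

definition tabloid :: "nat list \<Rightarrow> (nat \<times> nat \<Rightarrow> nat) \<Rightarrow> nat \<Rightarrow> nat set"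
  where "tabloid lam t = (\<lambda>i. t ` {c \<in> cells lam. fst c = i})"

definition column_stabilizer :: "nat list \<Rightarrow> (nat \<times> nat \<Rightarrow> nat) \<Rightarrow> (nat \<Rightarrow> nat) set"
  where "column_stabilizer lam t =
    {\<sigma>. \<sigma> permutes {1..sum_list lam} \<and>
        (\<forall>j. \<sigma> ` t ` {c \<in> cells lam. snd c = j} = t ` {c \<in> cells lam. snd c = j})}"

definition polytabloid ::
  "nat list \<Rightarrow> (nat \<times> nat \<Rightarrow> nat) \<Rightarrow> (nat \<Rightarrow> nat set) \<Rightarrow> 'k::field"
  where "polytabloid lam t =
    (\<lambda>T. \<Sum>\<sigma>\<in>column_stabilizer lam t.
       if tabloid lam (\<sigma> \<circ> t) = T then of_int (sign \<sigma>) else 0)"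

text \<open>
  The Specht module, spanned by the polytabloids.  As products in \<open>sym_group\<close> are composed
  from right to left, the right action of a permutation \<open>\<sigma>\<close> sends a tabloid \<open>T\<close> to
  \<open>\<sigma>\<inverse>T\<close>, that is, a function \<open>f\<close> on tabloids to \<open>T \<mapsto> f (\<sigma>T)\<close>.
\<close>

definition specht ::
  "nat list \<Rightarrow> ((nat \<Rightarrow> nat) \<Rightarrow> 'k::field, (nat \<Rightarrow> nat set) \<Rightarrow> 'k) module"
  where "specht lam =
    \<lparr>carrier = {f. \<exists>c. f = (\<lambda>T. \<Sum>t\<in>tableaux lam. c t * polytabloid lam t T)},
     mult = undefined, one = undefined,
     zero = (\<lambda>_. 0), add = (\<lambda>f g T. f T + g T),
     module.smult = (\<lambda>a f T. \<Sum>\<sigma>\<in>carrier (sym_group (sum_list lam)). a \<sigma> * f (\<lambda>i. \<sigma> ` T i))\<rparr>"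


section \<open>Walled Brauer diagrams\<close>

text \<open>
  The point \<open>(0, i)\<close> is the \<open>i\<close>-th point of the top edge and \<open>(1, i)\<close> the \<open>i\<close>-th point of
  the bottom edge, counted from the left starting with 1.  A strand is the set of its two end
  points.
\<close>

type_synonym diagram = "(nat \<times> nat) set set"

definition points :: "nat \<times> nat \<Rightarrow> nat \<times> nat \<Rightarrow> (nat \<times> nat) set"
  where "points r s = {0} \<times> {1..fst r + snd r} \<union> {1} \<times> {1..fst s + snd s}"

definition left_of_wall :: "nat \<times> nat \<Rightarrow> nat \<times> nat \<Rightarrow> nat \<times> nat \<Rightarrow> bool"
  where "left_of_wall r s v \<longleftrightarrow> snd v \<le> (if fst v = 0 then fst r else fst s)"

definition walled_diagrams :: "nat \<times> nat \<Rightarrow> nat \<times> nat \<Rightarrow> diagram set"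
  where "walled_diagrams r s =
    {d. partition_on (points r s) d \<and>
        (\<forall>b\<in>d. \<exists>u v. u \<noteq> v \<and> b = {u, v} \<and>
           (if fst u = fst v then left_of_wall r s u \<noteq> left_of_wall r s v
            else left_of_wall r s u = left_of_wall r s v))}"

definition propagating :: "nat \<times> nat \<Rightarrow> diagram \<Rightarrow> nat \<times> nat"
  where "propagating r d =
    (card {b \<in> d. \<exists>i j. b = {(0, i), (1, j)} \<and> i \<le> fst r},
     card {b \<in> d. \<exists>i j. b = {(0, i), (1, j)} \<and> i > fst r})"

definition walled_diagrams_prop :: "nat \<times> nat \<Rightarrow> nat \<times> nat \<Rightarrow> nat \<times> nat \<Rightarrow> diagram set"
  where "walled_diagrams_prop r s p = {d \<in> walled_diagrams r s. propagating r d = p}"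

text \<open>
  Stacking \<open>x\<close> on top of \<open>y\<close> gives a graph on three rows 0, 1, 2 of points, whose connected
  components are the strands of \<open>x \<circ> y\<close> together with the closed loops; the latter are the
  components contained in row 1.
\<close>

definition stack_components :: "diagram \<Rightarrow> diagram \<Rightarrow> (nat \<times> nat) set set"
  where "stack_components x y =
    (let E = x \<union> (\<lambda>b. (\<lambda>(k, i). (k + 1, i)) ` b) ` y
     in (\<lambda>u. {(v, w). {v, w} \<in> E}\<^sup>* `` {u}) ` \<Union>E)"

definition diagram_comp :: "diagram \<Rightarrow> diagram \<Rightarrow> diagram"
  where "diagram_comp x y =
    (\<lambda>C. (\<lambda>(k, i). (if k = 0 then 0 else 1, i)) ` {v \<in> C. fst v \<noteq> 1}) `
      {C \<in> stack_components x y. \<exists>v\<in>C. fst v \<noteq> 1}"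

definition loops :: "diagram \<Rightarrow> diagram \<Rightarrow> nat"
  where "loops x y = card {C \<in> stack_components x y. \<forall>v\<in>C. fst v = 1}"

text \<open>
  The bilinear extension of \<open>x \<cdot> y = \<delta>\<^sup>c x \<circ> y\<close>, \<open>c = loops x y\<close>, to \<open>KP \<times> KQ\<close>, with the
  diagrams outside of \<open>R\<close> set to zero.
\<close>

definition diagram_mult ::
  "'k::field \<Rightarrow> diagram set \<Rightarrow> diagram set \<Rightarrow> diagram set \<Rightarrow>
   (diagram \<Rightarrow> 'k) \<Rightarrow> (diagram \<Rightarrow> 'k) \<Rightarrow> diagram \<Rightarrow> 'k"
  where "diagram_mult \<delta> P Q R f g =
    (\<lambda>z. if z \<in> R
         then \<Sum>x\<in>P. \<Sum>y\<in>Q. if diagram_comp x y = z then \<delta> ^ loops x y * (f x * g y) else 0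
         else 0)"

definition identity_diagram :: "nat \<times> nat \<Rightarrow> diagram"
  where "identity_diagram r = (\<lambda>i. {(0, i), (1, i)}) ` {1..fst r + snd r}"

definition walled_brauer :: "'k::field \<Rightarrow> nat \<times> nat \<Rightarrow> (diagram \<Rightarrow> 'k) ring"
  where "walled_brauer \<delta> r =
    \<lparr>carrier = free_space (walled_diagrams r r),
     mult = diagram_mult \<delta> (walled_diagrams r r) (walled_diagrams r r) (walled_diagrams r r),
     one = single (identity_diagram r) 1,
     zero = (\<lambda>_. 0), add = (\<lambda>f g d. f d + g d)\<rparr>"

text \<open>The inclusion of \<open>D\<^bsub>(r\<^sub>1, r\<^sub>2)\<^esub>\<close> into \<open>D\<^bsub>(r\<^sub>1, r\<^sub>2 + 1)\<^esub>\<close>.\<close>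

definition add_strand :: "nat \<times> nat \<Rightarrow> diagram \<Rightarrow> diagram"
  where "add_strand r d =
    insert {(0, fst r + snd r + 1), (1, fst r + snd r + 1)} d"

definition walled_brauer_incl ::
  "nat \<times> nat \<Rightarrow> (diagram \<Rightarrow> 'k::field) \<Rightarrow> diagram \<Rightarrow> 'k"
  where "walled_brauer_incl r = linear_extension (walled_diagrams r r) (add_strand r)"


section \<open>Inflation\<close>

abbreviation sym_group2 :: "nat \<times> nat \<Rightarrow> ((nat \<Rightarrow> nat) \<times> (nat \<Rightarrow> nat)) monoid"
  where "sym_group2 p \<equiv> sym_group (fst p) \<times>\<times> sym_group (snd p)"

text \<open>
  The identification of \<open>\<SS>\<^bsub>p\<^sub>1\<^esub> \<times> \<SS>\<^bsub>p\<^sub>2\<^esub>\<close> with the diagrams in \<open>D(p, p; p)\<close>.  A permutation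
  \<open>\<sigma>\<close> joins the bottom point \<open>i\<close> to the top point \<open>\<sigma> i\<close>; in this way stacking corresponds
  to the product \<open>\<sigma> \<circ> \<tau>\<close> of \<open>sym_group\<close>.
\<close>

definition perm_diagram :: "nat \<times> nat \<Rightarrow> (nat \<Rightarrow> nat) \<times> (nat \<Rightarrow> nat) \<Rightarrow> diagram"
  where "perm_diagram p g =
    (\<lambda>i. {(0, fst g i), (1, i)}) ` {1..fst p} \<union>
    (\<lambda>j. {(0, fst p + snd g j), (1, fst p + j)}) ` {1..snd p}"

text \<open>
  The bimodule \<open>KD(p, r; p)\<close> as a left module over \<open>K(\<SS>\<^bsub>p\<^sub>1\<^esub> \<times> \<SS>\<^bsub>p\<^sub>2\<^esub>)\<close> and as a right module over
  the walled Brauer algebra.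
\<close>

definition diagram_module_left ::
  "'k::field \<Rightarrow> nat \<times> nat \<Rightarrow> nat \<times> nat \<Rightarrow>
   ((nat \<Rightarrow> nat) \<times> (nat \<Rightarrow> nat) \<Rightarrow> 'k, diagram \<Rightarrow> 'k) module"
  where "diagram_module_left \<delta> p r =
    \<lparr>carrier = free_space (walled_diagrams_prop p r p), mult = undefined, one = undefined,
     zero = (\<lambda>_. 0), add = (\<lambda>f g d. f d + g d),
     module.smult = (\<lambda>a. diagram_mult \<delta>
       (walled_diagrams_prop p p p) (walled_diagrams_prop p r p) (walled_diagrams_prop p r p)
       (linear_extension (carrier (sym_group2 p)) (perm_diagram p) a))\<rparr>"

definition diagram_module_right ::
  "'k::field \<Rightarrow> nat \<times> nat \<Rightarrow> nat \<times> nat \<Rightarrow> (diagram \<Rightarrow> 'k, diagram \<Rightarrow> 'k) module"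
  where "diagram_module_right \<delta> p r =
    \<lparr>carrier = free_space (walled_diagrams_prop p r p), mult = undefined, one = undefined,
     zero = (\<lambda>_. 0), add = (\<lambda>f g d. f d + g d),
     module.smult = (\<lambda>a f. diagram_mult \<delta>
       (walled_diagrams_prop p r p) (walled_diagrams r r) (walled_diagrams_prop p r p) f a)\<rparr>"

definition inflation ::
  "'k::field \<Rightarrow> nat \<times> nat \<Rightarrow> nat \<times> nat \<Rightarrow>
   ((nat \<Rightarrow> nat) \<times> (nat \<Rightarrow> nat) \<Rightarrow> 'k, 'm) module \<Rightarrow>
   (diagram \<Rightarrow> 'k, ('m \<times> (diagram \<Rightarrow> 'k) \<Rightarrow>\<^sub>0 int) set) module"
  where "inflation \<delta> p r V =
    bimodule_tensor (group_algebra (sym_group2 p)) V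
      (diagram_module_left \<delta> p r) (diagram_module_right \<delta> p r)"

definition U_module where
  "U_module (\<delta> :: 'k::field) r lam =
    (let n1 = sum_list (fst lam); n2 = sum_list (snd lam)
     in inflation \<delta> (n1, n2) r
          (outer_tensor (sym_group n1) (specht (fst lam) :: (_ \<Rightarrow> 'k, _) module)
                        (sym_group n2) (specht (snd lam) :: (_ \<Rightarrow> 'k, _) module)))"

definition branching_set :: "nat list \<times> nat list \<Rightarrow> (nat list \<times> nat list) set"
  where "branching_set lam =
    {mu. is_partition (fst mu) \<and> is_partition (snd mu) \<and>
         (adds_cell (fst lam) (fst mu) \<and> snd mu = snd lam \<or>
          fst mu = fst lam \<and> adds_cell (snd mu) (snd lam))}"

end

theory Submission
 imports Defs "HOL-Library.Function_Algebras"
begin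

text \<open>
 The Specht modules are the images of explicit symmetric idempotent kernels on tabloids.  This turns
 \<open>U(r, lam)\<close> into the space of functions on pairs of tabloids and diagrams without strands joining two
 top points that are equivariant under permutations of the top points.  Bending the last bottom point
 up to a new last top point \<open>v\<close> left of the wall, the restriction of \<open>U((r1, r2 + 1), lam)\<close> becomes a
 space of functions on diagrams in which every strand joining two top points ends in \<open>v\<close>.  The functions
 supported on the diagrams in which such a strand exists form a submodule, given by restricting the
 Specht module of \<open>lam2\<close> to permutations of one point less; the quotient is given by inducing that
 of \<open>lam1\<close> to one point more.
 Semisimplicity splits the extension.  The branching rules for symmetric groups come from Bessel
 inequalities for explicit intertwiners, which counting dimensions along Young's lattice shows to be
 equalities.
\<close>

text \<open>The orientation of strands explains the asymmetry of the sum. Every strand joins a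
  positive to a negative point, where top points left and bottom points right of the wall are
  positive. The last bottom point is positive, so it can be bent to the top only on the left side.
  Joined to the bottom, it acts as one more top point on the left and makes room for a cell of
  \<open>lam1\<close>; joined to a top point on the right, it takes one point away from
  \<open>lam2\<close>.

  The kernels have rational entries although \<open>K\<close> is any field of characteristic zero.
  Over \<open>rat\<close> a sum of squares vanishes only if every term does. This replaces
  characters and hermitian forms: it makes the constants in Schur's lemma nonzero and turns an
  equality of traces into an equality of projections. The identities are carried to \<open>K\<close>
  by \<open>of_rat\<close>.

  Semisimplicity is used once, for an equivariant projection onto the submodule. All other maps are
  explicit, with inverses given by formulas; no dimension of a module over the walled Brauer algebra
  is ever computed.\<close>

type_synonym tab2 = "(nat => nat set) \<times> (nat => nat set)"

abbreviation WD :: "nat * nat => nat * nat => diagram set"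
 where "WD == walled_diagrams"

section \<open>Polytabloids\<close>

definition tab_act :: "(nat => nat) => (nat => nat set) => nat => nat set"
 where "tab_act sg T = (\<lambda>i. sg ` T i)"

lemma tab_act_comp: "tab_act (sg \<circ> ta) T = tab_act sg (tab_act ta T)"
 by (simp add: tab_act_def image_comp)

lemma tab_act_id [simp]: "tab_act id T = T"
 by (simp add: tab_act_def)

lemma tab_act_inv:
 assumes "sg permutes A"
 shows "tab_act (inv' sg) (tab_act sg T) = T" "tab_act sg (tab_act (inv' sg) T) = T"
 using assms by (simp_all add: tab_act_comp[symmetric] permutes_inv_o)

lemma cells_Sigma: "cells lam = Sigma {..<length lam} (\<lambda>i. {..<lam ! i})"
 by (auto simp: cells_def)

lemma finite_cells [simp]: "finite (cells lam)"
 by (simp add: cells_Sigma)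

lemma card_cells: "card (cells lam) = sum_list lam"
 by (simp add: cells_Sigma sum_list_sum_nth atLeast0LessThan)

text \<open>\<open>tableaux\<close> also asks for extensionality, which keeps it finite but is lost
  on composing with a permutation. This version is stable under \<open>sg \<circ> t\<close>;
  tabloids and polytabloids see only the values on the cells, so \<open>restrict\<close> leads
  back.\<close>

definition is_tab :: "nat list => (nat \<times> nat => nat) => bool"
 where "is_tab lam t \<longleftrightarrow> bij_betw t (cells lam) {1..sum_list lam}"

definition tabs :: "nat list => (nat => nat set) set"
 where "tabs lam = tabloid lam ` tableaux lam"

lemma tableaux_is_tab: "t \<in> tableaux lam ==> is_tab lam t"
 by (simp add: tableaux_def is_tab_def)

lemma is_tab_restrict: "is_tab lam t ==> restrict t (cells lam) \<in> tableaux lam"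
 by (auto simp: is_tab_def tableaux_def cong: bij_betw_cong)

lemma tabloid_cong: "(\<And>c. c \<in> cells lam ==> t c = t' c) ==> tabloid lam t = tabloid lam t'"
 unfolding tabloid_def by (intro ext image_cong) auto

lemma tabloid_restrict: "tabloid lam (restrict t (cells lam)) = tabloid lam t"
 by (rule tabloid_cong) simp

lemma tabloid_in_tabs: "is_tab lam t ==> tabloid lam t \<in> tabs lam"
 unfolding tabs_def by (metis image_eqI is_tab_restrict tabloid_restrict)

lemma tabsE:
 assumes "T \<in> tabs lam" obtains t where "is_tab lam t" "T = tabloid lam t"
 using assms tableaux_is_tab by (auto simp: tabs_def)

lemma finite_tableaux [simp]: "finite (tableaux lam)"
proof -
 have "tableaux lam \<subseteq> (cells lam) \<rightarrow>\<^sub>E {1..sum_list lam}"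
  by (auto simp: tableaux_def PiE_def bij_betw_def)
 thus ?thesis
  by (rule finite_subset) (simp add: finite_PiE)
qed

lemma finite_tabs [simp]: "finite (tabs lam)"
 by (simp add: tabs_def)

lemma is_tab_exists: "\<exists>t. is_tab lam t"
 unfolding is_tab_def by (rule finite_same_card_bij) (simp_all add: card_cells)

lemma is_tab_comp:
 assumes "is_tab lam t" "sg permutes {1..sum_list lam}"
 shows "is_tab lam (sg \<circ> t)"
 using assms unfolding is_tab_def by (blast intro: bij_betw_trans permutes_imp_bij)

lemma is_tab_transitive:
 assumes "is_tab lam t" "is_tab lam t'"
 obtains sg where "sg permutes {1..sum_list lam}" "\<And>c. c \<in> cells lam ==> t' c = sg (t c)"
proof -
 let ?N = "{1..sum_list lam}"
 let ?s = "t' \<circ> inv_into (cells lam) t"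
 have b: "bij_betw ?s ?N ?N"
  using assms unfolding is_tab_def by (blast intro: bij_betw_trans bij_betw_inv_into)
 let ?sg = "\<lambda>x. if x \<in> ?N then ?s x else x"
 have "?sg permutes ?N"
  using b by (intro bij_imp_permutes) (simp_all only: if_True if_False cong: bij_betw_cong)
 moreover have "t' c = ?sg (t c)" if "c \<in> cells lam" for c
  using assms that unfolding is_tab_def
  by (metis (no_types, lifting) bij_betwE bij_betw_inv_into_left comp_apply)
 ultimately show thesis by (rule that)
qed

lemma tabloid_comp: "tabloid lam (sg \<circ> t) = tab_act sg (tabloid lam t)"
 by (simp add: tabloid_def tab_act_def image_comp)

lemma tab_act_tabs:
 assumes "T \<in> tabs lam" "sg permutes {1..sum_list lam}"
 shows "tab_act sg T \<in> tabs lam"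
 using assms by (metis is_tab_comp tabloid_comp tabloid_in_tabs tabsE)

lemma tab_act_tabs_iff:
 assumes "sg permutes {1..sum_list lam}"
 shows "tab_act sg T \<in> tabs lam \<longleftrightarrow> T \<in> tabs lam"
 using assms tab_act_tabs permutes_inv tab_act_inv by metis

lemma bij_tab_act:
 assumes "sg permutes {1..sum_list lam}"
 shows "bij_betw (tab_act sg) (tabs lam) (tabs lam)"
 by (rule bij_betw_byWitness[where f' = "tab_act (inv' sg)"])
  (use assms in \<open>auto simp: tab_act_inv tab_act_tabs permutes_inv\<close>)

lemma sum_tabs_act:
 assumes "sg permutes {1..sum_list lam}"
 shows "(\<Sum>T\<in>tabs lam. f (tab_act sg T)) = (\<Sum>T\<in>tabs lam. f T)"
 by (rule sum.reindex_bij_betw[OF bij_tab_act[OF assms]])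

section \<open>Polytabloids and column stabilizers\<close>

definition ptab :: "nat list => (nat \<times> nat => nat) => (nat => nat set) => rat"
 where "ptab = polytabloid"

text \<open>The coefficients are sums of signs, so they may be computed in \<open>rat\<close>, where
  an order is available, and mapped to \<open>K\<close> at the end.\<close>

lemma polytabloid_of_rat: "polytabloid lam t T = (of_rat (ptab lam t T) :: 'k::field_char_0)"
 unfolding polytabloid_def ptab_def by (simp add: of_rat_sum if_distrib cong: if_cong)

lemma column_stabilizer_cong:
 assumes "\<And>c. c \<in> cells lam ==> t c = t' c"
 shows "column_stabilizer lam t = column_stabilizer lam t'"
proof -
 have "t ` {c \<in> cells lam. snd c = j} = t' ` {c \<in> cells lam. snd c = j}" for j
  using assms by (intro image_cong) auto
 thus ?thesis by (simp add: column_stabilizer_def)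
qed

lemma ptab_cong:
 assumes "\<And>c. c \<in> cells lam ==> t c = t' c"
 shows "ptab lam t = ptab lam t'"
proof -
 have "tabloid lam (sg \<circ> t) = tabloid lam (sg \<circ> t')" for sg
  using assms by (intro tabloid_cong) simp
 thus ?thesis
  using column_stabilizer_cong[OF assms] by (simp add: ptab_def polytabloid_def)
qed

lemma ptab_restrict [simp]: "ptab lam (restrict t (cells lam)) = ptab lam t"
 by (rule ptab_cong) simp

lemma column_stabilizer_permutes:
 "sg \<in> column_stabilizer lam t ==> sg permutes {1..sum_list lam}"
 by (simp add: column_stabilizer_def)

lemma column_stabilizer_image:
 "sg \<in> column_stabilizer lam t ==>
  sg ` t ` {c \<in> cells lam. snd c = j} = t ` {c \<in> cells lam. snd c = j}"
 by (simp add: column_stabilizer_def)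

lemma finite_column_stabilizer [simp]: "finite (column_stabilizer lam t)"
 by (rule finite_subset[OF _ finite_permutations[of "{1..sum_list lam}"]])
  (auto simp: column_stabilizer_def)

lemma id_column_stabilizer [simp]: "id \<in> column_stabilizer lam t"
 by (simp add: column_stabilizer_def permutes_id)

lemma column_stabilizer_comp:
 assumes "sg \<in> column_stabilizer lam t" "ta \<in> column_stabilizer lam t"
 shows "sg \<circ> ta \<in> column_stabilizer lam t"
proof -
 have "(sg \<circ> ta) ` A = sg ` ta ` A" for A by (simp add: image_image)
 hence "(sg \<circ> ta) ` t ` {c \<in> cells lam. snd c = j} = t ` {c \<in> cells lam. snd c = j}" for j
  by (simp only: column_stabilizer_image[OF assms(1)] column_stabilizer_image[OF assms(2)])
 moreover have "sg \<circ> ta permutes {1..sum_list lam}"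
  by (intro permutes_compose column_stabilizer_permutes[OF assms(1)]
    column_stabilizer_permutes[OF assms(2)])
 ultimately show ?thesis unfolding column_stabilizer_def by blast
qed

lemma column_stabilizer_inv:
 assumes "sg \<in> column_stabilizer lam t"
 shows "inv' sg \<in> column_stabilizer lam t"
proof -
 have p: "sg permutes {1..sum_list lam}" by (rule column_stabilizer_permutes[OF assms])
 have "inv' sg ` t ` {c \<in> cells lam. snd c = j} = t ` {c \<in> cells lam. snd c = j}" for j
 proof -
  have "inv' sg ` sg ` A = A" for A by (simp add: image_image permutes_inverses[OF p])
  thus ?thesis by (metis (no_types) column_stabilizer_image[OF assms])
 qed
 with p show ?thesis by (simp add: column_stabilizer_def permutes_inv)
qed

lemma permutes_permutation: "sg permutes {1..n::nat} ==> permutation sg"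
 unfolding permutation_permutes by blast

lemma bij_column_stabilizer_conj:
 assumes s: "sg permutes {1..sum_list lam}"
 shows "bij_betw (\<lambda>pm. sg \<circ> pm \<circ> inv' sg) (column_stabilizer lam t) (column_stabilizer lam (sg \<circ> t))"
proof (rule bij_betw_byWitness[where f' = "\<lambda>pm. inv' sg \<circ> pm \<circ> sg"])
 have i1: "inv' sg (sg x) = x" "sg (inv' sg x) = x" for x
  using s by (simp_all add: permutes_inverses)
 show "\<forall>pm\<in>column_stabilizer lam t. inv' sg \<circ> (sg \<circ> pm \<circ> inv' sg) \<circ> sg = pm"
  "\<forall>pm\<in>column_stabilizer lam (sg \<circ> t). sg \<circ> (inv' sg \<circ> pm \<circ> sg) \<circ> inv' sg = pm"
  by (auto simp: fun_eq_iff i1)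
 have im: "(sg \<circ> t) ` A = sg ` t ` A" for A by (simp add: image_comp)
 show "(\<lambda>pm. sg \<circ> pm \<circ> inv' sg) ` column_stabilizer lam t \<subseteq> column_stabilizer lam (sg \<circ> t)"
 proof safe
  fix pm assume p: "pm \<in> column_stabilizer lam t"
  have "(sg \<circ> pm \<circ> inv' sg) ` (sg \<circ> t) ` {c \<in> cells lam. snd c = j}
    = sg ` pm ` t ` {c \<in> cells lam. snd c = j}" for j
   by (auto simp: image_image i1)
  also have "... j = (sg \<circ> t) ` {c \<in> cells lam. snd c = j}" for j
   by (simp only: column_stabilizer_image[OF p] im)
  finally show "sg \<circ> pm \<circ> inv' sg \<in> column_stabilizer lam (sg \<circ> t)"
   using permutes_compose[OF permutes_inv[OF s] permutes_compose[OF column_stabilizer_permutes[OF p] s]]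
   unfolding column_stabilizer_def by (simp add: comp_assoc)
 qed
 show "(\<lambda>pm. inv' sg \<circ> pm \<circ> sg) ` column_stabilizer lam (sg \<circ> t) \<subseteq> column_stabilizer lam t"
 proof safe
  fix pm assume p: "pm \<in> column_stabilizer lam (sg \<circ> t)"
  have "(inv' sg \<circ> pm \<circ> sg) ` t ` {c \<in> cells lam. snd c = j}
    = inv' sg ` pm ` (sg \<circ> t) ` {c \<in> cells lam. snd c = j}" for j
   by (auto simp: image_image)
  also have "... j = inv' sg ` (sg \<circ> t) ` {c \<in> cells lam. snd c = j}" for j
   using column_stabilizer_image[OF p] by simp
  also have "... j = t ` {c \<in> cells lam. snd c = j}" for j
   by (auto simp: image_image i1)
  finally show "inv' sg \<circ> pm \<circ> sg \<in> column_stabilizer lam t"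
   using permutes_compose[OF s permutes_compose[OF column_stabilizer_permutes[OF p] permutes_inv[OF s]]]
   unfolding column_stabilizer_def by (simp add: comp_assoc)
 qed
qed

lemma tab_act_inj:
 assumes "sg permutes A"
 shows "tab_act sg S = tab_act sg T \<longleftrightarrow> S = T"
 using assms by (metis tab_act_inv(1))

text \<open>Conjugation by \<open>sg\<close> carries the column stabilizer of \<open>t\<close> to
  that of \<open>sg \<circ> t\<close> and preserves signs.\<close>

lemma ptab_equivariant:
 assumes s: "sg permutes {1..sum_list lam}"
 shows "ptab lam (sg \<circ> t) (tab_act sg T) = ptab lam t T"
proof -
 have sg: "sign (sg \<circ> pm \<circ> inv' sg) = sign pm" if "pm \<in> column_stabilizer lam t" for pm
 proof -
  have "permutation sg" "permutation pm" "permutation (inv' sg)"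
   using s column_stabilizer_permutes[OF that] permutes_permutation permutes_inv by blast+
  thus ?thesis
   by (simp add: sign_compose permutation_compose sign_inverse)
 qed
 have tb: "tabloid lam ((sg \<circ> pm \<circ> inv' sg) \<circ> (sg \<circ> t)) = tab_act sg (tabloid lam (pm \<circ> t))" for pm
 proof -
  have "(sg \<circ> pm \<circ> inv' sg) \<circ> (sg \<circ> t) = sg \<circ> (pm \<circ> t)"
   using s by (simp add: fun_eq_iff permutes_inverses)
  thus ?thesis by (simp add: tabloid_comp)
 qed
 show ?thesis
  unfolding ptab_def polytabloid_def
  by (subst sum.reindex_bij_betw[OF bij_column_stabilizer_conj[OF s], symmetric])
   (auto intro!: sum.cong simp: tb sg tab_act_inj[OF s])
qed

text \<open>Left translation by \<open>sg\<close> permutes the column stabilizer and multiplies all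
  signs by \<open>sign sg\<close>.\<close>

lemma ptab_antisymmetric:
 assumes s: "sg \<in> column_stabilizer lam t"
 shows "ptab lam t (tab_act sg T) = of_int (sign sg) * ptab lam t T"
proof -
 have p: "sg permutes {1..sum_list lam}" by (rule column_stabilizer_permutes[OF s])
 have b: "bij_betw ((\<circ>) sg) (column_stabilizer lam t) (column_stabilizer lam t)"
  by (rule bij_betw_byWitness[where f' = "(\<circ>) (inv' sg)"])
   (use s p in \<open>auto simp: fun_eq_iff permutes_inverses column_stabilizer_comp column_stabilizer_inv\<close>)
 have sg: "sign (sg \<circ> pm) = sign sg * sign pm" if "pm \<in> column_stabilizer lam t" for pm
  using p column_stabilizer_permutes[OF that] permutes_permutation by (blast intro: sign_compose)
 have tb: "tabloid lam ((sg \<circ> pm) \<circ> t) = tab_act sg (tabloid lam (pm \<circ> t))" for pm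
  by (simp add: tabloid_comp tab_act_comp)
 show ?thesis
  unfolding ptab_def polytabloid_def
  by (subst sum.reindex_bij_betw[OF b, symmetric])
   (auto intro!: sum.cong simp: tb sg tab_act_inj[OF p] sum_distrib_left)
qed

section \<open>Row weights, and functions antisymmetric under a column stabilizer\<close>

definition row_index :: "nat list => (nat \<times> nat => nat) => nat => nat"
 where "row_index mu s a = fst (inv_into (cells mu) s a)"

lemma row_index_apply: "is_tab mu s ==> c \<in> cells mu ==> row_index mu s (s c) = fst c"
 unfolding is_tab_def row_index_def by (metis bij_betw_inv_into_left)

lemma tabloid_row_index:
 assumes "is_tab mu s"
 shows "tabloid mu s i = {a \<in> {1..sum_list mu}. row_index mu s a = i}"
proof -
 have im: "s ` cells mu = {1..sum_list mu}"
  using assms by (simp add: is_tab_def bij_betw_def)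
 show ?thesis
  unfolding tabloid_def im[symmetric] by (auto simp: row_index_apply[OF assms])
qed

text \<open>Induction on the cardinality, removing the maximum \<open>M\<close>: as \<open>A\<close>
  lies in \<open>{..M}\<close>, it satisfies \<open>M \<ge> card A - 1\<close>, and a minimal total
  forces equality here.\<close>

lemma sum_lessThan_card_le:
 fixes A :: "nat set"
 assumes "finite A"
 shows "\<Sum>{..<card A} \<le> \<Sum>A \<and> (\<Sum>A = \<Sum>{..<card A} \<longrightarrow> A = {..<card A})"
 using assms
proof (induction "card A" arbitrary: A)
 case 0
 thus ?case by simp
next
 case (Suc k)
 define M where "M = Max A"
 have ne: "A \<noteq> {}" using Suc.hyps(2) by auto
 have M: "M \<in> A" "A \<subseteq> {..M}" using Suc.prems ne by (auto simp: M_def)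
 have "card A \<le> card {..M}" using M(2) by (intro card_mono) auto
 hence kM: "k \<le> M" using Suc.hyps(2) by simp
 have c: "card (A - {M}) = k" using Suc.hyps(2) M(1) Suc.prems by simp
 have IH: "\<Sum>{..<k} \<le> \<Sum>(A - {M}) \<and> (\<Sum>(A - {M}) = \<Sum>{..<k} \<longrightarrow> A - {M} = {..<k})"
  using Suc.hyps(1)[of "A - {M}"] c Suc.prems by auto
 have sA: "\<Sum>A = M + \<Sum>(A - {M})" using M(1) Suc.prems by (simp add: sum.remove)
 have sk: "\<Sum>{..<Suc k} = k + \<Sum>{..<k}" by simp
 have "A = {..<Suc k}" if "\<Sum>A = \<Sum>{..<Suc k}"
 proof -
  have "M = k" "\<Sum>(A - {M}) = \<Sum>{..<k}" using that sA sk IH kM by linarith+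
  hence "A - {k} = {..<k}" "k \<in> A" using IH M(1) by auto
  thus ?thesis by (auto simp: lessThan_Suc)
 qed
 moreover have "\<Sum>{..<Suc k} \<le> \<Sum>A" using sA sk IH kM by linarith
 ultimately show ?case using Suc.hyps(2) by metis
qed

text \<open>The statistic n(\<lambda>), the sum of i \<lambda>_i with rows counted from 0. It stands
  in for the dominance order: inequalities of this number in both directions are enough to identify
  two shapes in Schur's lemma.\<close>

definition row_weight :: "nat list => nat"
 where "row_weight lam = (\<Sum>c\<in>cells lam. fst c)"

lemma cells_down_closed:
 assumes "is_partition lam" "(i, j) \<in> cells lam" "i' \<le> i" "j' \<le> j"
 shows "(i', j') \<in> cells lam"
proof -
 have "lam ! i \<le> lam ! i'"
  using assms sorted_wrt_nth_less[of "(\<ge>)" lam i' i]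
  by (cases "i' = i") (auto simp: is_partition_def cells_def)
 thus ?thesis using assms by (auto simp: cells_def)
qed

text \<open>A function that is injective on every column has total value at least the row weight,
 because a set of \<open>k\<close> natural numbers has sum at least \<open>0 + ... + (k - 1)\<close>.\<close>

lemma row_weight_le_sum:
 assumes lam: "is_partition lam"
  and inj: "\<And>j. inj_on h {c \<in> cells lam. snd c = j}"
 shows "row_weight lam \<le> (\<Sum>c\<in>cells lam. h c)"
  and "(\<Sum>c\<in>cells lam. h c) = row_weight lam ==>
   bij_betw (\<lambda>c. (h c, snd c)) (cells lam) (cells lam)"
proof -
 define col where "col j = {c \<in> cells lam. snd c = j}" for j
 have fin: "finite (col j)" for j by (simp add: col_def)
 have inj_fst: "inj_on fst (col j)" for j by (auto simp: inj_on_def col_def)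
 \<comment> \<open>Down-closedness makes the rows met by a column an initial segment, the set on
   which the minimal sum is attained.\<close>
 have fst_col: "fst ` col j = {..<card (col j)}" for j
 proof -
  have "\<exists>k. fst ` col j = {..<k}"
  proof -
   have d: "i' \<in> fst ` col j" if "i \<in> fst ` col j" "i' \<le> i" for i i'
    using that cells_down_closed[OF lam, of i j i' j] by (force simp: col_def)
   define k where "k = (LEAST k. k \<notin> fst ` col j)"
   have "\<exists>k. k \<notin> fst ` col j"
    using fin[of j] by (meson finite_imageI ex_new_if_finite infinite_UNIV_nat)
   hence k: "k \<notin> fst ` col j" unfolding k_def by (rule LeastI_ex)
   have "i \<in> fst ` col j" if "i < k" for i
    using not_less_Least that unfolding k_def by blast
   moreover have "i < k" if "i \<in> fst ` col j" for i
    using d[OF that] k by (meson not_le)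
   ultimately show ?thesis by blast
  qed
  then obtain k where "fst ` col j = {..<k}" by blast
  thus ?thesis using card_image[OF inj_fst[of j]] by simp
 qed
 have card_h: "card (h ` col j) = card (col j)" for j
  using inj by (simp add: card_image col_def)
 have split: "(\<Sum>c\<in>cells lam. g c) = (\<Sum>j\<in>snd ` cells lam. \<Sum>c\<in>col j. g c)" for g :: "nat \<times> nat => nat"
  unfolding col_def by (rule sum.image_gen) simp
 have f: "(\<Sum>c\<in>col j. fst c) = \<Sum>{..<card (col j)}" for j
  using sum.reindex[OF inj_fst[of j], of id] fst_col[of j] by simp
 have h: "(\<Sum>c\<in>col j. h c) = \<Sum>(h ` col j)" for j
  using sum.reindex[of h "col j" id] inj by (simp add: col_def)
 have le: "(\<Sum>c\<in>col j. fst c) \<le> (\<Sum>c\<in>col j. h c)" for j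
  using sum_lessThan_card_le[of "h ` col j"] fin card_h f h by simp
 thus "row_weight lam \<le> (\<Sum>c\<in>cells lam. h c)"
  unfolding row_weight_def split by (intro sum_mono le)
 assume eq: "(\<Sum>c\<in>cells lam. h c) = row_weight lam"
 \<comment> \<open>Every column contributes at least its minimum, so equality of the totals forces
   equality in each column, where the values then form the initial segment.\<close>
 have eqj: "h ` col j = fst ` col j" if j: "j \<in> snd ` cells lam" for j
 proof -
  have "(\<Sum>c\<in>col j. h c) = (\<Sum>c\<in>col j. fst c)"
  proof (rule ccontr)
   assume "\<not> ?thesis"
   hence "(\<Sum>c\<in>col j. fst c) < (\<Sum>c\<in>col j. h c)" using le[of j] by linarith
   hence "(\<Sum>j\<in>snd ` cells lam. \<Sum>c\<in>col j. fst c) < (\<Sum>j\<in>snd ` cells lam. \<Sum>c\<in>col j. h c)"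
    using j le by (intro sum_strict_mono_ex1) auto
   thus False using eq unfolding row_weight_def split by simp
  qed
  thus ?thesis
   using sum_lessThan_card_le[of "h ` col j"] fin card_h f h fst_col by simp
 qed
 let ?g = "\<lambda>c. (h c, snd c)"
 have "inj_on ?g (cells lam)"
  using inj unfolding inj_on_def by auto
 moreover have "?g ` cells lam \<subseteq> cells lam"
 proof safe
  fix i j assume c: "(i, j) \<in> cells lam"
  hence "h (i, j) \<in> h ` col j" by (auto simp: col_def)
  also have "... = fst ` col j" using c by (intro eqj) force
  finally show "(h (i, j), snd (i, j)) \<in> cells lam" by (auto simp: col_def)
 qed
 ultimately show "bij_betw ?g (cells lam) (cells lam)"
  by (simp add: bij_betw_def endo_inj_surj)
qed

definition rowlen :: "nat list => nat => nat"
 where "rowlen lam i = (if i < length lam then lam ! i else 0)"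

lemma cells_rowlen: "(i, j) \<in> cells lam \<longleftrightarrow> j < rowlen lam i"
 by (auto simp: cells_def rowlen_def)

text \<open>Parts are nonzero, so the length of the list is visible in its row lengths.\<close>

lemma cells_inj:
 assumes "is_partition lam" "is_partition mu" "cells lam = cells mu"
 shows "lam = mu"
proof -
 have pos: "lam ! i > 0" if "i < length lam" "is_partition lam" for i and lam :: "nat list"
  using that by (metis gr0I is_partition_def nth_mem)
 have "rowlen lam i = rowlen mu i" for i
  using assms(3) cells_rowlen by (metis linorder_neqE_nat less_irrefl)
 hence r: "rowlen lam = rowlen mu" by auto
 have "i < length lam \<longleftrightarrow> i < length mu" for i
  using fun_cong[OF r, of i] pos[of i lam] pos[of i mu] assms(1,2)
  by (auto simp: rowlen_def split: if_splits)
 hence l: "length lam = length mu" by (metis linorder_neqE_nat less_irrefl)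
 show ?thesis
  using r l by (intro nth_equalityI) (auto simp: rowlen_def fun_eq_iff split: if_splits)
qed

lemma card_row: "card {c \<in> cells lam. fst c = i} = rowlen lam i"
proof -
 have "{c \<in> cells lam. fst c = i} = Pair i ` {..<rowlen lam i}"
  by (auto simp: cells_rowlen)
 thus ?thesis by (simp add: card_image inj_on_def)
qed

lemma sum_row_index:
 assumes t: "is_tab lam t" and s: "is_tab mu s" and n: "sum_list lam = sum_list mu"
 shows "(\<Sum>c\<in>cells lam. row_index mu s (t c)) = row_weight mu"
proof -
 have "(\<Sum>c\<in>cells lam. row_index mu s (t c)) = (\<Sum>a\<in>{1..sum_list mu}. row_index mu s a)"
  using t n unfolding is_tab_def by (metis sum.reindex_bij_betw)
 also have "... = (\<Sum>c\<in>cells mu. row_index mu s (s c))"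
  using s unfolding is_tab_def by (metis sum.reindex_bij_betw)
 finally show ?thesis by (simp add: row_weight_def row_index_apply[OF s])
qed

text \<open>Row \<open>i\<close> of \<open>mu\<close> has as many entries as there are cells of
  \<open>lam\<close> that \<open>t\<close> fills with entries from that row; the bijection matches
  these cells with row \<open>i\<close> of \<open>lam\<close>.\<close>

lemma shape_eqI:
 assumes lam: "is_partition lam" and mu: "is_partition mu"
  and t: "is_tab lam t" and s: "is_tab mu s" and n: "sum_list lam = sum_list mu"
  and b: "bij_betw (\<lambda>c. (row_index mu s (t c), snd c)) (cells lam) (cells lam)"
 shows "lam = mu"
proof -
 let ?h = "\<lambda>c. row_index mu s (t c)"
 have "rowlen lam i = rowlen mu i" for i
 proof -
  have "bij_betw (\<lambda>c. (?h c, snd c)) {c \<in> cells lam. ?h c = i} {c \<in> cells lam. fst c = i}"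
  proof (rule bij_betw_subset[OF b])
   have "(\<lambda>c. (?h c, snd c)) ` {c \<in> cells lam. ?h c = i} =
     {c \<in> (\<lambda>c. (?h c, snd c)) ` cells lam. fst c = i}" by auto
   thus "(\<lambda>c. (?h c, snd c)) ` {c \<in> cells lam. ?h c = i} = {c \<in> cells lam. fst c = i}"
    by (simp only: bij_betw_imp_surj_on[OF b])
  qed auto
  from bij_betw_same_card[OF this] have "rowlen lam i = card {c \<in> cells lam. ?h c = i}"
   by (simp only: card_row)
  also have "... = card (t ` {c \<in> cells lam. ?h c = i})"
   using t by (intro card_image[symmetric]) (auto simp: is_tab_def bij_betw_def inj_on_def)
  also have "t ` {c \<in> cells lam. ?h c = i} = {a \<in> t ` cells lam. row_index mu s a = i}"
   by auto
  also have "... = s ` {c \<in> cells mu. fst c = i}"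
  proof -
   have "t ` cells lam = s ` cells mu" using t s n by (simp add: is_tab_def bij_betw_def)
   thus ?thesis using row_index_apply[OF s] by auto
  qed
  also have "card ... = rowlen mu i"
   using s by (subst card_image) (auto simp: card_row is_tab_def bij_betw_def inj_on_def)
  finally show ?thesis .
 qed
 hence "cells lam = cells mu" by (auto simp: cells_rowlen)
 with lam mu show ?thesis by (rule cells_inj)
qed

text \<open>If two entries shared a column of \<open>t\<close> and a row of \<open>s\<close>, their
  transposition would fix the tabloid of \<open>s\<close> and yet reverse the sign of its value,
  which would be zero.\<close>

lemma antisymmetric_collision:
 assumes t: "is_tab lam t" and s: "is_tab mu s" and n: "sum_list lam = sum_list mu"
  and anti: "\<And>sg. sg \<in> column_stabilizer lam t ==>
   f (tab_act sg (tabloid mu s)) = of_int (sign sg) * (f (tabloid mu s) :: rat)"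
  and nz: "f (tabloid mu s) \<noteq> 0"
 shows "inj_on (\<lambda>c. row_index mu s (t c)) {c \<in> cells lam. snd c = j}"
proof (rule inj_onI)
 fix c d assume cd: "c \<in> {c \<in> cells lam. snd c = j}" "d \<in> {c \<in> cells lam. snd c = j}"
  and eq: "row_index mu s (t c) = row_index mu s (t d)"
 show "c = d"
 proof (rule ccontr)
  assume "c \<noteq> d"
  hence ne: "t c \<noteq> t d" using t cd by (auto simp: is_tab_def bij_betw_def inj_on_def)
  have r: "t c \<in> {1..sum_list lam}" "t d \<in> {1..sum_list lam}"
   using t cd by (auto simp: is_tab_def bij_betw_def)
  let ?ta = "transpose (t c) (t d)"
  have perm: "?ta permutes {1..sum_list lam}" using r by (rule permutes_swap_id)
  have tr: "?ta ` A = A" if "t c \<in> A \<longleftrightarrow> t d \<in> A" for A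
   using that by (auto simp: transpose_def image_iff split: if_splits)
  have "t c \<in> t ` {c \<in> cells lam. snd c = k} \<longleftrightarrow> t d \<in> t ` {c \<in> cells lam. snd c = k}" for k
  proof -
   have "t x \<in> t ` {c \<in> cells lam. snd c = k} \<longleftrightarrow> snd x = k" if "x \<in> cells lam" for x
    using t that by (auto simp: is_tab_def bij_betw_def inj_on_def)
   thus ?thesis using cd by auto
  qed
  hence "?ta \<in> column_stabilizer lam t"
   using perm tr by (auto simp: column_stabilizer_def)
  hence "f (tab_act ?ta (tabloid mu s)) = - f (tabloid mu s)"
   using anti ne by (simp add: sign_swap_id)
  moreover have "tab_act ?ta (tabloid mu s) = tabloid mu s"
   unfolding tab_act_def using r eq n
   by (intro ext tr) (simp add: tabloid_row_index[OF s])
  ultimately show False using nz by simp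
 qed
qed

text \<open>The bijection allows every entry of \<open>t\<close> to be moved within its column to
  the row in which \<open>s\<close> has it; this produces the rows of \<open>s\<close>.\<close>

lemma tabloid_column_orbit:
 assumes t: "is_tab lam t" and s: "is_tab lam s"
  and b: "bij_betw (\<lambda>c. (row_index lam s (t c), snd c)) (cells lam) (cells lam)"
 obtains sg where "sg \<in> column_stabilizer lam t" "tabloid lam s = tab_act sg (tabloid lam t)"
proof -
 let ?ph = "\<lambda>c. (row_index lam s (t c), snd c)"
 define ps where "ps = inv_into (cells lam) ?ph"
 have bpsi: "bij_betw ps (cells lam) (cells lam)"
  unfolding ps_def by (rule bij_betw_inv_into[OF b])
 have psi: "ps c \<in> cells lam" "?ph (ps c) = c" if "c \<in> cells lam" for c
  using that b bpsi unfolding ps_def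
  by (auto simp: bij_betw_def) (metis (mono_tags, lifting) f_inv_into_f)
 have "is_tab lam (t \<circ> ps)"
  using t bpsi unfolding is_tab_def by (blast intro: bij_betw_trans)
 from is_tab_transitive[OF t this] obtain sg
  where p: "sg permutes {1..sum_list lam}" and c: "\<And>c. c \<in> cells lam ==> (t \<circ> ps) c = sg (t c)"
  by blast
 have "sg ` t ` {c \<in> cells lam. snd c = j} = t ` {c \<in> cells lam. snd c = j}" for j
 proof -
  have "snd (ps c) = snd c" if "c \<in> cells lam" for c
   using arg_cong[OF psi(2)[OF that], of snd] by simp
  hence "ps ` {c \<in> cells lam. snd c = j} = {c \<in> cells lam. snd c = j}"
  proof (intro subset_antisym subsetI)
   fix x assume x: "x \<in> {c \<in> cells lam. snd c = j}"
   hence "x \<in> ps ` cells lam" using bij_betw_imp_surj_on[OF bpsi] by simp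
   then obtain y where "y \<in> cells lam" "x = ps y" by blast
   thus "x \<in> ps ` {c \<in> cells lam. snd c = j}"
    using x \<open>\<And>c. c \<in> cells lam ==> snd (ps c) = snd c\<close> by auto
  qed (use psi(1) \<open>\<And>c. c \<in> cells lam ==> snd (ps c) = snd c\<close> in auto)
  moreover have "sg ` t ` {c \<in> cells lam. snd c = j} = t ` ps ` {c \<in> cells lam. snd c = j}"
   using c by (auto simp: image_image intro!: image_cong)
  ultimately show ?thesis by simp
 qed
 hence "sg \<in> column_stabilizer lam t" using p by (simp add: column_stabilizer_def)
 moreover have "tabloid lam s = tab_act sg (tabloid lam t)"
 proof
  fix i
  have "tab_act sg (tabloid lam t) i = t ` ps ` {c \<in> cells lam. fst c = i}"
   using c by (auto simp: tab_act_def tabloid_def image_image intro!: image_cong)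
  also have "ps ` {c \<in> cells lam. fst c = i} = {c \<in> cells lam. row_index lam s (t c) = i}"
  proof (intro subset_antisym subsetI)
   fix x assume "x \<in> ps ` {c \<in> cells lam. fst c = i}"
   thus "x \<in> {c \<in> cells lam. row_index lam s (t c) = i}"
    using psi by (auto simp: prod_eq_iff)
  next
   fix x assume x: "x \<in> {c \<in> cells lam. row_index lam s (t c) = i}"
   hence "?ph x \<in> {c \<in> cells lam. fst c = i}" using b by (auto simp: bij_betw_def)
   moreover have "ps (?ph x) = x"
    using x b unfolding ps_def by (intro bij_betw_inv_into_left) auto
   ultimately show "x \<in> ps ` {c \<in> cells lam. fst c = i}" by force
  qed
  also have "t ` ... = {a \<in> t ` cells lam. row_index lam s a = i}" by auto
  also have "... = tabloid lam s i"
   using t by (simp add: tabloid_row_index[OF s] is_tab_def bij_betw_def)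
  finally show "tabloid lam s i = tab_act sg (tabloid lam t) i" ..
 qed
 ultimately show thesis by (rule that)
qed

text \<open>Only the identity preserves both the columns and the rows of \<open>t\<close>, since a
  cell is determined by its row and its column.\<close>

lemma ptab_diag:
 assumes t: "is_tab lam t"
 shows "ptab lam t (tabloid lam t) = 1"
proof -
 have "sg = id" if s: "sg \<in> column_stabilizer lam t" and e: "tabloid lam (sg \<circ> t) = tabloid lam t" for sg
 proof
  fix a
  have p: "sg permutes {1..sum_list lam}" by (rule column_stabilizer_permutes[OF s])
  show "sg a = id a"
  proof (cases "a \<in> {1..sum_list lam}")
   case True
   hence "a \<in> t ` cells lam" using t by (simp add: is_tab_def bij_betw_def)
   then obtain c where c: "c \<in> cells lam" "a = t c" by blast
   have "sg a \<in> tabloid lam (sg \<circ> t) (fst c)" using c by (auto simp: tabloid_def)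
   then obtain d where d: "d \<in> cells lam" "fst d = fst c" "sg a = t d"
    unfolding e by (auto simp: tabloid_def)
   have "sg a \<in> sg ` t ` {d \<in> cells lam. snd d = snd c}" using c by auto
   then obtain d' where d': "d' \<in> cells lam" "snd d' = snd c" "sg a = t d'"
    unfolding column_stabilizer_image[OF s] by auto
   have "d = d'" using t d d' by (auto simp: is_tab_def bij_betw_def inj_on_def)
   hence "d = c" using d d' by (simp add: prod_eq_iff)
   thus ?thesis using d c by simp
  next
   case False
   thus ?thesis using p by (simp add: permutes_not_in)
  qed
 qed
 hence "ptab lam t (tabloid lam t) =
   (\<Sum>sg\<in>column_stabilizer lam t. if sg = id then 1 else 0)"
  unfolding ptab_def polytabloid_def by (intro sum.cong) (auto simp: sign_id)
 thus ?thesis by simp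
qed

text \<open>By \<open>antisymmetric_collision\<close> the map sending a cell of \<open>lam\<close>
  to the row of \<open>T\<close> that contains its entry is injective on columns. Its total over all
  cells is the row weight of \<open>mu\<close>, whatever the tableau.\<close>

lemma antisymmetric_shape:
 assumes lam: "is_partition lam" and mu: "is_partition mu"
  and t: "is_tab lam t" and T: "T \<in> tabs mu" and n: "sum_list lam = sum_list mu"
  and anti: "\<And>sg. sg \<in> column_stabilizer lam t ==>
   f (tab_act sg T) = of_int (sign sg) * (f T :: rat)"
  and nz: "f T \<noteq> 0"
 shows "row_weight lam \<le> row_weight mu" and "row_weight lam = row_weight mu ==> lam = mu"
proof -
 obtain s where s: "is_tab mu s" "T = tabloid mu s" using T by (rule tabsE)
 have inj: "inj_on (\<lambda>c. row_index mu s (t c)) {c \<in> cells lam. snd c = j}" for j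
  using antisymmetric_collision[OF t s(1) n, of f] anti nz s(2) by blast
 note w = row_weight_le_sum[OF lam inj] sum_row_index[OF t s(1) n]
 show "row_weight lam \<le> row_weight mu" using w(1,3) by simp
 show "lam = mu" if "row_weight lam = row_weight mu"
  using shape_eqI[OF lam mu t s(1) n] w that by simp
qed

text \<open>A form of the classical fact that a column antisymmetrizer sends every tabloid to a
  multiple of the polytabloid. Both sides vanish off the column orbit of the tabloid of
  \<open>t\<close>, transform in the same way along it, and agree at its base point, where
  \<open>ptab\<close> is 1.\<close>

lemma antisymmetric_multiple:
 assumes lam: "is_partition lam" and t: "is_tab lam t" and T: "T \<in> tabs lam"
  and anti: "\<And>sg T. sg \<in> column_stabilizer lam t ==> T \<in> tabs lam ==>
   f (tab_act sg T) = of_int (sign sg) * (f T :: rat)"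
 shows "f T = f (tabloid lam t) * ptab lam t T"
proof -
 obtain s where s: "is_tab lam s" "T = tabloid lam s" using T by (rule tabsE)
 have *: "\<exists>sg\<in>column_stabilizer lam t. T = tab_act sg (tabloid lam t)"
  if "g T \<noteq> 0" "\<And>sg. sg \<in> column_stabilizer lam t ==>
   g (tab_act sg T) = of_int (sign sg) * (g T :: rat)" for g
 proof -
  have inj: "inj_on (\<lambda>c. row_index lam s (t c)) {c \<in> cells lam. snd c = j}" for j
   using antisymmetric_collision[OF t s(1) refl, of g] that s(2) by blast
  have "bij_betw (\<lambda>c. (row_index lam s (t c), snd c)) (cells lam) (cells lam)"
   using row_weight_le_sum(2)[OF lam inj] sum_row_index[OF t s(1) refl] by simp
  from tabloid_column_orbit[OF t s(1) this] s(2) show ?thesis by blast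
 qed
 show ?thesis
 proof (cases "f T \<noteq> 0 \<or> ptab lam t T \<noteq> 0")
  case True
  then obtain sg where "sg \<in> column_stabilizer lam t" "T = tab_act sg (tabloid lam t)"
   using *[of f] *[of "ptab lam t"] anti T ptab_antisymmetric by blast
  thus ?thesis
   using anti tabloid_in_tabs[OF t] ptab_diag[OF t] ptab_antisymmetric by simp
 qed simp
qed

section \<open>The projection onto a Specht module\<close>

lemma sum_mult_assoc:
 fixes a :: "'x => 'k::comm_semiring_0"
 shows "(\<Sum>y\<in>B. (\<Sum>x\<in>A. a x * b x y) * c y) = (\<Sum>x\<in>A. a x * (\<Sum>y\<in>B. b x y * c y))"
 by (simp add: sum_distrib_left sum_distrib_right mult.assoc sum.swap[of _ A])

lemma ptab_support:
 assumes "is_tab lam t" "T \<notin> tabs lam"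
 shows "ptab lam t T = 0"
proof -
 have "tabloid lam (sg \<circ> t) \<noteq> T" if "sg \<in> column_stabilizer lam t" for sg
  using assms is_tab_comp[OF assms(1) column_stabilizer_permutes[OF that]] tabloid_in_tabs by blast
 thus ?thesis unfolding ptab_def polytabloid_def by simp
qed

text \<open>The sum of the rank-one kernels of all polytabloids. It is symmetric and equivariant
  with image in the Specht module, so that only a scalar separates it from the projection.\<close>

definition gram :: "nat list => (nat => nat set) => (nat => nat set) => rat"
 where "gram lam S T = (\<Sum>t\<in>tableaux lam. ptab lam t S * ptab lam t T)"

lemma gram_sym: "gram lam S T = gram lam T S"
 by (simp add: gram_def mult.commute)

lemma gram_support: "S \<notin> tabs lam ==> gram lam S T = 0"
 by (simp add: gram_def ptab_support tableaux_is_tab)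

lemma bij_tableaux_act:
 assumes s: "sg permutes {1..sum_list lam}"
 shows "bij_betw (\<lambda>t. restrict (sg \<circ> t) (cells lam)) (tableaux lam) (tableaux lam)"
proof (rule bij_betw_byWitness[where f' = "\<lambda>t. restrict (inv' sg \<circ> t) (cells lam)"])
 have e: "restrict t (cells lam) = t" if "t \<in> tableaux lam" for t
  using that by (simp add: tableaux_def extensional_restrict)
 have a: "restrict (f \<circ> restrict (g \<circ> t) (cells lam)) (cells lam) = t"
  if "t \<in> tableaux lam" "\<And>x. f (g x) = x" for f g :: "nat => nat" and t
 proof -
  have "restrict (f \<circ> restrict (g \<circ> t) (cells lam)) (cells lam) = restrict t (cells lam)"
   using that(2) by (auto simp: restrict_def fun_eq_iff)
  thus ?thesis using e[OF that(1)] by simp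
 qed
 show "\<forall>t\<in>tableaux lam. restrict (inv' sg \<circ> restrict (sg \<circ> t) (cells lam)) (cells lam) = t"
  "\<forall>t\<in>tableaux lam. restrict (sg \<circ> restrict (inv' sg \<circ> t) (cells lam)) (cells lam) = t"
  using a s by (simp_all add: permutes_inverses)
 show "(\<lambda>t. restrict (sg \<circ> t) (cells lam)) ` tableaux lam \<subseteq> tableaux lam"
  "(\<lambda>t. restrict (inv' sg \<circ> t) (cells lam)) ` tableaux lam \<subseteq> tableaux lam"
  using s permutes_inv[OF s] is_tab_comp is_tab_restrict tableaux_is_tab by blast+
qed

lemma gram_equivariant:
 assumes s: "sg permutes {1..sum_list lam}"
 shows "gram lam (tab_act sg S) (tab_act sg T) = gram lam S T"
 unfolding gram_def
 by (subst sum.reindex_bij_betw[OF bij_tableaux_act[OF s], symmetric])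
  (simp add: ptab_equivariant[OF s])

lemma equivariant_antisymmetric:
 assumes t: "is_tab lam t" and s: "sg \<in> column_stabilizer lam t"
  and eq: "\<And>S T. a (tab_act sg S) (tab_act sg T) = (a S T :: rat)"
 shows "(\<Sum>T\<in>tabs lam. a (tab_act sg S) T * ptab lam t T) =
  of_int (sign sg) * (\<Sum>T\<in>tabs lam. a S T * ptab lam t T)"
 by (subst sum_tabs_act[OF column_stabilizer_permutes[OF s], symmetric])
  (simp add: eq ptab_antisymmetric[OF s] sum_distrib_left mult_ac)

text \<open>Any two tableaux differ by a permutation, which equivariance absorbs.\<close>

lemma equivariant_const:
 assumes t: "is_tab lam t" and t': "is_tab lam t'"
  and eq: "\<And>sg S T. sg permutes {1..sum_list lam} ==> a (tab_act sg S) (tab_act sg T) = (a S T :: rat)"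
 shows "(\<Sum>T\<in>tabs lam. a (tabloid lam t) T * ptab lam t T) =
  (\<Sum>T\<in>tabs lam. a (tabloid lam t') T * ptab lam t' T)"
proof -
 obtain sg where s: "sg permutes {1..sum_list lam}" and c: "\<And>c. c \<in> cells lam ==> t' c = sg (t c)"
  using is_tab_transitive[OF t t'] by blast
 have "tabloid lam t' = tab_act sg (tabloid lam t)" "ptab lam t' = ptab lam (sg \<circ> t)"
  using c tabloid_cong[of lam t' "sg \<circ> t"] ptab_cong[of lam t' "sg \<circ> t"]
  by (simp_all add: tabloid_comp)
 thus ?thesis
  by (subst (2) sum_tabs_act[OF s, symmetric]) (simp add: eq[OF s] ptab_equivariant[OF s])
qed

text \<open>An equivariant map sends a polytabloid to a function that is antisymmetric under the same
 column stabilizer, hence to a multiple of the polytabloid.\<close>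

lemma equivariant_ptab:
 assumes lam: "is_partition lam" and t: "is_tab lam t" and t0: "is_tab lam t0"
  and eq: "\<And>sg S T. sg permutes {1..sum_list lam} ==> a (tab_act sg S) (tab_act sg T) = (a S T :: rat)"
  and supp: "\<And>S T. S \<notin> tabs lam ==> a S T = 0"
 shows "(\<Sum>T\<in>tabs lam. a S T * ptab lam t T) =
  (\<Sum>T\<in>tabs lam. a (tabloid lam t0) T * ptab lam t0 T) * ptab lam t S"
proof (cases "S \<in> tabs lam")
 case True
 have "(\<Sum>T\<in>tabs lam. a S T * ptab lam t T) =
  (\<Sum>T\<in>tabs lam. a (tabloid lam t) T * ptab lam t T) * ptab lam t S"
  using antisymmetric_multiple[OF lam t True, of "\<lambda>S. \<Sum>T\<in>tabs lam. a S T * ptab lam t T"]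
   equivariant_antisymmetric[OF t, of _ a, OF _ eq] column_stabilizer_permutes by blast
 also have "(\<Sum>T\<in>tabs lam. a (tabloid lam t) T * ptab lam t T) =
   (\<Sum>T\<in>tabs lam. a (tabloid lam t0) T * ptab lam t0 T)"
  by (rule equivariant_const[OF t t0, of a, OF eq])
 finally show ?thesis .
next
 case False
 thus ?thesis using ptab_support[OF t False] by (simp add: supp)
qed

text \<open>The eigenvalue of \<open>gram\<close> on the polytabloids, read off at the tabloid of an
  arbitrary tableau, where the polytabloid has coefficient 1. By \<open>equivariant_const\<close>
  every tableau gives the same value.\<close>

definition gram_const :: "nat list => rat"
 where "gram_const lam = (let t = SOME t. is_tab lam t in
  \<Sum>T\<in>tabs lam. gram lam (tabloid lam t) T * ptab lam t T)"

lemma gram_ptab: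
 assumes lam: "is_partition lam" and t: "is_tab lam t"
 shows "(\<Sum>T\<in>tabs lam. gram lam S T * ptab lam t T) = gram_const lam * ptab lam t S"
 unfolding gram_const_def Let_def
 by (rule equivariant_ptab[OF lam t someI_ex[OF is_tab_exists], of "gram lam"])
  (auto simp: gram_equivariant gram_support)

text \<open>With \<open>q s\<close> the inner product of the polytabloids of \<open>s\<close> and
  \<open>t\<close>, the product \<open>gram_const lam * q t\<close> is the sum of the squares of all
  \<open>q s\<close>, and one of these is the square of \<open>q t > 0\<close>.\<close>

lemma gram_const_pos:
 assumes lam: "is_partition lam"
 shows "gram_const lam > 0"
proof -
 obtain t where t: "is_tab lam t" using is_tab_exists by blast
 define t' where "t' = restrict t (cells lam)"
 have t': "t' \<in> tableaux lam" "ptab lam t' = ptab lam t"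
  using t is_tab_restrict by (simp_all add: t'_def)
 define q where "q s = (\<Sum>S\<in>tabs lam. ptab lam s S * ptab lam t S)" for s
 have q0: "q t > 0"
 proof -
  have "0 < ptab lam t (tabloid lam t) * ptab lam t (tabloid lam t)"
   by (simp add: ptab_diag[OF t])
  also have "... \<le> q t"
   unfolding q_def by (rule member_le_sum) (simp_all add: tabloid_in_tabs[OF t])
  finally show ?thesis .
 qed
 have "gram_const lam * q t = (\<Sum>S\<in>tabs lam. (gram_const lam * ptab lam t S) * ptab lam t S)"
  by (simp add: q_def sum_distrib_left mult_ac)
 also have "... = (\<Sum>S\<in>tabs lam. (\<Sum>T\<in>tabs lam. gram lam S T * ptab lam t T) * ptab lam t S)"
  by (simp only: gram_ptab[OF lam t])
 also have "... = (\<Sum>s\<in>tableaux lam. q s * q s)"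
 proof -
  have "(\<Sum>S\<in>tabs lam. (\<Sum>T\<in>tabs lam. gram lam S T * ptab lam t T) * ptab lam t S) =
    (\<Sum>S\<in>tabs lam. \<Sum>T\<in>tabs lam. \<Sum>s\<in>tableaux lam.
     ptab lam s S * ptab lam t S * (ptab lam s T * ptab lam t T))"
   by (simp add: gram_def sum_distrib_right sum_distrib_left mult_ac)
  also have "... = (\<Sum>S\<in>tabs lam. \<Sum>s\<in>tableaux lam. \<Sum>T\<in>tabs lam.
     ptab lam s S * ptab lam t S * (ptab lam s T * ptab lam t T))"
   by (intro sum.cong refl sum.swap)
  also have "... = (\<Sum>s\<in>tableaux lam. \<Sum>S\<in>tabs lam. \<Sum>T\<in>tabs lam.
     ptab lam s S * ptab lam t S * (ptab lam s T * ptab lam t T))"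
   by (rule sum.swap)
  also have "... = (\<Sum>s\<in>tableaux lam. q s * q s)"
   by (simp add: q_def sum_product)
  finally show ?thesis .
 qed
 also have "... \<ge> q t' * q t'" by (rule member_le_sum) (use t' in auto)
 finally have "q t' * q t' \<le> gram_const lam * q t" .
 moreover have "q t' = q t" by (simp add: q_def t')
 ultimately show ?thesis using q0
  by (metis mult_less_cancel_right_pos mult_pos_pos mult_zero_left not_less order_less_le_trans)
qed

text \<open>The orthogonal projection of functions on tabloids onto the span of the polytabloids, as
  a matrix with rational entries.\<close>

definition spk :: "nat list => (nat => nat set) => (nat => nat set) => rat"
 where "spk lam S T = gram lam S T / gram_const lam"

lemma spk_sym: "spk lam S T = spk lam T S"
 by (simp add: spk_def gram_sym)

lemma spk_support: "S \<notin> tabs lam ==> spk lam S T = 0" "T \<notin> tabs lam ==> spk lam S T = 0"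
 using gram_support[of T lam S] gram_sym[of lam S T] by (simp_all add: spk_def gram_support)

lemma spk_equivariant:
 "sg permutes {1..sum_list lam} ==> spk lam (tab_act sg S) (tab_act sg T) = spk lam S T"
 by (simp add: spk_def gram_equivariant)

lemma spk_ptab:
 assumes "is_partition lam" "is_tab lam t"
 shows "(\<Sum>T\<in>tabs lam. spk lam S T * ptab lam t T) = ptab lam t S"
 using gram_ptab[OF assms, of S] gram_const_pos[OF assms(1)]
 by (simp add: spk_def sum_divide_distrib[symmetric])

lemma spk_expand: "spk lam S T = (\<Sum>t\<in>tableaux lam. ptab lam t S * ptab lam t T / gram_const lam)"
 by (simp add: spk_def gram_def sum_divide_distrib)

lemma spk_idem:
 assumes "is_partition lam"
 shows "(\<Sum>T\<in>tabs lam. spk lam S T * spk lam T U) = spk lam S U"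
proof -
 have "(\<Sum>T\<in>tabs lam. spk lam S T * spk lam T U) =
   (\<Sum>t\<in>tableaux lam. (\<Sum>T\<in>tabs lam. spk lam S T * ptab lam t T) * ptab lam t U / gram_const lam)"
  unfolding spk_expand[of lam _ U]
  by (simp add: sum_distrib_left sum_distrib_right sum_divide_distrib mult_ac
    sum.swap[of _ "tabs lam"])
 also have "... = spk lam S U"
  by (simp add: spk_ptab[OF assms tableaux_is_tab] spk_expand[of lam S U])
 finally show ?thesis .
qed

definition kapply :: "'x set => ('y => 'x => rat) => ('x => 'k::field_char_0) => 'y => 'k"
 where "kapply B a f = (\<lambda>y. \<Sum>x\<in>B. of_rat (a y x) * f x)"

text \<open>Replaces the existence of coefficients by a system of linear equations. Closure under
  sums and permutations then involves no choice of coefficients, and the vanishing off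
  \<open>tabs lam\<close> can be read off the kernel.\<close>

lemma carrier_specht_iff:
 fixes f :: "_ => 'k::field_char_0"
 assumes lam: "is_partition lam"
 shows "f \<in> carrier (specht lam) \<longleftrightarrow> kapply (tabs lam) (spk lam) f = f"
proof
 assume "f \<in> carrier (specht lam)"
 then obtain c where f: "f = (\<lambda>T. \<Sum>t\<in>tableaux lam. c t * polytabloid lam t T)"
  by (auto simp: specht_def)
 have p: "(\<Sum>T\<in>tabs lam. of_rat (spk lam S T) * of_rat (ptab lam t T)) = (of_rat (ptab lam t S) :: 'k)"
  if "t \<in> tableaux lam" for S t
  using arg_cong[OF spk_ptab[OF lam tableaux_is_tab[OF that], of S], of "of_rat :: rat => 'k"]
  by (simp add: of_rat_sum of_rat_mult)
 have "kapply (tabs lam) (spk lam) f S =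
   (\<Sum>t\<in>tableaux lam. c t * (\<Sum>T\<in>tabs lam. of_rat (spk lam S T) * of_rat (ptab lam t T)))" for S
  unfolding kapply_def f polytabloid_of_rat
  by (simp add: sum_distrib_left mult_ac sum.swap[of _ "tabs lam"])
 thus "kapply (tabs lam) (spk lam) f = f"
  by (simp add: p f polytabloid_of_rat fun_eq_iff)
next
 assume e: "kapply (tabs lam) (spk lam) f = f"
 have "f S = (\<Sum>t\<in>tableaux lam.
   (\<Sum>T\<in>tabs lam. of_rat (ptab lam t T / gram_const lam) * f T) * polytabloid lam t S)" for S
 proof -
  have k: "of_rat (spk lam S T) =
    (\<Sum>t\<in>tableaux lam. of_rat (ptab lam t S) * of_rat (ptab lam t T / gram_const lam) :: 'k)" for T
   by (simp add: spk_expand of_rat_sum of_rat_mult[symmetric])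
  have "f S = kapply (tabs lam) (spk lam) f S" using e by simp
  also have "... = (\<Sum>t\<in>tableaux lam. of_rat (ptab lam t S) *
   (\<Sum>T\<in>tabs lam. of_rat (ptab lam t T / gram_const lam) * f T))"
   unfolding kapply_def k by (rule sum_mult_assoc)
  also have "... = (\<Sum>t\<in>tableaux lam.
   (\<Sum>T\<in>tabs lam. of_rat (ptab lam t T / gram_const lam) * f T) * polytabloid lam t S)"
   by (simp add: polytabloid_of_rat mult.commute)
  finally show ?thesis .
 qed
 hence "f = (\<lambda>S. \<Sum>t\<in>tableaux lam.
   (\<Sum>T\<in>tabs lam. of_rat (ptab lam t T / gram_const lam) * f T) * polytabloid lam t S)"
  by (rule ext)
 thus "f \<in> carrier (specht lam)"
  unfolding specht_def by (simp only: partial_object.simps mem_Collect_eq) (rule exI)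
qed

section \<open>Schur's lemma\<close>

text \<open>A kernel absorbed by the projection is determined by its action on polytabloids.\<close>

lemma equivariant_kernel_expand:
 assumes abs: "\<And>S T. (\<Sum>T'\<in>tabs lam. a S T' * spk lam T' T) = (a S T :: rat)"
 shows "a S T = (\<Sum>t\<in>tableaux lam. (\<Sum>T'\<in>tabs lam. a S T' * ptab lam t T') * ptab lam t T / gram_const lam)"
proof -
 have "a S T = (\<Sum>T'\<in>tabs lam. a S T' * spk lam T' T)" by (simp add: abs)
 also have "... = (\<Sum>t\<in>tableaux lam. (\<Sum>T'\<in>tabs lam. a S T' * ptab lam t T') * ptab lam t T / gram_const lam)"
  unfolding spk_expand
  by (simp add: sum_distrib_left sum_distrib_right sum_divide_distrib mult_ac
    sum.swap[of _ "tabs lam"])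
 finally show ?thesis .
qed

text \<open>Every polytabloid is multiplied by the same scalar, by \<open>equivariant_ptab\<close>,
  and the projection is assembled from polytabloids.\<close>

lemma schur_scalar:
 assumes lam: "is_partition lam"
  and eq: "\<And>sg S T. sg permutes {1..sum_list lam} ==> a (tab_act sg S) (tab_act sg T) = (a S T :: rat)"
  and supp: "\<And>S T. S \<notin> tabs lam ==> a S T = 0"
  and abs: "\<And>S T. (\<Sum>T'\<in>tabs lam. a S T' * spk lam T' T) = a S T"
 shows "\<exists>k. \<forall>S T. a S T = k * spk lam S T"
proof -
 obtain t0 where t0: "is_tab lam t0" using is_tab_exists by blast
 let ?k = "\<Sum>T\<in>tabs lam. a (tabloid lam t0) T * ptab lam t0 T"
 have "a S T = ?k * spk lam S T" for S T
 proof -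
  have e: "(\<Sum>T'\<in>tabs lam. a S T' * ptab lam t T') = ?k * ptab lam t S" if "t \<in> tableaux lam" for t
   using equivariant_ptab[OF lam tableaux_is_tab[OF that] t0, where a = a and S = S] eq supp
   by blast
  have "a S T = (\<Sum>t\<in>tableaux lam.
    (\<Sum>T'\<in>tabs lam. a S T' * ptab lam t T') * ptab lam t T / gram_const lam)"
   by (rule equivariant_kernel_expand[where a = a and lam = lam, OF abs])
  also have "... = (\<Sum>t\<in>tableaux lam. (?k * ptab lam t S) * ptab lam t T / gram_const lam)"
   by (intro sum.cong refl) (simp only: e)
  finally show ?thesis by (simp only: spk_expand sum_distrib_left mult.assoc times_divide_eq_right)
 qed
 thus ?thesis by blast
qed

text \<open>A nonzero intertwiner from the Specht module of \<open>lam\<close> to functions on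
  \<open>tabs mu\<close> sends some polytabloid to a nonzero function antisymmetric under its column
  stabilizer, to which \<open>antisymmetric_shape\<close> applies.\<close>

lemma equivariant_kernel_weight:
 assumes lam: "is_partition lam" and mu: "is_partition mu" and n: "sum_list lam = sum_list mu"
  and eq: "\<And>sg S T. sg permutes {1..sum_list lam} ==> a (tab_act sg S) (tab_act sg T) = (a S T :: rat)"
  and supp: "\<And>S T. S \<notin> tabs mu ==> a S T = 0"
  and abs: "\<And>S T. (\<Sum>T'\<in>tabs lam. a S T' * spk lam T' T) = a S T"
  and nz: "a S T \<noteq> 0"
 shows "row_weight lam \<le> row_weight mu \<and> (row_weight lam = row_weight mu \<longrightarrow> lam = mu)"
proof -
 have S: "S \<in> tabs mu" using nz supp by blast
 obtain t where t: "t \<in> tableaux lam" and f: "(\<Sum>T'\<in>tabs lam. a S T' * ptab lam t T') \<noteq> 0"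
  using nz equivariant_kernel_expand[where a = a and lam = lam, OF abs, of S T]
  by (metis (no_types, lifting) div_0 mult_zero_left sum.neutral)
 note sh = antisymmetric_shape[OF lam mu tableaux_is_tab[OF t] S n,
   of "\<lambda>S. \<Sum>T'\<in>tabs lam. a S T' * ptab lam t T'", OF _ f]
 have "(\<Sum>T'\<in>tabs lam. a (tab_act sg S) T' * ptab lam t T') =
   of_int (sign sg) * (\<Sum>T'\<in>tabs lam. a S T' * ptab lam t T')"
  if "sg \<in> column_stabilizer lam t" for sg
  by (rule equivariant_antisymmetric[OF tableaux_is_tab[OF t] that, of a, OF eq])
   (rule column_stabilizer_permutes[OF that])
 from sh[OF this] show ?thesis by blast
qed

text \<open>The weight inequality for \<open>a\<close> and for its transpose; the transpose
  qualifies because \<open>a\<close> is absorbed by the projections on both sides.\<close>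

lemma schur_zero:
 assumes lam: "is_partition lam" and mu: "is_partition mu" and n: "sum_list lam = sum_list mu"
  and ne: "lam \<noteq> mu"
  and eq: "\<And>sg S T. sg permutes {1..sum_list lam} ==> a (tab_act sg S) (tab_act sg T) = (a S T :: rat)"
  and supp: "\<And>S T. S \<notin> tabs mu ==> a S T = 0" "\<And>S T. T \<notin> tabs lam ==> a S T = 0"
  and abs: "\<And>S T. (\<Sum>T'\<in>tabs lam. a S T' * spk lam T' T) = a S T"
   "\<And>S T. (\<Sum>S'\<in>tabs mu. spk mu S S' * a S' T) = a S T"
 shows "a S T = 0"
proof (rule ccontr)
 assume nz: "a S T \<noteq> 0"
 have "row_weight lam \<le> row_weight mu \<and> (row_weight lam = row_weight mu \<longrightarrow> lam = mu)"
  by (rule equivariant_kernel_weight[OF lam mu n, of a]) (use eq supp abs nz in auto)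
 moreover have "row_weight mu \<le> row_weight lam \<and> (row_weight mu = row_weight lam \<longrightarrow> mu = lam)"
  by (rule equivariant_kernel_weight[OF mu lam n[symmetric], of "\<lambda>S T. a T S" T S])
   (use eq supp abs(2) nz n in \<open>auto simp: spk_sym[of mu] mult.commute\<close>)
 ultimately show False using ne by simp
qed

section \<open>Bessel's inequality\<close>

text \<open>A symmetric idempotent rational matrix has nonnegative trace, and vanishes if its trace
 does, because the trace is then the sum of the squares of the entries.\<close>

lemma bessel:
 fixes P :: "'y => 'y => rat" and u :: "'i => 'x => 'y => rat"
 assumes fin: "finite Y" "finite I" and finZ: "\<And>i. i \<in> I ==> finite (Z i)"
  and sym: "\<And>a b. P a b = P b a"
  and idem: "\<And>a b. (\<Sum>y\<in>Y. P a y * P y b) = P a b"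
  and abs: "\<And>i x y. i \<in> I ==> (\<Sum>y'\<in>Y. u i x y' * P y' y) = u i x y"
  and orth: "\<And>i j x x'. i \<in> I ==> j \<in> I ==> i \<noteq> j ==> (\<Sum>y\<in>Y. u i x y * u j x' y) = 0"
  and norm: "\<And>i x x'. i \<in> I ==> (\<Sum>y\<in>Y. u i x y * u i x' y) = k i * p i x x'"
  and k: "\<And>i. i \<in> I ==> k i \<noteq> 0"
  and pabs: "\<And>i x y. i \<in> I ==> (\<Sum>x'\<in>Z i. p i x x' * u i x' y) = u i x y"
 shows "(\<Sum>i\<in>I. \<Sum>x\<in>Z i. p i x x) \<le> (\<Sum>y\<in>Y. P y y)"
  and "(\<Sum>i\<in>I. \<Sum>x\<in>Z i. p i x x) = (\<Sum>y\<in>Y. P y y) ==> a \<in> Y ==> b \<in> Y ==>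
   P a b = (\<Sum>i\<in>I. \<Sum>x\<in>Z i. u i x a * u i x b / k i)"
proof -
 define J where "J = Sigma I Z"
 define v where "v q = u (fst q) (snd q)" for q
 define w where "w q b = v q b / k (fst q)" for q b
 \<comment> \<open>\<open>R\<close> projects onto the sum of the spaces spanned by the rows of the
   \<open>u i\<close>. Since \<open>RP = PR = RR = R\<close>, the difference \<open>Q\<close> is
   again a symmetric idempotent.\<close>
 define R where "R a b = (\<Sum>q\<in>J. v q a * w q b)" for a b
 define Q where "Q a b = P a b - R a b" for a b
 have J: "(\<Sum>q\<in>J. f (fst q) (snd q)) = (\<Sum>i\<in>I. \<Sum>x\<in>Z i. f i x)" for f :: "'i => 'x => rat"
  unfolding J_def by (subst sum.Sigma) (auto simp: fin finZ split_def)
 have R: "R a b = (\<Sum>i\<in>I. \<Sum>x\<in>Z i. u i x a * u i x b / k i)" for a b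
  using J[of "\<lambda>i x. u i x a * u i x b / k i"] by (simp add: R_def v_def w_def)
 have Rsym: "R a b = R b a" for a b by (simp add: R_def v_def w_def mult_ac)
 have Qsym: "Q a b = Q b a" for a b by (simp add: Q_def Rsym[of a] sym[of a])
 have uR: "(\<Sum>y\<in>Y. u i x y * R y b) = u i x b" if i: "i \<in> I" for i x b
 proof -
  have "(\<Sum>y\<in>Y. u i x y * R y b) = (\<Sum>q\<in>J. (\<Sum>y\<in>Y. u i x y * v q y) * w q b)"
   unfolding R_def by (rule sum_mult_assoc[symmetric])
  also have "... = (\<Sum>j\<in>I. \<Sum>x'\<in>Z j. (\<Sum>y\<in>Y. u i x y * u j x' y) * (u j x' b / k j))"
   using J[of "\<lambda>j x'. (\<Sum>y\<in>Y. u i x y * u j x' y) * (u j x' b / k j)"]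
   by (simp add: v_def w_def)
  also have "... = (\<Sum>j\<in>I. if j = i then (\<Sum>x'\<in>Z i. p i x x' * u i x' b) else 0)"
   by (rule sum.cong) (use i orth k in \<open>auto simp: norm\<close>)
  also have "... = u i x b" using i fin by (simp add: pabs)
  finally show ?thesis .
 qed
 have RM: "(\<Sum>y\<in>Y. R a y * M y b) = R a b"
  if M: "\<And>i x. i \<in> I ==> (\<Sum>y\<in>Y. u i x y * M y b) = u i x b" for a b M
 proof -
  have "(\<Sum>y\<in>Y. R a y * M y b) = (\<Sum>q\<in>J. v q a * (\<Sum>y\<in>Y. w q y * M y b))"
   unfolding R_def by (rule sum_mult_assoc)
  also have "... = (\<Sum>q\<in>J. v q a * w q b)"
  proof (rule sum.cong[OF refl])
   fix q assume "q \<in> J"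
   hence "(\<Sum>y\<in>Y. v q y * M y b) / k (fst q) = w q b"
    by (auto simp: J_def v_def w_def M)
   thus "v q a * (\<Sum>y\<in>Y. w q y * M y b) = v q a * w q b"
    by (simp add: w_def sum_divide_distrib)
  qed
  finally show ?thesis by (simp add: R_def)
 qed
 have RP: "(\<Sum>y\<in>Y. R a y * P y b) = R a b" for a b by (rule RM) (rule abs)
 have RR: "(\<Sum>y\<in>Y. R a y * R y b) = R a b" for a b by (rule RM) (rule uR)
 have PR: "(\<Sum>y\<in>Y. P a y * R y b) = R a b" for a b
 proof -
  have "(\<Sum>y\<in>Y. P a y * R y b) = (\<Sum>y\<in>Y. R b y * P y a)"
   by (intro sum.cong refl) (metis Rsym sym mult.commute)
  thus ?thesis using RP[of b a] Rsym[of a b] by simp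
 qed
 have Qidem: "(\<Sum>y\<in>Y. Q a y * Q y b) = Q a b" for a b
  unfolding Q_def
  by (simp add: left_diff_distrib right_diff_distrib sum_subtractf sum.distrib RP RR PR idem)
 have sq: "(\<Sum>y\<in>Y. Q y y) = (\<Sum>y\<in>Y. \<Sum>z\<in>Y. Q y z * Q y z)"
  by (rule sum.cong) (use Qidem Qsym in \<open>metis (no_types, lifting) sum.cong\<close>)+
 have "(\<Sum>y\<in>Y. R y y) = (\<Sum>i\<in>I. \<Sum>x\<in>Z i. \<Sum>y\<in>Y. u i x y * u i x y / k i)"
  unfolding R by (subst sum.swap, subst (2) sum.swap, rule refl)
 also have "... = (\<Sum>i\<in>I. \<Sum>x\<in>Z i. p i x x)"
  by (intro sum.cong refl) (simp add: norm k sum_divide_distrib[symmetric])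
 finally have tr: "(\<Sum>y\<in>Y. Q y y) = (\<Sum>y\<in>Y. P y y) - (\<Sum>i\<in>I. \<Sum>x\<in>Z i. p i x x)"
  by (simp add: Q_def sum_subtractf)
 have "(\<Sum>y\<in>Y. Q y y) \<ge> 0" unfolding sq by (intro sum_nonneg) simp
 thus "(\<Sum>i\<in>I. \<Sum>x\<in>Z i. p i x x) \<le> (\<Sum>y\<in>Y. P y y)" using tr by simp
 assume "(\<Sum>i\<in>I. \<Sum>x\<in>Z i. p i x x) = (\<Sum>y\<in>Y. P y y)" and ab: "a \<in> Y" "b \<in> Y"
 hence "(\<Sum>y\<in>Y. \<Sum>z\<in>Y. Q y z * Q y z) = 0" using tr sq by simp
 hence "(\<Sum>z\<in>Y. Q a z * Q a z) = 0"
  using ab fin by (subst (asm) sum_nonneg_eq_0_iff) (auto intro: sum_nonneg)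
 hence "Q a b * Q a b = 0"
  using ab fin by (subst (asm) sum_nonneg_eq_0_iff) auto
 thus "P a b = (\<Sum>i\<in>I. \<Sum>x\<in>Z i. u i x a * u i x b / k i)"
  by (simp add: Q_def R)
qed

section \<open>Young's lattice\<close>

definition down_closed :: "(nat \<times> nat) set => bool"
 where "down_closed C \<longleftrightarrow> (\<forall>i j i' j'. (i, j) \<in> C \<longrightarrow> i' \<le> i \<longrightarrow> j' \<le> j \<longrightarrow> (i', j') \<in> C)"

lemma down_closed_cells: "is_partition lam ==> down_closed (cells lam)"
 unfolding down_closed_def using cells_down_closed by blast

lemma nat_initial_segment:
 fixes A :: "nat set"
 assumes "finite A" "\<And>i j. i \<in> A ==> j \<le> i ==> j \<in> A"
 shows "A = {..<card A}"
proof -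
 define k where "k = (LEAST k. k \<notin> A)"
 have "\<exists>k. k \<notin> A" using assms(1) ex_new_if_finite infinite_UNIV_nat by blast
 hence k: "k \<notin> A" unfolding k_def by (rule LeastI_ex)
 have "i \<in> A" if "i < k" for i using not_less_Least that unfolding k_def by blast
 moreover have "i < k" if "i \<in> A" for i using assms(2)[OF that] k by (meson not_le)
 ultimately have "A = {..<k}" by blast
 thus ?thesis by simp
qed

text \<open>Passing to order ideals gives access to unions and intersections of Young diagrams,
  which supply joins and meets of partitions.\<close>

lemma partition_of_cells:
 assumes fin: "finite C" and d: "down_closed C"
 obtains lam where "is_partition lam" "cells lam = C"
proof -
 define r where "r i = card {j. (i, j) \<in> C}" for i
 define k where "k = card {i. (i, 0) \<in> C}"
 have f: "finite {j. (i, j) \<in> C}" for i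
  by (rule finite_subset[of _ "snd ` C"]) (use fin in force)+
 have f0: "finite {i. (i, 0) \<in> C}"
  by (rule finite_subset[of _ "fst ` C"]) (use fin in force)+
 have "{j. (i, j) \<in> C} = {..<r i}" for i
  unfolding r_def by (rule nat_initial_segment[OF f]) (use d in \<open>auto simp: down_closed_def\<close>)
 hence r: "(i, j) \<in> C \<longleftrightarrow> j < r i" for i j by blast
 have "{i. (i, 0) \<in> C} = {..<k}"
  unfolding k_def by (rule nat_initial_segment[OF f0]) (use d in \<open>auto simp: down_closed_def\<close>)
 hence k: "0 < r i \<longleftrightarrow> i < k" for i using r by blast
 have anti: "r i' \<le> r i" if "i \<le> i'" for i i'
 proof (rule ccontr)
  assume "\<not> r i' \<le> r i"
  hence "(i', r i) \<in> C" "(i, r i) \<notin> C" using r by auto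
  thus False using d that unfolding down_closed_def by blast
 qed
 let ?lam = "map r [0..<k]"
 have "is_partition ?lam"
 proof -
  have "sorted_wrt (\<ge>) ?lam" by (simp add: sorted_wrt_iff_nth_less anti)
  moreover have "0 \<notin> set ?lam"
  proof
   assume "0 \<in> set ?lam"
   then obtain i where "i < k" "r i = 0" by auto
   thus False using k[of i] by simp
  qed
  ultimately show ?thesis unfolding is_partition_def by simp
 qed
 moreover have "cells ?lam = C"
 proof -
  have "(i, j) \<in> cells ?lam \<longleftrightarrow> (i, j) \<in> C" for i j
   using r[of i j] k[of i] by (auto simp: cells_def)
  thus ?thesis by auto
 qed
 ultimately show thesis by (rule that)
qed

section \<open>Adding and removing cells\<close>

definition up_set :: "nat list => nat list set"
 where "up_set lam = {mu. is_partition mu \<and> adds_cell lam mu}"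

definition down_set :: "nat list => nat list set"
 where "down_set lam = {nu. is_partition nu \<and> adds_cell nu lam}"

lemma adds_cell_sum_list: "adds_cell lam mu ==> sum_list mu = Suc (sum_list lam)"
 unfolding adds_cell_def card_cells[symmetric] by auto

definition removable_rows :: "nat list => nat set"
 where "removable_rows lam = {a. rowlen lam (Suc a) < rowlen lam a}"

lemma finite_removable_rows [simp]: "finite (removable_rows lam)"
 by (rule finite_subset[of _ "{..<length lam}"]) (auto simp: removable_rows_def rowlen_def split: if_splits)

lemma rowlen_antimono:
 assumes "is_partition lam" "i \<le> i'"
 shows "rowlen lam i' \<le> rowlen lam i"
proof (rule ccontr)
 assume "\<not> ?thesis"
 hence "(i', rowlen lam i) \<in> cells lam" "(i, rowlen lam i) \<notin> cells lam"
  by (auto simp: cells_rowlen)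
 thus False using assms down_closed_cells unfolding down_closed_def by blast
qed

text \<open>A removed cell is the last one of its row, and the row below must be strictly shorter
  for the rest to be a diagram.\<close>

lemma bij_removable_down:
 assumes lam: "is_partition lam"
 shows "card (down_set lam) = card (removable_rows lam)" "finite (down_set lam)"
proof -
 define P where "P a nu \<longleftrightarrow> is_partition nu \<and> cells nu = cells lam - {(a, rowlen lam a - 1)}" for a nu
 define h where "h a = (SOME nu. P a nu)" for a
 have h: "P a (h a)" if a: "a \<in> removable_rows lam" for a
 proof -
  have "down_closed (cells lam - {(a, rowlen lam a - 1)})"
   unfolding down_closed_def
  proof (intro allI impI)
   fix i j i' j' assume 1: "(i, j) \<in> cells lam - {(a, rowlen lam a - 1)}" "i' \<le> i" "j' \<le> j"
   have "(i', j') \<in> cells lam"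
    using 1 down_closed_cells[OF lam] unfolding down_closed_def by blast
   moreover have "\<not> (i' = a \<and> j' = rowlen lam a - 1)"
   proof
    assume 2: "i' = a \<and> j' = rowlen lam a - 1"
    show False
    proof (cases "i = a")
     case True
     thus ?thesis using 1 2 a by (auto simp: cells_rowlen removable_rows_def)
    next
     case False
     hence "rowlen lam i \<le> rowlen lam (Suc a)" using 1 2 by (intro rowlen_antimono[OF lam]) auto
     thus ?thesis using 1 2 a by (auto simp: cells_rowlen removable_rows_def)
    qed
   qed
   ultimately show "(i', j') \<in> cells lam - {(a, rowlen lam a - 1)}" by blast
  qed
  then obtain nu where "P a nu"
   using partition_of_cells[of "cells lam - {(a, rowlen lam a - 1)}"] unfolding P_def by auto
  thus ?thesis unfolding h_def by (rule someI)
 qed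
 have c: "(a, rowlen lam a - 1) \<in> cells lam" if "a \<in> removable_rows lam" for a
  using that by (auto simp: cells_rowlen removable_rows_def)
 have "inj_on h (removable_rows lam)"
 proof (rule inj_onI)
  fix a a' assume *: "a \<in> removable_rows lam" "a' \<in> removable_rows lam" "h a = h a'"
  hence "cells lam - {(a, rowlen lam a - 1)} = cells lam - {(a', rowlen lam a' - 1)}"
   using h unfolding P_def by metis
  thus "a = a'" using c * by blast
 qed
 moreover have "h ` removable_rows lam = down_set lam"
 proof (intro subset_antisym subsetI)
  fix nu assume "nu \<in> h ` removable_rows lam"
  then obtain a where a: "a \<in> removable_rows lam" "P a nu" using h by auto
  thus "nu \<in> down_set lam"
   unfolding down_set_def adds_cell_def P_def using c[OF a(1)] by auto
 next
  fix nu assume "nu \<in> down_set lam"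
  then obtain i j where nu: "is_partition nu" "(i, j) \<notin> cells nu" "cells lam = insert (i, j) (cells nu)"
   unfolding down_set_def adds_cell_def by auto
  have dn: "down_closed (cells nu)" by (rule down_closed_cells[OF nu(1)])
  have j: "j = rowlen lam i - 1" "j < rowlen lam i"
  proof -
   show "j < rowlen lam i" using nu(3) by (simp add: cells_rowlen[symmetric])
   hence "rowlen lam i - 1 < rowlen lam i" by simp
   hence "(i, rowlen lam i - 1) \<in> insert (i, j) (cells nu)" using nu(3) cells_rowlen by blast
   moreover have "(i, rowlen lam i - 1) \<notin> cells nu"
   proof
    assume "(i, rowlen lam i - 1) \<in> cells nu"
    moreover have "j \<le> rowlen lam i - 1" using \<open>j < rowlen lam i\<close> by simp
    ultimately have "(i, j) \<in> cells nu" using dn unfolding down_closed_def by blast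
    thus False using nu(2) by simp
   qed
   ultimately show "j = rowlen lam i - 1" by simp
  qed
  have "\<not> j < rowlen lam (Suc i)"
  proof
   assume "j < rowlen lam (Suc i)"
   hence "(Suc i, j) \<in> cells nu" using nu(3) by (auto simp: cells_rowlen[symmetric])
   hence "(i, j) \<in> cells nu" using dn unfolding down_closed_def by (meson le_refl le_Suc_eq)
   thus False using nu(2) by simp
  qed
  hence i: "i \<in> removable_rows lam" using j by (simp add: removable_rows_def)
  have "cells nu = cells lam - {(i, rowlen lam i - 1)}" using nu(2,3) j(1) by auto
  hence "h i = nu" using h[OF i] nu(1) unfolding P_def by (metis cells_inj)
  thus "nu \<in> h ` removable_rows lam" using i by blast
 qed
 ultimately show "card (down_set lam) = card (removable_rows lam)" "finite (down_set lam)"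
  by (metis card_image) (metis \<open>h ` removable_rows lam = down_set lam\<close> finite_imageI finite_removable_rows)
qed

text \<open>A row can be lengthened iff it is row 0 or lies directly below a removable row. Hence
  there is one addable row more than there are removable rows, the source of the 1 in
  \<open>DU - UD = 1\<close>.\<close>

lemma bij_addable_up:
 assumes lam: "is_partition lam"
 shows "card (up_set lam) = Suc (card (removable_rows lam))" "finite (up_set lam)"
proof -
 define A where "A = insert 0 (Suc ` removable_rows lam)"
 define P where "P a nu \<longleftrightarrow> is_partition nu \<and> cells nu = insert (a, rowlen lam a) (cells lam)" for a nu
 define h where "h a = (SOME nu. P a nu)" for a
 have A: "a \<in> A \<longleftrightarrow> (\<forall>i<a. rowlen lam a < rowlen lam i)" for a
 proof (cases a)
  case (Suc b)
  have "rowlen lam b \<le> rowlen lam i" if "i < Suc b" for i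
   using that by (intro rowlen_antimono[OF lam]) simp
  thus ?thesis using Suc unfolding A_def removable_rows_def
   by (auto simp: less_le_trans)
 qed (simp add: A_def)
 have h: "P a (h a)" if a: "a \<in> A" for a
 proof -
  have "down_closed (insert (a, rowlen lam a) (cells lam))"
   unfolding down_closed_def
  proof (intro allI impI)
   fix i j i' j' assume 1: "(i, j) \<in> insert (a, rowlen lam a) (cells lam)" "i' \<le> i" "j' \<le> j"
   show "(i', j') \<in> insert (a, rowlen lam a) (cells lam)"
   proof (cases "(i, j) \<in> cells lam")
    case True
    thus ?thesis using 1 down_closed_cells[OF lam] unfolding down_closed_def by blast
   next
    case False
    hence 2: "i = a" "j = rowlen lam a" using 1 by auto
    show ?thesis
    proof (cases "i' = a")
     case True
     thus ?thesis using 1 2 by (auto simp: cells_rowlen)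
    next
     case False
     hence "rowlen lam a < rowlen lam i'" using A a 1 2 by simp
     thus ?thesis using 1 2 by (simp add: cells_rowlen)
    qed
   qed
  qed
  then obtain nu where "P a nu"
   using partition_of_cells[of "insert (a, rowlen lam a) (cells lam)"] unfolding P_def by auto
  thus ?thesis unfolding h_def by (rule someI)
 qed
 have c: "(a, rowlen lam a) \<notin> cells lam" for a by (simp add: cells_rowlen)
 have "inj_on h A"
 proof (rule inj_onI)
  fix a a' assume *: "a \<in> A" "a' \<in> A" "h a = h a'"
  hence "insert (a, rowlen lam a) (cells lam) = insert (a', rowlen lam a') (cells lam)"
   using h unfolding P_def by metis
  thus "a = a'" using c by blast
 qed
 moreover have im: "h ` A = up_set lam"
 proof (intro subset_antisym subsetI)
  fix nu assume "nu \<in> h ` A"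
  then obtain a where a: "a \<in> A" "P a nu" using h by auto
  thus "nu \<in> up_set lam"
   unfolding up_set_def adds_cell_def P_def using c by blast
 next
  fix nu assume "nu \<in> up_set lam"
  then obtain i j where nu: "is_partition nu" "(i, j) \<notin> cells lam" "cells nu = insert (i, j) (cells lam)"
   unfolding up_set_def adds_cell_def by auto
  have dn: "down_closed (cells nu)" by (rule down_closed_cells[OF nu(1)])
  have ij: "(i, j) \<in> cells nu" using nu(3) by simp
  have le: "rowlen lam i \<le> j" using nu(2) by (simp add: cells_rowlen)
  hence "(i, rowlen lam i) \<in> cells nu" using dn ij unfolding down_closed_def by blast
  hence j: "j = rowlen lam i" using nu(3) c by auto
  have "rowlen lam i < rowlen lam i'" if "i' < i" for i'
  proof -
   have "(i', j) \<in> cells nu" using dn ij that unfolding down_closed_def by (meson less_imp_le le_refl)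
   thus ?thesis using nu(3) that j by (auto simp: cells_rowlen)
  qed
  hence i: "i \<in> A" using A by blast
  hence "h i = nu" using h[OF i] nu j unfolding P_def by (metis cells_inj)
  thus "nu \<in> h ` A" using i by blast
 qed
 moreover have "card A = Suc (card (removable_rows lam))" "finite A"
  unfolding A_def by (auto simp: card_image)
 ultimately show "card (up_set lam) = Suc (card (removable_rows lam))" "finite (up_set lam)"
  by (metis card_image) (metis im \<open>finite A\<close> finite_imageI)
qed

text \<open>Two distinct shapes below \<open>mu\<close> miss different cells of \<open>mu\<close>,
  so their union is \<open>mu\<close> and their intersection lies one cell below each of them. With
  the dual \<open>down_up_cells\<close>, distinct shapes are joined through a shape above exactly
  when they are joined through one below, in each case through only one.\<close>

lemma up_down_cells:
 assumes "nu \<noteq> lam" "is_partition nu" "is_partition lam" "adds_cell lam mu" "adds_cell nu mu"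
 shows "cells mu = cells lam \<union> cells nu"
  and "\<exists>ka. is_partition ka \<and> adds_cell ka lam \<and> adds_cell ka nu"
proof -
 obtain c d where c: "c \<notin> cells lam" "cells mu = insert c (cells lam)"
  and d: "d \<notin> cells nu" "cells mu = insert d (cells nu)"
  using assms by (auto simp: adds_cell_def)
 have "c \<noteq> d" using c d assms cells_inj by (metis insert_ident)
 have "c \<in> insert d (cells nu)" "d \<in> insert c (cells lam)" using c(2) d(2) by auto
 with \<open>c \<noteq> d\<close> have cd: "c \<in> cells nu" "d \<in> cells lam" by auto
 have "cells mu - {c} = cells lam" "cells mu - {d} = cells nu" using c d by auto
 thus "cells mu = cells lam \<union> cells nu" using \<open>c \<noteq> d\<close> by blast
 obtain ka where ka: "is_partition ka" "cells ka = cells lam \<inter> cells nu"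
  using partition_of_cells[of "cells lam \<inter> cells nu"] down_closed_cells assms(2,3)
  by (auto simp: down_closed_def) metis
 have "cells lam = insert d (cells ka)" "cells nu = insert c (cells ka)"
 proof -
  have L: "cells lam = cells mu - {c}" "cells nu = cells mu - {d}" using c d by auto
  hence K: "cells ka = cells mu - {c} - {d}" using ka by auto
  show "cells lam = insert d (cells ka)" "cells nu = insert c (cells ka)"
   unfolding K using L cd by auto
 qed
 thus "\<exists>ka. is_partition ka \<and> adds_cell ka lam \<and> adds_cell ka nu"
  unfolding adds_cell_def using ka c d by (intro exI[of _ ka]) blast
qed

lemma down_up_cells:
 assumes "nu \<noteq> lam" "is_partition nu" "is_partition lam" "adds_cell ka lam" "adds_cell ka nu"
 shows "cells ka = cells lam \<inter> cells nu"
  and "\<exists>mu. is_partition mu \<and> adds_cell lam mu \<and> adds_cell nu mu"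
proof -
 obtain c d where c: "c \<notin> cells ka" "cells lam = insert c (cells ka)"
  and d: "d \<notin> cells ka" "cells nu = insert d (cells ka)"
  using assms by (auto simp: adds_cell_def)
 have "c \<noteq> d" using c d assms cells_inj by metis
 thus "cells ka = cells lam \<inter> cells nu" unfolding c(2) d(2) using c(1) d(1) by auto
 obtain mu where mu: "is_partition mu" "cells mu = cells lam \<union> cells nu"
  using partition_of_cells[of "cells lam \<union> cells nu"] down_closed_cells assms(2,3)
  by (auto simp: down_closed_def)
 have "cells mu = insert d (cells lam)" "cells mu = insert c (cells nu)" "d \<notin> cells lam" "c \<notin> cells nu"
  using mu c d \<open>c \<noteq> d\<close> by auto
 thus "\<exists>mu. is_partition mu \<and> adds_cell lam mu \<and> adds_cell nu mu"
  unfolding adds_cell_def using mu by (intro exI[of _ mu]) blast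
qed

text \<open>Young's lattice is a differential poset: \<open>DU - UD = 1\<close>.\<close>

lemma young_lattice_DU_UD:
 fixes a :: "nat list => 'b::comm_semiring_1"
 assumes lam: "is_partition lam"
 shows "(\<Sum>mu\<in>up_set lam. \<Sum>nu\<in>down_set mu. a nu) =
  a lam + (\<Sum>ka\<in>down_set lam. \<Sum>mu\<in>up_set ka. a mu)"
proof -
 note fin = bij_addable_up(2) bij_removable_down(2)
 have pu: "is_partition mu" "lam \<in> down_set mu" if "mu \<in> up_set lam" for mu
  using that lam by (auto simp: up_set_def down_set_def)
 have pd: "is_partition ka" "lam \<in> up_set ka" if "ka \<in> down_set lam" for ka
  using that lam by (auto simp: up_set_def down_set_def)
 have "(\<Sum>mu\<in>up_set lam. \<Sum>nu\<in>down_set mu. a nu) =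
   (\<Sum>mu\<in>up_set lam. a lam + (\<Sum>nu\<in>down_set mu - {lam}. a nu))"
  by (intro sum.cong refl) (simp add: sum.remove[OF fin(2)[OF pu(1)] pu(2)])
 also have "... = of_nat (card (up_set lam)) * a lam + (\<Sum>mu\<in>up_set lam. \<Sum>nu\<in>down_set mu - {lam}. a nu)"
  by (simp add: sum.distrib)
 \<comment> \<open>For \<open>nu \<noteq> lam\<close> the intermediate shape is forced to be the
   union, or from below the intersection, of the two. So both double sums run over the same
   \<open>nu\<close>, each taken once.\<close>
 also have "(\<Sum>mu\<in>up_set lam. \<Sum>nu\<in>down_set mu - {lam}. a nu) =
   sum a (\<Union>mu\<in>up_set lam. down_set mu - {lam})"
 proof (rule sum.UNION_disjoint[symmetric])
  show "\<forall>mu\<in>up_set lam. \<forall>mu'\<in>up_set lam. mu \<noteq> mu' \<longrightarrow>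
    (down_set mu - {lam}) \<inter> (down_set mu' - {lam}) = {}"
  proof (intro ballI impI equals0I)
   fix mu mu' nu assume 1: "mu \<in> up_set lam" "mu' \<in> up_set lam" "mu \<noteq> mu'"
    "nu \<in> (down_set mu - {lam}) \<inter> (down_set mu' - {lam})"
   have "cells mu = cells lam \<union> cells nu" "cells mu' = cells lam \<union> cells nu"
    by (rule up_down_cells(1); use 1 lam in \<open>auto simp: up_set_def down_set_def\<close>)+
   thus False using 1 cells_inj by (metis pu(1))
  qed
 qed (use fin lam pu in auto)
 also have "(\<Union>mu\<in>up_set lam. down_set mu - {lam}) = (\<Union>ka\<in>down_set lam. up_set ka - {lam})"
  (is "?N1 = ?N2")
 proof (intro subset_antisym subsetI)
  fix nu assume "nu \<in> ?N1"
  then obtain mu where 1: "nu \<noteq> lam" "is_partition nu" "adds_cell lam mu" "adds_cell nu mu"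
   by (auto simp: up_set_def down_set_def)
  show "nu \<in> ?N2"
   using up_down_cells(2)[OF 1(1,2) lam 1(3,4)] 1 by (auto simp: up_set_def down_set_def)
 next
  fix nu assume "nu \<in> ?N2"
  then obtain ka where 1: "nu \<noteq> lam" "is_partition nu" "adds_cell ka lam" "adds_cell ka nu"
   by (auto simp: up_set_def down_set_def)
  show "nu \<in> ?N1"
   using down_up_cells(2)[OF 1(1,2) lam 1(3,4)] 1 by (auto simp: up_set_def down_set_def)
 qed
 also have "sum a ?N2 = (\<Sum>ka\<in>down_set lam. \<Sum>nu\<in>up_set ka - {lam}. a nu)"
 proof (rule sum.UNION_disjoint)
  show "\<forall>ka\<in>down_set lam. \<forall>ka'\<in>down_set lam. ka \<noteq> ka' \<longrightarrow>
    (up_set ka - {lam}) \<inter> (up_set ka' - {lam}) = {}"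
  proof (intro ballI impI equals0I)
   fix ka ka' nu assume 1: "ka \<in> down_set lam" "ka' \<in> down_set lam" "ka \<noteq> ka'"
    "nu \<in> (up_set ka - {lam}) \<inter> (up_set ka' - {lam})"
   have "cells ka = cells lam \<inter> cells nu" "cells ka' = cells lam \<inter> cells nu"
    by (rule down_up_cells(1); use 1 lam in \<open>auto simp: up_set_def down_set_def\<close>)+
   thus False using 1 cells_inj by (metis pd(1))
  qed
 qed (use fin lam pd in auto)
 also have "of_nat (card (up_set lam)) * a lam + (\<Sum>ka\<in>down_set lam. \<Sum>nu\<in>up_set ka - {lam}. a nu) =
   a lam + (\<Sum>ka\<in>down_set lam. a lam + (\<Sum>nu\<in>up_set ka - {lam}. a nu))"
  using lam by (simp add: sum.distrib bij_addable_up bij_removable_down distrib_right add_ac)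
 also have "(\<Sum>ka\<in>down_set lam. a lam + (\<Sum>nu\<in>up_set ka - {lam}. a nu)) =
   (\<Sum>ka\<in>down_set lam. \<Sum>nu\<in>up_set ka. a nu)"
  by (intro sum.cong refl) (simp add: sum.remove[OF fin(1)[OF pd(1)] pd(2)])
 finally show ?thesis .
qed

text \<open>Without removable rows the row lengths would never decrease, but they are zero beyond
  the last row.\<close>

lemma down_set_nonempty:
 assumes lam: "is_partition lam" and pos: "sum_list lam > 0"
 shows "down_set lam \<noteq> {}"
proof -
 have "removable_rows lam \<noteq> {}"
 proof
  assume "removable_rows lam = {}"
  hence "rowlen lam i \<le> rowlen lam (Suc i)" for i
   by (auto simp: removable_rows_def not_less)
  hence "rowlen lam i \<le> rowlen lam (i + k)" for i k
   by (induction k) (auto intro: order_trans)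
  hence "rowlen lam i \<le> rowlen lam (i + length lam)" for i by blast
  hence "rowlen lam i = 0" for i by (simp add: rowlen_def)
  hence "cells lam = {}" by (auto simp: cells_rowlen)
  hence "card (cells lam) = 0" by simp
  thus False using card_cells[of lam] pos by linarith
 qed
 hence "card (down_set lam) \<noteq> 0" by (simp add: bij_removable_down[OF lam])
 thus ?thesis by auto
qed

section \<open>The branching kernel\<close>

definition added_row :: "nat list => nat list => nat"
 where "added_row lam mu = fst (THE c. c \<in> cells mu - cells lam)"

lemma added_row:
 assumes "c \<notin> cells lam" "cells mu = insert c (cells lam)"
 shows "added_row lam mu = fst c"
proof -
 have "cells mu - cells lam = {c}" using assms by auto
 thus ?thesis by (simp add: added_row_def)
qed

text \<open>Places the new largest entry in the row of the added cell. As this entry is absent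
  before, the map is injective, and it commutes with the permutations that fix the new
  entry.\<close>

definition add_entry :: "nat list => nat list => (nat => nat set) => nat => nat set"
 where "add_entry lam mu S = S(added_row lam mu := insert (Suc (sum_list lam)) (S (added_row lam mu)))"

lemma tabs_subset: "S \<in> tabs lam ==> S i \<subseteq> {1..sum_list lam}"
 by (auto elim!: tabsE simp: tabloid_row_index)

lemma add_entry_inj:
 assumes S: "\<And>i. Suc (sum_list lam) \<notin> S i" "\<And>i. Suc (sum_list lam) \<notin> S' i"
  and eq: "add_entry lam mu S = add_entry lam mu S'"
 shows "S = S'"
proof
 fix i
 show "S i = S' i"
  using fun_cong[OF eq, of i] insert_ident[OF S(1) S(2)]
  by (auto simp: add_entry_def split: if_splits)
qed

lemma add_entry_act:
 assumes "sg (Suc (sum_list lam)) = Suc (sum_list lam)"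
 shows "tab_act sg (add_entry lam mu S) = add_entry lam mu (tab_act sg S)"
 using assms by (auto simp: add_entry_def tab_act_def fun_eq_iff)

definition entry_kernel :: "nat list => nat list => (nat => nat set) => (nat => nat set) => rat"
 where "entry_kernel lam mu S T = (if S \<in> tabs lam \<and> T = add_entry lam mu S then 1 else 0)"

lemma permutes_Suc: "sg permutes {1..n} ==> sg permutes {1..Suc n}" "sg permutes {1..n} ==> sg (Suc n) = Suc n"
 by (auto intro: permutes_subset simp: permutes_not_in)

lemma entry_kernel_equivariant:
 assumes s: "sg permutes {1..sum_list lam}"
 shows "entry_kernel lam mu (tab_act sg S) (tab_act sg T) = entry_kernel lam mu S T"
 unfolding entry_kernel_def
 using s by (simp add: tab_act_tabs_iff add_entry_act[symmetric] tab_act_inj permutes_Suc)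

lemma column_stabilizer_extend:
 assumes c: "c \<notin> cells lam" "cells mu = insert c (cells lam)"
  and t: "is_tab lam t" "t c = Suc (sum_list lam)"
 shows "{sg \<in> column_stabilizer mu t. sg (Suc (sum_list lam)) = Suc (sum_list lam)} = column_stabilizer lam t"
proof -
 let ?n = "sum_list lam"
 have n: "sum_list mu = Suc ?n" using adds_cell_sum_list c unfolding adds_cell_def by blast
 have col: "t ` {d \<in> cells mu. snd d = j} =
   (if snd c = j then insert (Suc ?n) (t ` {d \<in> cells lam. snd d = j}) else t ` {d \<in> cells lam. snd d = j})" for j
 proof -
  have "{d \<in> cells mu. snd d = j} =
    (if snd c = j then insert c {d \<in> cells lam. snd d = j} else {d \<in> cells lam. snd d = j})"
   using c by auto
  thus ?thesis using t by simp
 qed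
 have nt: "Suc ?n \<notin> t ` {d \<in> cells lam. snd d = j}" for j
 proof
  assume "Suc ?n \<in> t ` {d \<in> cells lam. snd d = j}"
  hence "Suc ?n \<in> t ` cells lam" by auto
  thus False using t(1) by (simp add: is_tab_def bij_betw_def)
 qed
 have perm: "sg permutes {1..Suc ?n} \<and> sg (Suc ?n) = Suc ?n \<longleftrightarrow> sg permutes {1..?n}" for sg
  using permutes_Suc[of sg ?n] permutes_superset[of sg "{1..Suc ?n}" "{1..?n}"]
  by (auto simp: atLeastAtMostSuc_conv)
 have ins: "sg ` insert x A = insert x A \<longleftrightarrow> sg ` A = A"
  if "sg x = x" "x \<notin> A" "inj sg" for sg :: "nat => nat" and x A
 proof -
  have "x \<notin> sg ` A" using that by (metis imageE injD)
  thus ?thesis using that by (simp add: insert_ident)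
 qed
 have "sg \<in> column_stabilizer mu t \<and> sg (Suc ?n) = Suc ?n \<longleftrightarrow> sg \<in> column_stabilizer lam t" for sg
 proof (cases "sg permutes {1..?n}")
  case True
  hence p: "sg permutes {1..Suc ?n}" "sg (Suc ?n) = Suc ?n" "inj sg"
   using permutes_Suc permutes_inj by blast+
  hence q: "sg ` t ` {d \<in> cells mu. snd d = j} = t ` {d \<in> cells mu. snd d = j} \<longleftrightarrow>
    sg ` t ` {d \<in> cells lam. snd d = j} = t ` {d \<in> cells lam. snd d = j}" for j
   unfolding col by (simp only: ins nt not_False_eq_True split: if_split) simp
  show ?thesis
   by (simp only: column_stabilizer_def n mem_Collect_eq q p True simp_thms)
 next
  case False
  thus ?thesis using perm n unfolding column_stabilizer_def by auto
 qed
 thus ?thesis by blast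
qed

text \<open>A column permutation contributes only if some entry of the row of the added cell is sent
  to the new largest entry. As that entry sits in the added cell, row and column together force it
  to be fixed, and what remains is the column stabilizer of the smaller tableau.\<close>

lemma entry_kernel_ptab:
 assumes c: "c \<notin> cells lam" "cells mu = insert c (cells lam)"
  and t: "is_tab mu t" "is_tab lam t" "t c = Suc (sum_list lam)" and S: "S \<in> tabs lam"
 shows "(\<Sum>T\<in>tabs mu. entry_kernel lam mu S T * ptab mu t T) = ptab lam t S"
proof -
 let ?n = "sum_list lam" let ?N = "Suc ?n"
 have n: "sum_list mu = ?N" using adds_cell_sum_list c unfolding adds_cell_def by blast
 have "(\<Sum>T\<in>tabs mu. entry_kernel lam mu S T * ptab mu t T) =
   (\<Sum>T\<in>tabs mu. if T = add_entry lam mu S then ptab mu t T else 0)"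
  using S by (intro sum.cong refl) (simp add: entry_kernel_def)
 also have "... = ptab mu t (add_entry lam mu S)"
  using ptab_support[OF t(1)] by simp
 finally have 1: "(\<Sum>T\<in>tabs mu. entry_kernel lam mu S T * ptab mu t T) = ptab mu t (add_entry lam mu S)" .
 have tm: "tabloid mu t = add_entry lam mu (tabloid lam t)"
 proof
  fix i
  have "{d \<in> cells mu. fst d = i} =
    (if fst c = i then insert c {d \<in> cells lam. fst d = i} else {d \<in> cells lam. fst d = i})"
   using c by auto
  thus "tabloid mu t i = add_entry lam mu (tabloid lam t) i"
   using t(3) by (auto simp: tabloid_def add_entry_def added_row[OF c])
 qed
 have fixN: "sg ?N = ?N"
  if s: "sg \<in> column_stabilizer mu t" and e: "tabloid mu (sg \<circ> t) = add_entry lam mu S" for sg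
 proof -
  have "?N \<in> tabloid mu (sg \<circ> t) (fst c)" unfolding e by (simp add: add_entry_def added_row[OF c])
  then obtain d where d: "d \<in> cells mu" "fst d = fst c" "sg (t d) = ?N" by (auto simp: tabloid_def)
  have "sg (t d) \<in> sg ` t ` {e \<in> cells mu. snd e = snd d}" using d(1) by blast
  hence "t c \<in> t ` {e \<in> cells mu. snd e = snd d}"
   unfolding column_stabilizer_image[OF s] using d t(3) by simp
  hence "snd c = snd d"
   using t(1) c by (auto simp: is_tab_def bij_betw_def inj_on_def)
  hence "d = c" using d by (simp add: prod_eq_iff)
  thus ?thesis using d t(3) by simp
 qed
 have NS: "?N \<notin> S i" for i using tabs_subset[OF S, of i] by auto
 have iff: "tabloid mu (sg \<circ> t) = add_entry lam mu S \<longleftrightarrow> tabloid lam (sg \<circ> t) = S"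
  if s: "sg \<in> column_stabilizer lam t" for sg
 proof -
  have p: "sg permutes {1..?n}" by (rule column_stabilizer_permutes[OF s])
  have "tabloid mu (sg \<circ> t) = add_entry lam mu (tabloid lam (sg \<circ> t))"
   by (simp add: tabloid_comp tm add_entry_act permutes_Suc(2)[OF p])
  moreover have "?N \<notin> tabloid lam (sg \<circ> t) i" for i
   using tabs_subset[OF tabloid_in_tabs[OF is_tab_comp[OF t(2) p]], of i] by auto
  ultimately show ?thesis using add_entry_inj NS by metis
 qed
 have "ptab mu t (add_entry lam mu S) =
   (\<Sum>sg\<in>{sg \<in> column_stabilizer mu t. sg ?N = ?N}.
    if tabloid mu (sg \<circ> t) = add_entry lam mu S then of_int (sign sg) else 0)"
  unfolding ptab_def polytabloid_def using fixN by (intro sum.mono_neutral_right) auto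
 also have "... = ptab lam t S"
  unfolding column_stabilizer_extend[OF c t(2,3)] ptab_def polytabloid_def
  by (intro sum.cong refl) (simp add: iff)
 finally show ?thesis using 1 by simp
qed

text \<open>Pulling back along \<open>add_entry\<close> is an intertwiner of tabloid functions for
  the smaller symmetric group; the two projections compress it to one between the Specht
  modules.\<close>

definition brk :: "nat list => nat list => (nat => nat set) => (nat => nat set) => rat"
 where "brk lam mu S T =
  (\<Sum>S'\<in>tabs lam. spk lam S S' * (\<Sum>T'\<in>tabs mu. entry_kernel lam mu S' T' * spk mu T' T))"

lemma brk_support: "S \<notin> tabs lam ==> brk lam mu S T = 0" "T \<notin> tabs mu ==> brk lam mu S T = 0"
 by (simp_all add: brk_def spk_support)

lemma brk_equivariant:
 assumes n: "sum_list mu = Suc (sum_list lam)" and s: "sg permutes {1..sum_list lam}"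
 shows "brk lam mu (tab_act sg S) (tab_act sg T) = brk lam mu S T"
proof -
 have s': "sg permutes {1..sum_list mu}" using permutes_Suc(1)[OF s] n by simp
 show ?thesis
  unfolding brk_def
  by (subst sum_tabs_act[OF s, symmetric], subst sum_tabs_act[OF s', symmetric])
   (simp add: spk_equivariant[OF s] spk_equivariant[OF s'] entry_kernel_equivariant[OF s])
qed

lemma brk_left:
 assumes "is_partition lam"
 shows "(\<Sum>S'\<in>tabs lam. spk lam S S' * brk lam mu S' T) = brk lam mu S T"
 unfolding brk_def by (subst sum_mult_assoc[symmetric]) (simp add: spk_idem[OF assms])

lemma brk_right:
 assumes "is_partition mu"
 shows "(\<Sum>T'\<in>tabs mu. brk lam mu S T' * spk mu T' T) = brk lam mu S T"
 unfolding brk_def sum_mult_assoc by (simp add: spk_idem[OF assms])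

text \<open>The polytabloid of a tableau with its largest entry in the added cell is sent to the
  polytabloid of the tableau with that cell deleted.\<close>

lemma brk_nonzero:
 assumes lam: "is_partition lam" and mu: "is_partition mu" and add: "adds_cell lam mu"
 shows "\<exists>S\<in>tabs lam. \<exists>T\<in>tabs mu. brk lam mu S T \<noteq> 0"
proof -
 obtain c where c: "c \<notin> cells lam" "cells mu = insert c (cells lam)"
  using add by (auto simp: adds_cell_def)
 have n: "sum_list mu = Suc (sum_list lam)" by (rule adds_cell_sum_list[OF add])
 obtain s where s: "is_tab lam s" using is_tab_exists by blast
 define t where "t = s(c := Suc (sum_list lam))"
 have t: "is_tab lam t" "t c = Suc (sum_list lam)"
 proof -
  have "bij_betw t (cells lam) {1..sum_list lam} \<longleftrightarrow> bij_betw s (cells lam) {1..sum_list lam}"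
   by (rule bij_betw_cong) (use c in \<open>auto simp: t_def\<close>)
  thus "is_tab lam t" using s by (simp add: is_tab_def)
 qed (simp add: t_def)
 have "bij_betw t (insert c (cells lam)) (insert (t c) {1..sum_list lam})"
  using t c(1) unfolding is_tab_def by (subst notIn_Un_bij_betw3[where b = c, simplified, symmetric]) auto
 hence tm: "is_tab mu t"
  using t(2) unfolding is_tab_def c n by (simp add: atLeastAtMostSuc_conv)
 have "(\<Sum>T\<in>tabs mu. brk lam mu S T * ptab mu t T) = ptab lam t S" for S
  unfolding brk_def sum_mult_assoc
  by (simp add: spk_ptab[OF mu tm] entry_kernel_ptab[OF c tm t] spk_ptab[OF lam t(1)])
 from this[of "tabloid lam t"]
 have "(\<Sum>T\<in>tabs mu. brk lam mu (tabloid lam t) T * ptab mu t T) \<noteq> 0"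
  by (simp add: ptab_diag[OF t(1)])
 then obtain T where "T \<in> tabs mu" "brk lam mu (tabloid lam t) T \<noteq> 0"
  by (metis (no_types, lifting) mult_zero_left sum.neutral)
 thus ?thesis using tabloid_in_tabs[OF t(1)] by blast
qed

section \<open>Branching rules for Specht modules\<close>

definition perms :: "nat => (nat => nat) set"
 where "perms n = {sg. sg permutes {1..n}}"

lemma finite_perms [simp]: "finite (perms n)"
 unfolding perms_def by (rule finite_permutations) simp

lemma card_perms: "card (perms n) = fact n"
 unfolding perms_def by (rule card_permutations) simp_all

lemma perms_closed:
 "sg \<in> perms n ==> ta \<in> perms n ==> sg \<circ> ta \<in> perms n"
 "sg \<in> perms n ==> inv' sg \<in> perms n" "id \<in> perms n"
 by (simp_all add: perms_def permutes_compose permutes_inv permutes_id)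

lemma perms_Suc: "sg \<in> perms n ==> sg \<in> perms (Suc n)"
 unfolding perms_def using permutes_Suc(1) by blast

lemma perms_inv:
 assumes "sg \<in> perms n"
 shows "inv' sg \<circ> sg = id" "sg \<circ> inv' sg = id" "inv' sg (sg x) = x" "sg (inv' sg x) = x"
  "inv' (inv' sg) = sg"
 using assms unfolding perms_def
 by (simp_all add: permutes_inv_o permutes_inverses permutes_inv_inv)

lemma bij_perms_right: "ta \<in> perms n ==> bij_betw (\<lambda>sg. sg \<circ> ta) (perms n) (perms n)"
 by (rule bij_betw_byWitness[where f' = "\<lambda>sg. sg \<circ> inv' ta"])
  (auto simp: perms_closed perms_inv fun_eq_iff)

text \<open>Contracting two equivariant kernels over \<open>Y\<close> gives an equivariant kernel
  between two Specht modules, so Schur's lemma applies. On \<open>Y\<close> only compatible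
  bijections are required: it will be \<open>tabs mu\<close> for restriction and
  \<open>ind_index lam\<close> for induction.\<close>

lemma kernel_schur:
 fixes f :: "(nat => nat set) => 'y => rat"
 assumes lam: "is_partition lam" and lam': "is_partition lam'" and n: "sum_list lam = sum_list lam'"
  and act: "\<And>sg. sg \<in> perms (sum_list lam) ==> \<exists>h. bij_betw h Y Y \<and>
   (\<forall>y\<in>Y. \<forall>S. f (tab_act sg S) (h y) = f S y \<and> f' (tab_act sg S) (h y) = f' S y)"
  and supp: "\<And>S y. S \<notin> tabs lam ==> f S y = 0" "\<And>S y. S \<notin> tabs lam' ==> f' S y = 0"
  and abs: "\<And>S y. (\<Sum>S'\<in>tabs lam. spk lam S S' * f S' y) = f S y"
   "\<And>S y. (\<Sum>S'\<in>tabs lam'. spk lam' S S' * f' S' y) = f' S y"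
 shows "lam \<noteq> lam' ==> (\<Sum>y\<in>Y. f S y * f' S' y) = 0"
  and "lam = lam' ==> \<exists>k. \<forall>S S'. (\<Sum>y\<in>Y. f S y * f' S' y) = k * spk lam S S'"
proof -
 define a where "a S' S = (\<Sum>y\<in>Y. f S y * f' S' y)" for S' S
 have eq: "a (tab_act sg S') (tab_act sg S) = a S' S" if s: "sg permutes {1..sum_list lam}" for sg S' S
 proof -
  from act[of sg] s obtain h where h: "bij_betw h Y Y"
   "\<And>y S. y \<in> Y ==> f (tab_act sg S) (h y) = f S y \<and> f' (tab_act sg S) (h y) = f' S y"
   unfolding perms_def by blast
  have "a (tab_act sg S') (tab_act sg S) = (\<Sum>y\<in>Y. f (tab_act sg S) (h y) * f' (tab_act sg S') (h y))"
   unfolding a_def by (rule sum.reindex_bij_betw[OF h(1), symmetric])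
  also have "... = a S' S" unfolding a_def by (intro sum.cong refl) (simp add: h(2))
  finally show ?thesis .
 qed
 have sp: "S' \<notin> tabs lam' ==> a S' S = 0" "S \<notin> tabs lam ==> a S' S = 0" for S' S
  by (simp_all add: a_def supp)
 have r: "(\<Sum>T\<in>tabs lam. a S' T * spk lam T S) = a S' S" for S' S
 proof -
  have "(\<Sum>T\<in>tabs lam. a S' T * spk lam T S) =
    (\<Sum>T\<in>tabs lam. (\<Sum>y\<in>Y. f' S' y * f T y) * spk lam T S)"
   by (simp add: a_def mult.commute)
  also have "... = (\<Sum>y\<in>Y. f' S' y * (\<Sum>T\<in>tabs lam. f T y * spk lam T S))"
   by (rule sum_mult_assoc)
  also have "... = a S' S"
   using abs(1)[of S] by (simp add: a_def spk_sym[of lam _ S] mult.commute)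
  finally show ?thesis .
 qed
 have l: "(\<Sum>T\<in>tabs lam'. spk lam' S' T * a T S) = a S' S" for S' S
 proof -
  have "(\<Sum>T\<in>tabs lam'. spk lam' S' T * a T S) =
    (\<Sum>T\<in>tabs lam'. (\<Sum>y\<in>Y. f S y * f' T y) * spk lam' S' T)"
   by (simp add: a_def mult.commute)
  also have "... = (\<Sum>y\<in>Y. f S y * (\<Sum>T\<in>tabs lam'. f' T y * spk lam' S' T))"
   by (rule sum_mult_assoc)
  also have "... = a S' S"
   using abs(2)[of S'] by (simp add: a_def mult.commute)
  finally show ?thesis .
 qed
 show "(\<Sum>y\<in>Y. f S y * f' S' y) = 0" if "lam \<noteq> lam'"
  using schur_zero[OF lam lam' n that, of a S' S] eq sp r l unfolding a_def by blast
 show "\<exists>k. \<forall>S S'. (\<Sum>y\<in>Y. f S y * f' S' y) = k * spk lam S S'" if "lam = lam'"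
 proof -
  have "\<exists>k. \<forall>S' S. a S' S = k * spk lam S' S"
   by (rule schur_scalar[OF lam, of a, OF eq _ r]) (use sp(1) that in auto)
  thus ?thesis unfolding a_def by (metis spk_sym)
 qed
qed

text \<open>If the constant were zero, a sum of rational squares with a nonzero term would
  vanish.\<close>

lemma kernel_schur_nonzero:
 fixes f :: "'x => 'y => rat"
 assumes "finite Y" "y \<in> Y" "f S y \<noteq> 0" and k: "\<And>S. (\<Sum>y\<in>Y. f S y * f S y) = k * q S"
 shows "k \<noteq> 0"
proof
 assume "k = 0"
 hence "(\<Sum>y\<in>Y. f S y * f S y) = 0" using k by simp
 hence "f S y * f S y = 0" using assms(1,2) by (subst (asm) sum_nonneg_eq_0_iff) auto
 thus False using assms(3) by simp
qed

text \<open>The trace of the projection, that is, the dimension of the Specht module; only traces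
  are ever compared.\<close>

definition specht_dim :: "nat list => rat"
 where "specht_dim lam = (\<Sum>S\<in>tabs lam. spk lam S S)"

section \<open>Restriction to one point less\<close>

definition restrict_const :: "nat list => nat list => rat"
 where "restrict_const lam mu =
  (SOME k. \<forall>S S'. (\<Sum>T\<in>tabs mu. brk lam mu S T * brk lam mu S' T) = k * spk lam S S')"

text \<open>\<open>restrict_const\<close> is the scalar by which the intertwiner composed with its
  transpose acts. It is nonzero because \<open>brk\<close> is.\<close>

lemma restrict_schur:
 assumes mu: "is_partition mu" and lam: "lam \<in> down_set mu" "lam' \<in> down_set mu"
 shows "lam \<noteq> lam' ==> (\<Sum>T\<in>tabs mu. brk lam mu S T * brk lam' mu S' T) = 0"
  and "(\<Sum>T\<in>tabs mu. brk lam mu S T * brk lam mu S' T) = restrict_const lam mu * spk lam S S'"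
  and "restrict_const lam mu \<noteq> 0"
proof -
 have l: "is_partition lam" "is_partition lam'" "adds_cell lam mu" "adds_cell lam' mu"
  using lam by (auto simp: down_set_def)
 have n: "sum_list mu = Suc (sum_list lam)" "sum_list mu = Suc (sum_list lam')"
  using l adds_cell_sum_list by blast+
 have act: "\<exists>h. bij_betw h (tabs mu) (tabs mu) \<and> (\<forall>T\<in>tabs mu. \<forall>S.
   brk lam mu (tab_act sg S) (h T) = brk lam mu S T \<and> brk lam' mu (tab_act sg S) (h T) = brk lam' mu S T)"
  if "sg \<in> perms (sum_list lam)" for sg
  using bij_tab_act[of sg mu] brk_equivariant[OF n(1)] brk_equivariant[OF n(2)] that n
   perms_Suc[OF that] unfolding perms_def by (intro exI[of _ "tab_act sg"]) auto
 show "(\<Sum>T\<in>tabs mu. brk lam mu S T * brk lam' mu S' T) = 0" if "lam \<noteq> lam'"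
  by (rule kernel_schur(1)[OF l(1,2) _ act])
   (use n that brk_support brk_left l in auto)
 have act': "\<exists>h. bij_betw h (tabs mu) (tabs mu) \<and> (\<forall>T\<in>tabs mu. \<forall>S.
   brk lam mu (tab_act sg S) (h T) = brk lam mu S T \<and> brk lam mu (tab_act sg S) (h T) = brk lam mu S T)"
  if "sg \<in> perms (sum_list lam)" for sg
  using act[OF that] by blast
 have "\<exists>k. \<forall>S S'. (\<Sum>T\<in>tabs mu. brk lam mu S T * brk lam mu S' T) = k * spk lam S S'"
  by (rule kernel_schur(2)[OF l(1,1) refl act'])
   (use brk_support brk_left l in auto)
 from someI_ex[OF this] have k: "(\<Sum>T\<in>tabs mu. brk lam mu S T * brk lam mu S' T) =
   restrict_const lam mu * spk lam S S'" for S S'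
  unfolding restrict_const_def by blast
 thus "(\<Sum>T\<in>tabs mu. brk lam mu S T * brk lam mu S' T) = restrict_const lam mu * spk lam S S'" .
 obtain S T where "T \<in> tabs mu" "brk lam mu S T \<noteq> 0" using brk_nonzero[OF l(1) mu l(3)] by blast
 thus "restrict_const lam mu \<noteq> 0"
  using kernel_schur_nonzero[of "tabs mu" T "brk lam mu" S "restrict_const lam mu" "\<lambda>S. spk lam S S"] k
  by simp
qed

text \<open>The Specht modules below \<open>mu\<close> occur in the restriction and are mutually
  orthogonal, which bounds the sum of their dimensions; in case of equality the intertwiners resolve
  the projection.\<close>

lemma restrict_bessel:
 assumes mu: "is_partition mu"
 shows "(\<Sum>lam\<in>down_set mu. specht_dim lam) \<le> specht_dim mu"
  and "(\<Sum>lam\<in>down_set mu. specht_dim lam) = specht_dim mu ==> T \<in> tabs mu ==> T' \<in> tabs mu ==>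
   spk mu T T' = (\<Sum>lam\<in>down_set mu. \<Sum>S\<in>tabs lam. brk lam mu S T * brk lam mu S T' / restrict_const lam mu)"
proof -
 have p: "is_partition lam" if "lam \<in> down_set mu" for lam using that by (simp add: down_set_def)
 note B = bessel[where Y = "tabs mu" and I = "down_set mu" and Z = tabs and P = "spk mu"
   and u = "\<lambda>lam. brk lam mu" and p = spk and k = "\<lambda>lam. restrict_const lam mu",
   OF finite_tabs bij_removable_down(2)[OF mu] finite_tabs spk_sym spk_idem[OF mu]
    brk_right[OF mu] restrict_schur(1)[OF mu] restrict_schur(2)[OF mu]
    restrict_schur(3)[OF mu] brk_left[OF p]]
 show "(\<Sum>lam\<in>down_set mu. specht_dim lam) \<le> specht_dim mu"
  unfolding specht_dim_def by (rule B(1))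
 show "spk mu T T' = (\<Sum>lam\<in>down_set mu. \<Sum>S\<in>tabs lam. brk lam mu S T * brk lam mu S T' / restrict_const lam mu)"
  if "(\<Sum>lam\<in>down_set mu. specht_dim lam) = specht_dim mu" "T \<in> tabs mu" "T' \<in> tabs mu"
  by (rule B(2)) (use that in \<open>simp_all add: specht_dim_def\<close>)
qed

text \<open>Functions \<open>f\<close> on the symmetric group of degree \<open>n + 1\<close> with values in functions on tabloids and
 with \<open>f (sg \<circ> g) = sg (f g)\<close> for \<open>sg\<close> in the symmetric group of degree \<open>n\<close> form the induced
 representation; \<open>ind_kernel\<close> is the projection onto it.\<close>

definition ind_index :: "nat list => ((nat => nat) \<times> (nat => nat set)) set"
 where "ind_index lam = perms (Suc (sum_list lam)) \<times> tabs lam"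

definition ind_kernel ::
 "nat list => (nat => nat) \<times> (nat => nat set) => (nat => nat) \<times> (nat => nat set) => rat"
 where "ind_kernel lam y z =
  (\<Sum>sg\<in>perms (sum_list lam). if fst y \<in> perms (Suc (sum_list lam)) \<and> fst z = sg \<circ> fst y
   then spk lam (tab_act sg (snd y)) (snd z) else 0) / of_nat (fact (sum_list lam))"

text \<open>The counterpart of \<open>brk\<close> under Frobenius reciprocity: the group component
  of the index first moves \<open>T\<close>.\<close>

definition ind_brk :: "nat list => nat list => (nat => nat set) => (nat => nat) \<times> (nat => nat set) => rat"
 where "ind_brk lam mu T y =
  (if fst y \<in> perms (Suc (sum_list lam)) then brk lam mu (snd y) (tab_act (fst y) T) else 0)"

lemma finite_ind_index [simp]: "finite (ind_index lam)"
 by (simp add: ind_index_def)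

lemma sum_ind_kernel:
 fixes F :: "_ => 'k::field_char_0"
 assumes y: "y \<in> ind_index lam"
 shows "(\<Sum>z\<in>ind_index lam. of_rat (ind_kernel lam y z) * F z) =
  (\<Sum>sg\<in>perms (sum_list lam). \<Sum>S\<in>tabs lam.
   of_rat (spk lam (tab_act sg (snd y)) S) * F (sg \<circ> fst y, S)) / of_nat (fact (sum_list lam))"
proof -
 let ?n = "sum_list lam"
 have y1: "fst y \<in> perms (Suc ?n)" using y by (auto simp: ind_index_def)
 have g: "sg \<circ> fst y \<in> perms (Suc ?n)" if "sg \<in> perms ?n" for sg
  using y1 that by (simp add: perms_closed perms_Suc)
 have "(\<Sum>z\<in>ind_index lam. of_rat (ind_kernel lam y z) * F z) =
   (\<Sum>z\<in>ind_index lam. \<Sum>sg\<in>perms ?n.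
    (if fst z = sg \<circ> fst y then of_rat (spk lam (tab_act sg (snd y)) (snd z)) * F z else 0)) / of_nat (fact ?n)"
  unfolding ind_kernel_def sum_divide_distrib
  by (intro sum.cong refl)
   (simp add: y1 of_rat_divide of_rat_sum sum_distrib_right if_distrib[of of_rat]
    if_distrib[of "\<lambda>x. x * _"] del: of_nat_fact cong: if_cong)
 also have "(\<Sum>z\<in>ind_index lam. \<Sum>sg\<in>perms ?n.
    (if fst z = sg \<circ> fst y then of_rat (spk lam (tab_act sg (snd y)) (snd z)) * F z else 0)) =
   (\<Sum>sg\<in>perms ?n. \<Sum>z\<in>ind_index lam.
    (if fst z = sg \<circ> fst y then of_rat (spk lam (tab_act sg (snd y)) (snd z)) * F z else 0))"
  by (rule sum.swap)
 also have "... = (\<Sum>sg\<in>perms ?n. \<Sum>S\<in>tabs lam. of_rat (spk lam (tab_act sg (snd y)) S) * F (sg \<circ> fst y, S))"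
 proof (rule sum.cong[OF refl])
  fix sg assume s: "sg \<in> perms ?n"
  have "(\<Sum>z\<in>ind_index lam.
    (if fst z = sg \<circ> fst y then of_rat (spk lam (tab_act sg (snd y)) (snd z)) * F z else 0)) =
   (\<Sum>z\<in>Pair (sg \<circ> fst y) ` tabs lam. of_rat (spk lam (tab_act sg (snd y)) (snd z)) * F z)"
   using g[OF s] by (intro sum.mono_neutral_cong_right) (auto simp: ind_index_def)
  also have "... = (\<Sum>S\<in>tabs lam. of_rat (spk lam (tab_act sg (snd y)) S) * F (sg \<circ> fst y, S))"
   by (subst sum.reindex) (auto simp: inj_on_def)
  finally show "(\<Sum>z\<in>ind_index lam.
    (if fst z = sg \<circ> fst y then of_rat (spk lam (tab_act sg (snd y)) (snd z)) * F z else 0)) =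
   (\<Sum>S\<in>tabs lam. of_rat (spk lam (tab_act sg (snd y)) S) * F (sg \<circ> fst y, S))" .
 qed
 finally show ?thesis .
qed

text \<open>On an equivariant function all terms of the average agree.\<close>

lemma ind_kernel_fixed:
 fixes F :: "_ => 'k::field_char_0"
 assumes y: "y \<in> ind_index lam"
  and F: "\<And>g. g \<in> perms (Suc (sum_list lam)) ==>
   kapply (tabs lam) (spk lam) (\<lambda>S. F (g, S)) = (\<lambda>S. F (g, S))"
  and eq: "\<And>sg g S. sg \<in> perms (sum_list lam) ==> g \<in> perms (Suc (sum_list lam)) ==>
   F (sg \<circ> g, tab_act sg S) = F (g, S)"
 shows "(\<Sum>z\<in>ind_index lam. of_rat (ind_kernel lam y z) * F z) = F y"
proof -
 have g: "fst y \<in> perms (Suc (sum_list lam))" using y by (auto simp: ind_index_def)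
 have "(\<Sum>S\<in>tabs lam. of_rat (spk lam (tab_act sg (snd y)) S) * F (sg \<circ> fst y, S)) = F y"
  if s: "sg \<in> perms (sum_list lam)" for sg
  using fun_cong[OF F[of "sg \<circ> fst y"], of "tab_act sg (snd y)"] eq[OF s g, of "snd y"] s g
  by (simp add: kapply_def perms_closed perms_Suc)
 thus ?thesis unfolding sum_ind_kernel[OF y] by (simp add: card_perms)
qed

lemma perms_comp_iff:
 assumes "sg \<in> perms n"
 shows "sg \<circ> g \<in> perms n \<longleftrightarrow> g \<in> perms n"
proof
 assume "sg \<circ> g \<in> perms n"
 hence "inv' sg \<circ> (sg \<circ> g) \<in> perms n" by (rule perms_closed(1)[OF perms_closed(2)[OF assms]])
 thus "g \<in> perms n" by (simp add: perms_inv[OF assms] comp_assoc[symmetric])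
qed (use assms perms_closed in auto)

text \<open>Replacing \<open>sg\<close> by its inverse exchanges the roles of the two
  indices.\<close>

lemma ind_kernel_sym: "ind_kernel lam y z = ind_kernel lam z y"
proof -
 let ?P = "perms (Suc (sum_list lam))"
 have b: "bij_betw inv' (perms (sum_list lam)) (perms (sum_list lam))"
  by (rule bij_betw_byWitness[where f' = inv']) (auto simp: perms_closed perms_inv)
 have "(\<Sum>sg\<in>perms (sum_list lam). if fst y \<in> ?P \<and> fst z = sg \<circ> fst y then spk lam (tab_act sg (snd y)) (snd z) else 0) =
  (\<Sum>sg\<in>perms (sum_list lam). if fst y \<in> ?P \<and> fst z = inv' sg \<circ> fst y then spk lam (tab_act (inv' sg) (snd y)) (snd z) else 0)"
  by (rule sum.reindex_bij_betw[OF b, symmetric])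
 also have "... = (\<Sum>sg\<in>perms (sum_list lam). if fst z \<in> ?P \<and> fst y = sg \<circ> fst z then spk lam (tab_act sg (snd z)) (snd y) else 0)"
 proof (rule sum.cong[OF refl])
  fix sg assume s: "sg \<in> perms (sum_list lam)"
  hence s': "sg permutes {1..sum_list lam}" by (simp add: perms_def)
  have "fst z = inv' sg \<circ> fst y \<longleftrightarrow> fst y = sg \<circ> fst z"
   using perms_inv[OF s] by (auto simp: fun_eq_iff)
  hence "fst y \<in> ?P \<and> fst z = inv' sg \<circ> fst y \<longleftrightarrow> fst z \<in> ?P \<and> fst y = sg \<circ> fst z"
   using perms_comp_iff[OF perms_Suc[OF s], of "fst z"] by auto
  moreover have "spk lam (tab_act (inv' sg) (snd y)) (snd z) = spk lam (tab_act sg (snd z)) (snd y)"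
   using spk_equivariant[OF s', of "tab_act (inv' sg) (snd y)" "snd z"] tab_act_inv[OF s']
   by (simp add: spk_sym)
  ultimately show "(if fst y \<in> ?P \<and> fst z = inv' sg \<circ> fst y then spk lam (tab_act (inv' sg) (snd y)) (snd z) else 0) =
   (if fst z \<in> ?P \<and> fst y = sg \<circ> fst z then spk lam (tab_act sg (snd z)) (snd y) else 0)" by simp
 qed
 finally show ?thesis by (simp add: ind_kernel_def)
qed

lemma ind_kernel_equivariant:
 assumes t: "ta \<in> perms (sum_list lam)"
 shows "ind_kernel lam (ta \<circ> g, tab_act ta S) z = ind_kernel lam (g, S) z"
proof -
 have "(\<Sum>sg\<in>perms (sum_list lam). if g \<in> perms (Suc (sum_list lam)) \<and> fst z = (sg \<circ> ta) \<circ> g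
   then spk lam (tab_act (sg \<circ> ta) S) (snd z) else 0) =
  (\<Sum>sg\<in>perms (sum_list lam). if g \<in> perms (Suc (sum_list lam)) \<and> fst z = sg \<circ> g
   then spk lam (tab_act sg S) (snd z) else 0)"
  by (rule sum.reindex_bij_betw[OF bij_perms_right[OF t]])
 thus ?thesis
  by (simp add: ind_kernel_def perms_comp_iff[OF perms_Suc[OF t]] tab_act_comp comp_assoc cong: if_cong)
qed

lemma ind_kernel_spk:
 assumes lam: "is_partition lam"
 shows "(\<Sum>S'\<in>tabs lam. spk lam S S' * ind_kernel lam (g, S') z) = ind_kernel lam (g, S) z"
proof -
 let ?c = "\<lambda>sg. g \<in> perms (Suc (sum_list lam)) \<and> fst z = sg \<circ> g"
 have e: "(\<Sum>S'\<in>tabs lam. spk lam S S' * (if ?c sg then spk lam (tab_act sg S') (snd z) else 0)) =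
   (if ?c sg then spk lam (tab_act sg S) (snd z) else 0)" if s: "sg \<in> perms (sum_list lam)" for sg
 proof -
  have s': "sg permutes {1..sum_list lam}" using s by (simp add: perms_def)
  have "(\<Sum>S'\<in>tabs lam. spk lam S S' * spk lam (tab_act sg S') (snd z)) =
    (\<Sum>S'\<in>tabs lam. spk lam (tab_act sg S) (tab_act sg S') * spk lam (tab_act sg S') (snd z))"
   by (simp add: spk_equivariant[OF s'])
  also have "... = (\<Sum>S'\<in>tabs lam. spk lam (tab_act sg S) S' * spk lam S' (snd z))"
   by (rule sum_tabs_act[OF s'])
  finally show ?thesis
   by (cases "?c sg") (simp_all only: spk_idem[OF lam] simp_thms if_True if_False mult_zero_right sum.neutral_const)
 qed
 have "(\<Sum>S'\<in>tabs lam. spk lam S S' * ind_kernel lam (g, S') z) =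
  (\<Sum>S'\<in>tabs lam. \<Sum>sg\<in>perms (sum_list lam). spk lam S S' *
   (if ?c sg then spk lam (tab_act sg S') (snd z) else 0)) / of_nat (fact (sum_list lam))"
  unfolding ind_kernel_def fst_conv snd_conv times_divide_eq_right sum_divide_distrib[symmetric]
   sum_distrib_left ..
 also have "... = ind_kernel lam (g, S) z"
  by (subst sum.swap) (simp add: e ind_kernel_def cong: if_cong)
 finally show ?thesis .
qed

lemma ind_kernel_outside:
 assumes "y \<notin> ind_index lam"
 shows "ind_kernel lam y z = 0"
proof -
 have "spk lam (tab_act sg (snd y)) (snd z) = 0"
  if "sg \<in> perms (sum_list lam)" "fst y \<in> perms (Suc (sum_list lam))" for sg
  using assms that tab_act_tabs_iff[of sg lam "snd y"]
  by (intro spk_support) (auto simp: ind_index_def perms_def mem_Times_iff)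
 thus ?thesis unfolding ind_kernel_def by (auto intro!: sum.neutral)
qed

lemma ind_kernel_absorb:
 fixes F :: "_ => rat"
 assumes y: "y \<in> ind_index lam"
  and F: "\<And>g S. (\<Sum>S'\<in>tabs lam. spk lam S S' * F (g, S')) = F (g, S)"
  and eq: "\<And>sg g S. sg \<in> perms (sum_list lam) ==> F (sg \<circ> g, tab_act sg S) = F (g, S)"
 shows "(\<Sum>z\<in>ind_index lam. ind_kernel lam y z * F z) = F y"
proof -
 have "kapply (tabs lam) (spk lam) (\<lambda>S. F (g, S)) = (\<lambda>S. F (g, S))" for g
  using F by (simp add: kapply_def)
 from ind_kernel_fixed[OF y this eq] show ?thesis by simp
qed

lemma ind_kernel_idem:
 assumes lam: "is_partition lam"
 shows "(\<Sum>z\<in>ind_index lam. ind_kernel lam a z * ind_kernel lam z b) = ind_kernel lam a b"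
proof (cases "a \<in> ind_index lam")
 case True
 thus ?thesis
  by (rule ind_kernel_absorb[where F = "\<lambda>z. ind_kernel lam z b"])
   (simp_all add: ind_kernel_spk[OF lam] ind_kernel_equivariant)
qed (simp add: ind_kernel_outside)

text \<open>Only \<open>sg = id\<close> contributes to the diagonal; the factor is the quotient of
  the orders of the two symmetric groups.\<close>

lemma ind_kernel_trace:
 "(\<Sum>y\<in>ind_index lam. ind_kernel lam y y) = of_nat (Suc (sum_list lam)) * specht_dim lam"
proof -
 let ?n = "sum_list lam"
 have "ind_kernel lam (g, S) (g, S) = spk lam S S / of_nat (fact ?n)" if g: "g \<in> perms (Suc ?n)" for g S
 proof -
  have "g = sg \<circ> g \<longleftrightarrow> sg = id" for sg
  proof
   assume "g = sg \<circ> g"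
   hence "g \<circ> inv' g = sg \<circ> (g \<circ> inv' g)" by (simp add: comp_assoc[symmetric])
   thus "sg = id" by (simp add: perms_inv[OF g])
  qed simp
  hence "(\<Sum>sg\<in>perms ?n. if g \<in> perms (Suc ?n) \<and> g = sg \<circ> g then spk lam (tab_act sg S) S else 0) =
    (\<Sum>sg\<in>perms ?n. if sg = id then spk lam S S else 0)"
   using g by (intro sum.cong refl) auto
  thus ?thesis by (simp add: ind_kernel_def perms_closed cong: if_cong)
 qed
 hence "(\<Sum>y\<in>ind_index lam. ind_kernel lam y y) =
   (\<Sum>g\<in>perms (Suc ?n). \<Sum>S\<in>tabs lam. spk lam S S / of_nat (fact ?n))"
  unfolding ind_index_def sum.cartesian_product' by (intro sum.cong refl) auto
 also have "... = of_nat (Suc ?n) * specht_dim lam"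
  by (simp add: specht_dim_def card_perms sum_divide_distrib[symmetric] field_simps)
 finally show ?thesis .
qed

definition ind_const :: "nat list => nat list => rat"
 where "ind_const lam mu =
  (SOME k. \<forall>T T'. (\<Sum>y\<in>ind_index lam. ind_brk lam mu T y * ind_brk lam mu T' y) = k * spk mu T T')"

lemma ind_brk_left:
 assumes mu: "is_partition mu" and n: "sum_list mu = Suc (sum_list lam)"
 shows "(\<Sum>T'\<in>tabs mu. spk mu T T' * ind_brk lam mu T' y) = ind_brk lam mu T y"
proof (cases "fst y \<in> perms (Suc (sum_list lam))")
 case True
 hence s: "fst y permutes {1..sum_list mu}" by (simp add: perms_def n)
 have "(\<Sum>T'\<in>tabs mu. spk mu T T' * brk lam mu (snd y) (tab_act (fst y) T')) =
   (\<Sum>T'\<in>tabs mu. spk mu (tab_act (fst y) T) (tab_act (fst y) T') * brk lam mu (snd y) (tab_act (fst y) T'))"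
  by (simp add: spk_equivariant[OF s])
 also have "... = (\<Sum>T'\<in>tabs mu. spk mu (tab_act (fst y) T) T' * brk lam mu (snd y) T')"
  by (rule sum_tabs_act[OF s])
 also have "... = brk lam mu (snd y) (tab_act (fst y) T)"
  using brk_right[OF mu, of lam "snd y" "tab_act (fst y) T"]
  by (simp add: spk_sym[of mu "tab_act (fst y) T"] mult.commute)
 finally show ?thesis using True by (simp add: ind_brk_def)
qed (simp add: ind_brk_def)

lemma ind_brk_support:
 assumes "sum_list mu = Suc (sum_list lam)" "T \<notin> tabs mu"
 shows "ind_brk lam mu T y = 0"
 using assms tab_act_tabs_iff[of "fst y" mu T]
 by (auto simp: ind_brk_def perms_def intro: brk_support)

lemma ind_brk_equivariant:
 assumes n: "sum_list mu = Suc (sum_list lam)" and s: "sg \<in> perms (sum_list lam)"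
 shows "ind_brk lam mu T (sg \<circ> g, tab_act sg S) = ind_brk lam mu T (g, S)"
 using s perms_comp_iff[OF perms_Suc[OF s]]
 by (simp add: ind_brk_def tab_act_comp brk_equivariant[OF n] perms_def)

lemma ind_brk_right:
 assumes lam: "is_partition lam" and n: "sum_list mu = Suc (sum_list lam)"
 shows "(\<Sum>z\<in>ind_index lam. ind_brk lam mu T z * ind_kernel lam z y) = ind_brk lam mu T y"
proof (cases "y \<in> ind_index lam")
 case True
 have "(\<Sum>z\<in>ind_index lam. ind_kernel lam y z * ind_brk lam mu T z) = ind_brk lam mu T y"
  by (rule ind_kernel_absorb[OF True])
   (simp_all add: ind_brk_equivariant[OF n], simp add: ind_brk_def brk_left[OF lam])
 thus ?thesis by (simp add: ind_kernel_sym[of lam y] mult.commute)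
next
 case False
 hence "ind_brk lam mu T y = 0"
  by (auto simp: ind_brk_def ind_index_def mem_Times_iff brk_support)
 thus ?thesis using ind_kernel_outside[OF False] by (simp add: ind_kernel_sym[of lam _ y])
qed

lemma ind_schur:
 assumes lam: "is_partition lam" and mu: "mu \<in> up_set lam" "mu' \<in> up_set lam"
 shows "mu \<noteq> mu' ==> (\<Sum>y\<in>ind_index lam. ind_brk lam mu T y * ind_brk lam mu' T' y) = 0"
  and "(\<Sum>y\<in>ind_index lam. ind_brk lam mu T y * ind_brk lam mu T' y) = ind_const lam mu * spk mu T T'"
  and "ind_const lam mu \<noteq> 0"
proof -
 have l: "is_partition mu" "is_partition mu'" "adds_cell lam mu" "adds_cell lam mu'"
  using mu by (auto simp: up_set_def)
 have n: "sum_list mu = Suc (sum_list lam)" "sum_list mu' = Suc (sum_list lam)"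
  using l adds_cell_sum_list by blast+
 have act: "\<exists>h. bij_betw h (ind_index lam) (ind_index lam) \<and> (\<forall>y\<in>ind_index lam. \<forall>T.
   ind_brk lam mu (tab_act sg T) (h y) = ind_brk lam mu T y \<and>
   ind_brk lam mu' (tab_act sg T) (h y) = ind_brk lam mu' T y)"
  if s: "sg \<in> perms (sum_list mu)" for sg
 proof (intro exI conjI ballI allI)
  \<comment> \<open>The larger symmetric group acts on the induced representation by right
    translation, which leaves the tabloid alone.\<close>
  let ?h = "\<lambda>y. (fst y \<circ> inv' sg, snd y)"
  have s': "sg \<in> perms (Suc (sum_list lam))" using s n by simp
  show "bij_betw ?h (ind_index lam) (ind_index lam)"
   by (rule bij_betw_byWitness[where f' = "\<lambda>y. (fst y \<circ> sg, snd y)"])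
    (use s' in \<open>auto simp: ind_index_def perms_closed comp_assoc perms_inv\<close>)
  show "ind_brk lam mu (tab_act sg T) (?h y) = ind_brk lam mu T y"
   "ind_brk lam mu' (tab_act sg T) (?h y) = ind_brk lam mu' T y"
   if "y \<in> ind_index lam" for y T
   using that s' by (auto simp: ind_brk_def ind_index_def perms_closed tab_act_comp[symmetric]
     comp_assoc perms_inv)
 qed
 show "(\<Sum>y\<in>ind_index lam. ind_brk lam mu T y * ind_brk lam mu' T' y) = 0" if "mu \<noteq> mu'"
  by (rule kernel_schur(1)[OF l(1,2) _ act])
   (use n that ind_brk_support ind_brk_left l in auto)
 have act': "\<exists>h. bij_betw h (ind_index lam) (ind_index lam) \<and> (\<forall>y\<in>ind_index lam. \<forall>T.
   ind_brk lam mu (tab_act sg T) (h y) = ind_brk lam mu T y \<and>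
   ind_brk lam mu (tab_act sg T) (h y) = ind_brk lam mu T y)"
  if "sg \<in> perms (sum_list mu)" for sg
  using act[OF that] by blast
 have "\<exists>k. \<forall>T T'. (\<Sum>y\<in>ind_index lam. ind_brk lam mu T y * ind_brk lam mu T' y) = k * spk mu T T'"
  by (rule kernel_schur(2)[OF l(1,1) refl act'])
   (use n ind_brk_support ind_brk_left l in auto)
 from someI_ex[OF this] have k: "(\<Sum>y\<in>ind_index lam. ind_brk lam mu T y * ind_brk lam mu T' y) =
   ind_const lam mu * spk mu T T'" for T T'
  unfolding ind_const_def by blast
 thus "(\<Sum>y\<in>ind_index lam. ind_brk lam mu T y * ind_brk lam mu T' y) = ind_const lam mu * spk mu T T'" .
 obtain S T where "S \<in> tabs lam" "brk lam mu S T \<noteq> 0" using brk_nonzero[OF lam l(1) l(3)] by blast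
 hence "(id, S) \<in> ind_index lam" "ind_brk lam mu T (id, S) \<noteq> 0"
  by (auto simp: ind_index_def ind_brk_def perms_closed)
 thus "ind_const lam mu \<noteq> 0"
  using kernel_schur_nonzero[of "ind_index lam" "(id, S)" "ind_brk lam mu" T "ind_const lam mu" "\<lambda>T. spk mu T T"] k
  by simp
qed

lemma ind_bessel:
 assumes lam: "is_partition lam"
 shows "(\<Sum>mu\<in>up_set lam. specht_dim mu) \<le> of_nat (Suc (sum_list lam)) * specht_dim lam"
  and "(\<Sum>mu\<in>up_set lam. specht_dim mu) = of_nat (Suc (sum_list lam)) * specht_dim lam ==>
   y \<in> ind_index lam ==> z \<in> ind_index lam ==>
   ind_kernel lam y z = (\<Sum>mu\<in>up_set lam. \<Sum>T\<in>tabs mu. ind_brk lam mu T y * ind_brk lam mu T z / ind_const lam mu)"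
proof -
 have p: "is_partition mu" "sum_list mu = Suc (sum_list lam)" if "mu \<in> up_set lam" for mu
  using that adds_cell_sum_list by (auto simp: up_set_def)
 note B = bessel[where Y = "ind_index lam" and I = "up_set lam" and Z = tabs and P = "ind_kernel lam"
   and u = "ind_brk lam" and p = spk and k = "ind_const lam",
   OF finite_ind_index bij_addable_up(2)[OF lam] finite_tabs ind_kernel_sym ind_kernel_idem[OF lam]
    ind_brk_right[OF lam p(2)] ind_schur(1)[OF lam] ind_schur(2)[OF lam]
    ind_schur(3)[OF lam] ind_brk_left[OF p]]
 show "(\<Sum>mu\<in>up_set lam. specht_dim mu) \<le> of_nat (Suc (sum_list lam)) * specht_dim lam"
  unfolding specht_dim_def[of "_ :: nat list"] ind_kernel_trace[symmetric, unfolded specht_dim_def]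
  by (rule B(1))
 show "ind_kernel lam y z = (\<Sum>mu\<in>up_set lam. \<Sum>T\<in>tabs mu. ind_brk lam mu T y * ind_brk lam mu T z / ind_const lam mu)"
  if "(\<Sum>mu\<in>up_set lam. specht_dim mu) = of_nat (Suc (sum_list lam)) * specht_dim lam"
   "y \<in> ind_index lam" "z \<in> ind_index lam"
  by (rule B(2)) (use that ind_kernel_trace[of lam] in \<open>simp_all add: specht_dim_def\<close>)
qed

text \<open>Both Bessel inequalities are equalities: going up and then down in Young's lattice,
 \<open>DU - UD = 1\<close> bounds the dimension of the induced representation from below.\<close>

lemma branching_step:
 assumes lam: "is_partition lam" and n: "sum_list lam = n"
  and ud: "(\<Sum>ka\<in>down_set lam. \<Sum>mu\<in>up_set ka. specht_dim mu) = of_nat n * specht_dim lam"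
 shows "(\<Sum>mu\<in>up_set lam. specht_dim mu) = of_nat (Suc n) * specht_dim lam \<and>
   (\<forall>mu\<in>up_set lam. (\<Sum>nu\<in>down_set mu. specht_dim nu) = specht_dim mu)"
proof -
 have p: "is_partition mu" if "mu \<in> up_set lam" for mu using that by (simp add: up_set_def)
 have 1: "(\<Sum>mu\<in>up_set lam. \<Sum>nu\<in>down_set mu. specht_dim nu) = of_nat (Suc n) * specht_dim lam"
  unfolding young_lattice_DU_UD[OF lam] ud by (simp add: distrib_right)
 have 2: "(\<Sum>nu\<in>down_set mu. specht_dim nu) \<le> specht_dim mu" if "mu \<in> up_set lam" for mu
  by (rule restrict_bessel(1)[OF p[OF that]])
 have 3: "(\<Sum>mu\<in>up_set lam. specht_dim mu) \<le> of_nat (Suc n) * specht_dim lam"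
  using ind_bessel(1)[OF lam] n by simp
 have 4: "(\<Sum>mu\<in>up_set lam. \<Sum>nu\<in>down_set mu. specht_dim nu) \<le> (\<Sum>mu\<in>up_set lam. specht_dim mu)"
  by (rule sum_mono) (rule 2)
 have 5: "(\<Sum>mu\<in>up_set lam. specht_dim mu) = of_nat (Suc n) * specht_dim lam"
  using 1 3 4 by linarith
 hence "(\<Sum>mu\<in>up_set lam. specht_dim mu - (\<Sum>nu\<in>down_set mu. specht_dim nu)) = 0"
  using 1 by (simp add: sum_subtractf)
 moreover have "0 \<le> specht_dim mu - (\<Sum>nu\<in>down_set mu. specht_dim nu)" if "mu \<in> up_set lam" for mu
  using 2[OF that] by simp
 ultimately have "\<forall>mu\<in>up_set lam. specht_dim mu - (\<Sum>nu\<in>down_set mu. specht_dim nu) = 0"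
  using sum_nonneg_eq_0_iff[OF bij_addable_up(2)[OF lam],
    of "\<lambda>mu. specht_dim mu - (\<Sum>nu\<in>down_set mu. specht_dim nu)"] by simp
 with 5 show ?thesis by auto
qed

text \<open>The premise \<open>ud\<close> of \<open>branching_step\<close> for \<open>lam\<close>
  comes from its conclusions one level below: inducing from each \<open>ka\<close> multiplies its
  dimension by the size of \<open>lam\<close>, and the dimensions of all \<open>ka\<close> add up to
  that of \<open>lam\<close>.\<close>

lemma branching_induct:
 "is_partition lam ==> sum_list lam = n ==>
  (\<Sum>ka\<in>down_set lam. \<Sum>mu\<in>up_set ka. specht_dim mu) = of_nat n * specht_dim lam"
proof (induction n arbitrary: lam)
 case 0
 have "nu \<notin> down_set lam" for nu
  using adds_cell_sum_list[of nu lam] 0 by (auto simp: down_set_def)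
 hence "down_set lam = {}" by blast
 thus ?case by simp
next
 case (Suc n)
 have ka: "is_partition ka" "sum_list ka = n" "lam \<in> up_set ka" if "ka \<in> down_set lam" for ka
  using that Suc.prems adds_cell_sum_list[of ka lam] by (auto simp: down_set_def up_set_def)
 note st = branching_step[OF ka(1,2) Suc.IH[OF ka(1,2)]]
 obtain ka where k: "ka \<in> down_set lam" using down_set_nonempty[OF Suc.prems(1)] Suc.prems(2) by auto
 hence d: "(\<Sum>nu\<in>down_set lam. specht_dim nu) = specht_dim lam" using st[OF k k k k] ka(3) by blast
 have "(\<Sum>ka\<in>down_set lam. \<Sum>mu\<in>up_set ka. specht_dim mu) =
   (\<Sum>ka\<in>down_set lam. of_nat (Suc n) * specht_dim ka)"
  by (rule sum.cong[OF refl]) (use st in blast)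
 thus ?case by (simp only: sum_distrib_left[symmetric] d)
qed

lemma restrict_dims:
 assumes "is_partition mu" "sum_list mu > 0"
 shows "(\<Sum>lam\<in>down_set mu. specht_dim lam) = specht_dim mu"
proof -
 obtain lam where "lam \<in> down_set mu" using down_set_nonempty[OF assms] by blast
 hence "is_partition lam" "mu \<in> up_set lam" using assms by (auto simp: down_set_def up_set_def)
 thus ?thesis using branching_step[OF _ refl branching_induct[OF _ refl]] by blast
qed

lemma ind_dims:
 assumes "is_partition lam"
 shows "(\<Sum>mu\<in>up_set lam. specht_dim mu) = of_nat (Suc (sum_list lam)) * specht_dim lam"
 using branching_step[OF assms refl branching_induct[OF assms refl]] by blast

section \<open>Coefficients of functions with respect to intertwiners\<close>

lemma frame_expand:
 fixes F :: "'y => 'k::field_char_0" and u :: "'i => 'x => 'y => rat"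
 assumes P: "\<And>b. b \<in> Y ==> P a b = (\<Sum>i\<in>I. \<Sum>x\<in>Z i. u i x a * u i x b / k i)"
  and F: "(\<Sum>b\<in>Y. of_rat (P a b) * F b) = F a"
 shows "F a = (\<Sum>i\<in>I. \<Sum>x\<in>Z i. of_rat (u i x a / k i) * (\<Sum>b\<in>Y. of_rat (u i x b) * F b))"
proof -
 have "F a = (\<Sum>b\<in>Y. \<Sum>i\<in>I. \<Sum>x\<in>Z i. of_rat (u i x a / k i) * (of_rat (u i x b) * F b))"
  unfolding F[symmetric]
  by (intro sum.cong refl)
   (simp add: P of_rat_sum of_rat_mult of_rat_divide sum_distrib_right sum_distrib_left mult_ac)
 also have "... = (\<Sum>i\<in>I. \<Sum>b\<in>Y. \<Sum>x\<in>Z i. of_rat (u i x a / k i) * (of_rat (u i x b) * F b))"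
  by (rule sum.swap)
 also have "... = (\<Sum>i\<in>I. \<Sum>x\<in>Z i. \<Sum>b\<in>Y. of_rat (u i x a / k i) * (of_rat (u i x b) * F b))"
  by (intro sum.cong refl sum.swap)
 finally show ?thesis by (simp only: sum_distrib_left)
qed

text \<open>Converse to \<open>frame_expand\<close>: coefficients fixed by the projections can be
  prescribed, since orthogonality kills all terms with \<open>i \<noteq> j\<close>. The expansion
  yields injectivity of the branching maps, the recovery surjectivity.\<close>

lemma frame_recover:
 fixes w :: "'i => 'x => 'k::field_char_0" and u :: "'i => 'x => 'y => rat"
 assumes I: "finite I" "j \<in> I"
  and orth: "\<And>i x'. i \<in> I ==> i \<noteq> j ==> (\<Sum>y\<in>Y. u j x y * u i x' y) = 0"
  and norm: "\<And>x'. (\<Sum>y\<in>Y. u j x y * u j x' y) = k j * p x x'" and k: "k j \<noteq> 0"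
  and w: "(\<Sum>x'\<in>Z j. of_rat (p x x') * w j x') = w j x"
 shows "(\<Sum>y\<in>Y. of_rat (u j x y) * (\<Sum>i\<in>I. \<Sum>x'\<in>Z i. of_rat (u i x' y / k i) * w i x')) = w j x"
proof -
 have "(\<Sum>y\<in>Y. of_rat (u j x y) * (\<Sum>i\<in>I. \<Sum>x'\<in>Z i. of_rat (u i x' y / k i) * w i x')) =
   (\<Sum>y\<in>Y. \<Sum>i\<in>I. \<Sum>x'\<in>Z i. of_rat (u j x y * u i x' y) * (w i x' / of_rat (k i)))"
  by (simp add: sum_distrib_left of_rat_mult of_rat_divide mult_ac)
 also have "... = (\<Sum>i\<in>I. \<Sum>y\<in>Y. \<Sum>x'\<in>Z i. of_rat (u j x y * u i x' y) * (w i x' / of_rat (k i)))"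
  by (rule sum.swap)
 also have "... = (\<Sum>i\<in>I. \<Sum>x'\<in>Z i. \<Sum>y\<in>Y. of_rat (u j x y * u i x' y) * (w i x' / of_rat (k i)))"
  by (intro sum.cong refl sum.swap)
 also have "... = (\<Sum>i\<in>I. \<Sum>x'\<in>Z i. of_rat (\<Sum>y\<in>Y. u j x y * u i x' y) * (w i x' / of_rat (k i)))"
  by (simp add: of_rat_sum sum_distrib_right sum_divide_distrib)
 also have "... = (\<Sum>i\<in>I. if i = j then (\<Sum>x'\<in>Z j. of_rat (p x x') * w j x') else 0)"
  by (rule sum.cong[OF refl]) (use orth k in \<open>auto simp: norm of_rat_mult\<close>)
 also have "... = w j x" using I w by simp
 finally show ?thesis .
qed

section \<open>Components of graphs\<close>

definition rel :: "'v set set => ('v \<times> 'v) set"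
 where "rel E = {(v, w). {v, w} \<in> E}"

definition conn :: "'v set set => ('v \<times> 'v) set"
 where "conn E = (rel E)\<^sup>*"

definition comps :: "'v set set => 'v set set"
 where "comps E = (\<lambda>u. conn E `` {u}) ` \<Union>E"

lemma conn_refl [simp]: "(v, v) \<in> conn E"
 by (simp add: conn_def)

lemma conn_edge: "{v, w} \<in> E ==> (v, w) \<in> conn E"
 by (auto simp: conn_def rel_def)

lemma conn_trans: "(u, v) \<in> conn E ==> (v, w) \<in> conn E ==> (u, w) \<in> conn E"
 by (auto simp: conn_def)

lemma conn_sym: "(u, v) \<in> conn E ==> (v, u) \<in> conn E"
proof -
 have "sym (rel E)" by (auto simp: sym_def rel_def insert_commute)
 thus "(u, v) \<in> conn E ==> (v, u) \<in> conn E"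
  unfolding conn_def by (meson sym_rtrancl symD)
qed

lemma conn_mono: "rel E \<subseteq> conn F ==> conn E \<subseteq> conn F"
 unfolding conn_def by (simp add: rtrancl_subset_rtrancl)

lemma conn_subset: "E \<subseteq> F ==> conn E \<subseteq> conn F"
 by (rule conn_mono) (auto simp: rel_def intro: conn_edge)

lemma conn_induct [consumes 1, case_names refl step]:
 assumes "(a, v) \<in> conn E" "P a"
  "\<And>v w. (a, v) \<in> conn E ==> {v, w} \<in> E ==> P v ==> P w"
 shows "P v"
 using assms(1) unfolding conn_def
proof (induction rule: rtrancl_induct)
 case base thus ?case by (rule assms(2))
next
 case (step v w) thus ?case using assms(3) by (auto simp: conn_def rel_def)
qed

lemma conn_vertex: "(a, v) \<in> conn E ==> a \<noteq> v ==> a \<in> \<Union>E \<and> v \<in> \<Union>E"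
proof -
 have "(a, v) \<in> conn E ==> a = v \<or> v \<in> \<Union>E" for a v
  by (induction rule: conn_induct) auto
 thus "(a, v) \<in> conn E ==> a \<noteq> v ==> a \<in> \<Union>E \<and> v \<in> \<Union>E"
  using conn_sym by metis
qed

lemma conn_class: "v \<in> conn E `` {u} ==> conn E `` {v} = conn E `` {u}"
 using conn_sym conn_trans by fast

lemma compsI: "u \<in> \<Union>E ==> conn E `` {u} \<in> comps E"
 by (auto simp: comps_def)

lemma comps_class: "C \<in> comps E ==> v \<in> C ==> C = conn E `` {v} \<and> v \<in> \<Union>E"
 unfolding comps_def using conn_class conn_vertex by fastforce

lemma comps_subset: "C \<in> comps E ==> C \<subseteq> \<Union>E"
 by (metis comps_class subsetI)

lemma finite_comps: "finite (\<Union>E) ==> finite (comps E)"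
 by (simp add: comps_def)

lemma conn_image:
 assumes "inj f"
 shows "(f a, w) \<in> conn ((`) f ` E) \<longleftrightarrow> (\<exists>b. w = f b \<and> (a, b) \<in> conn E)"
proof
 assume "(f a, w) \<in> conn ((`) f ` E)"
 thus "\<exists>b. w = f b \<and> (a, b) \<in> conn E"
 proof (induction rule: conn_induct)
  case (step v w)
  then obtain b B where b: "v = f b" "(a, b) \<in> conn E" and B: "B \<in> E" "{v, w} = f ` B" by auto
  obtain c where c: "w = f c" "c \<in> B" using B by blast
  have "f ` {b, c} = f ` B" using B b c by auto
  hence "{b, c} = B" by (simp only: inj_image_eq_iff[OF assms])
  hence "{b, c} \<in> E" using B by simp
  thus ?case using b c conn_trans conn_edge by metis
 qed auto
next
 assume "\<exists>b. w = f b \<and> (a, b) \<in> conn E"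
 then obtain b where b: "(a, b) \<in> conn E" and w: "w = f b" by blast
 from b have "(f a, f b) \<in> conn ((`) f ` E)"
 proof (induction rule: conn_induct)
  case (step v w)
  have "f ` {v, w} \<in> (`) f ` E" using step(2) by (rule imageI)
  hence "{f v, f w} \<in> (`) f ` E" by (simp only: image_insert image_empty)
  from conn_trans[OF step(3) conn_edge[OF this]] show ?case .
 qed simp
 thus "(f a, w) \<in> conn ((`) f ` E)" by (simp add: w)
qed

lemma comps_image:
 assumes "inj f"
 shows "comps ((`) f ` E) = (`) f ` comps E"
proof -
 have "conn ((`) f ` E) `` {f u} = f ` (conn E `` {u})" for u
  using conn_image[OF assms, of u _ E] by blast
 moreover have "\<Union>((`) f ` E) = f ` \<Union>E" by blast
 ultimately show ?thesis by (simp add: comps_def image_image)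
qed

lemma card_comps_image:
 assumes "inj f"
 shows "card {C \<in> comps ((`) f ` E). C \<subseteq> A} = card {C \<in> comps E. f ` C \<subseteq> A}"
proof -
 have "{C \<in> comps ((`) f ` E). C \<subseteq> A} = (`) f ` {C \<in> comps E. f ` C \<subseteq> A}"
  unfolding comps_image[OF assms] by blast
 moreover have "inj_on ((`) f) S" for S using assms by (simp add: inj_on_def inj_image_eq_iff)
 ultimately show ?thesis by (simp add: card_image)
qed

text \<open>A subgraph \<open>E\<close> may be replaced by any graph \<open>E'\<close> that induces the same connectivity
 among the vertices \<open>Q\<close> through which \<open>E\<close> communicates with the rest \<open>F\<close>.\<close>

lemma contract_conn:
 assumes h1: "rel E' \<subseteq> conn E"
  and h2: "\<And>a b. a \<in> Q ==> b \<in> Q ==> (a, b) \<in> conn E ==> (a, b) \<in> conn E'"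
  and h3: "\<Union>F \<subseteq> Q" and ab: "a \<in> Q" "b \<in> Q"
 shows "(a, b) \<in> conn (E \<union> F) \<longleftrightarrow> (a, b) \<in> conn (E' \<union> F)"
proof
 have sub: "conn E' \<subseteq> conn (E' \<union> F)" "conn E \<subseteq> conn (E \<union> F)" by (simp_all add: conn_subset)
 have "\<exists>c\<in>Q. (c, v) \<in> conn E \<and> (a, c) \<in> conn (E' \<union> F)" if "(a, v) \<in> conn (E \<union> F)" for v
  using that
 proof (induction rule: conn_induct)
  case refl thus ?case using ab by (intro bexI[of _ a]) auto
 next
  case (step v w)
  then obtain c where c: "c \<in> Q" "(c, v) \<in> conn E" "(a, c) \<in> conn (E' \<union> F)" by blast
  show ?case
  proof (cases "{v, w} \<in> E")
   case True
   thus ?thesis using c conn_edge conn_trans by metis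
  next
   case False
   hence F: "{v, w} \<in> F" using step(2) by simp
   hence "v \<in> Q" "w \<in> Q" using h3 by auto
   hence "(c, v) \<in> conn (E' \<union> F)" using h2 c sub by blast
   moreover have "(v, w) \<in> conn (E' \<union> F)" using F by (intro conn_edge) simp
   ultimately show ?thesis using c(3) \<open>w \<in> Q\<close> conn_trans conn_refl by metis
  qed
 qed
 thus "(a, b) \<in> conn (E' \<union> F)" if "(a, b) \<in> conn (E \<union> F)"
  using that ab h2 sub conn_trans by (meson subsetD)
 have "rel (E' \<union> F) \<subseteq> conn (E \<union> F)"
  using h1 sub(2) by (auto simp: rel_def intro: conn_edge)
 from conn_mono[OF this] show "(a, b) \<in> conn (E \<union> F)" if "(a, b) \<in> conn (E' \<union> F)"
  using that by blast
qed

text \<open>Components avoiding \<open>Q\<close> use only edges of \<open>E\<close> and disappear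
  when \<open>E\<close> is replaced; the remaining ones correspond to components of
  \<open>E' \<union> F\<close> by intersecting with \<open>Q\<close>. This split of the count gives
  the additivity of loop numbers.\<close>

lemma contract_card:
 assumes h1: "rel E' \<subseteq> conn E"
  and h2: "\<And>a b. a \<in> Q ==> b \<in> Q ==> (a, b) \<in> conn E ==> (a, b) \<in> conn E'"
  and h3: "\<Union>F \<subseteq> Q" and fin: "finite (\<Union>(E \<union> F))"
  and V: "Q \<inter> \<Union>(E \<union> F) = \<Union>(E' \<union> F)" and A: "\<Union>(E \<union> F) - Q \<subseteq> A"
 shows "card {C \<in> comps (E \<union> F). C \<subseteq> A} =
  card {C \<in> comps E. C \<inter> Q = {}} + card {C \<in> comps (E' \<union> F). C \<subseteq> A}"
proof -
 let ?G = "E \<union> F" let ?H = "E' \<union> F"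
 note cc = contract_conn[OF h1 h2 h3]
 define B where "B = {C \<in> comps ?G. C \<subseteq> A \<and> C \<inter> Q \<noteq> {}}"
 \<comment> \<open>Edges of \<open>F\<close> lie in \<open>Q\<close>, so a path that stays outside
   \<open>Q\<close> uses edges of \<open>E\<close> only.\<close>
 have avoid: "conn ?G `` {u} = conn E `` {u}"
  if "conn E `` {u} \<inter> Q = {} \<or> conn ?G `` {u} \<inter> Q = {}" for u
 proof -
  have sub: "conn E `` {u} \<subseteq> conn ?G `` {u}" using conn_subset[of E ?G] by auto
  have "v \<in> conn E `` {u}" if "(u, v) \<in> conn ?G" for v
   using that
  proof (induction rule: conn_induct)
   case (step v w)
   hence "v \<notin> Q" using \<open>conn E `` {u} \<inter> Q = {} \<or> conn ?G `` {u} \<inter> Q = {}\<close> sub by blast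
   hence "{v, w} \<in> E" using step(2) h3 by auto
   thus ?case using step(3) conn_edge conn_trans by fast
  qed simp
  thus ?thesis using sub by blast
 qed
 have "{C \<in> comps ?G. C \<inter> Q = {}} = {C \<in> comps E. C \<inter> Q = {}}"
 proof (intro subset_antisym subsetI)
  fix C assume "C \<in> {C \<in> comps ?G. C \<inter> Q = {}}"
  then obtain u where u: "u \<in> \<Union>?G" "C = conn ?G `` {u}" "C \<inter> Q = {}" by (auto simp: comps_def)
  hence "u \<notin> Q" by auto
  hence "u \<in> \<Union>E" using u(1) h3 by auto
  thus "C \<in> {C \<in> comps E. C \<inter> Q = {}}" using avoid[of u] u by (auto simp: comps_def)
 next
  fix C assume "C \<in> {C \<in> comps E. C \<inter> Q = {}}"
  then obtain u where u: "u \<in> \<Union>E" "C = conn E `` {u}" "C \<inter> Q = {}" by (auto simp: comps_def)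
  thus "C \<in> {C \<in> comps ?G. C \<inter> Q = {}}" using avoid[of u] by (auto simp: comps_def)
 qed
 moreover have "{C \<in> comps ?G. C \<subseteq> A} = {C \<in> comps ?G. C \<inter> Q = {}} \<union> B"
  using A comps_subset[of _ ?G] unfolding B_def by blast
 moreover have "{C \<in> comps ?G. C \<inter> Q = {}} \<inter> B = {}" unfolding B_def by blast
 moreover have "bij_betw (\<lambda>C. C \<inter> Q) B {C \<in> comps ?H. C \<subseteq> A}"
 proof (rule bij_betwI')
  have cls: "conn ?G `` {u} \<inter> Q = conn ?H `` {u}" if u: "u \<in> Q" "u \<in> \<Union>?H" for u
  proof -
   have "v \<in> Q" if "(u, v) \<in> conn ?H" for v
    using conn_vertex[OF that] V u by (cases "u = v") auto
   thus ?thesis using cc[of u] u by blast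
  qed
  have rep: "\<exists>u. u \<in> Q \<and> u \<in> \<Union>?H \<and> C = conn ?G `` {u}" if CB: "C \<in> B" for C
  proof -
   obtain u where u: "u \<in> C" "u \<in> Q" using CB unfolding B_def by blast
   have "C \<in> comps ?G" using CB by (simp add: B_def)
   from comps_class[OF this u(1)] have c: "C = conn ?G `` {u}" "u \<in> \<Union>?G" by simp_all
   hence "u \<in> \<Union>?H" using u(2) unfolding V[symmetric] by simp
   thus ?thesis using u(2) c(1) by blast
  qed
  fix C assume C: "C \<in> B"
  then obtain u where u: "u \<in> Q" "u \<in> \<Union>?H" "C = conn ?G `` {u}" using rep by blast
  show "C \<inter> Q \<in> {C \<in> comps ?H. C \<subseteq> A}"
   using cls[OF u(1,2)] u compsI[OF u(2)] C unfolding B_def by auto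
  fix C' assume C': "C' \<in> B"
  then obtain u' where u': "u' \<in> Q" "u' \<in> \<Union>?H" "C' = conn ?G `` {u'}" using rep by blast
  show "C \<inter> Q = C' \<inter> Q \<longleftrightarrow> C = C'"
  proof
   assume "C \<inter> Q = C' \<inter> Q"
   moreover have "u \<in> C" using u(3) by simp
   ultimately have "u \<in> C'" using u(1) by blast
   thus "C = C'" using conn_class[of u ?G u'] unfolding u(3) u'(3) by simp
  qed simp
 next
  fix C assume C: "C \<in> {C \<in> comps ?H. C \<subseteq> A}"
  then obtain u where u: "u \<in> \<Union>?H" "C = conn ?H `` {u}" by (auto simp: comps_def)
  hence uQ: "u \<in> Q" "u \<in> \<Union>?G" using V by auto
  have e: "conn ?G `` {u} \<inter> Q = conn ?H `` {u}"
  proof -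
   have "v \<in> Q" if "(u, v) \<in> conn ?H" for v
    using conn_vertex[OF that] V u by (cases "u = v") auto
   thus ?thesis using cc[of u] uQ by blast
  qed
  have "conn ?G `` {u} \<in> comps ?G" using uQ by (intro compsI)
  moreover from comps_subset[OF this] have "conn ?G `` {u} \<subseteq> A" using e u C A by blast
  moreover have "u \<in> conn ?G `` {u} \<inter> Q" using uQ by simp
  ultimately have "conn ?G `` {u} \<in> B" unfolding B_def by blast
  thus "\<exists>C'\<in>B. C = C' \<inter> Q" using e u by blast
 qed
 hence "card B = card {C \<in> comps ?H. C \<subseteq> A}" by (rule bij_betw_same_card)
 moreover have "finite (comps ?G)" by (rule finite_comps[OF fin])
 moreover have "finite {C \<in> comps ?G. C \<inter> Q = {}}" "finite B"
  using \<open>finite (comps ?G)\<close> by (simp_all add: B_def)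
 ultimately show ?thesis by (simp only: card_Un_disjoint)
qed

text \<open>In a finite digraph in which every vertex has at most one successor and at most one
 predecessor, the components are paths and cycles.\<close>

lemma bifunctional_conn:
 assumes "single_valued R" "single_valued (R\<inverse>)"
 shows "(R \<union> R\<inverse>)\<^sup>* = R\<^sup>* \<union> (R\<^sup>*)\<inverse>"
proof
 have "(u, v) \<in> R\<^sup>* \<or> (v, u) \<in> R\<^sup>*" if "(u, v) \<in> (R \<union> R\<inverse>)\<^sup>*" for u v
  using that
 proof (induction rule: rtrancl_induct)
  case (step v w)
  have sv: "single_valued S ==> (a, b) \<in> S ==> (a, c) \<in> S\<^sup>* ==> a = c \<or> (b, c) \<in> S\<^sup>*" for S :: "('a \<times> 'a) set" and a b c
   by (metis converse_rtranclE single_valuedD)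
  consider "(v, w) \<in> R" | "(w, v) \<in> R" using step by auto
  thus ?case
  proof cases
   case 1
   thus ?thesis using step(3) sv[OF assms(1) 1, of u] by auto
  next
   case 2
   hence "(v, w) \<in> R\<inverse>" by simp
   hence "(u, v) \<in> R\<^sup>* ==> v = u \<or> (w, u) \<in> (R\<inverse>)\<^sup>*"
    using sv[OF assms(2), of v w u] by (simp add: rtrancl_converse)
   thus ?thesis using step(3) 2 by (auto simp: rtrancl_converse intro: converse_rtrancl_into_rtrancl)
  qed
 qed simp
 thus "(R \<union> R\<inverse>)\<^sup>* \<subseteq> R\<^sup>* \<union> (R\<^sup>*)\<inverse>" by auto
 show "R\<^sup>* \<union> (R\<^sup>*)\<inverse> \<subseteq> (R \<union> R\<inverse>)\<^sup>*"
  using rtrancl_mono[of R "R \<union> R\<inverse>"] rtrancl_mono[of "R\<inverse>" "R \<union> R\<inverse>"] by (auto simp: rtrancl_converse)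
qed

text \<open>Otherwise every vertex reachable from \<open>u\<close> has a successor; the successor
  map is then an injection of a finite set into itself, hence onto, and \<open>u\<close> would have
  a predecessor.\<close>

lemma source_reaches_sink:
 assumes fin: "finite R" and sv: "single_valued R" "single_valued (R\<inverse>)"
  and u: "u \<in> Domain R" "u \<notin> Range R"
 shows "\<exists>v. (u, v) \<in> R\<^sup>* \<and> v \<in> Range R \<and> v \<notin> Domain R"
proof (rule ccontr)
 assume n: "\<not> ?thesis"
 define A where "A = R\<^sup>* `` {u}"
 have A: "A \<subseteq> insert u (Range R)" unfolding A_def by (auto elim: rtranclE)
 have finA: "finite A" using A fin by (meson finite_Range finite_insert finite_subset)
 have "A \<subseteq> Domain R"
 proof
  fix x assume x: "x \<in> A"
  hence "x = u \<or> x \<in> Range R" using A by auto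
  thus "x \<in> Domain R" using n u x unfolding A_def by auto
 qed
 hence s: "\<forall>v\<in>A. \<exists>w. (v, w) \<in> R" by auto
 then obtain f where f: "\<And>v. v \<in> A ==> (v, f v) \<in> R" by metis
 have "inj_on f A"
  by (rule inj_onI) (metis f sv(2) converseI single_valuedD)
 moreover have "f ` A \<subseteq> A" using f unfolding A_def by (auto intro: rtrancl_into_rtrancl)
 ultimately have "f ` A = A" using finA by (simp add: endo_inj_surj)
 hence "u \<in> f ` A" unfolding A_def by auto
 thus False using f u(2) by auto
qed

text \<open>The component of a source is a path, and only its two ends lack a successor or a
  predecessor.\<close>

lemma source_component:
 assumes fin: "finite R" and sv: "single_valued R" "single_valued (R\<inverse>)"
  and u: "u \<in> Domain R" "u \<notin> Range R"
 shows "\<exists>v. v \<in> Range R \<and> v \<notin> Domain R \<and>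
  {w \<in> (R \<union> R\<inverse>)\<^sup>* `` {u}. w \<notin> Domain R \<or> w \<notin> Range R} = {u, v}"
proof -
 obtain v where v: "(u, v) \<in> R\<^sup>*" "v \<in> Range R" "v \<notin> Domain R"
  using source_reaches_sink[OF assms] by blast
 have "w = u \<or> w = v" if w: "(u, w) \<in> (R \<union> R\<inverse>)\<^sup>*" "w \<notin> Domain R \<or> w \<notin> Range R" for w
 proof -
  have "(u, w) \<in> R\<^sup>* \<or> (w, u) \<in> R\<^sup>*" using w(1) unfolding bifunctional_conn[OF sv] by auto
  thus ?thesis
  proof
   assume r: "(w, u) \<in> R\<^sup>*"
   thus ?thesis using u(2) by (auto elim: rtranclE)
  next
   assume r: "(u, w) \<in> R\<^sup>*"
   hence c: "(w, v) \<in> R\<^sup>* \<or> (v, w) \<in> R\<^sup>*" using single_valued_confluent[OF sv(1) v(1)] by blast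
   show ?thesis
   proof (cases "w = u")
    case False
    hence "w \<in> Range R" using r by (auto elim: rtranclE)
    hence "w \<notin> Domain R" using w(2) by simp
    thus ?thesis using c v(3) by (auto elim: converse_rtranclE)
   qed simp
  qed
 qed
 moreover have "(u, v) \<in> (R \<union> R\<inverse>)\<^sup>*" unfolding bifunctional_conn[OF sv] using v by simp
 ultimately show ?thesis using u v by (intro exI[of _ v]) auto
qed

section \<open>Composition of walled diagrams\<close>

text \<open>Orienting every strand from its positive to its negative end turns a walled diagram into a
 matching of the positive with the negative points; the top points left of the wall and the bottom
 points right of the wall are positive.\<close>

definition positive :: "nat \<times> nat => nat \<times> nat => nat \<times> nat => bool"
 where "positive r s v \<longleftrightarrow> (fst v = 0) = left_of_wall r s v"

lemma points_fst: "v \<in> points r s ==> fst v = 0 \<or> fst v = 1"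
 by (auto simp: points_def)

lemma finite_points [simp]: "finite (points r s)"
 by (simp add: points_def)

text \<open>With signs the two halves of the wall condition, for strands within an edge and across,
  merge into one: the ends have opposite signs.\<close>

lemma walled_diagrams_iff:
 "d \<in> WD r s \<longleftrightarrow> partition_on (points r s) d \<and>
  (\<forall>b\<in>d. \<exists>u v. b = {u, v} \<and> positive r s u \<and> \<not> positive r s v)"
proof -
 have *: "(u \<noteq> v \<and> (if fst u = fst v then left_of_wall r s u \<noteq> left_of_wall r s v
      else left_of_wall r s u = left_of_wall r s v)) \<longleftrightarrow> positive r s u \<noteq> positive r s v"
  if "u \<in> points r s" "v \<in> points r s" for u v
  using points_fst[OF that(1)] points_fst[OF that(2)] by (auto simp: positive_def)
 have eq: "(\<exists>u v. u \<noteq> v \<and> b = {u, v} \<and> (if fst u = fst v then left_of_wall r s u \<noteq> left_of_wall r s v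
      else left_of_wall r s u = left_of_wall r s v)) \<longleftrightarrow>
   (\<exists>u v. b = {u, v} \<and> positive r s u \<and> \<not> positive r s v)"
  if d: "partition_on (points r s) d" "b \<in> d" for b
 proof -
  have "b \<subseteq> points r s" using d by (auto simp: partition_on_def)
  hence **: "(u \<noteq> v \<and> b = {u, v} \<and> (if fst u = fst v then left_of_wall r s u \<noteq> left_of_wall r s v
      else left_of_wall r s u = left_of_wall r s v)) \<longleftrightarrow> b = {u, v} \<and> positive r s u \<noteq> positive r s v" for u v
   using * [of u v] by auto
  show ?thesis unfolding ** by (metis insert_commute)
 qed
 show ?thesis
  unfolding walled_diagrams_def mem_Collect_eq by (intro conj_cong refl ball_cong eq) simp_all
qed

lemma walledD:
 assumes "d \<in> WD r s"
 shows "\<Union>d = points r s" "b \<in> d ==> b' \<in> d ==> v \<in> b ==> v \<in> b' ==> b = b'"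
  "b \<in> d ==> \<exists>u v. b = {u, v} \<and> u \<noteq> v \<and> positive r s u \<and> \<not> positive r s v"
proof -
 have p: "partition_on (points r s) d"
  and q: "\<forall>b\<in>d. \<exists>u v. b = {u, v} \<and> positive r s u \<and> \<not> positive r s v"
  using assms unfolding walled_diagrams_iff by simp_all
 show "\<Union>d = points r s" using p by (simp add: partition_on_def)
 show "b \<in> d ==> b' \<in> d ==> v \<in> b ==> v \<in> b' ==> b = b'"
  using p disjointD unfolding partition_on_def by blast
 show "b \<in> d ==> \<exists>u v. b = {u, v} \<and> u \<noteq> v \<and> positive r s u \<and> \<not> positive r s v"
  using q by fast
qed

lemma walledI:
 assumes "\<Union>d = points r s"
  "\<And>b b' v. b \<in> d ==> b' \<in> d ==> v \<in> b ==> v \<in> b' ==> b = b'"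
  "\<And>b. b \<in> d ==> \<exists>u v. b = {u, v} \<and> positive r s u \<and> \<not> positive r s v"
 shows "d \<in> WD r s"
proof -
 have "disjoint d"
  by (rule disjointI) (use assms(2) in \<open>simp add: disjoint_iff, blast\<close>)
 moreover have "{} \<notin> d"
  using assms(3) by (metis empty_not_insert)
 ultimately show ?thesis
  unfolding walled_diagrams_iff partition_on_def using assms(1,3) by simp
qed

lemma walled_pair: "d \<in> WD r s ==> {u, v} \<in> d ==>
  u \<in> points r s \<and> v \<in> points r s \<and> positive r s u \<noteq> positive r s v"
 using walledD(1) walledD(3)[of d r s "{u, v}"] by (fastforce simp: doubleton_eq_iff)

lemma walled_partner: "d \<in> WD r s ==> {u, v} \<in> d ==> {u, w} \<in> d ==> v = w"
 using walledD(2)[of d r s "{u, v}" "{u, w}" u] walled_pair by (fastforce simp: doubleton_eq_iff)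

lemma walled_partner_exists:
 assumes d: "d \<in> WD r s" and u: "u \<in> points r s"
 obtains v where "{u, v} \<in> d"
proof -
 obtain b where b: "b \<in> d" "u \<in> b" using walledD(1)[OF d] u by blast
 then obtain x y where xy: "b = {x, y}" using walledD(3)[OF d] by blast
 have "b = {u, x} \<or> b = {u, y}" using b(2) unfolding xy by auto
 thus thesis using b(1) that by blast
qed

lemma finite_walled_diagrams [simp]: "finite (WD r s)"
 by (rule finite_subset[of _ "Pow (Pow (points r s))"])
  (auto simp: dest: walledD(1))

lemma conn_walled:
 assumes "d \<in> WD r s"
 shows "(u, v) \<in> conn d \<longleftrightarrow> u = v \<or> {u, v} \<in> d"
proof
 assume "(u, v) \<in> conn d"
 thus "u = v \<or> {u, v} \<in> d"
 proof (induction rule: conn_induct)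
  case (step v w)
  thus ?case using walled_partner[OF assms, of v u w] by (auto simp: insert_commute)
 qed simp
qed (auto intro: conn_edge)

text \<open>One inclusion suffices, since both diagrams are perfect matchings of the same
  points.\<close>

lemma walled_eqI:
 assumes d: "d \<in> WD r s" and d': "d' \<in> WD r s"
  and sub: "\<And>u v. {u, v} \<in> d ==> {u, v} \<in> d'"
 shows "d = d'"
proof
 have s: "d \<subseteq> d'" using walledD(3)[OF d] sub by blast
 thus "d \<subseteq> d'" .
 show "d' \<subseteq> d"
 proof
  fix b assume b: "b \<in> d'"
  then obtain u v where uv: "b = {u, v}" using walledD(3)[OF d'] by blast
  have "u \<in> points r s" using walledD(1)[OF d'] b uv by blast
  then obtain w where w: "{u, w} \<in> d" by (rule walled_partner_exists[OF d])
  hence "{u, w} = b" using walledD(2)[OF d', of "{u, w}" b u] s b uv by blast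
  thus "b \<in> d" using w by simp
 qed
qed

definition shift :: "nat \<times> nat => nat \<times> nat"
 where "shift = (\<lambda>(k, i). (k + 1, i))"

text \<open>\<open>lift\<close> inserts a new row below row 0.\<close>

definition lift :: "nat \<times> nat => nat \<times> nat"
 where "lift = (\<lambda>(k, i). (if k = 0 then 0 else k + 1, i))"

definition unlift :: "nat \<times> nat => nat \<times> nat"
 where "unlift = (\<lambda>(k, i). (if k = 0 then 0 else 1, i))"

definition stack :: "diagram => diagram => diagram"
 where "stack x y = x \<union> (`) shift ` y"

lemma inj_shift: "inj shift"
 by (auto simp: inj_on_def shift_def)

lemma inj_lift: "inj lift"
 by (auto simp: inj_on_def lift_def split: if_splits)

lemma stack_components_eq: "stack_components x y = comps (stack x y)"
 by (simp add: stack_components_def comps_def conn_def rel_def stack_def shift_def)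

lemma diagram_comp_eq:
 "diagram_comp x y = (\<lambda>C. unlift ` {v \<in> C. fst v \<noteq> 1}) ` {C \<in> comps (stack x y). \<exists>v\<in>C. fst v \<noteq> 1}"
 by (simp add: diagram_comp_def stack_components_eq unlift_def)

lemma loops_eq: "loops x y = card {C \<in> comps (stack x y). \<forall>v\<in>C. fst v = 1}"
 by (simp add: loops_def stack_components_eq)

lemma unlift_lift: "fst v = 0 \<or> fst v = 1 ==> unlift (lift v) = v"
 by (cases v) (auto simp: unlift_def lift_def)

lemma lift_fst: "fst (lift v) \<noteq> 1"
 by (cases v) (auto simp: lift_def)

lemma Union_stack:
 assumes "x \<in> WD r s" "y \<in> WD s t"
 shows "\<Union>(stack x y) = points r s \<union> shift ` points s t"
proof -
 have "\<Union>((`) shift ` y) = shift ` \<Union>y" by blast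
 thus ?thesis
  by (simp only: stack_def Union_Un_distrib walledD(1)[OF assms(1)] walledD(1)[OF assms(2)])
qed

lemma stack_points:
 assumes "x \<in> WD r s" "y \<in> WD s t"
 shows "\<Union>(stack x y) = lift ` points r t \<union> {1} \<times> {1..fst s + snd s}"
proof -
 have *: "(\<lambda>(k, i). (g k, i)) ` ({c} \<times> A) = {g c} \<times> A" for g :: "nat => nat" and c and A :: "nat set"
  by force
 have 1: "lift ` points r t = {0} \<times> {1..fst r + snd r} \<union> {2} \<times> {1..fst t + snd t}"
  unfolding lift_def points_def image_Un * by (simp add: numeral_2_eq_2)
 have 2: "shift ` points s t = {1} \<times> {1..fst s + snd s} \<union> {2} \<times> {1..fst t + snd t}"
  unfolding shift_def points_def image_Un * by (simp add: numeral_2_eq_2)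
 show ?thesis by (simp only: Union_stack[OF assms] 1 2) (auto simp: points_def)
qed

lemma stack_outer:
 assumes "x \<in> WD r s" "y \<in> WD s t"
 shows "v \<in> \<Union>(stack x y) \<and> fst v \<noteq> 1 \<longleftrightarrow> v \<in> lift ` points r t"
 unfolding stack_points[OF assms] using lift_fst by auto

text \<open>Orient the strands from positive to negative. Middle vertices then have one predecessor
  and one successor, and outer vertices exactly one of the two, so the component of an outer vertex
  is a path whose ends are outer points of opposite sign.\<close>

lemma stack_component:
 assumes x: "x \<in> WD r s" and y: "y \<in> WD s t"
  and a: "a \<in> points r t"
 shows "\<exists>u v. {w \<in> conn (stack x y) `` {lift a}. fst w \<noteq> 1} = {lift u, lift v} \<and>
  u \<in> points r t \<and> v \<in> points r t \<and> positive r t u \<and> \<not> positive r t v"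
proof -
 define R where "R = {(u, v). {u, v} \<in> x \<and> positive r s u} \<union>
  {(shift u, shift v) | u v. {u, v} \<in> y \<and> positive s t u}"
 let ?E = "stack x y"
 have relE: "rel ?E = R \<union> R\<inverse>"
 proof -
  have 1: "{u, v} \<in> (`) shift ` y \<longleftrightarrow> (\<exists>u' v'. u = shift u' \<and> v = shift v' \<and> {u', v'} \<in> y)" for u v
  proof
   assume "{u, v} \<in> (`) shift ` y"
   then obtain b where b: "b \<in> y" "{u, v} = shift ` b" by auto
   then obtain u' v' where uv: "b = {u', v'}" using walledD(3)[OF y] by blast
   hence "{u, v} = {shift u', shift v'}" using b by simp
   thus "\<exists>u' v'. u = shift u' \<and> v = shift v' \<and> {u', v'} \<in> y"
    using b(1) uv unfolding doubleton_eq_iff by (metis insert_commute)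
  next
   assume "\<exists>u' v'. u = shift u' \<and> v = shift v' \<and> {u', v'} \<in> y"
   then obtain u' v' where uv: "u = shift u'" "v = shift v'" "{u', v'} \<in> y" by blast
   from imageI[OF uv(3), of "(`) shift"] show "{u, v} \<in> (`) shift ` y" by (simp only: uv image_insert image_empty)
  qed
  have "(u, v) \<in> R \<union> R\<inverse>" if "(u, v) \<in> rel ?E" for u v
  proof -
   from that consider "{u, v} \<in> x" | u' v' where "u = shift u'" "v = shift v'" "{u', v'} \<in> y"
    unfolding rel_def stack_def using 1 by auto
   thus ?thesis
   proof cases
    case c: 1
    hence "{v, u} \<in> x" "positive r s u \<or> positive r s v"
     using walled_pair[OF x c] by (auto simp: insert_commute)
    thus ?thesis using c unfolding R_def by auto
   next
    case c: 2
    hence "{v', u'} \<in> y" "positive s t u' \<or> positive s t v'"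
     using walled_pair[OF y c(3)] by (auto simp: insert_commute)
    thus ?thesis using c unfolding R_def by blast
   qed
  qed
  moreover have "(u, v) \<in> rel ?E \<and> (v, u) \<in> rel ?E" if "(u, v) \<in> R" for u v
  proof -
   have "{u, v} \<in> ?E" using that 1[of u v] unfolding R_def stack_def by auto
   thus ?thesis by (simp add: rel_def insert_commute)
  qed
  ultimately show ?thesis by auto
 qed
 have Rf: "finite R"
 proof (rule finite_subset)
  show "R \<subseteq> \<Union>?E \<times> \<Union>?E" using relE by (auto simp: rel_def)
  show "finite (\<Union>?E \<times> \<Union>?E)" unfolding Union_stack[OF x y] by simp
 qed
 \<comment> \<open>A middle point has opposite signs as a bottom point of \<open>x\<close> and as a
   top point of \<open>y\<close>, so an oriented path entering it along one diagram leaves it along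
   the other.\<close>
 have pol: "positive r s (1, i) \<longleftrightarrow> \<not> positive s t (0, i)" for i
  by (simp add: positive_def left_of_wall_def)
 have sh: "shift u = v \<longleftrightarrow> v = (Suc (fst u), snd u)" for u v
  by (cases u; cases v) (auto simp: shift_def)
 have memR: "(u, v) \<in> R \<longleftrightarrow> {u, v} \<in> x \<and> positive r s u \<or>
   (\<exists>k i l j. u = (Suc k, i) \<and> v = (Suc l, j) \<and> {(k, i), (l, j)} \<in> y \<and> positive s t (k, i))" for u v
  unfolding R_def by (auto simp: shift_def)
 have yp: "k = 0 \<or> k = 1" if "{(k, i), v} \<in> y" for k i v
  using walled_pair[OF y that] points_fst by fastforce
 have xp: "k = 0 \<or> k = 1" if "{(k, i), v} \<in> x" for k i v
  using walled_pair[OF x that] points_fst by fastforce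
 have sv: "single_valued R"
 proof (rule single_valuedI)
  fix u v w assume v: "(u, v) \<in> R" and w: "(u, w) \<in> R"
  from v consider "{u, v} \<in> x" "positive r s u"
   | k i l j where "u = (Suc k, i)" "v = (Suc l, j)" "{(k, i), (l, j)} \<in> y" "positive s t (k, i)"
   unfolding memR by blast
  thus "v = w"
  proof cases
   case 1
   have "\<not> (\<exists>k i l j. u = (Suc k, i) \<and> w = (Suc l, j) \<and> {(k, i), (l, j)} \<in> y \<and> positive s t (k, i))"
    using 1 xp[of "fst u" "snd u" v] pol by (auto dest!: yp)
   hence "{u, w} \<in> x" using w unfolding memR by blast
   thus ?thesis using walled_partner[OF x] 1 by blast
  next
   case 2
   have "\<not> ({u, w} \<in> x \<and> positive r s u)"
    using 2 yp[OF 2(3)] xp[of "fst u" "snd u" w] pol by auto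
   thus ?thesis using w 2 walled_partner[OF y] unfolding memR by blast
  qed
 qed
 have memR': "(u, v) \<in> R \<longleftrightarrow> {v, u} \<in> x \<and> \<not> positive r s v \<or>
   (\<exists>k i l j. u = (Suc k, i) \<and> v = (Suc l, j) \<and> {(l, j), (k, i)} \<in> y \<and> \<not> positive s t (l, j))" for u v
 proof -
  have "{u, v} \<in> x \<and> positive r s u \<longleftrightarrow> {v, u} \<in> x \<and> \<not> positive r s v" for u v
   using walled_pair[OF x, of u v] walled_pair[OF x, of v u] by (auto simp: insert_commute)
  moreover have "{u, v} \<in> y \<and> positive s t u \<longleftrightarrow> {v, u} \<in> y \<and> \<not> positive s t v" for u v
   using walled_pair[OF y, of u v] walled_pair[OF y, of v u] by (auto simp: insert_commute)
  ultimately show ?thesis by (simp only: memR)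
 qed
 have svc: "single_valued (R\<inverse>)"
 proof (rule single_valuedI)
  fix u v w assume "(u, v) \<in> R\<inverse>" "(u, w) \<in> R\<inverse>"
  hence v: "(v, u) \<in> R" and w: "(w, u) \<in> R" by auto
  from v consider "{u, v} \<in> x" "\<not> positive r s u"
   | k i l j where "u = (Suc k, i)" "v = (Suc l, j)" "{(k, i), (l, j)} \<in> y" "\<not> positive s t (k, i)"
   unfolding memR' by blast
  thus "v = w"
  proof cases
   case 1
   have "\<not> (\<exists>k i l j. u = (Suc k, i) \<and> w = (Suc l, j) \<and> {(k, i), (l, j)} \<in> y \<and> \<not> positive s t (k, i))"
    using 1 xp[of "fst u" "snd u" v] pol by (auto dest!: yp)
   hence "{u, w} \<in> x" using w unfolding memR' by blast
   thus ?thesis using walled_partner[OF x] 1 by blast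
  next
   case 2
   have "\<not> ({u, w} \<in> x \<and> \<not> positive r s u)"
    using 2 yp[OF 2(3)] xp[of "fst u" "snd u" w] pol by auto
   thus ?thesis using w 2 walled_partner[OF y] unfolding memR' by blast
  qed
 qed
 have dom: "lift b \<in> Domain R \<longleftrightarrow> positive r t b" "lift b \<in> Range R \<longleftrightarrow> \<not> positive r t b"
  if b: "b \<in> points r t" for b
 proof -
  obtain k i where ki: "b = (k, i)" by (cases b)
  have k: "k = 0 \<or> k = 1" using points_fst[OF b] ki by simp
  have "\<exists>v. (lift b, v) \<in> R \<or> (v, lift b) \<in> R"
  proof -
   have "lift b \<in> \<Union>?E" unfolding stack_points[OF x y] using b by blast
   then obtain e where e: "e \<in> ?E" "lift b \<in> e" by blast
   have "\<exists>v. e = {lift b, v}"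
   proof (cases "e \<in> x")
    case True
    thus ?thesis using e(2) walledD(3)[OF x] by (metis insert_iff singletonD insert_commute)
   next
    case False
    then obtain e' where e': "e' \<in> y" "e = shift ` e'" using e(1) unfolding stack_def by auto
    then obtain p q where "e' = {p, q}" using walledD(3)[OF y] by blast
    hence "e = {shift p, shift q}" using e' by simp
    thus ?thesis using e(2) by (metis insert_iff singletonD insert_commute)
   qed
   hence "\<exists>v. (lift b, v) \<in> rel ?E" using e(1) by (auto simp: rel_def)
   thus ?thesis unfolding relE by auto
  qed
  moreover have "positive r t b" if "(lift b, v) \<in> R" for v
   using that k yp xp[of "fst (lift b)" "snd (lift b)" v] unfolding memR ki
   by (auto simp: lift_def positive_def left_of_wall_def)
  moreover have "\<not> positive r t b" if "(v, lift b) \<in> R" for v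
   using that k yp xp[of "fst (lift b)" "snd (lift b)" v] unfolding memR' ki
   by (auto simp: lift_def positive_def left_of_wall_def)
  ultimately show "lift b \<in> Domain R \<longleftrightarrow> positive r t b" "lift b \<in> Range R \<longleftrightarrow> \<not> positive r t b"
   by blast+
 qed
 have mid: "v \<in> Domain R \<and> v \<in> Range R" if "v \<in> \<Union>?E" "fst v = 1" for v
 proof -
  have "v \<in> {1} \<times> {1..fst s + snd s}"
   using that lift_fst unfolding stack_points[OF x y] by (metis UnE imageE)
  then obtain i where v: "v = (1, i)" "i \<in> {1..fst s + snd s}" by blast
  have "(1, i) \<in> points r s" "(0, i) \<in> points s t" using v by (auto simp: points_def)
  then obtain a b where a: "{(1, i), a} \<in> x" and b: "{(0, i), b} \<in> y"
   using walled_partner_exists[OF x] walled_partner_exists[OF y] by metis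
  have b': "\<exists>k i l j. v = (Suc k, i) \<and> shift b = (Suc l, j) \<and> {(k, i), (l, j)} \<in> y \<and> k = 0"
   using b v by (cases b) (auto simp: shift_def)
  show ?thesis
  proof (cases "positive r s (1, i)")
   case True
   hence "(v, a) \<in> R" unfolding memR using a v by simp
   moreover have "(shift b, v) \<in> R" unfolding memR' using b v True pol by (cases b) (auto simp: shift_def)
   ultimately show ?thesis by blast
  next
   case False
   hence "(a, v) \<in> R" unfolding memR' using a v by simp
   moreover have "(v, shift b) \<in> R" unfolding memR using b v False pol by (cases b) (auto simp: shift_def)
   ultimately show ?thesis by blast
  qed
 qed
 have DR: "Domain R \<union> Range R = \<Union>?E"
 proof
  show "Domain R \<union> Range R \<subseteq> \<Union>?E" using relE by (auto simp: rel_def)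
  show "\<Union>?E \<subseteq> Domain R \<union> Range R"
  proof
   fix v assume v: "v \<in> \<Union>?E"
   show "v \<in> Domain R \<union> Range R"
   proof (cases "fst v = 1")
    case False
    then obtain b where "v = lift b" "b \<in> points r t" using stack_outer[OF x y, of v] v by blast
    thus ?thesis using dom by blast
   qed (use mid[OF v] in blast)
  qed
 qed
 have key: "\<exists>v. v \<in> points r t \<and> \<not> positive r t v \<and> {w \<in> conn ?E `` {lift u}. fst w \<noteq> 1} = {lift u, lift v}"
  if u: "u \<in> points r t" "positive r t u" for u
 proof -
  have "lift u \<in> Domain R" "lift u \<notin> Range R" using dom u by auto
  from source_component[OF Rf sv svc this] obtain v where v: "v \<in> Range R" "v \<notin> Domain R"
   "{w \<in> (R \<union> R\<inverse>)\<^sup>* `` {lift u}. w \<notin> Domain R \<or> w \<notin> Range R} = {lift u, v}" by blast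
  have "v \<in> \<Union>?E" using v DR by blast
  then obtain v' where v': "v = lift v'" "v' \<in> points r t"
   using mid[of v] v stack_outer[OF x y, of v] by blast
  have "w \<notin> Domain R \<or> w \<notin> Range R \<longleftrightarrow> fst w \<noteq> 1" if "(lift u, w) \<in> conn ?E" for w
  proof -
   have "lift u \<in> \<Union>?E" unfolding stack_points[OF x y] using u by blast
   hence w: "w \<in> \<Union>?E" using conn_vertex[OF that] by (cases "lift u = w") auto
   show ?thesis
   proof (cases "fst w = 1")
    case False
    then obtain b where "w = lift b" "b \<in> points r t" using w stack_outer[OF x y, of w] by blast
    thus ?thesis using dom False by blast
   qed (use mid w in auto)
  qed
  hence "{w \<in> conn ?E `` {lift u}. fst w \<noteq> 1} = {lift u, v}"
   using v(3) unfolding conn_def relE by blast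
  thus ?thesis using v' dom v by blast
 qed
 show ?thesis
 proof (cases "positive r t a")
  case True
  thus ?thesis using key[OF a] a by blast
 next
  case False
  \<comment> \<open>From a negative outer point the path is followed backwards; its other end is
    positive, and the case already treated applies there.\<close>
  let ?R = "R\<inverse>"
  have "lift a \<in> Domain ?R" "lift a \<notin> Range ?R" using dom a False by auto
  moreover have "single_valued (?R\<inverse>)" using sv by simp
  ultimately obtain v where v: "v \<in> Range ?R" "v \<notin> Domain ?R"
   "{w \<in> (?R \<union> ?R\<inverse>)\<^sup>* `` {lift a}. w \<notin> Domain ?R \<or> w \<notin> Range ?R} = {lift a, v}"
   using source_component[of ?R "lift a"] Rf svc by auto
  have "v \<in> \<Union>?E" using v DR by blast
  then obtain v' where v': "v = lift v'" "v' \<in> points r t"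
   using mid[of v] v stack_outer[OF x y, of v] by blast
  have pv: "positive r t v'" using dom[OF v'(2)] v v' by auto
  have "(lift a, v) \<in> conn ?E" using v(3) unfolding conn_def relE by (auto simp: Un_commute)
  hence "conn ?E `` {lift a} = conn ?E `` {lift v'}" using conn_class[of v ?E "lift a"] v' by simp
  moreover obtain b where b: "b \<in> points r t" "\<not> positive r t b"
   "{w \<in> conn ?E `` {lift v'}. fst w \<noteq> 1} = {lift v', lift b}" using key[OF v'(2) pv] by blast
  ultimately show ?thesis using v' pv by metis
 qed
qed

lemma conn_image_iff: "inj f ==> (f a, f b) \<in> conn ((`) f ` E) \<longleftrightarrow> (a, b) \<in> conn E"
 using conn_image[of f a "f b" E] by (auto dest: injD)

lemma diagram_comp_blocks:
 assumes x: "x \<in> WD r s" and y: "y \<in> WD s t"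
 shows "diagram_comp x y = (\<lambda>a. unlift ` {w \<in> conn (stack x y) `` {lift a}. fst w \<noteq> 1}) ` points r t"
proof -
 have "{C \<in> comps (stack x y). \<exists>v\<in>C. fst v \<noteq> 1} = (\<lambda>a. conn (stack x y) `` {lift a}) ` points r t"
 proof (intro subset_antisym subsetI)
  fix C assume "C \<in> {C \<in> comps (stack x y). \<exists>v\<in>C. fst v \<noteq> 1}"
  then obtain v where v: "C \<in> comps (stack x y)" "v \<in> C" "fst v \<noteq> 1" by blast
  from comps_class[OF v(1,2)] have c: "C = conn (stack x y) `` {v}" "v \<in> \<Union>(stack x y)" by auto
  then obtain a where "a \<in> points r t" "v = lift a" using stack_outer[OF x y, of v] v(3) by blast
  thus "C \<in> (\<lambda>a. conn (stack x y) `` {lift a}) ` points r t" using c(1) by blast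
 next
  fix C assume "C \<in> (\<lambda>a. conn (stack x y) `` {lift a}) ` points r t"
  then obtain a where a: "a \<in> points r t" "C = conn (stack x y) `` {lift a}" by blast
  have "lift a \<in> \<Union>(stack x y)" using stack_outer[OF x y, of "lift a"] a(1) by blast
  hence "C \<in> comps (stack x y)" unfolding a(2) by (rule compsI)
  moreover have "lift a \<in> C" unfolding a(2) by simp
  ultimately show "C \<in> {C \<in> comps (stack x y). \<exists>v\<in>C. fst v \<noteq> 1}"
   using lift_fst[of a] by blast
 qed
 thus ?thesis unfolding diagram_comp_eq by (simp add: image_image)
qed

lemma unlift_points:
 assumes "a \<in> points r t"
 shows "unlift (lift a) = a"
 using unlift_lift points_fst[OF assms] by blast

text \<open>By \<open>stack_component\<close> every block is a pair of points of opposite sign. The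
  second part reduces identities between composites to connectivity in stacks.\<close>

theorem diagram_comp_walled:
 assumes x: "x \<in> WD r s" and y: "y \<in> WD s t"
 shows "diagram_comp x y \<in> WD r t"
  and "a \<in> points r t ==> b \<in> points r t ==>
   (a, b) \<in> conn (diagram_comp x y) \<longleftrightarrow> (lift a, lift b) \<in> conn (stack x y)"
proof -
 let ?E = "stack x y"
 let ?B = "\<lambda>a. unlift ` {w \<in> conn ?E `` {lift a}. fst w \<noteq> 1}"
 note D = diagram_comp_blocks[OF x y]
 have B: "b \<in> ?B a \<longleftrightarrow> (lift a, lift b) \<in> conn ?E \<and> b \<in> points r t" if a: "a \<in> points r t" for a b
 proof
  assume "b \<in> ?B a"
  then obtain w where w: "(lift a, w) \<in> conn ?E" "fst w \<noteq> 1" "b = unlift w" by blast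
  obtain u v where uv: "{w \<in> conn ?E `` {lift a}. fst w \<noteq> 1} = {lift u, lift v}"
   "u \<in> points r t" "v \<in> points r t" using stack_component[OF x y a] by blast
  have "w = lift u \<or> w = lift v" using w uv(1) by blast
  thus "(lift a, lift b) \<in> conn ?E \<and> b \<in> points r t"
   using w uv(2,3) by (auto simp: unlift_points[OF uv(2)] unlift_points[OF uv(3)])
 next
  assume "(lift a, lift b) \<in> conn ?E \<and> b \<in> points r t"
  thus "b \<in> ?B a" using lift_fst[of b] unlift_points[of b r t]
   by (intro image_eqI[of _ _ "lift b"]) auto
 qed
 have blk: "\<exists>u v. ?B a = {u, v} \<and> positive r t u \<and> \<not> positive r t v" if a: "a \<in> points r t" for a
 proof -
  obtain u v where uv: "{w \<in> conn ?E `` {lift a}. fst w \<noteq> 1} = {lift u, lift v}"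
   "u \<in> points r t" "v \<in> points r t" "positive r t u \<and> \<not> positive r t v"
   using stack_component[OF x y a] by blast
  hence "?B a = {u, v}" using unlift_points by auto
  thus ?thesis using uv by blast
 qed
 have same: "?B a = ?B a'" if a: "a \<in> points r t" "a' \<in> points r t" "b \<in> ?B a" "b \<in> ?B a'" for a a' b
 proof -
  have "(lift a, lift b) \<in> conn ?E" "(lift a', lift b) \<in> conn ?E" using B a by blast+
  hence "lift a' \<in> conn ?E `` {lift a}" using conn_sym conn_trans by fast
  from conn_class[OF this] show ?thesis by simp
 qed
 show w: "diagram_comp x y \<in> WD r t"
 proof (rule walledI)
  have "a \<in> ?B a" if "a \<in> points r t" for a using B[OF that] that by simp
  thus "\<Union>(diagram_comp x y) = points r t" unfolding D using B by blast
  show "b = b'" if "b \<in> diagram_comp x y" "b' \<in> diagram_comp x y" "v \<in> b" "v \<in> b'" for b b' v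
  proof -
   from that(1,2) obtain a a' where "a \<in> points r t" "b = ?B a" "a' \<in> points r t" "b' = ?B a'"
    unfolding D by (elim imageE)
   thus ?thesis using same[of a a' v] that by simp
  qed
  show "\<exists>u v. b = {u, v} \<and> positive r t u \<and> \<not> positive r t v" if "b \<in> diagram_comp x y" for b
  proof -
   from that obtain a where "a \<in> points r t" "b = ?B a" unfolding D by (elim imageE)
   thus ?thesis using blk[of a] by simp
  qed
 qed
 show "(a, b) \<in> conn (diagram_comp x y) \<longleftrightarrow> (lift a, lift b) \<in> conn ?E"
  if a: "a \<in> points r t" and b: "b \<in> points r t"
 proof (cases "a = b")
  case False
  have "{a, b} \<in> diagram_comp x y \<longleftrightarrow> b \<in> ?B a"
  proof
   assume "{a, b} \<in> diagram_comp x y"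
   then obtain c where c: "c \<in> points r t" "{a, b} = ?B c" unfolding D by (elim imageE)
   hence "a \<in> ?B c" "b \<in> ?B c" by blast+
   moreover have "a \<in> ?B a" using B[OF a] a by simp
   ultimately have "?B a = ?B c" using same[OF a c(1)] by blast
   thus "b \<in> ?B a" using \<open>b \<in> ?B c\<close> by simp
  next
   assume b': "b \<in> ?B a"
   moreover have "a \<in> ?B a" using B[OF a] a by simp
   moreover obtain u v where "?B a = {u, v}" using blk[OF a] by blast
   ultimately have e: "?B a = {a, b}" using False by auto
   have "?B a \<in> diagram_comp x y" unfolding D using a by (rule imageI)
   thus "{a, b} \<in> diagram_comp x y" by (simp only: e)
  qed
  thus ?thesis using conn_walled[OF w, of a b] False B[OF a, of b] b by simp
 qed simp
qed

lemma walled_conn_eqI: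
 assumes d: "d \<in> WD r s" "d' \<in> WD r s"
  and c: "\<And>a b. a \<in> points r s ==> b \<in> points r s ==> (a, b) \<in> conn d ==> (a, b) \<in> conn d'"
 shows "d = d'"
proof (rule walled_eqI[OF d])
 fix u v assume e: "{u, v} \<in> d"
 hence p: "u \<in> points r s" "v \<in> points r s" "u \<noteq> v" using walled_pair[OF d(1) e] by auto
 have "(u, v) \<in> conn d'" using c[OF p(1,2)] conn_edge[OF e] by blast
 thus "{u, v} \<in> d'" using conn_walled[OF d(2)] p(3) by blast
qed

text \<open>It suffices to trace each strand of the expected result through the stack, because
  perfect matchings cannot be properly contained in one another.\<close>

lemma diagram_comp_eqI:
 assumes x: "x \<in> WD r s" and y: "y \<in> WD s t" and z: "z \<in> WD r t"
  and c: "\<And>a b. {a, b} \<in> z ==> (lift a, lift b) \<in> conn (stack x y)"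
 shows "diagram_comp x y = z"
proof (rule sym, rule walled_conn_eqI[OF z diagram_comp_walled(1)[OF x y]])
 fix a b assume ab: "a \<in> points r t" "b \<in> points r t" "(a, b) \<in> conn z"
 thus "(a, b) \<in> conn (diagram_comp x y)"
 proof (cases "a = b")
  case False
  hence "{a, b} \<in> z" using conn_walled[OF z] ab(3) by blast
  from c[OF this] show ?thesis using diagram_comp_walled(2)[OF x y ab(1,2)] by simp
 qed simp
qed

section \<open>Associativity\<close>

text \<open>Inserts a new row below row 1, for a composite that is stacked below \<open>x\<close>;
  \<open>lift\<close> serves the composite on top.\<close>

definition lift2 :: "nat \<times> nat => nat \<times> nat"
 where "lift2 = (\<lambda>(k, i). (if k \<le> 1 then k else k + 1, i))"

lemma inj_lift2: "inj lift2"
 by (auto simp: inj_on_def lift2_def split: if_splits)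

lemma image_ident: "(\<And>v. v \<in> \<Union>x ==> f v = v) ==> (`) f ` x = x"
proof -
 assume "\<And>v. v \<in> \<Union>x ==> f v = v"
 hence "f ` b = b" if "b \<in> x" for b using that by (force simp: image_def)
 thus "(`) f ` x = x" by simp
qed

lemma lift_shift: "lift (shift v) = shift (shift v)"
 by (cases v) (simp add: lift_def shift_def)

lemma lift2_shift: "lift2 (shift v) = shift (lift v)"
 by (cases v) (auto simp: lift2_def lift_def shift_def)

lemma lift2_lift: "fst v \<le> 1 ==> lift2 (lift v) = lift (lift v)"
 by (cases v) (auto simp: lift2_def lift_def)

text \<open>The hypotheses of the contraction lemmas, with \<open>Q\<close> the complement of the
  middle row: the composite is the stack as seen from the outer rows.\<close>

lemma contract_h:
 assumes x: "x \<in> WD r s" and y: "y \<in> WD s t"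
 shows "rel ((`) lift ` diagram_comp x y) \<subseteq> conn (stack x y)"
  and "a \<in> - ({1} \<times> UNIV) ==> b \<in> - ({1} \<times> UNIV) ==> (a, b) \<in> conn (stack x y) ==>
   (a, b) \<in> conn ((`) lift ` diagram_comp x y)"
proof -
 note w = diagram_comp_walled[OF x y]
 show "rel ((`) lift ` diagram_comp x y) \<subseteq> conn (stack x y)"
 proof
  fix e assume e: "e \<in> rel ((`) lift ` diagram_comp x y)"
  then obtain p q B where pq: "e = (p, q)" "{p, q} = lift ` B" "B \<in> diagram_comp x y"
   by (auto simp: rel_def)
  obtain a b where ab: "p = lift a" "q = lift b" "a \<in> B" "b \<in> B" using pq(2) by blast
  have "a \<in> points r t" "b \<in> points r t" using ab pq(3) walledD(1)[OF w(1)] by blast+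
  moreover have "(a, b) \<in> conn (diagram_comp x y)"
  proof -
   obtain c d where "B = {c, d}" using walledD(3)[OF w(1) pq(3)] by blast
   hence "a = b \<or> B = {a, b}" using ab by auto
   thus ?thesis using pq(3) conn_edge by (cases "a = b") auto
  qed
  ultimately show "e \<in> conn (stack x y)" using w(2) pq(1) ab by blast
 qed
 assume a: "a \<in> - ({1} \<times> UNIV)" and b: "b \<in> - ({1} \<times> UNIV)" and c: "(a, b) \<in> conn (stack x y)"
 show "(a, b) \<in> conn ((`) lift ` diagram_comp x y)"
 proof (cases "a = b")
  case False
  have "a \<in> \<Union>(stack x y)" "b \<in> \<Union>(stack x y)" using conn_vertex[OF c False] by auto
  then obtain a' b' where ab: "a = lift a'" "b = lift b'" "a' \<in> points r t" "b' \<in> points r t"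
   using stack_outer[OF x y, of a] stack_outer[OF x y, of b] a b by (cases a; cases b) auto
  hence "(a', b') \<in> conn (diagram_comp x y)" using w(2) c by blast
  thus ?thesis using conn_image[OF inj_lift] ab by blast
 qed simp
qed

lemma contract_shift:
 assumes "rel A \<subseteq> conn B"
 shows "rel ((`) shift ` A) \<subseteq> conn ((`) shift ` B)"
proof
 fix e assume "e \<in> rel ((`) shift ` A)"
 then obtain p q where pq: "e = (p, q)" "(p, q) \<in> conn ((`) shift ` A)"
  by (cases e) (auto simp: rel_def intro: conn_edge)
 have "{p, q} \<in> (`) shift ` A" using \<open>e \<in> rel _\<close> pq(1) by (simp add: rel_def)
 then obtain p' where p: "p = shift p'" by blast
 then obtain q' where q: "q = shift q'" "(p', q') \<in> conn A" using pq conn_image[OF inj_shift] by blast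
 hence "(p', q') \<in> conn B" using conn_mono[OF assms] by blast
 thus "e \<in> conn ((`) shift ` B)" using pq p q conn_image[OF inj_shift] by blast
qed

lemma loops_set: "loops a b = card {C \<in> comps (stack a b). C \<subseteq> {1} \<times> UNIV}"
 unfolding loops_eq by (rule arg_cong[where f = card]) (auto simp: mem_Times_iff)

context
 fixes r s t u x y z
 assumes x: "x \<in> WD r s" and y: "y \<in> WD s t" and z: "z \<in> WD t u"
begin

lemma stack3_left_eq:
 "(`) lift ` stack (diagram_comp x y) z = (`) lift ` diagram_comp x y \<union> (`) shift ` (`) shift ` z"
 by (simp add: stack_def image_Un image_image lift_shift)

lemma stack3_right_eq:
 "(`) lift2 ` stack x (diagram_comp y z) = (`) shift ` (`) lift ` diagram_comp y z \<union> x"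
proof -
 have "(`) lift2 ` x = x"
 proof (rule image_ident)
  fix v assume "v \<in> \<Union>x"
  hence "fst v = 0 \<or> fst v = 1" unfolding walledD(1)[OF x] by (rule points_fst)
  thus "lift2 v = v" by (cases v) (auto simp: lift2_def)
 qed
 thus ?thesis by (simp add: stack_def image_Un image_image lift2_shift Un_commute)
qed

text \<open>Four rows for three diagrams. Contracting row 1 gives one bracketing, contracting row 2
  the other.\<close>

abbreviation "stack3 \<equiv> stack x y \<union> (`) shift ` (`) shift ` z"

lemma stack3_alt: "stack3 = (`) shift ` stack y z \<union> x"
 by (auto simp: stack_def image_Un image_image)

lemma stack3_vertices: "\<Union>stack3 = points r s \<union> shift ` points s t \<union> shift ` shift ` points t u"
proof -
 have "\<Union>((`) shift ` (`) shift ` z) = shift ` shift ` \<Union>z" by blast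
 thus ?thesis
  by (simp only: Union_Un_distrib Union_stack[OF x y] walledD(1)[OF z])
qed

lemma conn_left:
 assumes "a \<in> points r u" "b \<in> points r u"
 shows "(a, b) \<in> conn (diagram_comp (diagram_comp x y) z) \<longleftrightarrow> (lift (lift a), lift (lift b)) \<in> conn stack3"
proof -
 have F: "\<Union>((`) shift ` (`) shift ` z) \<subseteq> - ({1} \<times> UNIV)" by (auto simp: shift_def)
 have "(lift (lift a), lift (lift b)) \<in> conn stack3 \<longleftrightarrow>
   (lift (lift a), lift (lift b)) \<in> conn ((`) lift ` diagram_comp x y \<union> (`) shift ` (`) shift ` z)"
  by (rule contract_conn[OF contract_h[OF x y] F]) (auto simp: lift_def split: prod.splits)
 also have "... \<longleftrightarrow> (lift a, lift b) \<in> conn (stack (diagram_comp x y) z)"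
  unfolding stack3_left_eq[symmetric] by (rule conn_image_iff[OF inj_lift])
 finally show ?thesis
  using diagram_comp_walled(2)[OF diagram_comp_walled(1)[OF x y] z assms] by simp
qed

lemma contract_h_shift:
 "rel ((`) shift ` (`) lift ` diagram_comp y z) \<subseteq> conn ((`) shift ` stack y z)"
 "a \<in> - ({2} \<times> UNIV) ==> b \<in> - ({2} \<times> UNIV) ==> (a, b) \<in> conn ((`) shift ` stack y z) ==>
   (a, b) \<in> conn ((`) shift ` (`) lift ` diagram_comp y z)"
proof -
 show "rel ((`) shift ` (`) lift ` diagram_comp y z) \<subseteq> conn ((`) shift ` stack y z)"
  by (rule contract_shift[OF contract_h(1)[OF y z]])
 assume a: "a \<in> - ({2} \<times> UNIV)" and b: "b \<in> - ({2} \<times> UNIV)" and c: "(a, b) \<in> conn ((`) shift ` stack y z)"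
 show "(a, b) \<in> conn ((`) shift ` (`) lift ` diagram_comp y z)"
 proof (cases "a = b")
  case False
  hence "a \<in> \<Union>((`) shift ` stack y z)" using conn_vertex[OF c] by blast
  then obtain a' where a': "a = shift a'" by blast
  then obtain b' where b': "b = shift b'" "(a', b') \<in> conn (stack y z)"
   using c conn_image[OF inj_shift] by blast
  have "a' \<in> - ({1} \<times> UNIV)" "b' \<in> - ({1} \<times> UNIV)"
   using a b unfolding a' b'(1) by (cases a'; cases b'; simp add: shift_def)+
  from contract_h(2)[OF y z this b'(2)] show ?thesis
   using a' b' conn_image[OF inj_shift] by blast
 qed simp
qed

lemma conn_right:
 assumes "a \<in> points r u" "b \<in> points r u"
 shows "(a, b) \<in> conn (diagram_comp x (diagram_comp y z)) \<longleftrightarrow> (lift (lift a), lift (lift b)) \<in> conn stack3"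
proof -
 have F: "\<Union>x \<subseteq> - ({2} \<times> UNIV)" unfolding walledD(1)[OF x] by (auto simp: points_def)
 have "(lift (lift a), lift (lift b)) \<in> conn stack3 \<longleftrightarrow>
   (lift (lift a), lift (lift b)) \<in> conn ((`) shift ` (`) lift ` diagram_comp y z \<union> x)"
  unfolding stack3_alt
  by (rule contract_conn[OF contract_h_shift F])
   (use points_fst[OF assms(1)] points_fst[OF assms(2)] in \<open>auto simp: lift_def split: prod.splits\<close>)
 also have "... \<longleftrightarrow> (lift a, lift b) \<in> conn (stack x (diagram_comp y z))"
 proof -
  have "lift (lift a) = lift2 (lift a)" "lift (lift b) = lift2 (lift b)"
   using points_fst[OF assms(1)] points_fst[OF assms(2)] by (auto simp: lift2_lift)
  thus ?thesis
   unfolding stack3_right_eq[symmetric] by (simp only: conn_image_iff[OF inj_lift2])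
 qed
 finally show ?thesis
  using diagram_comp_walled(2)[OF x diagram_comp_walled(1)[OF y z] assms] by simp
qed

theorem diagram_comp_assoc:
 "diagram_comp (diagram_comp x y) z = diagram_comp x (diagram_comp y z)"
 by (rule walled_conn_eqI[of _ r u])
  (use diagram_comp_walled(1) x y z conn_left conn_right in \<open>blast+\<close>)

text \<open>A closed loop of the triple stack either stays in row 1, being formed by
  \<open>x\<close> and \<open>y\<close> alone, or survives as a loop of the contracted
  stack.\<close>

lemma loops_left:
 "card {C \<in> comps stack3. C \<subseteq> {1, 2} \<times> UNIV} = loops x y + loops (diagram_comp x y) z"
proof -
 let ?Q = "- ({1} \<times> UNIV) :: (nat \<times> nat) set"
 have F: "\<Union>((`) shift ` (`) shift ` z) \<subseteq> ?Q" by (auto simp: shift_def)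
 have V: "?Q \<inter> \<Union>stack3 = \<Union>((`) lift ` diagram_comp x y \<union> (`) shift ` (`) shift ` z)"
 proof -
  have "\<Union>((`) lift ` diagram_comp x y) = lift ` \<Union>(diagram_comp x y)" by blast
  also have "... = lift ` points r t" by (simp only: walledD(1)[OF diagram_comp_walled(1)[OF x y]])
  also have "... = {v \<in> \<Union>(stack x y). fst v \<noteq> 1}" using stack_outer[OF x y] by blast
  also have "... = ?Q \<inter> \<Union>(stack x y)" by (auto simp: mem_Times_iff)
  finally have "\<Union>((`) lift ` diagram_comp x y) = ?Q \<inter> \<Union>(stack x y)" .
  moreover have "?Q \<inter> \<Union>((`) shift ` (`) shift ` z) = \<Union>((`) shift ` (`) shift ` z)"
   using F by (simp only: Int_absorb1)
  ultimately show ?thesis by (simp only: Union_Un_distrib Int_Un_distrib)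
 qed
 have fin: "finite (\<Union>stack3)" unfolding stack3_vertices by simp
 have "card {C \<in> comps stack3. C \<subseteq> {1, 2} \<times> UNIV} = card {C \<in> comps (stack x y). C \<inter> ?Q = {}} +
   card {C \<in> comps ((`) lift ` diagram_comp x y \<union> (`) shift ` (`) shift ` z). C \<subseteq> {1, 2} \<times> UNIV}"
  by (rule contract_card[OF contract_h[OF x y] F fin V]) auto
 also have "card {C \<in> comps (stack x y). C \<inter> ?Q = {}} = loops x y"
  unfolding loops_set by (rule arg_cong[where f = card]) auto
 also have "card {C \<in> comps ((`) lift ` diagram_comp x y \<union> (`) shift ` (`) shift ` z). C \<subseteq> {1, 2} \<times> UNIV} =
   loops (diagram_comp x y) z"
  unfolding stack3_left_eq[symmetric] card_comps_image[OF inj_lift] loops_set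
  by (rule arg_cong[where f = card]) (auto simp: lift_def image_subset_iff split: if_splits)
 finally show ?thesis .
qed

lemma loops_right:
 "card {C \<in> comps stack3. C \<subseteq> {1, 2} \<times> UNIV} = loops y z + loops x (diagram_comp y z)"
proof -
 let ?Q = "- ({2} \<times> UNIV) :: (nat \<times> nat) set"
 have F: "\<Union>x \<subseteq> ?Q" unfolding walledD(1)[OF x] by (auto simp: points_def)
 have V: "?Q \<inter> \<Union>((`) shift ` stack y z \<union> x) = \<Union>((`) shift ` (`) lift ` diagram_comp y z \<union> x)"
 proof -
  have "\<Union>((`) shift ` (`) lift ` diagram_comp y z) = shift ` lift ` \<Union>(diagram_comp y z)" by blast
  also have "... = shift ` lift ` points s u"
   by (simp only: walledD(1)[OF diagram_comp_walled(1)[OF y z]])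
  also have "... = shift ` {v \<in> \<Union>(stack y z). fst v \<noteq> 1}"
   using stack_outer[OF y z] by blast
  also have "... = ?Q \<inter> shift ` \<Union>(stack y z)"
   by (auto simp: shift_def)
  also have "shift ` \<Union>(stack y z) = \<Union>((`) shift ` stack y z)" by blast
  finally show ?thesis using F by auto
 qed
 have fin: "finite (\<Union>((`) shift ` stack y z \<union> x))"
  unfolding stack3_alt[symmetric] stack3_vertices by simp
 have "card {C \<in> comps ((`) shift ` stack y z \<union> x). C \<subseteq> {1, 2} \<times> UNIV} =
   card {C \<in> comps ((`) shift ` stack y z). C \<inter> ?Q = {}} +
   card {C \<in> comps ((`) shift ` (`) lift ` diagram_comp y z \<union> x). C \<subseteq> {1, 2} \<times> UNIV}"
  by (rule contract_card[OF contract_h_shift F fin V]) auto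
 also have "{C \<in> comps ((`) shift ` stack y z). C \<inter> ?Q = {}} =
   {C \<in> comps ((`) shift ` stack y z). C \<subseteq> {2} \<times> UNIV}" by auto
 also have "card ... = loops y z"
  unfolding card_comps_image[OF inj_shift] loops_set
  by (rule arg_cong[where f = card]) (auto simp: shift_def image_subset_iff)
 also have "card {C \<in> comps ((`) shift ` (`) lift ` diagram_comp y z \<union> x). C \<subseteq> {1, 2} \<times> UNIV} =
   loops x (diagram_comp y z)"
 proof -
  have "lift2 ` C \<subseteq> {1, 2} \<times> UNIV \<longleftrightarrow> C \<subseteq> {1} \<times> UNIV" for C
   by (auto simp: lift2_def image_subset_iff split: if_splits)
  thus ?thesis
   unfolding stack3_right_eq[symmetric] card_comps_image[OF inj_lift2] loops_set by simp
 qed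
 finally show ?thesis unfolding stack3_alt .
qed

theorem loops_assoc: "loops x y + loops (diagram_comp x y) z = loops y z + loops x (diagram_comp y z)"
 using loops_left loops_right by simp

end

section \<open>Relabelling of diagrams\<close>

lemma conn_map:
 assumes ab: "(a, b) \<in> conn E" and M: "\<And>u v. {u, v} \<in> E ==> (M u, M v) \<in> conn E'"
 shows "(M a, M b) \<in> conn E'"
 using ab by (induction rule: conn_induct) (auto intro: conn_trans M)

lemma stack_left: "{u, v} \<in> x ==> (u, v) \<in> conn (stack x y)"
 by (rule conn_edge) (simp add: stack_def)

lemma stack_right: "{u, v} \<in> y ==> (shift u, shift v) \<in> conn (stack x y)"
proof (rule conn_edge)
 assume "{u, v} \<in> y"
 from imageI[OF this, of "(`) shift"] show "{shift u, shift v} \<in> stack x y"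
  by (simp add: stack_def)
qed

lemma stack_edge:
 assumes "y \<in> WD s t" "{u, v} \<in> stack x y"
 shows "{u, v} \<in> x \<or> (\<exists>u' v'. u = shift u' \<and> v = shift v' \<and> {u', v'} \<in> y)"
proof (cases "{u, v} \<in> x")
 case False
 then obtain b where b: "b \<in> y" "{u, v} = shift ` b" using assms(2) by (auto simp: stack_def)
 then obtain p q where pq: "b = {p, q}" using walledD(3)[OF assms(1)] by blast
 hence "{u, v} = {shift p, shift q}" using b by simp
 thus ?thesis using b(1) pq unfolding doubleton_eq_iff by (metis insert_commute)
qed simp

lemma stack_pairs:
 assumes "x \<in> WD r s" "y \<in> WD s t" "e \<in> stack x y" "u \<in> e"
 shows "\<exists>v. {u, v} \<in> stack x y"
proof -
 have "\<exists>p q. e = {p, q}"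
 proof (cases "e \<in> x")
  case True
  thus ?thesis using walledD(3)[OF assms(1)] by blast
 next
  case False
  then obtain b where b: "b \<in> y" "e = shift ` b" using assms(3) by (auto simp: stack_def)
  then obtain p q where "b = {p, q}" using walledD(3)[OF assms(2)] by blast
  hence "e = {shift p, shift q}" using b by simp
  thus ?thesis by blast
 qed
 then obtain p q where "e = {p, q}" by blast
 hence "e = {u, p} \<or> e = {u, q}" using assms(4) by auto
 thus ?thesis using assms(3) by blast
qed

text \<open>Only edges at vertices of \<open>W\<close> matter for a component contained in
  \<open>W\<close>. There \<open>M\<close> matches the edges of the two graphs, and the last
  hypothesis keeps neighbours outside \<open>W\<close> from being moved into it; elsewhere
  \<open>M\<close> may identify vertices.\<close>

lemma comps_local:
 assumes E: "\<And>e u. e \<in> E ==> u \<in> e ==> \<exists>v. {u, v} \<in> E"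
  and E': "\<And>e u. e \<in> E' ==> u \<in> e ==> \<exists>v. {u, v} \<in> E'"
  and 1: "\<And>w v. w \<in> W ==> {w, v} \<in> E ==> {w, M v} \<in> E'"
  and 2: "\<And>w v'. w \<in> W ==> {w, v'} \<in> E' ==> \<exists>v. {w, v} \<in> E \<and> M v = v'"
  and 3: "\<And>w. w \<in> W ==> M w = w"
  and 4: "\<And>w v. {w, v} \<in> E ==> M v \<in> W ==> v \<in> W"
 shows "{C \<in> comps E. C \<subseteq> W} = {C \<in> comps E'. C \<subseteq> W}"
proof (intro subset_antisym subsetI)
 fix C assume "C \<in> {C \<in> comps E. C \<subseteq> W}"
 then obtain u where u: "u \<in> \<Union>E" "C = conn E `` {u}" "C \<subseteq> W" by (auto simp: comps_def)
 have uW: "u \<in> W" using u(2,3) by auto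
 obtain v where "{u, v} \<in> E" using E u(1) by blast
 hence uE': "u \<in> \<Union>E'" using 1[OF uW] by blast
 have "(u, v) \<in> conn E'" if "(u, v) \<in> conn E" for v
  using that
 proof (induction rule: conn_induct)
  case (step v w)
  have "v \<in> C" "w \<in> C" using step(1) u(2) conn_trans[OF step(1) conn_edge[OF step(2)]] by auto
  hence "v \<in> W" "w \<in> W" using u(3) by auto
  hence "{v, w} \<in> E'" using 1[OF _ step(2)] 3[of w] by simp
  thus ?case using step(3) conn_edge conn_trans by fast
 qed simp
 moreover have "(u, v) \<in> conn E" if "(u, v) \<in> conn E'" for v
  using that
 proof (induction rule: conn_induct)
  case (step v w)
  have "v \<in> W" using step(3) u(2,3) by auto
  then obtain w' where w': "{v, w'} \<in> E" "M w' = w" using 2 step(2) by blast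
  have r: "(u, w') \<in> conn E" using step(3) w'(1) conn_edge conn_trans by fast
  hence "w' \<in> W" using u(2,3) by auto
  thus ?case using 3 w'(2) r by simp
 qed simp
 ultimately have "C = conn E' `` {u}" unfolding u(2) by blast
 thus "C \<in> {C \<in> comps E'. C \<subseteq> W}" using compsI[OF uE'] u(3) by simp
next
 fix C assume "C \<in> {C \<in> comps E'. C \<subseteq> W}"
 then obtain u where u: "u \<in> \<Union>E'" "C = conn E' `` {u}" "C \<subseteq> W" by (auto simp: comps_def)
 have uW: "u \<in> W" using u(2,3) by auto
 obtain v where "{u, v} \<in> E'" using E' u(1) by blast
 hence uE: "u \<in> \<Union>E" using 2[OF uW] by blast
 have "(u, v) \<in> conn E'" if "(u, v) \<in> conn E" for v
  using that
 proof (induction rule: conn_induct)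
  case (step v w)
  have "v \<in> W" using step(3) u(2,3) by auto
  hence e: "{v, M w} \<in> E'" using 1 step(2) by blast
  hence r: "(u, M w) \<in> conn E'" using step(3) conn_edge conn_trans by fast
  hence "M w \<in> W" using u(2,3) by auto
  hence "w \<in> W" using 4 step(2) by blast
  thus ?case using 3 r by simp
 qed simp
 moreover have "(u, v) \<in> conn E" if "(u, v) \<in> conn E'" for v
  using that
 proof (induction rule: conn_induct)
  case (step v w)
  have "v \<in> W" using step(1) u(2,3) by auto
  then obtain w' where w': "{v, w'} \<in> E" "M w' = w" using 2 step(2) by blast
  have "(u, w) \<in> conn E'" using step(1,2) conn_edge conn_trans by fast
  hence "w \<in> W" using u(2,3) by auto
  hence "w' = w" using 3 4 w' by metis
  thus ?case using step(3) w'(1) conn_edge conn_trans by fast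
 qed simp
 ultimately have "C = conn E `` {u}" unfolding u(2) by blast
 thus "C \<in> {C \<in> comps E. C \<subseteq> W}" using compsI[OF uE] u(3) by simp
qed

section \<open>Images of diagrams under maps of their points\<close>

lemma image_walled:
 assumes d: "d \<in> WD r s" and b: "bij_betw f (points r s) (points r' s')"
  and pos: "\<And>v. v \<in> points r s ==> positive r' s' (f v) = positive r s v"
 shows "(`) f ` d \<in> WD r' s'"
proof (rule walledI)
 have "\<Union>((`) f ` d) = f ` \<Union>d" by blast
 thus "\<Union>((`) f ` d) = points r' s'" using b by (simp only: walledD(1)[OF d] bij_betw_def)
 show "c = c'" if cc: "c \<in> (`) f ` d" "c' \<in> (`) f ` d" "v \<in> c" "v \<in> c'" for c c' v
 proof -
  obtain e e' where e: "e \<in> d" "c = f ` e" "e' \<in> d" "c' = f ` e'" using cc(1,2) by blast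
  obtain w w' where w: "w \<in> e" "w' \<in> e'" "v = f w" "v = f w'" using cc(3,4) e by blast
  have "w \<in> points r s" "w' \<in> points r s" using w e walledD(1)[OF d] by blast+
  hence "w = w'" using w b unfolding bij_betw_def inj_on_def by metis
  thus ?thesis using e w walledD(2)[OF d] by blast
 qed
 show "\<exists>u v. c = {u, v} \<and> positive r' s' u \<and> \<not> positive r' s' v" if cc: "c \<in> (`) f ` d" for c
 proof -
  obtain e where e: "e \<in> d" "c = f ` e" using cc by blast
  then obtain u v where uv: "e = {u, v}" "positive r s u" "\<not> positive r s v" using walledD(3)[OF d] by blast
  hence "u \<in> points r s" "v \<in> points r s" using e(1) walledD(1)[OF d] by blast+
  hence "c = {f u, f v} \<and> positive r' s' (f u) \<and> \<not> positive r' s' (f v)" using uv e(2) pos by simp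
  thus ?thesis by blast
 qed
qed

lemma image_edge:
 assumes d: "d \<in> WD r s" and e: "{a, b} \<in> (`) f ` d"
 obtains a' b' where "a = f a'" "b = f b'" "{a', b'} \<in> d"
proof -
 obtain c where c: "c \<in> d" "{a, b} = f ` c" using e by auto
 then obtain p q where pq: "c = {p, q}" using walledD(3)[OF d] by blast
 hence "{a, b} = {f p, f q}" using c by simp
 thus thesis using c(1) pq that unfolding doubleton_eq_iff by (metis insert_commute)
qed

lemma image_pair: "{a, b} \<in> d ==> {f a, f b} \<in> (`) f ` d"
 using imageI[of "{a, b}" d "(`) f"] by simp

section \<open>The identity and the action of permutations\<close>

lemma edge_in_points: "d \<in> WD r s ==> {u, v} \<in> d ==> u \<in> points r s"
 using walled_pair by blast

lemma points_cases:
 assumes "v \<in> points r s"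
 obtains (top) i where "v = (0, i)" "1 \<le> i" "i \<le> fst r + snd r"
  | (bottom) i where "v = (1, i)" "1 \<le> i" "i \<le> fst s + snd s"
 using assms by (auto simp: points_def)

lemma loops_zero:
 assumes "\<And>i. (1, i) \<in> \<Union>(stack x y) ==> \<exists>w. fst w \<noteq> 1 \<and> ((1, i), w) \<in> conn (stack x y)"
 shows "loops x y = 0"
proof -
 have "{C \<in> comps (stack x y). \<forall>v\<in>C. fst v = 1} = {}"
 proof (rule equals0I)
  fix C assume C: "C \<in> {C \<in> comps (stack x y). \<forall>v\<in>C. fst v = 1}"
  then obtain u where u: "u \<in> \<Union>(stack x y)" "C = conn (stack x y) `` {u}" by (auto simp: comps_def)
  have "fst u = 1" using C u(2) by auto
  then obtain i where i: "u = (1, i)" by (cases u) auto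
  then obtain w where "fst w \<noteq> 1" "(u, w) \<in> conn (stack x y)" using assms u(1) by blast
  thus False using C u(2) by auto
 qed
 thus ?thesis by (simp only: loops_eq card.empty)
qed

lemma identity_diagram_walled: "identity_diagram s \<in> WD s s"
proof (rule walledI)
 show "\<Union>(identity_diagram s) = points s s" by (auto simp: identity_diagram_def points_def)
 show "b = b'" if "b \<in> identity_diagram s" "b' \<in> identity_diagram s" "v \<in> b" "v \<in> b'" for b b' v
  using that by (auto simp: identity_diagram_def)
 show "\<exists>u v. b = {u, v} \<and> positive s s u \<and> \<not> positive s s v" if b: "b \<in> identity_diagram s" for b
 proof -
  obtain i where i: "b = {(0, i), (1, i)}" using b unfolding identity_diagram_def by blast
  have "positive s s (0, i) \<longleftrightarrow> \<not> positive s s (1, i)" by (simp add: positive_def left_of_wall_def)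
  thus ?thesis using i insert_commute by metis
 qed
qed

lemma identity_edge: "1 \<le> i ==> i \<le> fst s + snd s ==> {(0, i), (1, i)} \<in> identity_diagram s"
 by (auto simp: identity_diagram_def)

lemma identity_stack:
 assumes d: "d \<in> WD r s" and a: "a \<in> points r s"
 shows "(a, lift a) \<in> conn (stack d (identity_diagram s))"
 using a
proof (cases rule: points_cases)
 case (top i)
 thus ?thesis by (simp add: lift_def)
next
 case (bottom i)
 thus ?thesis using stack_right[OF identity_edge, of i s d] by (simp add: lift_def shift_def)
qed

lemma diagram_comp_identity:
 assumes d: "d \<in> WD r s"
 shows "diagram_comp d (identity_diagram s) = d" "loops d (identity_diagram s) = 0"
proof -
 show "diagram_comp d (identity_diagram s) = d"
 proof (rule diagram_comp_eqI[OF d identity_diagram_walled d])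
  fix a b assume e: "{a, b} \<in> d"
  hence "a \<in> points r s" "b \<in> points r s" using walled_pair[OF d] by auto
  thus "(lift a, lift b) \<in> conn (stack d (identity_diagram s))"
   using identity_stack[OF d] stack_left[OF e] conn_sym conn_trans by meson
 qed
 show "loops d (identity_diagram s) = 0"
 proof (rule loops_zero)
  fix i assume "(1, i) \<in> \<Union>(stack d (identity_diagram s))"
  hence "1 \<le> i" "i \<le> fst s + snd s"
   unfolding stack_points[OF d identity_diagram_walled] using lift_fst by (auto simp: image_iff) (metis fst_conv)+
  thus "\<exists>w. fst w \<noteq> 1 \<and> ((1, i), w) \<in> conn (stack d (identity_diagram s))"
   using stack_right[OF identity_edge, of i s d] by (intro exI[of _ "(2, i)"]) (simp add: shift_def numeral_2_eq_2)
 qed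
qed

section \<open>Permutations of the top points\<close>

definition block_perm :: "nat \<times> nat => (nat => nat) \<times> (nat => nat) => nat => nat"
 where "block_perm p g i = (if i \<le> fst p then fst g i else fst p + snd g (i - fst p))"

definition top_act :: "nat \<times> nat => (nat => nat) \<times> (nat => nat) => nat \<times> nat => nat \<times> nat"
 where "top_act p g = (\<lambda>(k, i). (k, if k = 0 then block_perm p g i else i))"

text \<open>The left action of a pair of permutations, given as a relabelling of top points;
  \<open>diagram_comp_perm\<close> identifies it with composition with
  \<open>perm_diagram\<close>.\<close>

definition dact :: "nat \<times> nat => (nat => nat) \<times> (nat => nat) => diagram => diagram"
 where "dact p g d = (`) (top_act p g) ` d"

definition block_perms :: "nat \<times> nat => ((nat => nat) \<times> (nat => nat)) set"
 where "block_perms p = {g. fst g permutes {1..fst p} \<and> snd g permutes {1..snd p}}"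

lemma block_perm_cases:
 assumes g: "g \<in> block_perms p"
 shows "1 \<le> i ==> i \<le> fst p ==> 1 \<le> block_perm p g i \<and> block_perm p g i \<le> fst p"
  and "fst p < i ==> i \<le> fst p + snd p ==> fst p < block_perm p g i \<and> block_perm p g i \<le> fst p + snd p"
proof -
 have g1: "fst g permutes {1..fst p}" and g2: "snd g permutes {1..snd p}"
  using g by (auto simp: block_perms_def)
 show "1 \<le> i ==> i \<le> fst p ==> 1 \<le> block_perm p g i \<and> block_perm p g i \<le> fst p"
  using permutes_in_image[OF g1, of i] by (auto simp: block_perm_def)
 show "fst p < i ==> i \<le> fst p + snd p ==> fst p < block_perm p g i \<and> block_perm p g i \<le> fst p + snd p"
  using permutes_in_image[OF g2, of "i - fst p"] by (auto simp: block_perm_def)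
qed

lemma block_perm_comp:
 assumes "g \<in> block_perms p" "h \<in> block_perms p" "1 \<le> i" "i \<le> fst p + snd p"
 shows "block_perm p g (block_perm p h i) = block_perm p (fst g \<circ> fst h, snd g \<circ> snd h) i"
 using block_perm_cases[OF assms(2), of i] assms(3,4)
 by (cases "i \<le> fst p") (auto simp: block_perm_def)

lemma dact_comp:
 assumes g: "g \<in> block_perms p" "h \<in> block_perms p" and d: "d \<in> WD p r"
 shows "dact p g (dact p h d) = dact p (fst g \<circ> fst h, snd g \<circ> snd h) d"
proof -
 have "top_act p g (top_act p h v) = top_act p (fst g \<circ> fst h, snd g \<circ> snd h) v" if "v \<in> points p r" for v
  using that by (cases rule: points_cases) (simp_all add: top_act_def block_perm_comp[OF g])
 hence "top_act p g ` top_act p h ` b = top_act p (fst g \<circ> fst h, snd g \<circ> snd h) ` b" if "b \<in> d" for b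
  using that walledD(1)[OF d] unfolding image_image by (intro image_cong) auto
 thus ?thesis by (auto simp: dact_def image_image)
qed

lemma block_perms_closed:
 "g \<in> block_perms p ==> h \<in> block_perms p ==> (fst g \<circ> fst h, snd g \<circ> snd h) \<in> block_perms p"
 "g \<in> block_perms p ==> (inv' (fst g), inv' (snd g)) \<in> block_perms p"
 by (auto simp: block_perms_def permutes_compose permutes_inv)

lemma dact_id:
 assumes d: "d \<in> WD p r"
 shows "dact p (id, id) d = d"
proof -
 have "top_act p (id, id) v = v" for v by (cases v) (simp add: top_act_def block_perm_def)
 thus ?thesis by (simp add: dact_def)
qed

lemma dact_inv:
 assumes g: "g \<in> block_perms p" and d: "d \<in> WD p r"
 shows "dact p (inv' (fst g), inv' (snd g)) (dact p g d) = d"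
  "dact p g (dact p (inv' (fst g), inv' (snd g)) d) = d"
 using g d dact_comp[OF block_perms_closed(2)[OF g] g d] dact_comp[OF g block_perms_closed(2)[OF g] d]
 by (auto simp: block_perms_def permutes_inv_o dact_id)

lemma top_act_bij:
 assumes g: "g \<in> block_perms p"
 shows "bij_betw (top_act p g) (points p r) (points p r)"
proof -
 let ?h = "(inv' (fst g), inv' (snd g))"
 have inv: "top_act p ?h (top_act p g v) = v \<and> top_act p g (top_act p ?h v) = v" if "v \<in> points p r" for v
 proof -
  have i: "block_perm p (id, id) i = i" for i by (simp add: block_perm_def)
  have o: "inv' (fst g) \<circ> fst g = id" "inv' (snd g) \<circ> snd g = id"
   "fst g \<circ> inv' (fst g) = id" "snd g \<circ> inv' (snd g) = id"
   using g by (auto simp: block_perms_def permutes_inv_o)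
  note h = block_perms_closed(2)[OF g]
  from that show ?thesis
   by (cases rule: points_cases)
    (simp_all add: top_act_def block_perm_comp[OF g h] block_perm_comp[OF h g] o i)
 qed
 have in_points: "top_act p h v \<in> points p r" if "v \<in> points p r" "h \<in> block_perms p" for v h
  using that(1)
 proof (cases rule: points_cases)
  case (top i)
  thus ?thesis using block_perm_cases[OF that(2), of i]
   by (cases "i \<le> fst p") (auto simp: top_act_def points_def)
 qed (auto simp: top_act_def points_def)
 show ?thesis
  by (rule bij_betw_byWitness[where f' = "top_act p ?h"])
   (use inv in_points[OF _ g] in_points[OF _ block_perms_closed(2)[OF g]] in \<open>auto simp del: split_paired_All\<close>)
qed

lemma dact_walled:
 assumes g: "g \<in> block_perms p" and d: "d \<in> WD p r"
 shows "dact p g d \<in> WD p r"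
 unfolding dact_def
proof (rule image_walled[OF d top_act_bij[OF g]])
 fix v assume "v \<in> points p r"
 thus "positive p r (top_act p g v) = positive p r v"
 proof (cases rule: points_cases)
  case (top i)
  thus ?thesis using block_perm_cases[OF g, of i]
   by (cases "i \<le> fst p") (auto simp: top_act_def positive_def left_of_wall_def)
 qed (simp add: top_act_def positive_def left_of_wall_def)
qed

lemma perm_diagram_eq: "perm_diagram p g = (\<lambda>i. {(0, block_perm p g i), (1, i)}) ` {1..fst p + snd p}"
proof -
 have "{1..fst p + snd p} = {1..fst p} \<union> (\<lambda>j. fst p + j) ` {1..snd p}"
 proof (intro subset_antisym subsetI)
  fix i assume i: "i \<in> {1..fst p + snd p}"
  show "i \<in> {1..fst p} \<union> (\<lambda>j. fst p + j) ` {1..snd p}"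
  proof (cases "i \<le> fst p")
   case False
   hence "i = fst p + (i - fst p)" "i - fst p \<in> {1..snd p}" using i by auto
   thus ?thesis by blast
  qed (use i in simp)
 qed auto
 thus ?thesis
  unfolding perm_diagram_def by (simp only: image_Un image_image)
   (rule arg_cong2[where f = "(\<union>)"]; rule image_cong; auto simp: block_perm_def)
qed

lemma perm_diagram_dact:
 shows "perm_diagram p g = dact p g (identity_diagram p)"
 by (simp add: perm_diagram_eq dact_def identity_diagram_def image_image top_act_def)

lemma perm_diagram_walled:
 assumes "g \<in> block_perms p"
 shows "perm_diagram p g \<in> WD p p"
 unfolding perm_diagram_dact by (rule dact_walled[OF assms identity_diagram_walled])

lemma perm_edge: "1 \<le> i ==> i \<le> fst p + snd p ==> {(0, block_perm p g i), (1, i)} \<in> perm_diagram p g"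
 by (auto simp: perm_diagram_eq)

lemma diagram_comp_perm:
 assumes g: "g \<in> block_perms p" and d: "d \<in> WD p r"
 shows "diagram_comp (perm_diagram p g) d = dact p g d" "loops (perm_diagram p g) d = 0"
proof -
 have c: "(lift (top_act p g v), shift v) \<in> conn (stack (perm_diagram p g) d)" if "v \<in> points p r" for v
  using that
 proof (cases rule: points_cases)
  case (top i)
  thus ?thesis using stack_left[OF perm_edge, of i p g d] by (simp add: top_act_def lift_def shift_def)
 qed (simp add: top_act_def lift_def shift_def)
 show "diagram_comp (perm_diagram p g) d = dact p g d"
 proof (rule diagram_comp_eqI[OF perm_diagram_walled[OF g] d dact_walled[OF g d]])
  fix a b assume "{a, b} \<in> dact p g d"
  then obtain a' b' where ab: "a = top_act p g a'" "b = top_act p g b'" "{a', b'} \<in> d"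
   unfolding dact_def by (rule image_edge[OF d])
  hence "a' \<in> points p r" "b' \<in> points p r" using walled_pair[OF d] by auto
  thus "(lift a, lift b) \<in> conn (stack (perm_diagram p g) d)"
   using c stack_right[OF ab(3)] conn_sym conn_trans unfolding ab(1,2) by meson
 qed
 show "loops (perm_diagram p g) d = 0"
 proof (rule loops_zero)
  fix i assume "(1, i) \<in> \<Union>(stack (perm_diagram p g) d)"
  hence "1 \<le> i" "i \<le> fst p + snd p"
   unfolding stack_points[OF perm_diagram_walled[OF g] d] using lift_fst
   by (auto simp: image_iff) (metis fst_conv)+
  thus "\<exists>w. fst w \<noteq> 1 \<and> ((1, i), w) \<in> conn (stack (perm_diagram p g) d)"
   using stack_left[OF perm_edge, of i p g d] conn_sym by (intro exI[of _ "(0, block_perm p g i)"]) auto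
 qed
qed

text \<open>Associativity and the additivity of loop numbers, with a permutation diagram as the
  first of the three factors.\<close>

lemma dact_diagram_comp:
 assumes g: "g \<in> block_perms p" and x: "x \<in> WD p s" and y: "y \<in> WD s t"
 shows "diagram_comp (dact p g x) y = dact p g (diagram_comp x y)" "loops (dact p g x) y = loops x y"
proof -
 note w = perm_diagram_walled[OF g] and c = diagram_comp_walled(1)[OF x y]
 show "diagram_comp (dact p g x) y = dact p g (diagram_comp x y)"
  using diagram_comp_assoc[OF w x y]
  by (simp only: diagram_comp_perm(1)[OF g x] diagram_comp_perm(1)[OF g c])
 show "loops (dact p g x) y = loops x y"
  using loops_assoc[OF w x y]
  by (simp add: diagram_comp_perm[OF g x] diagram_comp_perm[OF g c])
qed

section \<open>Bending the last strand\<close>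

text \<open>Loops lie in the middle row. Middle vertices of the first stack outside \<open>W\<close>
  are connected to the outer rows, and the second stack has none outside \<open>W\<close>, so both
  numbers count the components inside \<open>W\<close>.\<close>

lemma loops_local:
 assumes x: "x \<in> WD r s" and y: "y \<in> WD s t"
  and x': "x' \<in> WD r' s'" and y': "y' \<in> WD s' t'"
  and 1: "\<And>w v. w \<in> W ==> {w, v} \<in> stack x y ==> {w, M v} \<in> stack x' y'"
  and 2: "\<And>w v'. w \<in> W ==> {w, v'} \<in> stack x' y' ==> \<exists>v. {w, v} \<in> stack x y \<and> M v = v'"
  and 3: "\<And>w. w \<in> W ==> M w = w"
  and 4: "\<And>w v. {w, v} \<in> stack x y ==> M v \<in> W ==> v \<in> W"
  and W: "W \<subseteq> {1} \<times> UNIV"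
  and out: "\<And>i. (1, i) \<in> \<Union>(stack x y) ==> (1, i) \<notin> W ==> \<exists>w. fst w \<noteq> 1 \<and> ((1, i), w) \<in> conn (stack x y)"
  and out': "\<And>i. (1, i) \<in> \<Union>(stack x' y') ==> (1, i) \<in> W"
 shows "loops x y = loops x' y'"
proof -
 have W1: "fst v = 1" if "v \<in> W" for v using W that by auto
 have "{C \<in> comps (stack x y). \<forall>v\<in>C. fst v = 1} = {C \<in> comps (stack x y). C \<subseteq> W}"
 proof (intro subset_antisym subsetI)
  fix C assume C: "C \<in> {C \<in> comps (stack x y). \<forall>v\<in>C. fst v = 1}"
  have "v \<in> W" if v: "v \<in> C" for v
  proof (rule ccontr)
   assume "v \<notin> W"
   obtain i where i: "v = (1, i)" using C v by (cases v) auto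
   have c: "C = conn (stack x y) `` {v}" "v \<in> \<Union>(stack x y)" using comps_class[of C _ v] C v by auto
   then obtain w where "fst w \<noteq> 1" "(v, w) \<in> conn (stack x y)" using out \<open>v \<notin> W\<close> i by blast
   thus False using C c(1) by auto
  qed
  thus "C \<in> {C \<in> comps (stack x y). C \<subseteq> W}" using C by blast
 qed (use W1 in blast)
 also have "... = {C \<in> comps (stack x' y'). C \<subseteq> W}"
  by (rule comps_local[OF stack_pairs[OF x y] stack_pairs[OF x' y'] 1 2 3 4])
 also have "... = {C \<in> comps (stack x' y'). \<forall>v\<in>C. fst v = 1}"
 proof (intro subset_antisym subsetI)
  fix C assume C: "C \<in> {C \<in> comps (stack x' y'). \<forall>v\<in>C. fst v = 1}"
  have "v \<in> W" if v: "v \<in> C" for v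
  proof -
   obtain i where i: "v = (1, i)" using C v by (cases v) auto
   have "v \<in> \<Union>(stack x' y')" using comps_class[of C _ v] C v by auto
   thus ?thesis using out' i by blast
  qed
  thus "C \<in> {C \<in> comps (stack x' y'). \<forall>v\<in>C. fst v = 1}
   ==> C \<in> {C \<in> comps (stack x' y'). C \<subseteq> W}" by blast
 qed (use W1 in blast)
 finally show ?thesis by (simp only: loops_eq)
qed

lemma add_strand_walled:
 assumes d: "d \<in> WD (r1, r2) (s1, s2)" and n: "r1 + r2 = s1 + s2"
 shows "add_strand (r1, r2) d \<in> WD (r1, r2 + 1) (s1, s2 + 1)"
proof (rule walledI)
 let ?N = "Suc (r1 + r2)"
 have p: "points (r1, r2 + 1) (s1, s2 + 1) = insert (0, ?N) (insert (1, ?N) (points (r1, r2) (s1, s2)))"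
  using n by (auto simp: points_def le_Suc_eq)
 have np: "(k, ?N) \<notin> points (r1, r2) (s1, s2)" for k using n by (auto simp: points_def)
 show "\<Union>(add_strand (r1, r2) d) = points (r1, r2 + 1) (s1, s2 + 1)"
  unfolding p by (simp add: add_strand_def walledD(1)[OF d])
 have nd: "(k, ?N) \<notin> b" if "b \<in> d" for k b using np[of k] that walledD(1)[OF d] by blast
 show "b = b'" if "b \<in> add_strand (r1, r2) d" "b' \<in> add_strand (r1, r2) d" "v \<in> b" "v \<in> b'" for b b' v
 proof -
  have "b = {(0, ?N), (1, ?N)} \<or> b \<in> d" "b' = {(0, ?N), (1, ?N)} \<or> b' \<in> d"
   using that(1,2) by (simp_all add: add_strand_def)
  thus ?thesis using that(3,4) nd walledD(2)[OF d, of b b' v] by blast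
 qed
 have pos: "positive (r1, r2 + 1) (s1, s2 + 1) v = positive (r1, r2) (s1, s2) v" for v
  by (simp add: positive_def left_of_wall_def)
 show "\<exists>u v. b = {u, v} \<and> positive (r1, r2 + 1) (s1, s2 + 1) u \<and> \<not> positive (r1, r2 + 1) (s1, s2 + 1) v"
  if b: "b \<in> add_strand (r1, r2) d" for b
 proof (cases "b \<in> d")
  case True
  thus ?thesis using walledD(3)[OF d] pos by blast
 next
  case False
  hence "b = {(1, ?N), (0, ?N)}" using b by (auto simp: add_strand_def)
  moreover have "positive (r1, r2 + 1) (s1, s2 + 1) (1, ?N)" "\<not> positive (r1, r2 + 1) (s1, s2 + 1) (0, ?N)"
   using n by (auto simp: positive_def left_of_wall_def)
  ultimately show ?thesis by blast
 qed
qed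

definition bend_pt :: "nat => nat => nat \<times> nat => nat \<times> nat"
 where "bend_pt p1 n = (\<lambda>(k, i). if k = 0 then (0, if i \<le> p1 then i else Suc i)
  else if i = Suc n then (0, Suc p1) else (k, i))"

text \<open>The last point of the bottom edge becomes the last top point left of the wall.\<close>

definition bend :: "nat => nat => diagram => diagram"
 where "bend p1 n d = (`) (bend_pt p1 n) ` d"

lemma bend_pt_bij:
 "bij_betw (bend_pt p1 (r1 + r2)) (points (p1, p2) (r1, r2 + 1)) (points (Suc p1, p2) (r1, r2))"
proof -
 let ?g = "\<lambda>(k, i). if k = 0 then (if i \<le> p1 then (0, i) else if i = Suc p1 then (1, Suc (r1 + r2)) else (0, i - 1))
  else (k :: nat, i :: nat)"
 show ?thesis
  by (rule bij_betw_byWitness[where f' = ?g])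
   (auto simp: bend_pt_def points_def split: if_splits)
qed

text \<open>Bottom points right of the wall and top points left of it are both positive, so the bent
  point keeps its sign only if it is placed on the left.\<close>

lemma bend_pt_positive:
 assumes "v \<in> points (p1, p2) (r1, r2 + 1)"
 shows "positive (Suc p1, p2) (r1, r2) (bend_pt p1 (r1 + r2) v) = positive (p1, p2) (r1, r2 + 1) v"
 using assms by (cases rule: points_cases) (auto simp: bend_pt_def positive_def left_of_wall_def)

lemma bend_walled:
 "d \<in> WD (p1, p2) (r1, r2 + 1) ==> bend p1 (r1 + r2) d \<in> WD (Suc p1, p2) (r1, r2)"
 unfolding bend_def by (rule image_walled[OF _ bend_pt_bij bend_pt_positive])

lemma image_walled_bij:
 assumes b: "bij_betw f (points r s) (points r' s')"
  and pos: "\<And>v. v \<in> points r s ==> positive r' s' (f v) = positive r s v"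
 shows "bij_betw ((`) ((`) f)) (WD r s) (WD r' s')"
proof (rule bij_betw_byWitness[where f' = "(`) ((`) (inv_into (points r s) f))"])
 let ?g = "inv_into (points r s) f"
 have bg: "bij_betw ?g (points r' s') (points r s)" by (rule bij_betw_inv_into[OF b])
 have gf: "?g (f v) = v" if "v \<in> points r s" for v using b that by (rule bij_betw_inv_into_left)
 have fg: "f (?g v) = v" if "v \<in> points r' s'" for v using b that by (rule bij_betw_inv_into_right)
 have posg: "positive r s (?g v) = positive r' s' v" if "v \<in> points r' s'" for v
  using pos[of "?g v"] fg[OF that] bg that by (auto simp: bij_betw_def)
 have comp: "(`) h ` (`) k ` d = d" if "\<And>v. v \<in> \<Union>d ==> h (k v) = v"
  for h :: "nat \<times> nat => nat \<times> nat" and k d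
 proof -
  have "(`) h ` (`) k ` d = (`) (h \<circ> k) ` d" by (simp add: image_comp comp_def image_image)
  thus ?thesis using image_ident[of d "h \<circ> k"] that by simp
 qed
 show "\<forall>d\<in>WD r s. (`) ?g ` (`) f ` d = d"
  by (intro ballI comp gf) (simp only: walledD(1))
 show "\<forall>d\<in>WD r' s'. (`) f ` (`) ?g ` d = d"
  by (intro ballI comp fg) (simp only: walledD(1))
 show "(`) ((`) f) ` WD r s \<subseteq> WD r' s'"
  using image_walled[OF _ b pos] by blast
 show "(`) ((`) ?g) ` WD r' s' \<subseteq> WD r s"
  using image_walled[OF _ bg posg] by blast
qed

text \<open>The strand added to \<open>y\<close> merely carries the last bottom point of
  \<open>x\<close> one row down, so bending before or after the multiplication gives the same
  diagram. The extra middle point is connected to the bottom row and lies on no loop.\<close>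

lemma bend_comp:
 assumes x: "x \<in> WD (p1, p2) (r1, r2 + 1)" and y: "y \<in> WD (r1, r2) (r1, r2)"
 shows "diagram_comp (bend p1 (r1 + r2) x) y =
   bend p1 (r1 + r2) (diagram_comp x (add_strand (r1, r2) y))"
  and "loops x (add_strand (r1, r2) y) = loops (bend p1 (r1 + r2) x) y"
proof -
 let ?n = "r1 + r2" let ?N = "Suc (r1 + r2)"
 let ?x' = "bend p1 ?n x" let ?y' = "add_strand (r1, r2) y"
 have y': "?y' \<in> WD (r1, r2 + 1) (r1, r2 + 1)" by (rule add_strand_walled[OF y refl])
 have x': "?x' \<in> WD (Suc p1, p2) (r1, r2)" by (rule bend_walled[OF x])
 note c = diagram_comp_walled(1)[OF x y']
 let ?M = "bend_pt p1 ?n"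
 have My: "?M (shift v) = shift v" if "v \<in> points (r1, r2) (r1, r2)" for v
  using that by (cases rule: points_cases) (auto simp: bend_pt_def shift_def)
 have yedge: "{u, v} \<in> ?y' \<longleftrightarrow> {u, v} \<in> y \<or> {u, v} = {(0, ?N), (1, ?N)}" for u v
  by (simp add: add_strand_def disj_commute)
 have edge: "(?M u, ?M v) \<in> conn (stack ?x' y)" if e: "{u, v} \<in> stack x ?y'" for u v
 proof -
  from stack_edge[OF y' e] consider "{u, v} \<in> x"
   | u' v' where "u = shift u'" "v = shift v'" "{u', v'} \<in> y"
   | u' v' where "u = shift u'" "v = shift v'" "{u', v'} = {(0, ?N), (1, ?N)}"
   using yedge by blast
  thus ?thesis
  proof cases
   case 1
   thus ?thesis unfolding bend_def using image_pair by (intro stack_left) blast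
  next
   case 2
   hence "?M u = shift u'" "?M v = shift v'" using My walled_pair[OF y 2(3)] by auto
   thus ?thesis using stack_right[OF 2(3)] by simp
  next
   case 3
   \<comment> \<open>Both ends of the added strand, in rows 1 and 2, are sent to the new top
     point.\<close>
   hence "?M u = ?M v" by (auto simp: doubleton_eq_iff bend_pt_def shift_def)
   thus ?thesis by simp
  qed
 qed
 have Ml: "?M (lift v) = lift (?M v)" if "v \<in> points (p1, p2) (r1, r2 + 1)" for v
  using that by (cases rule: points_cases) (auto simp: bend_pt_def lift_def)
 show "diagram_comp ?x' y = bend p1 ?n (diagram_comp x ?y')"
 proof (rule diagram_comp_eqI[OF x' y bend_walled[OF c]])
  fix a b assume "{a, b} \<in> bend p1 ?n (diagram_comp x ?y')"
  then obtain a' b' where ab: "a = ?M a'" "b = ?M b'" "{a', b'} \<in> diagram_comp x ?y'"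
   unfolding bend_def by (rule image_edge[OF c])
  have p: "a' \<in> points (p1, p2) (r1, r2 + 1)" "b' \<in> points (p1, p2) (r1, r2 + 1)"
   using walled_pair[OF c ab(3)] by auto
  hence "(lift a', lift b') \<in> conn (stack x ?y')"
   using diagram_comp_walled(2)[OF x y' p] conn_edge[OF ab(3)] by blast
  from conn_map[OF this, of "bend_pt p1 (r1 + r2)", OF edge] show "(lift a, lift b) \<in> conn (stack ?x' y)"
   using Ml p ab by simp
 qed
 \<comment> \<open>The window leaves out the middle point at position \<open>?N\<close>, which the
   added strand connects to the bottom row.\<close>
 let ?W = "{1} \<times> {1..?n}"
 show "loops x ?y' = loops ?x' y"
 proof (rule loops_local[OF x y' x' y, of ?W ?M])
  show MW: "?M w = w" if "w \<in> ?W" for w using that by (auto simp: bend_pt_def)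
  have stW: "w \<noteq> shift (0, ?N) \<and> w \<noteq> shift (1, ?N)" if "w \<in> ?W" for w using that by (auto simp: shift_def)
  show "{w, ?M v} \<in> stack ?x' y" if w: "w \<in> ?W" and e: "{w, v} \<in> stack x ?y'" for w v
  proof -
   from stack_edge[OF y' e] consider "{w, v} \<in> x"
    | u' v' where "w = shift u'" "v = shift v'" "{u', v'} \<in> y"
    | u' v' where "w = shift u'" "v = shift v'" "{u', v'} = {(0, ?N), (1, ?N)}"
    using yedge by blast
   thus ?thesis
   proof cases
    case 1
    hence "{?M w, ?M v} \<in> ?x'" unfolding bend_def by (rule image_pair)
    thus ?thesis using MW[OF w] by (simp add: stack_def)
   next
    case 2
    hence "?M v = shift v'" using My walled_pair[OF y 2(3)] by auto
    thus ?thesis using image_pair[OF 2(3), of shift] 2(1) by (simp add: stack_def)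
   next
    case 3
    thus ?thesis using stW[OF w] by (auto simp: doubleton_eq_iff)
   qed
  qed
  show "\<exists>v. {w, v} \<in> stack x ?y' \<and> ?M v = v'" if w: "w \<in> ?W" and e: "{w, v'} \<in> stack ?x' y" for w v'
  proof -
   from stack_edge[OF y e] consider "{w, v'} \<in> ?x'"
    | u v where "w = shift u" "v' = shift v" "{u, v} \<in> y" by blast
   thus ?thesis
   proof cases
    case 1
    then obtain a b where ab: "w = ?M a" "v' = ?M b" "{a, b} \<in> x"
     unfolding bend_def by (rule image_edge[OF x])
    have "a \<in> points (p1, p2) (r1, r2 + 1)" using edge_in_points[OF x ab(3)] .
    hence "a = w" using w ab(1) by (cases rule: points_cases) (auto simp: bend_pt_def split: if_splits)
    thus ?thesis using ab by (intro exI[of _ b]) (simp add: stack_def)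
   next
    case 2
    have "?M (shift v) = v'" using My walled_pair[OF y 2(3)] 2 by auto
    moreover have "{shift u, shift v} \<in> stack x ?y'"
     using image_pair[of u v ?y' shift] 2(3) by (auto simp: stack_def add_strand_def)
    ultimately show ?thesis using 2 by blast
   qed
  qed
  show "v \<in> ?W" if e: "{w, v} \<in> stack x ?y'" and m: "?M v \<in> ?W" for w v
  proof -
   have "v \<in> \<Union>(stack x ?y')" using e by blast
   hence "v \<in> points (p1, p2) (r1, r2 + 1) \<union> shift ` points (r1, r2 + 1) (r1, r2 + 1)"
    unfolding Union_stack[OF x y'] .
   thus ?thesis using m
    by (cases v) (auto simp: bend_pt_def points_def shift_def split: if_splits)
  qed
  show "?W \<subseteq> {1} \<times> UNIV" by auto
  show "\<exists>w. fst w \<noteq> 1 \<and> ((1, i), w) \<in> conn (stack x ?y')"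
   if i: "(1, i) \<in> \<Union>(stack x ?y')" "(1, i) \<notin> ?W" for i
  proof -
   have "i = ?N" using i unfolding Union_stack[OF x y'] by (auto simp: points_def shift_def)
   moreover have "{(0, ?N), (1, ?N)} \<in> ?y'" by (simp add: add_strand_def)
   from stack_right[OF this] have "((1, ?N), (2, ?N)) \<in> conn (stack x ?y')"
    by (simp add: shift_def numeral_2_eq_2)
   ultimately show ?thesis by (intro exI[of _ "(2, ?N)"]) simp
  qed
  show "(1, i) \<in> ?W" if i: "(1, i) \<in> \<Union>(stack ?x' y)" for i
   using i unfolding Union_stack[OF x' y] by (auto simp: points_def shift_def)
 qed
qed

section \<open>Inserting a cap at the top\<close>

definition cap_pt :: "nat => nat \<times> nat => nat \<times> nat"
 where "cap_pt p1 = (\<lambda>(k, i). (k, if k = 0 \<and> \<not> i \<le> p1 then Suc i else i))"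

text \<open>A cap joining two new top points, the last one on either side of the wall.\<close>

definition cap :: "nat => nat => diagram => diagram"
 where "cap p1 p2 d = insert {(0, Suc p1), (0, Suc (Suc (p1 + p2)))} ((`) (cap_pt p1) ` d)"

lemma inj_cap_pt: "inj (cap_pt p1)"
 by (auto simp: inj_on_def cap_pt_def split: if_splits)

lemma cap_pt_points:
 "v \<in> points (p1, p2) s ==> cap_pt p1 v \<in> points (Suc p1, Suc p2) s \<and>
  cap_pt p1 v \<noteq> (0, Suc p1) \<and> cap_pt p1 v \<noteq> (0, Suc (Suc (p1 + p2)))"
 by (auto simp: cap_pt_def points_def split: if_splits)

lemma cap_points:
 "points (Suc p1, Suc p2) s = insert (0, Suc p1) (insert (0, Suc (Suc (p1 + p2))) (cap_pt p1 ` points (p1, p2) s))"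
proof (intro subset_antisym subsetI)
 fix v assume "v \<in> points (Suc p1, Suc p2) s"
 thus "v \<in> insert (0, Suc p1) (insert (0, Suc (Suc (p1 + p2))) (cap_pt p1 ` points (p1, p2) s))"
 proof (cases rule: points_cases)
  case (top i)
  consider "i = Suc p1" | "i = Suc (Suc (p1 + p2))" | "i \<le> p1" | "Suc p1 < i" "i < Suc (Suc (p1 + p2))"
   using top(3) by (simp, linarith)
  thus ?thesis
  proof cases
   case 3
   hence "v = cap_pt p1 (0, i)" "(0, i) \<in> points (p1, p2) s" using top by (auto simp: cap_pt_def points_def)
   thus ?thesis by blast
  next
   case 4
   hence "v = cap_pt p1 (0, i - 1)" "(0, i - 1) \<in> points (p1, p2) s"
    using top by (auto simp: cap_pt_def points_def)
   thus ?thesis by blast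
  qed (use top in auto)
 next
  case (bottom i)
  hence "v = cap_pt p1 (1, i)" "(1, i) \<in> points (p1, p2) s" by (auto simp: cap_pt_def points_def)
  thus ?thesis by blast
 qed
qed (auto dest: cap_pt_points simp: points_def cap_pt_def)

lemma cap_pt_positive:
 "v \<in> points (p1, p2) s ==> positive (Suc p1, Suc p2) s (cap_pt p1 v) = positive (p1, p2) s v"
 by (elim points_cases) (auto simp: cap_pt_def positive_def left_of_wall_def)

lemma cap_walled:
 assumes d: "d \<in> WD (p1, p2) s"
 shows "cap p1 p2 d \<in> WD (Suc p1, Suc p2) s"
proof (rule walledI)
 let ?c = "{(0, Suc p1), (0, Suc (Suc (p1 + p2)))}"
 have U: "\<Union>((`) (cap_pt p1) ` d) = cap_pt p1 ` points (p1, p2) s"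
  unfolding walledD(1)[OF d, symmetric] by blast
 show "\<Union>(cap p1 p2 d) = points (Suc p1, Suc p2) s"
  unfolding cap_points cap_def Union_insert U by blast
 have disj: "?c \<inter> b = {}" if "b \<in> (`) (cap_pt p1) ` d" for b
 proof -
  have "b \<subseteq> cap_pt p1 ` points (p1, p2) s" using that U by blast
  moreover have "(0, Suc p1) \<notin> cap_pt p1 ` points (p1, p2) s"
   "(0, Suc (Suc (p1 + p2))) \<notin> cap_pt p1 ` points (p1, p2) s"
   using cap_pt_points[of _ p1 p2 s] by (metis imageE)+
  ultimately show ?thesis by blast
 qed
 show "b = b'" if b: "b \<in> cap p1 p2 d" "b' \<in> cap p1 p2 d" "v \<in> b" "v \<in> b'" for b b' v
 proof -
  consider "b = ?c" "b' = ?c" | "b = ?c" "b' \<in> (`) (cap_pt p1) ` d" | "b' = ?c" "b \<in> (`) (cap_pt p1) ` d"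
   | "b \<in> (`) (cap_pt p1) ` d" "b' \<in> (`) (cap_pt p1) ` d"
   using b(1,2) unfolding cap_def by blast
  thus ?thesis
  proof cases
   case 1
   thus ?thesis by (simp only:)
  next
   case 2
   have "v \<in> ?c" using b(3) unfolding 2(1) .
   hence "v \<in> ?c \<inter> b'" using b(4) by (rule IntI)
   thus ?thesis unfolding disj[OF 2(2)] by (rule emptyE)
  next
   case 3
   have "v \<in> ?c" using b(4) unfolding 3(1) .
   hence "v \<in> ?c \<inter> b" using b(3) by (rule IntI)
   thus ?thesis unfolding disj[OF 3(2)] by (rule emptyE)
  next
   case 4
   then obtain e e' where e: "e \<in> d" "e' \<in> d" "b = cap_pt p1 ` e" "b' = cap_pt p1 ` e'" by blast
   hence "v \<in> cap_pt p1 ` e" "v \<in> cap_pt p1 ` e'" using b(3,4) by simp_all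
   then obtain w w' where "w \<in> e" "w' \<in> e'" "cap_pt p1 w = v" "cap_pt p1 w' = v" by (auto simp del: split_paired_All split_paired_Ex)
   hence "e = e'" using walledD(2)[OF d e(1,2)] injD[OF inj_cap_pt] by metis
   thus ?thesis using e by simp
  qed
 qed
 note pos = cap_pt_positive
 show "\<exists>u v. b = {u, v} \<and> positive (Suc p1, Suc p2) s u \<and> \<not> positive (Suc p1, Suc p2) s v"
  if b: "b \<in> cap p1 p2 d" for b
 proof (cases "b = ?c")
  case True
  moreover have "positive (Suc p1, Suc p2) s (0, Suc p1)"
   "\<not> positive (Suc p1, Suc p2) s (0, Suc (Suc (p1 + p2)))"
   by (auto simp: positive_def left_of_wall_def)
  ultimately show ?thesis by blast
 next
  case False
  then obtain e where e: "e \<in> d" "b = cap_pt p1 ` e" using b unfolding cap_def by blast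
  then obtain u v where uv: "e = {u, v}" "positive (p1, p2) s u" "\<not> positive (p1, p2) s v"
   using walledD(3)[OF d] by blast
  hence "u \<in> points (p1, p2) s" "v \<in> points (p1, p2) s" using e walledD(1)[OF d] by blast+
  hence "b = {cap_pt p1 u, cap_pt p1 v} \<and> positive (Suc p1, Suc p2) s (cap_pt p1 u) \<and>
    \<not> positive (Suc p1, Suc p2) s (cap_pt p1 v)" using uv e pos by simp
  thus ?thesis by blast
 qed
qed

text \<open>The cap joins two top points and never meets the middle row, so it forms a component of
  its own and affects neither the other paths nor the loops.\<close>

lemma cap_comp:
 assumes x: "x \<in> WD (p1, p2) s" and y: "y \<in> WD s t"
 shows "diagram_comp (cap p1 p2 x) y = cap p1 p2 (diagram_comp x y)"
  and "loops x y = loops (cap p1 p2 x) y"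
proof -
 let ?M = "cap_pt p1" let ?x' = "cap p1 p2 x"
 note x' = cap_walled[OF x] and c = diagram_comp_walled(1)[OF x y]
 have My: "?M (shift v) = shift v" for v by (cases v) (simp add: cap_pt_def shift_def)
 have Ml: "?M (lift v) = lift (?M v)" for v by (cases v) (simp add: cap_pt_def lift_def)
 have edge: "(?M u, ?M v) \<in> conn (stack ?x' y)" if e: "{u, v} \<in> stack x y" for u v
 proof -
  from stack_edge[OF y e] consider "{u, v} \<in> x"
   | u' v' where "u = shift u'" "v = shift v'" "{u', v'} \<in> y" by blast
  thus ?thesis
  proof cases
   case 1
   hence "{?M u, ?M v} \<in> ?x'" unfolding cap_def by (intro insertI2 image_pair)
   thus ?thesis by (rule stack_left)
  next
   case 2
   thus ?thesis using stack_right[OF 2(3)] My by simp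
  qed
 qed
 show "diagram_comp ?x' y = cap p1 p2 (diagram_comp x y)"
 proof (rule diagram_comp_eqI[OF x' y cap_walled[OF c]])
  fix a b assume "{a, b} \<in> cap p1 p2 (diagram_comp x y)"
  then consider "{a, b} = {(0, Suc p1), (0, Suc (Suc (p1 + p2)))}"
   | "{a, b} \<in> (`) ?M ` diagram_comp x y" unfolding cap_def by blast
  thus "(lift a, lift b) \<in> conn (stack ?x' y)"
  proof cases
   case 1
   hence "lift a = a" "lift b = b" by (auto simp: doubleton_eq_iff lift_def)
   moreover have "{a, b} \<in> ?x'" using 1 by (simp add: cap_def)
   ultimately show ?thesis using stack_left by metis
  next
   case 2
   then obtain a' b' where ab: "a = ?M a'" "b = ?M b'" "{a', b'} \<in> diagram_comp x y"
    by (rule image_edge[OF c])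
   have p: "a' \<in> points (p1, p2) t" "b' \<in> points (p1, p2) t" using walled_pair[OF c ab(3)] by auto
   hence "(lift a', lift b') \<in> conn (stack x y)"
    using diagram_comp_walled(2)[OF x y p] conn_edge[OF ab(3)] by blast
   from conn_map[OF this, of "cap_pt p1", OF edge] show ?thesis using Ml ab by simp
  qed
 qed
 let ?W = "{1} \<times> UNIV :: (nat \<times> nat) set"
 show "loops x y = loops ?x' y"
 proof (rule loops_local[OF x y x' y, of ?W ?M])
  show MW: "?M w = w" if "w \<in> ?W" for w using that by (auto simp: cap_pt_def)
  show "{w, ?M v} \<in> stack ?x' y" if w: "w \<in> ?W" and e: "{w, v} \<in> stack x y" for w v
  proof -
   from stack_edge[OF y e] consider "{w, v} \<in> x"
    | u' v' where "w = shift u'" "v = shift v'" "{u', v'} \<in> y" by blast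
   thus ?thesis
   proof cases
    case 1
    hence "{?M w, ?M v} \<in> ?x'" unfolding cap_def by (intro insertI2 image_pair)
    thus ?thesis using MW[OF w] by (simp add: stack_def)
   next
    case 2
    thus ?thesis using image_pair[OF 2(3), of shift] My by (simp add: stack_def)
   qed
  qed
  show "\<exists>v. {w, v} \<in> stack x y \<and> ?M v = v'" if w: "w \<in> ?W" and e: "{w, v'} \<in> stack ?x' y" for w v'
  proof -
   have "{w, v'} \<noteq> {(0, Suc p1), (0, Suc (Suc (p1 + p2)))}" using w by (auto simp: doubleton_eq_iff)
   with stack_edge[OF y e] consider "{w, v'} \<in> (`) ?M ` x"
    | u v where "w = shift u" "v' = shift v" "{u, v} \<in> y" unfolding cap_def by blast
   thus ?thesis
   proof cases
    case 1
    then obtain a b where ab: "w = ?M a" "v' = ?M b" "{a, b} \<in> x" by (rule image_edge[OF x])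
    have "a = w" using w ab(1) by (cases a) (auto simp: cap_pt_def)
    thus ?thesis using ab by (intro exI[of _ b]) (simp add: stack_def)
   next
    case 2
    thus ?thesis using image_pair[OF 2(3), of shift] My
     by (intro exI[of _ "shift v"]) (simp add: stack_def)
   qed
  qed
  show "v \<in> ?W" if "?M v \<in> ?W" for v using that by (cases v) (auto simp: cap_pt_def)
 qed auto
qed

section \<open>Diagrams without strands joining two top points\<close>

definition full :: "nat \<times> nat => nat \<times> nat => diagram set"
 where "full p r = {d \<in> WD p r. \<forall>i j. {(0, i), (0, j)} \<notin> d}"

lemma fullD: "d \<in> full p r ==> d \<in> WD p r"
 by (simp add: full_def)

lemma finite_full [simp]: "finite (full p r)"
 by (simp add: full_def)

lemma card_strands:
 assumes d: "d \<in> WD p r"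
 shows "card {b \<in> d. \<exists>i j. b = {(0, i), (1, j)} \<and> P i} = card {i. P i \<and> (\<exists>j. {(0, i), (1, j)} \<in> d)}"
proof -
 let ?A = "{i. P i \<and> (\<exists>j. {(0, i), (1, j)} \<in> d)}"
 define h where "h i = (SOME b. b \<in> d \<and> (0 :: nat, i) \<in> b)" for i :: nat
 have h: "h i = b" if "b \<in> d" "(0, i) \<in> b" for i b
 proof -
  have "h i \<in> d \<and> (0, i) \<in> h i" unfolding h_def by (rule someI[of _ b]) (use that in simp)
  thus ?thesis using walledD(2)[OF d] that by blast
 qed
 have "{b \<in> d. \<exists>i j. b = {(0, i), (1, j)} \<and> P i} = h ` ?A"
 proof (intro subset_antisym subsetI)
  fix b assume "b \<in> {b \<in> d. \<exists>i j. b = {(0, i), (1, j)} \<and> P i}"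
  then obtain i j where b: "b \<in> d" "b = {(0, i), (1, j)}" "P i" by blast
  hence "i \<in> ?A" "h i = b" using h[OF b(1), of i] by auto
  thus "b \<in> h ` ?A" by blast
 next
  fix b assume "b \<in> h ` ?A"
  then obtain i j where i: "b = h i" "P i" "{(0, i), (1, j)} \<in> d" by blast
  hence "b = {(0, i), (1, j)}" using h[OF i(3), of i] by simp
  thus "b \<in> {b \<in> d. \<exists>i j. b = {(0, i), (1, j)} \<and> P i}" using i by blast
 qed
 moreover have "inj_on h ?A"
 proof (rule inj_onI)
  fix i i' assume "i \<in> ?A" "i' \<in> ?A" and e: "h i = h i'"
  then obtain j j' where ij: "{(0, i), (1, j)} \<in> d" "{(0, i'), (1, j')} \<in> d" by blast
  have "h i = {(0, i), (1, j)}" using h[OF ij(1), of i] by simp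
  moreover have "h i' = {(0, i'), (1, j')}" using h[OF ij(2), of i'] by simp
  ultimately have "{(0 :: nat, i), (1, j)} = {(0, i'), (1, j')}" using e by (simp only:)
  thus "i = i'" by (simp add: doubleton_eq_iff)
 qed
 ultimately show ?thesis by (simp only: card_image)
qed

text \<open>Propagating strands are counted by their top ends, so the numbers reach \<open>p\<close>
  exactly when every top point propagates; a top point that does not is joined to another
  one.\<close>

lemma walled_diagrams_prop_full: "walled_diagrams_prop p r p = full p r"
proof -
 have "propagating p d = p \<longleftrightarrow> (\<forall>i j. {(0, i), (0, j)} \<notin> d)" if d: "d \<in> WD p r" for d
 proof -
  let ?q = "\<lambda>i. \<exists>j. {(0, i), (1, j)} \<in> d"
  have rng: "1 \<le> i \<and> i \<le> fst p + snd p" if "?q i" for i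
   using that walled_pair[OF d, of "(0, i)"] by (auto simp: points_def)
  have card_eq: "card {i. i \<in> I \<and> ?q i} = card I \<longleftrightarrow> (\<forall>i\<in>I. ?q i)" if I: "finite I" for I
  proof
   assume "card {i. i \<in> I \<and> ?q i} = card I"
   hence "{i. i \<in> I \<and> ?q i} = I" using I by (intro card_subset_eq) auto
   thus "\<forall>i\<in>I. ?q i" by blast
  next
   assume "\<forall>i\<in>I. ?q i"
   hence "{i. i \<in> I \<and> ?q i} = I" by blast
   thus "card {i. i \<in> I \<and> ?q i} = card I" by simp
  qed
  have L: "{i. i \<le> fst p \<and> ?q i} = {i. i \<in> {1..fst p} \<and> ?q i}"
   and Rr: "{i. fst p < i \<and> ?q i} = {i. i \<in> {Suc (fst p)..fst p + snd p} \<and> ?q i}"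
   using rng by force+
  have "propagating p d = p \<longleftrightarrow> (\<forall>i\<in>{1..fst p}. ?q i) \<and> (\<forall>i\<in>{Suc (fst p)..fst p + snd p}. ?q i)"
   unfolding propagating_def card_strands[OF d] L Rr
   using card_eq[of "{1..fst p}"] card_eq[of "{Suc (fst p)..fst p + snd p}"]
   by (simp add: prod_eq_iff del: atLeastAtMost_iff)
  also have "... \<longleftrightarrow> (\<forall>i\<in>{1..fst p + snd p}. ?q i)"
  proof -
   have "{1..fst p + snd p} = {1..fst p} \<union> {Suc (fst p)..fst p + snd p}" by auto
   thus ?thesis by (simp only: ball_Un)
  qed
  also have "... \<longleftrightarrow> (\<forall>i j. {(0, i), (0, j)} \<notin> d)"
  proof (intro iffI allI notI ballI)
   fix i j assume q: "\<forall>i\<in>{1..fst p + snd p}. ?q i" and e: "{(0, i), (0, j)} \<in> d"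
   hence "i \<in> {1..fst p + snd p}" using walled_pair[OF d e] by (auto simp: points_def)
   then obtain k where "{(0, i), (1, k)} \<in> d" using q by blast
   from walled_partner[OF d e this] show False by simp
  next
   fix i assume n: "\<forall>i j. {(0, i), (0, j)} \<notin> d" and i: "i \<in> {1..fst p + snd p}"
   have "(0, i) \<in> points p r" using i by (simp add: points_def)
   then obtain v where v: "{(0, i), v} \<in> d" by (rule walled_partner_exists[OF d])
   hence "v \<in> points p r" using walled_pair[OF d] by blast
   thus "?q i" using v n by (cases rule: points_cases) auto
  qed
  finally show ?thesis .
 qed
 thus ?thesis by (auto simp: walled_diagrams_prop_def full_def)
qed

lemma dact_top_edge:
 assumes g: "g \<in> block_perms p" and d: "d \<in> WD p r" and e: "{(0, i), (0, j)} \<in> dact p g d"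
 obtains i' j' where "i = block_perm p g i'" "j = block_perm p g j'" "{(0, i'), (0, j')} \<in> d"
proof -
 obtain a b where ab: "(0, i) = top_act p g a" "(0, j) = top_act p g b" "{a, b} \<in> d"
  using e unfolding dact_def by (rule image_edge[OF d])
 obtain k i' l j' where "a = (k, i')" "b = (l, j')" by (cases a; cases b)
 thus thesis using that[of i' j'] ab by (auto simp: top_act_def)
qed

lemma dact_full: "g \<in> block_perms p ==> d \<in> full p r ==> dact p g d \<in> full p r"
 using dact_top_edge[of g p d r] dact_walled[of g p d r] unfolding full_def by blast

lemma perm_diagram_full: "g \<in> block_perms p ==> perm_diagram p g \<in> full p p"
 using perm_diagram_walled[of g p] by (auto simp: full_def perm_diagram_eq doubleton_eq_iff)

text \<open>A strand between two top points is a component of the stack by itself. So a diagram with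
  such a strand never multiplies to a full one, and setting the non-full products to zero is
  consistent.\<close>

lemma top_edge_persists:
 assumes x: "x \<in> WD p s" and y: "y \<in> WD s t" and e: "{(0, i), (0, j)} \<in> x"
 shows "{(0, i), (0, j)} \<in> diagram_comp x y"
proof -
 note c = diagram_comp_walled[OF x y]
 have p: "(0, i) \<in> points p t" "(0, j) \<in> points p t" "(0 :: nat, i) \<noteq> (0, j)"
  using walled_pair[OF x e] by (auto simp: points_def)
 have "(lift (0, i), lift (0, j)) \<in> conn (stack x y)" using stack_left[OF e] by (simp add: lift_def)
 hence "((0, i), (0, j)) \<in> conn (diagram_comp x y)" using c(2)[OF p(1,2)] by simp
 thus ?thesis using conn_walled[OF c(1)] p(3) by blast
qed

lemma bij_dact: "g \<in> block_perms p ==> bij_betw (dact p g) (full p r) (full p r)"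
 by (rule bij_betw_byWitness[where f' = "dact p (inv' (fst g), inv' (snd g))"])
  (simp_all add: dact_inv[OF _ fullD] image_subset_iff dact_full block_perms_closed(2))

section \<open>Tensor products as function spaces\<close>

text \<open>The homomorphism that \<open>ph\<close> induces on the free abelian group, with
  pointwise addition of functions on the other side.\<close>

definition frag_eval :: "('q => 'i => 'k::comm_ring_1) => ('q \<Rightarrow>\<^sub>0 int) => 'i => 'k"
 where "frag_eval ph x = (\<lambda>i. \<Sum>q\<in>Poly_Mapping.keys x. of_int (Poly_Mapping.lookup x q) * ph q i)"

lemma frag_eval_superset:
 assumes "finite B" "Poly_Mapping.keys x \<subseteq> B"
 shows "frag_eval ph x i = (\<Sum>q\<in>B. of_int (Poly_Mapping.lookup x q) * ph q i)"
 unfolding frag_eval_def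
 by (rule sum.mono_neutral_left) (use assms in \<open>auto simp: in_keys_iff\<close>)

lemma frag_eval_zero [simp]: "frag_eval ph 0 = 0"
 by (simp add: frag_eval_def zero_fun_def)

lemma frag_eval_of [simp]: "frag_eval ph (frag_of q) = ph q"
 by (simp add: frag_eval_def)

lemma frag_eval_diff [simp]: "frag_eval ph (x - y) = frag_eval ph x - frag_eval ph y"
proof
 fix i
 let ?B = "Poly_Mapping.keys x \<union> Poly_Mapping.keys y"
 have "frag_eval ph (x - y) i = (\<Sum>q\<in>?B. of_int (Poly_Mapping.lookup (x - y) q) * ph q i)"
  by (rule frag_eval_superset) (auto simp: keys_diff)
 also have "... = frag_eval ph x i - frag_eval ph y i"
  by (simp add: frag_eval_superset[of ?B x] frag_eval_superset[of ?B y] lookup_minus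
    left_diff_distrib sum_subtractf)
 finally show "frag_eval ph (x - y) i = (frag_eval ph x - frag_eval ph y) i" by simp
qed

lemma frag_eval_minus [simp]: "frag_eval ph (- x) = - frag_eval ph x"
 using frag_eval_diff[of ph 0 x] by simp

lemma frag_eval_add [simp]: "frag_eval ph (x + y) = frag_eval ph x + frag_eval ph y"
 using frag_eval_diff[of ph x "- y"] by simp

lemma frag_eval_sum: "frag_eval ph (\<Sum>i\<in>I. x i) = (\<Sum>i\<in>I. frag_eval ph (x i))"
 by (induction I rule: infinite_finite_induct) simp_all

text \<open>The carrier of a tensor product consists of cosets of formal sums; such a model trades
  them for honest functions with pointwise addition. The action clause ranges over all
  \<open>b\<close>, so no membership has to be carried along for scalars.\<close>

definition function_model :: "('m => 'w::ab_group_add) => ('b, 'm) module => 'w set => ('b => 'w => 'w) => bool"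
 where "function_model io T W act \<longleftrightarrow> bij_betw io (carrier T) W \<and>
  (\<forall>c\<in>carrier T. \<forall>d\<in>carrier T. c \<oplus>\<^bsub>T\<^esub> d \<in> carrier T \<and> io (c \<oplus>\<^bsub>T\<^esub> d) = io c + io d) \<and>
  (\<forall>b. \<forall>c\<in>carrier T. b \<odot>\<^bsub>T\<^esub> c \<in> carrier T \<and> io (b \<odot>\<^bsub>T\<^esub> c) = act b (io c))"

lemma function_modelD:
 assumes "function_model io T W act"
 shows "bij_betw io (carrier T) W"
  "c \<in> carrier T ==> d \<in> carrier T ==> c \<oplus>\<^bsub>T\<^esub> d \<in> carrier T \<and> io (c \<oplus>\<^bsub>T\<^esub> d) = io c + io d"
  "c \<in> carrier T ==> b \<odot>\<^bsub>T\<^esub> c \<in> carrier T \<and> io (b \<odot>\<^bsub>T\<^esub> c) = act b (io c)"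
 using assms unfolding function_model_def by blast+

text \<open>A balanced map \<open>ph\<close> to a space \<open>W\<close> of functions identifies the tensor product with \<open>W\<close> as
 soon as it has a section that is additive modulo the relations.\<close>

lemma tensor_product_iso:
 fixes A :: "('a, 'c) ring_scheme" and M :: "('a, 'm) module" and N :: "('a, 'n) module"
  and act :: "'b => 'm \<times> 'n => ('m \<times> 'n \<Rightarrow>\<^sub>0 int)" and ph :: "'m \<times> 'n => 'i => 'k::comm_ring_1"
 defines "S \<equiv> carrier M \<times> carrier N"
 defines "G \<equiv> free_Abelian_group S"
 defines "R \<equiv> generate G (tensor_relations A M N)"
 defines "T \<equiv> tensor_product A M N act"
 assumes phi: "\<And>q. q \<in> S ==> ph q \<in> W"
  and W: "0 \<in> W" "\<And>v w. v \<in> W ==> w \<in> W ==> v - w \<in> W"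
  and rel: "\<And>x. x \<in> tensor_relations A M N ==> Poly_Mapping.keys x \<subseteq> S \<and> frag_eval ph x = 0"
  and sec: "\<And>w. w \<in> W ==> Poly_Mapping.keys (sec w) \<subseteq> S"
  and sec_add: "\<And>v w. v \<in> W ==> w \<in> W ==> sec (v + w) - sec v - sec w \<in> R"
  and sec_phi: "\<And>q. q \<in> S ==> sec (ph q) - frag_of q \<in> R"
  and eval_sec: "\<And>w. w \<in> W ==> frag_eval ph (sec w) = w"
  and act: "\<And>b q. q \<in> S ==> Poly_Mapping.keys (act b q) \<subseteq> S \<and> frag_eval ph (act b q) = actW b (ph q)"
  and actW: "\<And>b v w. v \<in> W ==> w \<in> W ==> actW b (v - w) = actW b v - actW b w"
 shows "\<exists>io. function_model io T W actW"
proof -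
 interpret G: comm_group G unfolding G_def by (rule abelian_free_Abelian_group)
 have carG: "x \<in> carrier G \<longleftrightarrow> Poly_Mapping.keys x \<subseteq> S" for x by (simp add: G_def)
 have relG: "tensor_relations A M N \<subseteq> carrier G" using rel carG by auto
 have R: "subgroup R G" unfolding R_def by (rule G.generate_is_subgroup[OF relG])
 interpret N: normal R G by (rule G.subgroup_imp_normal[OF R])
 have Rkeys: "Poly_Mapping.keys r \<subseteq> S" if "r \<in> R" for r using N.subset that carG by auto
 have R0: "0 \<in> R" using N.one_closed by (simp add: G_def)
 have Rp: "x + y \<in> R" if "x \<in> R" "y \<in> R" for x y
  using N.m_closed[OF that] by (simp add: G_def)
 have Rm: "- x \<in> R" if "x \<in> R" for x
  using N.m_inv_closed[OF that] Rkeys[OF that] by (simp add: G_def)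
 have Rd: "x - y \<in> R" if "x \<in> R" "y \<in> R" for x y
  using Rp[OF that(1) Rm[OF that(2)]] by simp
 have Rev: "frag_eval ph r = 0" if "r \<in> R" for r
  using that unfolding R_def
 proof (induction rule: generate.induct)
  case (inv h)
  hence "inv\<^bsub>G\<^esub> h = - h" using rel by (simp add: G_def)
  thus ?case using rel inv by simp
 qed (use rel in \<open>simp_all add: G_def\<close>)
 have sec0: "sec 0 \<in> R" using Rm[OF sec_add[OF W(1) W(1)]] by simp
 \<comment> \<open>\<open>sec\<close> inverts the evaluation modulo the relations; therefore the
   kernel of the evaluation is exactly \<open>R\<close>.\<close>
 have evW: "frag_eval ph x \<in> W \<and> sec (frag_eval ph x) - x \<in> R" if "Poly_Mapping.keys x \<subseteq> S" for x
  using that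
 proof (induction rule: free_Abelian_group_induct [consumes 1, case_names 1 2 3])
  case 1
  show ?case by (simp only: frag_eval_zero diff_zero W(1) sec0 simp_thms)
 next
  case (2 x y)
  let ?v = "frag_eval ph x" let ?w = "frag_eval ph y"
  have "sec (?v - ?w + ?w) - sec (?v - ?w) - sec ?w \<in> R"
   using 2 W by (intro sec_add) auto
  hence a: "sec ?v - sec (?v - ?w) - sec ?w \<in> R" by simp
  have "sec (?v - ?w) - (x - y) = (sec ?v - x) - (sec ?w - y) - (sec ?v - sec (?v - ?w) - sec ?w)"
   by (simp add: algebra_simps)
  moreover have "... \<in> R" using Rd[OF Rd a] 2 by blast
  ultimately have "sec (?v - ?w) - (x - y) \<in> R" by (simp only:)
  moreover have "?v - ?w \<in> W" using 2 W(2) by blast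
  ultimately show ?case by (simp only: frag_eval_diff simp_thms)
 next
  case (3 q)
  thus ?case using phi sec_phi by simp
 qed
 have ker: "x \<in> R" if "Poly_Mapping.keys x \<subseteq> S" "frag_eval ph x = 0" for x
  using evW[OF that(1)] that(2) Rd[OF sec0, of "sec 0 - x"] by simp
 have ext: "frag_eval ph (frag_extend (act b) x) = actW b (frag_eval ph x)"
  and ext_keys: "Poly_Mapping.keys (frag_extend (act b) x) \<subseteq> S"
  if x: "Poly_Mapping.keys x \<subseteq> S" for b x
 proof -
  have a0: "actW b 0 = 0" using actW[OF W(1) W(1), of b] by simp
  show "frag_eval ph (frag_extend (act b) x) = actW b (frag_eval ph x)"
   using x
  proof (induction rule: free_Abelian_group_induct [consumes 1, case_names 1 2 3])
   case (2 x y)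
   have "frag_eval ph x \<in> W" "frag_eval ph y \<in> W" using evW 2 by blast+
   thus ?case by (simp only: frag_extend_diff frag_eval_diff 2(3,4) actW)
  next
   case 1
   show ?case by (simp only: frag_extend_0 frag_eval_zero a0)
  next
   case (3 q)
   thus ?case using act[OF 3] by (simp only: frag_extend_of frag_eval_of)
  qed
  show "Poly_Mapping.keys (frag_extend (act b) x) \<subseteq> S"
   using keys_frag_extend[of "act b" x] act x by fast
 qed
 have carT: "carrier T = (\<lambda>x. R #>\<^bsub>G\<^esub> x) ` carrier G"
  unfolding T_def tensor_product_def Let_def
  by (auto simp: S_def[symmetric] G_def[symmetric] R_def[symmetric] FactGroup_def RCOSETS_def)
 have addT: "C \<oplus>\<^bsub>T\<^esub> D = C <#>\<^bsub>G\<^esub> D" for C D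
  unfolding T_def tensor_product_def Let_def
  by (simp add: S_def[symmetric] G_def[symmetric] R_def[symmetric] FactGroup_def)
 have smultT: "b \<odot>\<^bsub>T\<^esub> C = R <#>\<^bsub>G\<^esub> (frag_extend (act b) ` C)" for b C
  unfolding T_def tensor_product_def Let_def
  by (simp add: S_def[symmetric] G_def[symmetric] R_def[symmetric])
 have coset: "R #>\<^bsub>G\<^esub> x = {r + x | r. r \<in> R}" for x
  by (auto simp: r_coset_def G_def)
 \<comment> \<open>Any representative of the coset will do, because the evaluation kills
   \<open>R\<close>.\<close>
 define io where "io C = frag_eval ph (SOME x. x \<in> C)" for C
 have io: "io (R #>\<^bsub>G\<^esub> x) = frag_eval ph x" for x
 proof -
  have "x \<in> R #>\<^bsub>G\<^esub> x" using coset R0 by force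
  hence "(SOME y. y \<in> R #>\<^bsub>G\<^esub> x) \<in> R #>\<^bsub>G\<^esub> x" by (rule someI)
  thus ?thesis unfolding io_def using coset[of x] Rev by auto
 qed
 have sm: "b \<odot>\<^bsub>T\<^esub> (R #>\<^bsub>G\<^esub> x) = R #>\<^bsub>G\<^esub> frag_extend (act b) x"
  if x: "x \<in> carrier G" for b x
 proof -
  have Rf: "frag_extend (act b) r \<in> R" if r: "r \<in> R" for r
  proof (rule ker)
   show "Poly_Mapping.keys (frag_extend (act b) r) \<subseteq> S" using ext_keys[OF Rkeys[OF r]] .
   have "actW b 0 = 0" using actW[OF W(1) W(1), of b] by simp
   thus "frag_eval ph (frag_extend (act b) r) = 0" using ext[OF Rkeys[OF r]] Rev[OF r] by simp
  qed
  have "b \<odot>\<^bsub>T\<^esub> (R #>\<^bsub>G\<^esub> x) = {s + frag_extend (act b) (r + x) | s r. s \<in> R \<and> r \<in> R}"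
   unfolding smultT coset by (auto simp: set_mult_def G_def)
  also have "... = {r + frag_extend (act b) x | r. r \<in> R}"
  proof (intro subset_antisym subsetI)
   fix z assume "z \<in> {s + frag_extend (act b) (r + x) | s r. s \<in> R \<and> r \<in> R}"
   then obtain s r where "s \<in> R" "r \<in> R" "z = s + frag_extend (act b) (r + x)" by blast
   hence "z = (s + frag_extend (act b) r) + frag_extend (act b) x" "s + frag_extend (act b) r \<in> R"
    using Rp Rf by (simp_all add: frag_extend_add add.assoc)
   thus "z \<in> {r + frag_extend (act b) x | r. r \<in> R}" by blast
  next
   fix z assume "z \<in> {r + frag_extend (act b) x | r. r \<in> R}"
   then obtain s where "s \<in> R" "z = s + frag_extend (act b) (0 + x)" by auto
   thus "z \<in> {s + frag_extend (act b) (r + x) | s r. s \<in> R \<and> r \<in> R}" using R0 by blast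
  qed
  finally show ?thesis by (simp only: coset)
 qed
 have "bij_betw io (carrier T) W"
  unfolding bij_betw_def
 proof
  show "inj_on io (carrier T)"
  proof (rule inj_onI)
   fix C D assume "C \<in> carrier T" "D \<in> carrier T" and eq: "io C = io D"
   then obtain x y where xy: "x \<in> carrier G" "y \<in> carrier G" "C = R #>\<^bsub>G\<^esub> x" "D = R #>\<^bsub>G\<^esub> y"
    unfolding carT by blast
   have "Poly_Mapping.keys (x - y) \<subseteq> S" using xy(1,2) keys_diff[of x y] unfolding carG by blast
   moreover have "frag_eval ph (x - y) = 0" using eq xy io by simp
   ultimately have d: "x - y \<in> R" by (rule ker)
   have "x \<in> D" unfolding xy(4) coset using d by (intro CollectI exI[of _ "x - y"]) simp
   thus "C = D" using G.repr_independence[OF _ xy(2) R, of x] xy by simp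
  qed
  show "io ` carrier T = W"
  proof (intro subset_antisym subsetI)
   fix w assume "w \<in> io ` carrier T"
   thus "w \<in> W" unfolding carT using io evW carG by auto
  next
   fix w assume w: "w \<in> W"
   hence "w = io (R #>\<^bsub>G\<^esub> sec w)" by (simp add: io eval_sec)
   moreover have "sec w \<in> carrier G" using sec[OF w] carG by simp
   ultimately show "w \<in> io ` carrier T" unfolding carT by blast
  qed
 qed
 moreover have "C \<oplus>\<^bsub>T\<^esub> D \<in> carrier T \<and> io (C \<oplus>\<^bsub>T\<^esub> D) = io C + io D"
  if "C \<in> carrier T" "D \<in> carrier T" for C D
 proof -
  obtain x y where xy: "x \<in> carrier G" "y \<in> carrier G" "C = R #>\<^bsub>G\<^esub> x" "D = R #>\<^bsub>G\<^esub> y"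
   using \<open>C \<in> carrier T\<close> \<open>D \<in> carrier T\<close> unfolding carT by blast
  have "C \<oplus>\<^bsub>T\<^esub> D = R #>\<^bsub>G\<^esub> (x + y)"
   unfolding addT xy using N.rcos_sum[OF xy(1,2)] by (simp add: G_def)
  moreover have "x + y \<in> carrier G" using G.m_closed[OF xy(1,2)] by (simp add: G_def)
  ultimately show ?thesis unfolding xy carT using io by simp
 qed
 moreover have "b \<odot>\<^bsub>T\<^esub> C \<in> carrier T \<and> io (b \<odot>\<^bsub>T\<^esub> C) = actW b (io C)"
  if "C \<in> carrier T" for b C
 proof -
  obtain x where x: "x \<in> carrier G" "C = R #>\<^bsub>G\<^esub> x" using \<open>C \<in> carrier T\<close> unfolding carT by blast
  have "frag_extend (act b) x \<in> carrier G" using ext_keys x(1) carG by blast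
  thus ?thesis
   unfolding x(2) sm[OF x(1)] carT using io ext x(1) carG by auto
 qed
 ultimately show ?thesis unfolding function_model_def by (intro exI[of _ io]) blast
qed

text \<open>Exchanges a map that is additive modulo the relations with finite sums, as in expanding
  one factor of a pure tensor.\<close>

lemma sum_additive_mod:
 fixes h :: "'n::ab_group_add => 'h::ab_group_add"
 assumes R: "\<And>x y. x \<in> R ==> y \<in> R ==> x - y \<in> R"
  and C: "0 \<in> C" "\<And>n n'. n \<in> C ==> n' \<in> C ==> n + n' \<in> C"
  and h: "\<And>n n'. n \<in> C ==> n' \<in> C ==> h (n + n') - h n - h n' \<in> R"
  and f: "\<And>i. i \<in> I ==> f i \<in> C"
 shows "(\<Sum>i\<in>I. f i) \<in> C \<and> (\<Sum>i\<in>I. h (f i)) - h (\<Sum>i\<in>I. f i) \<in> R"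
 using f
proof (induction I rule: infinite_finite_induct)
 case (insert i I)
 let ?s = "\<Sum>i\<in>I. f i"
 have IH: "?s \<in> C" "(\<Sum>i\<in>I. h (f i)) - h ?s \<in> R" using insert by auto
 have "(h (f i) + (\<Sum>i\<in>I. h (f i))) - h (f i + ?s) =
   ((\<Sum>i\<in>I. h (f i)) - h ?s) - (h (f i + ?s) - h (f i) - h ?s)"
  by (simp add: algebra_simps)
 also have "... \<in> R" using R[OF IH(2) h[OF _ IH(1), of "f i"]] insert.prems by simp
 finally show ?case using insert IH C by simp
qed (use h[OF C(1) C(1)] C in simp_all)

lemma tensor_relation_additive:
 defines "R \<equiv> \<lambda>A M N. generate (free_Abelian_group (carrier M \<times> carrier N)) (tensor_relations A M N)"
 shows "m \<in> carrier M ==> n \<in> carrier N ==> n' \<in> carrier N ==>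
   frag_of (m, n \<oplus>\<^bsub>N\<^esub> n') - frag_of (m, n) - frag_of (m, n') \<in> R A M N"
  "m \<in> carrier M ==> m' \<in> carrier M ==> n \<in> carrier N ==>
   frag_of (m \<oplus>\<^bsub>M\<^esub> m', n) - frag_of (m, n) - frag_of (m', n) \<in> R A M N"
 unfolding R_def by (rule generate.incl; unfold tensor_relations_def; blast)+

section \<open>Complements over semisimple rings\<close>

text \<open>\<open>act a m\<close> is the product \<open>m \<cdot> a\<close> of a right module.\<close>

locale right_action =
 fixes A :: "('a, 'c) ring_scheme" and act :: "'a => 'm::ab_group_add => 'm" and U :: "'m set"
 assumes A: "abelian_group A" and one_closed: "\<one>\<^bsub>A\<^esub> \<in> carrier A"
  and mult_closed: "\<And>a b. a \<in> carrier A ==> b \<in> carrier A ==> a \<otimes>\<^bsub>A\<^esub> b \<in> carrier A"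
  and X0: "0 \<in> U" and X_diff: "\<And>m n. m \<in> U ==> n \<in> U ==> m - n \<in> U"
  and act_closed: "\<And>a m. a \<in> carrier A ==> m \<in> U ==> act a m \<in> U"
  and act_add: "\<And>a m n. a \<in> carrier A ==> m \<in> U ==> n \<in> U ==> act a (m + n) = act a m + act a n"
  and act_add_left: "\<And>a b m. a \<in> carrier A ==> b \<in> carrier A ==> m \<in> U ==>
   act (a \<oplus>\<^bsub>A\<^esub> b) m = act a m + act b m"
  and act_one: "\<And>m. m \<in> U ==> act \<one>\<^bsub>A\<^esub> m = m"
  and act_mult: "\<And>a b m. a \<in> carrier A ==> b \<in> carrier A ==> m \<in> U ==>
   act (a \<otimes>\<^bsub>A\<^esub> b) m = act b (act a m)"
begin

definition stable :: "'m set => bool"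
 where "stable C \<longleftrightarrow> C \<subseteq> U \<and> 0 \<in> C \<and> (\<forall>m\<in>C. \<forall>n\<in>C. m - n \<in> C) \<and>
  (\<forall>a\<in>carrier A. \<forall>m\<in>C. act a m \<in> C)"

lemma stableD:
 assumes "stable C"
 shows "C \<subseteq> U" "0 \<in> C" "m \<in> C ==> n \<in> C ==> m - n \<in> C" "m \<in> C ==> n \<in> C ==> m + n \<in> C"
  "m \<in> C ==> - m \<in> C" "a \<in> carrier A ==> m \<in> C ==> act a m \<in> C"
proof -
 note s = assms[unfolded stable_def]
 show 1: "C \<subseteq> U" "0 \<in> C" "m \<in> C ==> n \<in> C ==> m - n \<in> C" "a \<in> carrier A ==> m \<in> C ==> act a m \<in> C" for m n
  using s by auto
 show 2: "- m \<in> C" if "m \<in> C" for m using 1(3)[OF 1(2) that] by simp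
 show "m \<in> C ==> n \<in> C ==> m + n \<in> C" using 1(3)[of m "- n"] 2[of n] by simp
qed

lemma X_add: "m \<in> U ==> n \<in> U ==> m + n \<in> U"
 using X_diff[of m "- n"] X_diff[OF X0, of n] by simp

lemma act_diff:
 assumes "a \<in> carrier A" "m \<in> U" "n \<in> U"
 shows "act a (m - n) = act a m - act a n"
 using act_add[OF assms(1) X_diff[OF assms(2,3)] assms(3)] by simp

lemma act_zero_left: "m \<in> U ==> act \<zero>\<^bsub>A\<^esub> m = 0"
 using act_add_left[of "\<zero>\<^bsub>A\<^esub>" "\<zero>\<^bsub>A\<^esub>" m] abelian_group.axioms(1)[OF A]
 by (simp add: abelian_monoid.zero_closed abelian_monoid.l_zero)

lemma act_minus_left: "a \<in> carrier A ==> m \<in> U ==> act (\<ominus>\<^bsub>A\<^esub> a) m = - act a m"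
 using act_add_left[of a "\<ominus>\<^bsub>A\<^esub> a" m] act_zero_left[of m] abelian_group.r_neg[OF A, of a]
  abelian_group.a_inv_closed[OF A, of a]
 by (simp add: eq_neg_iff_add_eq_0 add.commute)

lemma stable_sum: "stable C ==> stable D ==> stable {c + d | c d. c \<in> C \<and> d \<in> D}"
 unfolding stable_def
proof (intro conjI ballI)
 assume C: "C \<subseteq> U \<and> 0 \<in> C \<and> (\<forall>m\<in>C. \<forall>n\<in>C. m - n \<in> C) \<and> (\<forall>a\<in>carrier A. \<forall>m\<in>C. act a m \<in> C)"
  and D: "D \<subseteq> U \<and> 0 \<in> D \<and> (\<forall>m\<in>D. \<forall>n\<in>D. m - n \<in> D) \<and> (\<forall>a\<in>carrier A. \<forall>m\<in>D. act a m \<in> D)"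
 let ?S = "{c + d | c d. c \<in> C \<and> d \<in> D}"
 show "?S \<subseteq> U" using C D X_add by blast
 have "0 = 0 + (0 :: 'm)" by simp
 thus "0 \<in> ?S" using C D by blast
 show "m - n \<in> ?S" if "m \<in> ?S" "n \<in> ?S" for m n
 proof -
  from that obtain c d c' d' where cd: "c \<in> C" "d \<in> D" "m = c + d" "c' \<in> C" "d' \<in> D" "n = c' + d'" by blast
  hence "m - n = (c - c') + (d - d')" by simp
  thus ?thesis using C D cd by blast
 qed
 show "act a m \<in> ?S" if "a \<in> carrier A" "m \<in> ?S" for a m
 proof -
  from that(2) obtain c d where cd: "c \<in> C" "d \<in> D" "m = c + d" by blast
  hence "act a m = act a c + act a d" using act_add that(1) C D by blast
  thus ?thesis using C D cd that(1) by blast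
 qed
qed

lemma right_regular_simps:
 "carrier (right_regular A) = carrier A" "\<zero>\<^bsub>right_regular A\<^esub> = \<zero>\<^bsub>A\<^esub>"
 "x \<oplus>\<^bsub>right_regular A\<^esub> y = x \<oplus>\<^bsub>A\<^esub> y" "a \<odot>\<^bsub>right_regular A\<^esub> x = x \<otimes>\<^bsub>A\<^esub> a"
 by (simp_all add: right_regular_def)

lemma add_monoid_right_regular:
 "carrier (add_monoid (right_regular A)) = carrier A" "\<one>\<^bsub>add_monoid (right_regular A)\<^esub> = \<zero>\<^bsub>A\<^esub>"
 "x \<otimes>\<^bsub>add_monoid (right_regular A)\<^esub> y = x \<oplus>\<^bsub>A\<^esub> y"
 "inv\<^bsub>add_monoid (right_regular A)\<^esub> x = \<ominus>\<^bsub>A\<^esub> x"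
 by (simp_all add: right_regular_def a_inv_def m_inv_def)

lemma submodule_right_regular:
 "submodule I A (right_regular A) \<longleftrightarrow> I \<subseteq> carrier A \<and> \<zero>\<^bsub>A\<^esub> \<in> I \<and>
  (\<forall>x\<in>I. \<forall>y\<in>I. x \<oplus>\<^bsub>A\<^esub> y \<in> I) \<and> (\<forall>x\<in>I. \<ominus>\<^bsub>A\<^esub> x \<in> I) \<and>
  (\<forall>a\<in>carrier A. \<forall>x\<in>I. x \<otimes>\<^bsub>A\<^esub> a \<in> I)"
 unfolding submodule_def submodule_axioms_def subgroup_def add_monoid_right_regular
 by (auto simp: right_regular_simps)

text \<open>The submodules meeting \<open>N\<close> trivially have a maximal element \<open>C\<close>.  For \<open>m \<in> U\<close> the elements
 \<open>a\<close> with \<open>m \<cdot> a \<in> N + C\<close> form a right ideal, which contains every simple right ideal \<open>I\<close>: otherwise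
 \<open>C + m \<cdot> I\<close> would contradict maximality.\<close>

lemma complement_exists:
 assumes ss: "semisimple_ring A" and N: "stable N"
 shows "\<exists>C. stable C \<and> C \<inter> N = {0} \<and> (\<forall>m\<in>U. \<exists>c\<in>C. \<exists>n\<in>N. m = n + c)"
proof -
 define F where "F = {C. stable C \<and> C \<inter> N = {0}}"
 have N': "0 \<in> N" using stableD(2)[OF N] .
 have "\<exists>C\<in>F. \<forall>D\<in>F. C \<subseteq> D \<longrightarrow> D = C"
 proof (rule subset_Zorn_nonempty)
  have z: "act a 0 = 0" if "a \<in> carrier A" for a using act_diff[OF that X0 X0] by simp
  have "stable {0}" unfolding stable_def using X0 z by auto
  thus "F \<noteq> {}" using N' unfolding F_def by blast
  fix \<C> assume ch: "\<C> \<noteq> {}" "subset.chain F \<C>"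
  hence sub: "\<And>C. C \<in> \<C> ==> stable C \<and> C \<inter> N = {0}"
   and lin: "\<And>C D. C \<in> \<C> ==> D \<in> \<C> ==> C \<subseteq> D \<or> D \<subseteq> C"
   unfolding subset_chain_def F_def by blast+
  have "stable (\<Union>\<C>)"
   unfolding stable_def
  proof (intro conjI ballI)
   show "\<Union>\<C> \<subseteq> U" using sub stableD(1) by blast
   show "0 \<in> \<Union>\<C>" using sub ch(1) stableD(2) by blast
   show "m - n \<in> \<Union>\<C>" if "m \<in> \<Union>\<C>" "n \<in> \<Union>\<C>" for m n
   proof -
    from that obtain C D where "C \<in> \<C>" "D \<in> \<C>" "m \<in> C" "n \<in> D" by blast
    then obtain E where "E \<in> \<C>" "m \<in> E" "n \<in> E" using lin by blast
    thus ?thesis using sub stableD(3) by blast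
   qed
   show "act a m \<in> \<Union>\<C>" if "a \<in> carrier A" "m \<in> \<Union>\<C>" for a m
    using that sub stableD(6) by blast
  qed
  moreover have "\<Union>\<C> \<inter> N = {0}" using sub ch(1) by blast
  ultimately show "\<Union>\<C> \<in> F" by (simp add: F_def)
 qed
 then obtain C where CF: "C \<in> F" and mx: "\<And>D. D \<in> F ==> C \<subseteq> D ==> D = C" by blast
 have C: "stable C" "C \<inter> N = {0}" using CF by (simp_all add: F_def)
 have max: "D = C" if "stable D" "D \<inter> N = {0}" "C \<subseteq> D" for D
  using mx that by (simp add: F_def)
 define S where "S = {n + c | n c. n \<in> N \<and> c \<in> C}"
 have S: "stable S" unfolding S_def by (rule stable_sum[OF N C(1)])
 have CS: "C \<subseteq> S" "N \<subseteq> S"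
 proof -
  have "0 + c \<in> S" if "c \<in> C" for c using that N' unfolding S_def by blast
  moreover have "n + 0 \<in> S" if "n \<in> N" for n using that stableD(2)[OF C(1)] unfolding S_def by blast
  ultimately show "C \<subseteq> S" "N \<subseteq> S" by auto
 qed
 have simple: "act a m \<in> S" if m: "m \<in> U" and I: "simple_submodule A (right_regular A) I" and a: "a \<in> I" for m I a
 proof -
  have sI: "submodule I A (right_regular A)" using I by (simp add: simple_submodule_def)
  note I' = sI[unfolded submodule_right_regular]
  have IA: "x \<in> carrier A" if "x \<in> I" for x using I' that by blast
  define J where "J = {x \<in> I. act x m \<in> S}"
  have "submodule J A (right_regular A)"
   unfolding submodule_right_regular
  proof (intro conjI ballI)
   show "J \<subseteq> carrier A" using IA by (auto simp: J_def)
   show "\<zero>\<^bsub>A\<^esub> \<in> J" using I' act_zero_left[OF m] stableD(2)[OF S] by (simp add: J_def)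
   show "x \<oplus>\<^bsub>A\<^esub> y \<in> J" if "x \<in> J" "y \<in> J" for x y
    using that I' act_add_left[OF IA IA m, of x y] stableD(4)[OF S] by (auto simp: J_def)
   show "\<ominus>\<^bsub>A\<^esub> x \<in> J" if "x \<in> J" for x
    using that I' act_minus_left[OF IA m, of x] stableD(5)[OF S] by (auto simp: J_def)
   show "x \<otimes>\<^bsub>A\<^esub> b \<in> J" if "b \<in> carrier A" "x \<in> J" for x b
    using that I' act_mult[OF IA _ m, of x b] stableD(6)[OF S] by (auto simp: J_def)
  qed
  moreover have "J \<subseteq> I" by (auto simp: J_def)
  ultimately have J: "J = {\<zero>\<^bsub>A\<^esub>} \<or> J = I"
   using I by (simp add: simple_submodule_def right_regular_simps)
  show ?thesis
  proof (rule ccontr)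
   assume n: "act a m \<notin> S"
   hence J0: "J = {\<zero>\<^bsub>A\<^esub>}" using J a by (auto simp: J_def)
   define K where "K = (\<lambda>x. act x m) ` I"
   have "stable K"
    unfolding stable_def
   proof (intro conjI ballI)
    show "K \<subseteq> U" using IA act_closed m by (auto simp: K_def)
    have "act \<zero>\<^bsub>A\<^esub> m \<in> K" using I' unfolding K_def by blast
    thus "0 \<in> K" by (simp only: act_zero_left[OF m])
    show "u - v \<in> K" if "u \<in> K" "v \<in> K" for u v
    proof -
     from that obtain x y where xy: "x \<in> I" "y \<in> I" "u = act x m" "v = act y m" unfolding K_def by blast
     have "x \<oplus>\<^bsub>A\<^esub> \<ominus>\<^bsub>A\<^esub> y \<in> I" using xy I' by blast
     moreover have "act (x \<oplus>\<^bsub>A\<^esub> \<ominus>\<^bsub>A\<^esub> y) m = u - v"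
      using act_add_left[of x "\<ominus>\<^bsub>A\<^esub> y" m] act_minus_left[of y m] xy IA I' m by auto
     ultimately show ?thesis unfolding K_def by (metis imageI)
    qed
    show "act b u \<in> K" if "b \<in> carrier A" "u \<in> K" for b u
    proof -
     from that(2) obtain x where x: "x \<in> I" "u = act x m" unfolding K_def by blast
     have "x \<otimes>\<^bsub>A\<^esub> b \<in> I" using x I' that(1) by blast
     moreover have "act (x \<otimes>\<^bsub>A\<^esub> b) m = act b u" using act_mult[OF IA[OF x(1)] that(1) m] x by simp
     ultimately show ?thesis unfolding K_def by (metis imageI)
    qed
   qed
   hence D: "stable {c + d | c d. c \<in> C \<and> d \<in> K}" (is "stable ?D") by (rule stable_sum[OF C(1)])
   \<comment> \<open>If \<open>c + act x m\<close> lies in \<open>N\<close>, then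
     \<open>act x m\<close> lies in \<open>S\<close>, so \<open>x\<close> belongs to
     \<open>J\<close>, which is zero.\<close>
   have "?D \<inter> N = {0}"
   proof (intro subset_antisym subsetI)
    fix z assume z: "z \<in> ?D \<inter> N"
    then obtain c x where cx: "c \<in> C" "x \<in> I" "z = c + act x m" unfolding K_def by blast
    have "act x m = z - c" using cx by simp
    moreover have "z - c \<in> S" using z cx(1) CS by (intro stableD(3)[OF S]) auto
    ultimately have "x \<in> J" using cx by (simp add: J_def)
    hence "act x m = 0" using J0 act_zero_left[OF m] by simp
    thus "z \<in> {0}" using z cx C(2) by auto
   next
    fix z :: 'm assume "z \<in> {0}"
    thus "z \<in> ?D \<inter> N" using stableD(2)[OF D] N' by simp
   qed
   moreover have "C \<subseteq> ?D"
   proof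
    fix c assume "c \<in> C"
    hence "c + 0 \<in> ?D" using stableD(2)[OF \<open>stable K\<close>] by blast
    thus "c \<in> ?D" by simp
   qed
   ultimately have "?D = C" using max[OF D] by blast
   moreover have "0 + act a m \<in> ?D" using stableD(2)[OF C(1)] a unfolding K_def by blast
   ultimately have "act a m \<in> C" by simp
   thus False using n CS(1) by blast
  qed
 qed
 have "\<exists>c\<in>C. \<exists>n\<in>N. m = n + c" if m: "m \<in> U" for m
 proof -
  have "a \<in> carrier A \<and> act a m \<in> S"
   if "a \<in> generate (add_monoid (right_regular A)) (\<Union>{S. simple_submodule A (right_regular A) S})" for a
   using that
  proof (induction rule: generate.induct)
   case one
   thus ?case using act_zero_left[OF m] stableD(2)[OF S] A
    by (simp add: add_monoid_right_regular right_regular_simps abelian_monoid.zero_closed abelian_group.axioms(1))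
  next
   case (incl h)
   then obtain I where "simple_submodule A (right_regular A) I" "h \<in> I" by blast
   thus ?case using simple[OF m, of I h]
    by (auto simp: simple_submodule_def submodule_right_regular)
  next
   case (inv h)
   then obtain I where I: "simple_submodule A (right_regular A) I" "h \<in> I" by blast
   hence "h \<in> carrier A" by (auto simp: simple_submodule_def submodule_right_regular)
   thus ?case
    using simple[OF m I] act_minus_left[OF _ m, of h] stableD(5)[OF S]
     abelian_group.a_inv_closed[OF A, of h]
    by (simp only: add_monoid_right_regular(4) simp_thms)
  next
   case (eng h1 h2)
   thus ?case using act_add_left[OF _ _ m] stableD(4)[OF S] abelian_group.axioms(1)[OF A]
    by (simp add: add_monoid_right_regular right_regular_simps abelian_monoid.a_closed)
  qed
  moreover have "\<one>\<^bsub>A\<^esub> \<in> generate (add_monoid (right_regular A)) (\<Union>{S. simple_submodule A (right_regular A) S})"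
   using ss one_closed by (simp add: semisimple_ring_def semisimple_module_def right_regular_simps)
  ultimately have "act \<one>\<^bsub>A\<^esub> m \<in> S" by blast
  thus ?thesis unfolding act_one[OF m] S_def by blast
 qed
 thus ?thesis using C by blast
qed

text \<open>The component in \<open>N\<close> along a complement; additivity and equivariance come
  from the uniqueness of that component.\<close>

lemma semisimple_projection:
 assumes ss: "semisimple_ring A" and N: "stable N"
 obtains p where "\<And>m. m \<in> U ==> p m \<in> N" "\<And>n. n \<in> N ==> p n = n"
  "\<And>m n. m \<in> U ==> n \<in> U ==> p (m + n) = p m + p n"
  "\<And>a m. a \<in> carrier A ==> m \<in> U ==> p (act a m) = act a (p m)"
proof -
 obtain C where C: "stable C" "C \<inter> N = {0}" "\<And>m. m \<in> U ==> \<exists>c\<in>C. \<exists>n\<in>N. m = n + c"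
  using complement_exists[OF ss N] by blast
 define p where "p m = (SOME n. n \<in> N \<and> m - n \<in> C)" for m
 have p: "p m \<in> N" "m - p m \<in> C" if "m \<in> U" for m
 proof -
  have "\<exists>n. n \<in> N \<and> m - n \<in> C" using C(3)[OF that] by auto
  from someI_ex[OF this] show "p m \<in> N" "m - p m \<in> C" by (simp_all add: p_def)
 qed
 have uniq: "p m = n" if "m \<in> U" "n \<in> N" "m - n \<in> C" for m n
 proof -
  have "(m - n) - (m - p m) \<in> C" using stableD(3)[OF C(1)] that p by blast
  hence "p m - n \<in> C" by simp
  moreover have "p m - n \<in> N" using stableD(3)[OF N] that p by blast
  ultimately have "p m - n \<in> {0}" using C(2) by blast
  thus ?thesis by simp
 qed
 show thesis
 proof (rule that[of p])
  show "p m \<in> N" if "m \<in> U" for m using p(1)[OF that] .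
  show "p n = n" if "n \<in> N" for n
   using that stableD(1)[OF N] stableD(2)[OF C(1)] by (intro uniq) auto
  show "p (m + n) = p m + p n" if mn: "m \<in> U" "n \<in> U" for m n
  proof (rule uniq)
   have "m + n - (p m + p n) = (m - p m) + (n - p n)" by simp
   also have "... \<in> C" using p(2) mn stableD(4)[OF C(1)] by blast
   finally show "m + n - (p m + p n) \<in> C" .
  qed (use mn X_add p(1) stableD(4)[OF N] in auto)
  show "p (act a m) = act a (p m)" if am: "a \<in> carrier A" "m \<in> U" for a m
  proof (rule uniq)
   have "act a m - act a (p m) = act a (m - p m)"
    using act_diff[OF am(1,2), of "p m"] p(1)[OF am(2)] stableD(1)[OF N] by auto
   also have "... \<in> C" using p(2) am stableD(6)[OF C(1)] by blast
   finally show "act a m - act a (p m) \<in> C" .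
  qed (use am act_closed p(1) stableD(6)[OF N] in auto)
 qed
qed

end

section \<open>Function models of Specht modules and of their outer tensor products\<close>

lemma carrier_sym_group: "carrier (sym_group n) = perms n"
 by (simp add: sym_group_def perms_def)

lemma sum_fun_apply: "(\<Sum>i\<in>I. f i) x = (\<Sum>i\<in>I. f i x :: 'k::comm_monoid_add)"
 by (induction I rule: infinite_finite_induct) simp_all

definition specht_space :: "nat list => ((nat => nat set) => 'k::field_char_0) set"
 where "specht_space lam = {f. kapply (tabs lam) (spk lam) f = f}"

lemma specht_space_iff:
 "f \<in> specht_space lam \<longleftrightarrow> (\<forall>S. (\<Sum>T\<in>tabs lam. of_rat (spk lam S T) * f T) = f S)"
 by (auto simp: specht_space_def kapply_def fun_eq_iff)

lemma specht_space_sum: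
 "(\<And>i. i \<in> I ==> f i \<in> specht_space lam) ==> (\<lambda>T. \<Sum>i\<in>I. c i * f i T) \<in> specht_space lam"
proof -
 assume f: "\<And>i. i \<in> I ==> f i \<in> specht_space lam"
 have "(\<Sum>T\<in>tabs lam. of_rat (spk lam S T) * (\<Sum>i\<in>I. c i * f i T)) = (\<Sum>i\<in>I. c i * f i S)" for S
 proof -
  have "(\<Sum>T\<in>tabs lam. of_rat (spk lam S T) * (\<Sum>i\<in>I. c i * f i T)) =
    (\<Sum>i\<in>I. c i * (\<Sum>T\<in>tabs lam. of_rat (spk lam S T) * f i T))"
   by (simp add: sum_distrib_left mult_ac sum.swap[of _ I])
  thus ?thesis using f by (simp add: specht_space_iff)
 qed
 thus ?thesis by (simp add: specht_space_iff)
qed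

lemma specht_space_scale: "f \<in> specht_space lam ==> (\<lambda>T. c * f T) \<in> specht_space lam"
 using specht_space_sum[of "{()}" "\<lambda>_. f" lam "\<lambda>_. c"] by simp

lemma specht_space_scale_right: "f \<in> specht_space lam ==> (\<lambda>T. f T * c) \<in> specht_space lam"
 using specht_space_scale[of f lam c] by (simp add: mult.commute)

lemma specht_space_diff:
 assumes "f \<in> specht_space lam" "g \<in> specht_space lam"
 shows "(\<lambda>T. f T - g T) \<in> specht_space lam"
 using assms by (simp add: specht_space_iff right_diff_distrib sum_subtractf)

lemma specht_space_add:
 assumes "f \<in> specht_space lam" "g \<in> specht_space lam"
 shows "(\<lambda>T. f T + g T) \<in> specht_space lam"
 using assms by (simp add: specht_space_iff distrib_left sum.distrib)

lemma specht_space_zero: "(\<lambda>T. 0) \<in> specht_space lam"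
 by (simp add: specht_space_iff)

lemma specht_space_support:
 assumes "f \<in> specht_space lam" "T \<notin> tabs lam"
 shows "f T = 0"
proof -
 have "f T = (\<Sum>S\<in>tabs lam. of_rat (spk lam T S) * f S)" using assms(1) by (simp add: specht_space_iff)
 also have "... = 0" by (simp add: spk_support(1)[OF assms(2)])
 finally show ?thesis .
qed

lemma specht_space_act:
 assumes f: "f \<in> specht_space lam" and s: "sg \<in> perms (sum_list lam)"
 shows "(\<lambda>T. f (tab_act sg T)) \<in> specht_space lam"
proof -
 have s': "sg permutes {1..sum_list lam}" using s by (simp add: perms_def)
 have "(\<Sum>T\<in>tabs lam. of_rat (spk lam S T) * f (tab_act sg T)) =
   (\<Sum>T\<in>tabs lam. of_rat (spk lam (tab_act sg S) (tab_act sg T)) * f (tab_act sg T))" for S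
  by (simp add: spk_equivariant[OF s'])
 also have "... S = (\<Sum>T\<in>tabs lam. of_rat (spk lam (tab_act sg S) T) * f T)" for S
  by (rule sum_tabs_act[OF s'])
 finally show ?thesis using f by (simp add: specht_space_iff)
qed

lemma specht_space_spk:
 assumes "is_partition lam"
 shows "(\<lambda>S. of_rat (spk lam S T)) \<in> specht_space lam"
 unfolding specht_space_iff
proof
 fix S
 have "(\<Sum>U\<in>tabs lam. of_rat (spk lam S U) * of_rat (spk lam U T)) =
   of_rat (\<Sum>U\<in>tabs lam. spk lam S U * spk lam U T)"
  by (simp add: of_rat_sum of_rat_mult)
 thus "(\<Sum>U\<in>tabs lam. of_rat (spk lam S U) * of_rat (spk lam U T)) = of_rat (spk lam S T)"
  by (simp add: spk_idem[OF assms])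
qed

text \<open>The model of the outer tensor product of two Specht modules, with pure tensors as
  products of functions in separate variables.\<close>

definition specht_space2 ::
 "nat list => nat list => (tab2 => 'k::field_char_0) set"
 where "specht_space2 lam1 lam2 = {G. (\<forall>T2. (\<lambda>T1. G (T1, T2)) \<in> specht_space lam1) \<and>
  (\<forall>T1. (\<lambda>T2. G (T1, T2)) \<in> specht_space lam2)}"

definition ga_act :: "nat => nat => ((nat => nat) \<times> (nat => nat) => 'k::comm_ring_1) =>
  (tab2 => 'k) => tab2 => 'k"
 where "ga_act n1 n2 b G = (\<lambda>T. \<Sum>g\<in>perms n1 \<times> perms n2. b g * G (tab_act (fst g) (fst T), tab_act (snd g) (snd T)))"

lemma tensor_relations_closed:
 assumes "\<And>x. x \<in> tensor_relations A M N ==> Poly_Mapping.keys x \<subseteq> carrier M \<times> carrier N"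
 defines "R \<equiv> generate (free_Abelian_group (carrier M \<times> carrier N)) (tensor_relations A M N)"
 shows "0 \<in> R" "x \<in> R ==> y \<in> R ==> x - y \<in> R" "(\<And>i. i \<in> I ==> h i \<in> R) ==> (\<Sum>i\<in>I. h i) \<in> R"
  "x \<in> R ==> y \<in> R ==> x + y \<in> R"
proof -
 let ?G = "free_Abelian_group (carrier M \<times> carrier N)"
 interpret G: comm_group ?G by (rule abelian_free_Abelian_group)
 have R: "subgroup R ?G" unfolding R_def
  by (rule G.generate_is_subgroup) (use assms(1) in auto)
 show 0: "0 \<in> R" using subgroup.one_closed[OF R] by simp
 have m: "x \<in> R ==> - x \<in> R" for x
  using subgroup.m_inv_closed[OF R, of x] subgroup.subset[OF R] by auto
 show p: "x \<in> R ==> y \<in> R ==> x + y \<in> R" for x y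
  using subgroup.m_closed[OF R, of x y] by simp
 show "x \<in> R ==> y \<in> R ==> x - y \<in> R" using p[of x "- y"] m[of y] by simp
 show "(\<And>i. i \<in> I ==> h i \<in> R) ==> (\<Sum>i\<in>I. h i) \<in> R"
  by (induction I rule: infinite_finite_induct) (use 0 p in auto)
qed

text \<open>The section expands \<open>w\<close> in the columns of the two projections with
  coefficients \<open>w (S, T)\<close>. It is additive modulo the relations because the coefficients
  are, and scalars may be moved between the factors.\<close>

lemma outer_tensor_iso:
 fixes lam1 lam2 :: "nat list"
 assumes p1: "is_partition lam1" and p2: "is_partition lam2"
 defines "n1 \<equiv> sum_list lam1" and "n2 \<equiv> sum_list lam2"
 defines "T \<equiv> outer_tensor (sym_group n1) (specht lam1 :: (_ => 'k::field_char_0, _) module)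
  (sym_group n2) (specht lam2 :: (_ => 'k, _) module)"
 shows "\<exists>io. function_model io T (specht_space2 lam1 lam2) (ga_act n1 n2)"
proof -
 define A where "A = (ring_of_type_algebra :: 'k ring)"
 define M where "M = restrict_scalars (single \<one>\<^bsub>sym_group n1\<^esub>) (specht lam1 :: (_ => 'k, _) module)"
 define N where "N = restrict_scalars (single \<one>\<^bsub>sym_group n2\<^esub>) (specht lam2 :: (_ => 'k, _) module)"
 define act where "act = (\<lambda>a (m, n). \<Sum>(g, h) \<in> carrier (sym_group n1) \<times> carrier (sym_group n2).
    frag_of (single g (a (g, h)) \<odot>\<^bsub>(specht lam1 :: (_ => 'k, _) module)\<^esub> m,
     single h 1 \<odot>\<^bsub>(specht lam2 :: (_ => 'k, _) module)\<^esub> n))"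
 have T: "T = tensor_product A M N act"
  unfolding T_def outer_tensor_def A_def M_def N_def act_def ..
 have A: "carrier A = UNIV" by (simp add: A_def ring_of_type_algebra_def)
 have single: "single g c \<odot>\<^bsub>specht lam\<^esub> f = (\<lambda>T. c * f (tab_act g T))"
  if "g \<in> perms (sum_list lam)" for g lam and c :: 'k and f
 proof
  fix T
  have "(single g c \<odot>\<^bsub>specht lam\<^esub> f) T = (\<Sum>sg\<in>perms (sum_list lam). (if sg = g then c else 0) * f (tab_act sg T))"
   by (simp add: specht_def carrier_sym_group single_def tab_act_def)
  also have "... = (\<Sum>sg\<in>perms (sum_list lam). if sg = g then c * f (tab_act sg T) else 0)"
   by (intro sum.cong refl) simp
  finally show "(single g c \<odot>\<^bsub>specht lam\<^esub> f) T = c * f (tab_act g T)" using that by simp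
 qed
 have carM: "carrier M = specht_space lam1" and carN: "carrier N = specht_space lam2"
  using carrier_specht_iff[OF p1] carrier_specht_iff[OF p2]
  by (auto simp: M_def N_def restrict_scalars_def specht_space_def)
 have addM: "m \<oplus>\<^bsub>M\<^esub> m' = m + m'" and addN: "n \<oplus>\<^bsub>N\<^esub> n' = n + n'" for m m' n n'
  by (simp_all add: M_def N_def restrict_scalars_def specht_def plus_fun_def)
 have one: "\<one>\<^bsub>sym_group n\<^esub> = id" for n by (simp add: sym_group_def)
 have smM: "a \<odot>\<^bsub>M\<^esub> m = (\<lambda>T. a * m T)" and smN: "a \<odot>\<^bsub>N\<^esub> n = (\<lambda>T. a * n T)" for a m n
  using single[OF perms_closed(3)]
  by (simp_all add: M_def N_def restrict_scalars_def one)
 let ?S = "carrier M \<times> carrier N"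
 let ?W = "specht_space2 lam1 lam2 :: (_ => 'k) set"
 let ?R = "generate (free_Abelian_group ?S) (tensor_relations A M N)"
 define ph where "ph q T = (fst q (fst T) * snd q (snd T) :: 'k)"
  for q :: "((nat => nat set) => 'k) \<times> ((nat => nat set) => 'k)" and T
 have plus_closed: "f + g \<in> specht_space lam" if "f \<in> specht_space lam" "g \<in> specht_space lam"
  for f g :: "_ => 'k" and lam
  using specht_space_add[OF that] by (simp add: plus_fun_def)
 have zero_closed: "(0 :: _ => 'k) \<in> specht_space lam" for lam
  by (simp add: zero_fun_def specht_space_zero)
 have relS: "Poly_Mapping.keys x \<subseteq> ?S" if "x \<in> tensor_relations A M N" for x
 proof -
  have k: "Poly_Mapping.keys (frag_of a - frag_of b - frag_of c) \<subseteq> {a, b, c}"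
   "Poly_Mapping.keys (frag_of a - frag_of b) \<subseteq> {a, b}" for a b c :: "(_ => 'k) \<times> (_ => 'k)"
   using keys_diff[of "frag_of a - frag_of b" "frag_of c"] keys_diff[of "frag_of a" "frag_of b"] by auto
  show ?thesis
   using that unfolding tensor_relations_def Un_iff mem_Collect_eq addM addN smM smN carM carN
   by (elim disjE exE conjE) (use k plus_closed specht_space_scale in blast)+
 qed
 note Rc = tensor_relations_closed[OF relS]
 have rel0: "frag_eval ph x = 0" if "x \<in> tensor_relations A M N" for x
  using that unfolding tensor_relations_def Un_iff mem_Collect_eq addM addN smM smN
  by (elim disjE exE conjE; hypsubst)
   (simp_all only: frag_eval_diff frag_eval_of, simp_all add: ph_def fun_eq_iff algebra_simps)
 define P where "P lam T = (\<lambda>U. of_rat (spk lam U T) :: 'k)" for lam T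
 have P: "P lam T \<in> specht_space lam" if "is_partition lam" for lam T
  unfolding P_def by (rule specht_space_spk[OF that])
 define sec where "sec w = (\<Sum>S\<in>tabs lam1. \<Sum>T\<in>tabs lam2. frag_of (\<lambda>U. w (S, T) * P lam1 S U, P lam2 T))"
  for w :: "_ => 'k"
 have inS: "(\<lambda>U. c * P lam1 S U, P lam2 T) \<in> ?S" for c S T
  using specht_space_scale[OF P[OF p1]] P[OF p2] by (simp add: carM carN)
 have rsum: "Poly_Mapping.keys (\<Sum>i\<in>I. f i) \<subseteq> ?S" if "\<And>i. i \<in> I ==> Poly_Mapping.keys (f i) \<subseteq> ?S"
  for I and f :: "'z => _"
  using that by (induction I rule: infinite_finite_induct) (auto dest!: subsetD[OF keys_add])
 have expand: "(\<Sum>T\<in>tabs lam. (\<lambda>U. f T * P lam T U)) = f" if "f \<in> specht_space lam" for f lam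
  using that by (simp add: specht_space_iff fun_eq_iff sum_fun_apply P_def mult.commute)
 have "\<exists>io. function_model io (tensor_product A M N act) ?W (ga_act n1 n2)"
 proof (rule tensor_product_iso[where ph = ph and sec = sec])
  show "ph q \<in> ?W" if "q \<in> ?S" for q
   using that specht_space_scale_right[of "fst q" lam1] specht_space_scale[of "snd q" lam2]
   by (auto simp: ph_def specht_space2_def carM carN)
  show "0 \<in> ?W" by (simp add: specht_space2_def specht_space_zero)
  show "v - w \<in> ?W" if "v \<in> ?W" "w \<in> ?W" for v w
   using that by (simp add: specht_space2_def specht_space_diff)
  show "Poly_Mapping.keys x \<subseteq> ?S \<and> frag_eval ph x = 0" if "x \<in> tensor_relations A M N" for x
   using relS[OF that] rel0[OF that] by (rule conjI)
  show "Poly_Mapping.keys (sec w) \<subseteq> ?S" for w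
   unfolding sec_def by (intro rsum) (use inS in auto)
  show "sec (v + w) - sec v - sec w \<in> ?R" for v w
  proof -
   have "frag_of (\<lambda>U. (v + w) (S, T) * P lam1 S U, P lam2 T) - frag_of (\<lambda>U. v (S, T) * P lam1 S U, P lam2 T)
     - frag_of (\<lambda>U. w (S, T) * P lam1 S U, P lam2 T) \<in> ?R" for S T
   proof -
    have e: "(\<lambda>U. (v + w) (S, T) * P lam1 S U) = (\<lambda>U. v (S, T) * P lam1 S U) \<oplus>\<^bsub>M\<^esub> (\<lambda>U. w (S, T) * P lam1 S U)"
     by (simp add: addM fun_eq_iff distrib_right)
    show ?thesis unfolding e
     by (rule generate.incl) (use inS in \<open>unfold tensor_relations_def, blast\<close>)
   qed
   thus ?thesis
    unfolding sec_def sum_subtractf[symmetric] by (intro Rc(3))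
  qed
  show "sec (ph q) - frag_of q \<in> ?R" if q: "q \<in> ?S" for q
  proof -
   obtain m n where mn: "q = (m, n)" "m \<in> specht_space lam1" "n \<in> specht_space lam2"
    using q by (auto simp: carM carN)
   let ?m = "\<lambda>S U. m S * P lam1 S U" and ?n = "\<lambda>T U. n T * P lam2 T U"
   have mS: "?m S \<in> carrier M" for S using specht_space_scale[OF P[OF p1]] by (simp add: carM)
   have nT: "?n T \<in> carrier N" for T using specht_space_scale[OF P[OF p2]] by (simp add: carN)
   have 1: "frag_of (\<lambda>U. ph (m, n) (S, T) * P lam1 S U, P lam2 T) - frag_of (?m S, ?n T) \<in> ?R" for S T
   proof -
    have e: "(\<lambda>U. ph (m, n) (S, T) * P lam1 S U) = n T \<odot>\<^bsub>M\<^esub> ?m S" "?n T = n T \<odot>\<^bsub>N\<^esub> P lam2 T"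
     by (simp_all add: smM smN ph_def mult_ac)
    have "P lam2 T \<in> carrier N" using P[OF p2] by (simp add: carN)
    thus ?thesis unfolding e
     by (intro generate.incl) (use mS A in \<open>unfold tensor_relations_def, blast\<close>)
   qed
   have 2: "(\<Sum>T\<in>tabs lam2. frag_of (?m S, ?n T)) - frag_of (?m S, n) \<in> ?R" for S
    using sum_additive_mod[of ?R "carrier N" "\<lambda>n. frag_of (?m S, n)" "tabs lam2" ?n,
      OF Rc(2) _ _ tensor_relation_additive(1)[OF mS, of _ N, unfolded addN] nT] plus_closed zero_closed expand[OF mn(3)] by (simp add: carN)
   have nN: "n \<in> carrier N" using mn by (simp add: carN)
   have 3: "(\<Sum>S\<in>tabs lam1. frag_of (?m S, n)) - frag_of (m, n) \<in> ?R"
    using sum_additive_mod[of ?R "carrier M" "\<lambda>m. frag_of (m, n)" "tabs lam1" ?m,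
      OF Rc(2) _ _ tensor_relation_additive(2)[OF _ _ nN, of _ M, unfolded addM] mS] plus_closed zero_closed expand[OF mn(2)] by (simp add: carM)
   \<comment> \<open>The three differences move the scalar \<open>n T\<close> to the second factor,
     then sum the second factor over \<open>T\<close>, then the first over \<open>S\<close>.\<close>
   have "sec (ph (m, n)) - frag_of (m, n) =
    (\<Sum>S\<in>tabs lam1. \<Sum>T\<in>tabs lam2. frag_of (\<lambda>U. ph (m, n) (S, T) * P lam1 S U, P lam2 T) - frag_of (?m S, ?n T))
    + (\<Sum>S\<in>tabs lam1. (\<Sum>T\<in>tabs lam2. frag_of (?m S, ?n T)) - frag_of (?m S, n))
    + ((\<Sum>S\<in>tabs lam1. frag_of (?m S, n)) - frag_of (m, n))"
    by (simp add: sec_def sum_subtractf)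
   also have "... \<in> ?R" by (intro Rc(4) Rc(3) 1 2 3)
   finally show ?thesis by (simp add: mn)
  qed
  show "frag_eval ph (sec w) = w" if w: "w \<in> ?W" for w
  proof
   fix T :: "tab2"
   have "frag_eval ph (sec w) T =
     (\<Sum>S1\<in>tabs lam1. \<Sum>S2\<in>tabs lam2. w (S1, S2) * P lam1 S1 (fst T) * P lam2 S2 (snd T))"
    by (simp add: sec_def frag_eval_sum sum_fun_apply ph_def)
   also have "... = (\<Sum>S1\<in>tabs lam1. P lam1 S1 (fst T) * (\<Sum>S2\<in>tabs lam2. P lam2 S2 (snd T) * w (S1, S2)))"
    by (simp add: sum_distrib_left mult_ac)
   also have "... = (\<Sum>S1\<in>tabs lam1. P lam1 S1 (fst T) * w (S1, snd T))"
    using w by (simp add: specht_space2_def specht_space_iff P_def)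
   also have "... = w (fst T, snd T)"
    using w by (simp add: specht_space2_def specht_space_iff P_def)
   finally show "frag_eval ph (sec w) T = w T" by simp
  qed
  show "Poly_Mapping.keys (act b q) \<subseteq> ?S \<and> frag_eval ph (act b q) = ga_act n1 n2 b (ph q)"
   if q: "q \<in> ?S" for b q
  proof -
   obtain m n where mn: "q = (m, n)" "m \<in> specht_space lam1" "n \<in> specht_space lam2"
    using q by (auto simp: carM carN)
   have act: "act b q = (\<Sum>g\<in>perms n1 \<times> perms n2.
     frag_of (\<lambda>T. b g * m (tab_act (fst g) T), \<lambda>T. n (tab_act (snd g) T)))"
    unfolding act_def mn(1) prod.case carrier_sym_group
    by (intro sum.cong refl) (auto simp: single n1_def n2_def)
   have "frag_eval ph (act b q) T = ga_act n1 n2 b (ph q) T" for T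
    unfolding act by (simp add: frag_eval_sum sum_fun_apply ph_def ga_act_def mn(1) mult.assoc)
   moreover have "(\<lambda>T. b g * m (tab_act (fst g) T), \<lambda>T. n (tab_act (snd g) T)) \<in> ?S"
    if "g \<in> perms n1 \<times> perms n2" for g
    using that specht_space_scale[OF specht_space_act[OF mn(2), of "fst g"]] specht_space_act[OF mn(3), of "snd g"]
    by (auto simp: carM carN n1_def n2_def)
   ultimately show ?thesis unfolding act by (intro conjI rsum ext) (auto simp: act)
  qed
  show "ga_act n1 n2 b (v - w) = ga_act n1 n2 b v - ga_act n1 n2 b w" for b and v w :: "_ => 'k"
   by (rule ext) (simp add: ga_act_def right_diff_distrib sum_subtractf)
 qed
 thus ?thesis unfolding T .
qed

section \<open>Inflations as function spaces\<close>

definition gcomp :: "('a => 'a) \<times> ('b => 'b) => ('a => 'a) \<times> ('b => 'b) => ('a => 'a) \<times> ('b => 'b)"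
 where "gcomp g h = (fst g \<circ> fst h, snd g \<circ> snd h)"

definition ginv :: "('a => 'a) \<times> ('b => 'b) => ('a => 'a) \<times> ('b => 'b)"
 where "ginv g = (inv' (fst g), inv' (snd g))"

definition act2 :: "(nat => nat) \<times> (nat => nat) => tab2 =>
  tab2"
 where "act2 g T = (tab_act (fst g) (fst T), tab_act (snd g) (snd T))"

lemma block_perms_eq: "block_perms p = perms (fst p) \<times> perms (snd p)"
 by (auto simp: block_perms_def perms_def)

lemma finite_block_perms [simp]: "finite (block_perms p)"
 by (simp add: block_perms_eq)

lemma block_perms_nonempty: "card (block_perms p) > 0"
 by (simp add: block_perms_eq card_cartesian_product card_perms)

lemma gcomp_closed: "g \<in> block_perms p ==> h \<in> block_perms p ==> gcomp g h \<in> block_perms p"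
 unfolding gcomp_def by (rule block_perms_closed(1))

lemma ginv_closed: "g \<in> block_perms p ==> ginv g \<in> block_perms p"
 unfolding ginv_def by (rule block_perms_closed(2))

lemma gcomp_ginv:
 assumes "g \<in> block_perms p"
 shows "gcomp (ginv g) (gcomp g h) = h" "gcomp g (gcomp (ginv g) h) = h"
  "gcomp (gcomp h g) (ginv g) = h" "gcomp (gcomp h (ginv g)) g = h" "ginv (ginv g) = g"
 using assms unfolding block_perms_def gcomp_def ginv_def
 by (auto simp: prod_eq_iff fun_eq_iff permutes_inverses permutes_inv_inv)

lemma bij_gcomp: "h \<in> block_perms p ==> bij_betw (gcomp h) (block_perms p) (block_perms p)"
 by (rule bij_betw_byWitness[where f' = "gcomp (ginv h)"]) (auto simp: gcomp_ginv gcomp_closed ginv_closed)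

lemma bij_gcomp_right: "h \<in> block_perms p ==> bij_betw (\<lambda>g. gcomp g h) (block_perms p) (block_perms p)"
 by (rule bij_betw_byWitness[where f' = "\<lambda>g. gcomp g (ginv h)"]) (auto simp: gcomp_ginv gcomp_closed ginv_closed)

lemma act2_gcomp: "act2 (gcomp g h) T = act2 g (act2 h T)"
 by (simp add: act2_def gcomp_def tab_act_comp)

lemma dact_gcomp:
 "g \<in> block_perms p ==> h \<in> block_perms p ==> d \<in> full p r ==> dact p (gcomp g h) d = dact p g (dact p h d)"
 unfolding gcomp_def by (rule dact_comp[symmetric]) (auto dest: fullD)

lemma dact_ginv:
 "g \<in> block_perms p ==> d \<in> full p r ==> dact p (ginv g) (dact p g d) = d"
 "g \<in> block_perms p ==> d \<in> full p r ==> dact p g (dact p (ginv g) d) = d"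
 unfolding ginv_def by (auto simp: dact_inv dest!: fullD)

text \<open>In characteristic zero equivariant functions model the tensor product over a group
  algebra. \<open>H\<close> is kept separate from \<open>p\<close> because after bending only the
  permutations of the old top points act.\<close>

definition diag_space ::
 "diagram set => nat \<times> nat => ((nat => nat) \<times> (nat => nat)) set => nat list => nat list =>
  (diagram \<times> tab2 => 'k::field_char_0) set"
 where "diag_space B p H lam1 lam2 = {F. (\<forall>z T. z \<notin> B \<longrightarrow> F (z, T) = 0) \<and>
  (\<forall>z. (\<lambda>T. F (z, T)) \<in> specht_space2 lam1 lam2) \<and>
  (\<forall>g\<in>H. \<forall>z\<in>B. \<forall>T. F (dact p g z, act2 g T) = F (z, T))}"

lemma diag_spaceD:
 assumes "F \<in> diag_space B p H lam1 lam2"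
 shows "z \<notin> B ==> F (z, T) = 0" "(\<lambda>T. F (z, T)) \<in> specht_space2 lam1 lam2"
  "g \<in> H ==> z \<in> B ==> F (dact p g z, act2 g T) = F (z, T)"
 using assms unfolding diag_space_def by blast+

abbreviation infl_space ::
 "nat \<times> nat => nat \<times> nat => nat list => nat list =>
  (diagram \<times> tab2 => 'k::field_char_0) set"
 where "infl_space p r \<equiv> diag_space (full p r) p (block_perms p)"

text \<open>The action of the walled Brauer algebra on functions on a set \<open>B\<close> of diagrams, where the
 diagrams outside of \<open>B\<close> are set to zero.\<close>

definition diag_act ::
 "'k::field => diagram set => nat \<times> nat => (diagram => 'k) => (diagram \<times> 't => 'k) => diagram \<times> 't => 'k"
 where "diag_act dl B r a F = (\<lambda>(z, T). if z \<in> B then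
  \<Sum>x\<in>B. \<Sum>y\<in>WD r r. if diagram_comp x y = z then dl ^ loops x y * (F (x, T) * a y) else 0
  else 0)"

lemma specht_space2_act:
 assumes "G \<in> specht_space2 lam1 lam2" "g \<in> block_perms (sum_list lam1, sum_list lam2)"
 shows "(\<lambda>T. G (act2 g T)) \<in> specht_space2 lam1 lam2"
 using assms specht_space_act[of "\<lambda>T1. G (T1, _)" lam1 "fst g"] specht_space_act[of "\<lambda>T2. G (_, T2)" lam2 "snd g"]
 unfolding specht_space2_def act2_def block_perms_eq by auto

lemma specht_space2_sum:
 "(\<And>i. i \<in> I ==> G i \<in> specht_space2 lam1 lam2) ==> (\<lambda>T. \<Sum>i\<in>I. c i * G i T) \<in> specht_space2 lam1 lam2"
 unfolding specht_space2_def
 using specht_space_sum[of I "\<lambda>i T1. G i (T1, _)" lam1 c] specht_space_sum[of I "\<lambda>i T2. G i (_, T2)" lam2 c]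
 by auto

lemma specht_space2_zero: "(\<lambda>T. 0) \<in> specht_space2 lam1 lam2"
 by (simp add: specht_space2_def specht_space_zero)

lemma specht_space2_diff:
 "G \<in> specht_space2 lam1 lam2 ==> H \<in> specht_space2 lam1 lam2 ==> (\<lambda>T. G T - H T) \<in> specht_space2 lam1 lam2"
 by (simp add: specht_space2_def specht_space_diff)

lemma specht_space2_scale: "G \<in> specht_space2 lam1 lam2 ==> (\<lambda>T. c * G T) \<in> specht_space2 lam1 lam2"
 using specht_space2_sum[of "{()}" "\<lambda>_. G" lam1 lam2 "\<lambda>_. c"] by simp

lemma left_smult:
 fixes f :: "diagram => 'k::field"
 assumes f: "f \<in> free_space (full p r)"
 shows "a \<odot>\<^bsub>diagram_module_left dl p r\<^esub> f =
  (\<lambda>z. if z \<in> full p r then \<Sum>g\<in>block_perms p. a g * f (dact p (ginv g) z) else 0)"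
proof
 fix z
 let ?F = "full p r"
 let ?m = "\<lambda>x y. if diagram_comp x y = z then dl ^ loops x y * f y else 0"
 show "(a \<odot>\<^bsub>diagram_module_left dl p r\<^esub> f) z =
  (if z \<in> ?F then \<Sum>g\<in>block_perms p. a g * f (dact p (ginv g) z) else 0)"
 proof (cases "z \<in> ?F")
  case z: True
  have "(a \<odot>\<^bsub>diagram_module_left dl p r\<^esub> f) z =
    (\<Sum>x\<in>full p p. \<Sum>y\<in>?F. if diagram_comp x y = z then dl ^ loops x y *
     ((\<Sum>g\<in>block_perms p. if perm_diagram p g = x then a g else 0) * f y) else 0)"
   using z by (simp add: diagram_module_left_def diagram_mult_def walled_diagrams_prop_full
     linear_extension_def carrier_sym_group block_perms_eq cong: if_cong)
  also have "... = (\<Sum>x\<in>full p p. (\<Sum>g\<in>block_perms p. if perm_diagram p g = x then a g else 0) * (\<Sum>y\<in>?F. ?m x y))"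
   unfolding sum_distrib_left by (intro sum.cong refl) simp
  also have "... = (\<Sum>x\<in>full p p. \<Sum>g\<in>block_perms p. if perm_diagram p g = x then a g * (\<Sum>y\<in>?F. ?m x y) else 0)"
   unfolding sum_distrib_right by (intro sum.cong refl) simp
  also have "... = (\<Sum>g\<in>block_perms p. \<Sum>x\<in>full p p. if perm_diagram p g = x then a g * (\<Sum>y\<in>?F. ?m x y) else 0)"
   by (rule sum.swap)
  also have "... = (\<Sum>g\<in>block_perms p. a g * f (dact p (ginv g) z))"
  proof (rule sum.cong[OF refl])
   fix g assume g: "g \<in> block_perms p"
   have "(\<Sum>x\<in>full p p. if perm_diagram p g = x then a g * (\<Sum>y\<in>?F. ?m x y) else 0) =
     a g * (\<Sum>y\<in>?F. ?m (perm_diagram p g) y)"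
    using perm_diagram_full[OF g] by simp
   also have "(\<Sum>y\<in>?F. ?m (perm_diagram p g) y) = (\<Sum>y\<in>?F. if y = dact p (ginv g) z then f y else 0)"
   proof (rule sum.cong[OF refl])
    fix y assume y: "y \<in> ?F"
    have "diagram_comp (perm_diagram p g) y = z \<longleftrightarrow> y = dact p (ginv g) z"
     unfolding diagram_comp_perm(1)[OF g fullD[OF y]]
     using dact_ginv(1)[OF g y] dact_ginv(2)[OF g z] by auto
    thus "?m (perm_diagram p g) y = (if y = dact p (ginv g) z then f y else 0)"
     using diagram_comp_perm(2)[OF g fullD[OF y]] by (cases "y = dact p (ginv g) z") simp_all
   qed
   also have "... = f (dact p (ginv g) z)" using dact_full[OF ginv_closed[OF g] z] by simp
   finally show "(\<Sum>x\<in>full p p. if perm_diagram p g = x then a g * (\<Sum>y\<in>?F. ?m x y) else 0) =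
     a g * f (dact p (ginv g) z)" .
  qed
  finally show ?thesis using z by simp
 qed (simp add: diagram_module_left_def diagram_mult_def walled_diagrams_prop_full)
qed

section \<open>Right multiplication on functions of diagrams\<close>

definition dmul :: "'k::field => diagram set => nat \<times> nat => (diagram => 'k) => (diagram => 'k) => diagram => 'k"
 where "dmul dl B r a f z = (if z \<in> B then
  \<Sum>x\<in>B. \<Sum>y\<in>WD r r. if diagram_comp x y = z then dl ^ loops x y * (f x * a y) else 0
  else 0)"

lemma diag_act_dmul: "diag_act dl B r a F (z, T) = dmul dl B r a (\<lambda>x. F (x, T)) z"
 by (simp add: diag_act_def dmul_def)

lemma dmul_cong: "(\<And>x. x \<in> B ==> f x = f' x) ==> dmul dl B r a f z = dmul dl B r a f' z"
 by (simp add: dmul_def cong: sum.cong if_cong)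

lemma dmul_sum: "dmul dl B r a (\<lambda>x. \<Sum>i\<in>I. c i * f i x) z = (\<Sum>i\<in>I. c i * dmul dl B r a (f i) z)"
proof (cases "z \<in> B")
 case True
 have "(\<Sum>i\<in>I. c i * dmul dl B r a (f i) z) = (\<Sum>i\<in>I. \<Sum>x\<in>B. \<Sum>y\<in>WD r r.
   if diagram_comp x y = z then dl ^ loops x y * (c i * f i x * a y) else 0)"
  using True by (simp add: dmul_def sum_distrib_left if_distrib[of "\<lambda>x. _ * x"] mult_ac cong: if_cong)
 also have "... = (\<Sum>x\<in>B. \<Sum>y\<in>WD r r. \<Sum>i\<in>I.
   if diagram_comp x y = z then dl ^ loops x y * (c i * f i x * a y) else 0)"
  by (subst sum.swap) (intro sum.cong refl sum.swap)
 also have "... = dmul dl B r a (\<lambda>x. \<Sum>i\<in>I. c i * f i x) z"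
  using True by (auto simp: dmul_def sum_distrib_left sum_distrib_right intro!: sum.cong)
 finally show ?thesis ..
qed (simp add: dmul_def)

lemma dmul_add: "dmul dl B r a (\<lambda>x. f x + g x) z = dmul dl B r a f z + dmul dl B r a g z"
 using dmul_sum[where I = "{True, False}" and c = "\<lambda>_. 1" and f = "\<lambda>i. if i then f else g"] by simp

lemma dmul_diff: "dmul dl B r a (\<lambda>x. f x - g x) z = dmul dl B r a f z - dmul dl B r a g z"
 using dmul_add[of dl B r a "\<lambda>x. f x - g x" g z] by simp

text \<open>Relabelling the top commutes with composing at the bottom and preserves loop numbers, so
  the sum over \<open>x\<close> may be reindexed.\<close>

lemma dmul_dact:
 assumes B: "B \<subseteq> WD p r" and bij: "bij_betw (dact p g) B B" and g: "g \<in> block_perms p"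
  and z: "z \<in> B"
 shows "dmul dl B r a f (dact p g z) = dmul dl B r a (\<lambda>x. f (dact p g x)) z"
proof -
 let ?t = "\<lambda>x y. if diagram_comp x y = dact p g z then dl ^ loops x y * (f x * a y) else 0"
 have "(\<Sum>x\<in>B. \<Sum>y\<in>WD r r. ?t x y) = (\<Sum>x\<in>B. \<Sum>y\<in>WD r r. ?t (dact p g x) y)"
  by (rule sum.reindex_bij_betw[OF bij, symmetric])
 also have "... = (\<Sum>x\<in>B. \<Sum>y\<in>WD r r.
   if diagram_comp x y = z then dl ^ loops x y * (f (dact p g x) * a y) else 0)"
 proof (intro sum.cong refl)
  fix x y assume x: "x \<in> B" and y: "y \<in> WD r r"
  have x': "x \<in> WD p r" and z': "z \<in> WD p r" using x z B by blast+
  note w = dact_diagram_comp[OF g x' y] and cw = diagram_comp_walled(1)[OF x' y]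
  have "dact p g (diagram_comp x y) = dact p g z \<longleftrightarrow> diagram_comp x y = z"
   using dact_inv(1)[OF g cw] dact_inv(1)[OF g z'] by metis
  thus "?t (dact p g x) y = (if diagram_comp x y = z then dl ^ loops x y * (f (dact p g x) * a y) else 0)"
   by (simp add: w)
 qed
 finally show ?thesis using z bij by (simp add: dmul_def bij_betw_apply)
qed

text \<open>Built on the model of the outer tensor product; the remaining tensor product over the
  group algebra is computed by symmetrizing. Right multiplication commutes with relabelling the top,
  hence with the symmetrization.\<close>

theorem U_module_iso:
 fixes dl :: "'k::field_char_0" and r :: "nat \<times> nat" and lam1 lam2 :: "nat list"
 assumes p1: "is_partition lam1" and p2: "is_partition lam2"
 defines "p \<equiv> (sum_list lam1, sum_list lam2)"
 defines "T \<equiv> U_module dl r (lam1, lam2)"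
 shows "\<exists>io. function_model io T (infl_space p r lam1 lam2) (diag_act dl (full p r) r)"
proof -
 let ?F = "full p r" and ?BP = "block_perms p"
 let ?V = "specht_space2 lam1 lam2 :: (_ => 'k) set"
 define M where "M = outer_tensor (sym_group (fst p)) (specht lam1 :: (_ => 'k, _) module)
  (sym_group (snd p)) (specht lam2 :: (_ => 'k, _) module)"
 define A where "A = (group_algebra (sym_group2 p) :: (_ => 'k) ring)"
 define N where "N = diagram_module_left dl p r"
 define N' where "N' = diagram_module_right dl p r"
 define act where "act = (\<lambda>b (m :: (((nat => nat set) => 'k) \<times> ((nat => nat set) => 'k) \<Rightarrow>\<^sub>0 int) set, n).
  frag_of (m, b \<odot>\<^bsub>N'\<^esub> n))"
 have T: "T = tensor_product A M N act"
  unfolding T_def U_module_def inflation_def bimodule_tensor_def A_def M_def N_def N'_def act_def p_def Let_def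
  by simp
 obtain i where im: "function_model i M ?V (ga_act (fst p) (snd p))"
  using outer_tensor_iso[OF p1 p2, where 'k = 'k] unfolding M_def p_def fst_conv snd_conv by blast
 note i = function_modelD(1)[OF im] and i_add = function_modelD(2)[OF im] and i_act = function_modelD(3)[OF im]
 define j where "j = inv_into (carrier M) i"
 have jM: "j w \<in> carrier M" and ij: "i (j w) = w" if "w \<in> ?V" for w
  using that i unfolding j_def by (simp_all add: bij_betw_def inv_into_into f_inv_into_f)
 have ji: "j (i m) = m" if "m \<in> carrier M" for m
  using that i unfolding j_def by (simp add: bij_betw_def)
 have iV: "i m \<in> ?V" if "m \<in> carrier M" for m using that i by (auto simp: bij_betw_def)
 have gaV: "ga_act (fst p) (snd p) b w T = (\<Sum>h\<in>?BP. b h * w (act2 h T))" for b and w :: "_ => 'k" and T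
  by (simp add: ga_act_def block_perms_eq act2_def)
 have carN: "carrier N = free_space ?F"
  by (simp add: N_def diagram_module_left_def walled_diagrams_prop_full)
 have addN: "n \<oplus>\<^bsub>N\<^esub> n' = n + n'" for n n'
  by (simp add: N_def diagram_module_left_def plus_fun_def)
 have smN: "a \<odot>\<^bsub>N\<^esub> f = (\<lambda>z. if z \<in> ?F then \<Sum>g\<in>?BP. a g * f (dact p (ginv g) z) else 0)"
  if "f \<in> carrier N" for a f
  using left_smult[of f p r dl a] that unfolding N_def[symmetric] carN by blast
 have smN': "b \<odot>\<^bsub>N'\<^esub> f = dmul dl ?F r b f" for b f
  by (rule ext) (simp add: N'_def diagram_module_right_def diagram_mult_def walled_diagrams_prop_full dmul_def)
 have plusN: "n + n' \<in> carrier N" if "n \<in> carrier N" "n' \<in> carrier N" for n n'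
  using that by (simp add: carN free_space_def)
 have smNc: "a \<odot>\<^bsub>N\<^esub> f \<in> carrier N" if "f \<in> carrier N" for a f
  unfolding smN[OF that] by (simp add: carN free_space_def)
 let ?S = "carrier M \<times> carrier N"
 let ?R = "generate (free_Abelian_group ?S) (tensor_relations A M N)"
 let ?W = "infl_space p r lam1 lam2 :: (_ => 'k) set"
 \<comment> \<open>The symmetrization of the pure tensor over the block group; it is balanced
   because a group element on one factor is absorbed by reindexing.\<close>
 define ph where "ph = (\<lambda>q (z, T). if z \<in> ?F then \<Sum>g\<in>?BP. snd q (dact p g z) * i (fst q) (act2 g T) else 0)"
 have phi: "ph (m, f) (z, T) = (if z \<in> ?F then \<Sum>g\<in>?BP. f (dact p g z) * i m (act2 g T) else 0)" for m f z T
  by (simp add: ph_def)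
 have relS: "Poly_Mapping.keys x \<subseteq> ?S" if "x \<in> tensor_relations A M N" for x
 proof -
  have k: "Poly_Mapping.keys (frag_of a - frag_of b - frag_of c) \<subseteq> {a, b, c}"
   "Poly_Mapping.keys (frag_of a - frag_of b) \<subseteq> {a, b}"
   for a b c :: "(((nat => nat set) => 'k) \<times> ((nat => nat set) => 'k) \<Rightarrow>\<^sub>0 int) set \<times> (diagram => 'k)"
   using keys_diff[of "frag_of a - frag_of b" "frag_of c"] keys_diff[of "frag_of a" "frag_of b"] by auto
  show ?thesis
   using that unfolding tensor_relations_def Un_iff mem_Collect_eq addN
   by (elim disjE exE conjE) (use k i_add i_act plusN smNc in blast)+
 qed
 note Rc = tensor_relations_closed[OF relS]
 have rel0: "frag_eval ph x = 0" if "x \<in> tensor_relations A M N" for x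
 proof -
  have 1: "ph (m \<oplus>\<^bsub>M\<^esub> m', n) - ph (m, n) - ph (m', n) = 0" if "m \<in> carrier M" "m' \<in> carrier M" for m m' n
  proof -
   have "i (m \<oplus>\<^bsub>M\<^esub> m') T = i m T + i m' T" for T using i_add[OF that] by simp
   thus ?thesis by (auto simp: fun_eq_iff phi distrib_left sum.distrib)
  qed
  have 2: "ph (m, n + n') - ph (m, n) - ph (m, n') = 0" for m n n'
   by (auto simp: fun_eq_iff phi distrib_right sum.distrib)
  have 3: "ph (a \<odot>\<^bsub>M\<^esub> m, n) - ph (m, a \<odot>\<^bsub>N\<^esub> n) = 0" if m: "m \<in> carrier M" and n: "n \<in> carrier N" for a m n
  proof -
   have "ph (a \<odot>\<^bsub>M\<^esub> m, n) (z, T) = ph (m, a \<odot>\<^bsub>N\<^esub> n) (z, T)" for z T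
   proof (cases "z \<in> ?F")
    case z: True
    have "ph (a \<odot>\<^bsub>M\<^esub> m, n) (z, T) = (\<Sum>g\<in>?BP. \<Sum>h\<in>?BP. a h * n (dact p g z) * i m (act2 h (act2 g T)))"
     using z i_act[OF m] by (simp add: phi gaV sum_distrib_left mult_ac)
    also have "... = (\<Sum>h\<in>?BP. \<Sum>g\<in>?BP. a h * n (dact p g z) * i m (act2 h (act2 g T)))"
     by (rule sum.swap)
    also have "... = (\<Sum>h\<in>?BP. \<Sum>g\<in>?BP. a h * n (dact p (ginv h) (dact p g z)) * i m (act2 g T))"
    proof (rule sum.cong[OF refl])
     fix h assume h: "h \<in> ?BP"
     have "(\<Sum>g\<in>?BP. a h * n (dact p (ginv h) (dact p g z)) * i m (act2 g T)) =
      (\<Sum>g\<in>?BP. a h * n (dact p (ginv h) (dact p (gcomp h g) z)) * i m (act2 (gcomp h g) T))"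
      by (rule sum.reindex_bij_betw[OF bij_gcomp[OF h], symmetric])
     also have "... = (\<Sum>g\<in>?BP. a h * n (dact p g z) * i m (act2 h (act2 g T)))"
      by (intro sum.cong refl)
       (simp add: dact_gcomp[OF h _ z] dact_ginv(1)[OF h dact_full[OF _ z]] act2_gcomp)
     finally show "(\<Sum>g\<in>?BP. a h * n (dact p g z) * i m (act2 h (act2 g T))) =
      (\<Sum>g\<in>?BP. a h * n (dact p (ginv h) (dact p g z)) * i m (act2 g T))" ..
    qed
    also have "... = (\<Sum>g\<in>?BP. \<Sum>h\<in>?BP. a h * n (dact p (ginv h) (dact p g z)) * i m (act2 g T))"
     by (rule sum.swap)
    also have "... = ph (m, a \<odot>\<^bsub>N\<^esub> n) (z, T)"
     unfolding smN[OF n] using z by (simp add: phi dact_full sum_distrib_right)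
    finally show ?thesis .
   qed (simp add: phi)
   thus ?thesis by (simp add: fun_eq_iff)
  qed
  show ?thesis
   using that unfolding tensor_relations_def Un_iff mem_Collect_eq addN
   by (elim disjE exE conjE; hypsubst) (simp_all only: frag_eval_diff frag_eval_of 1 2 3)
 qed
 \<comment> \<open>The symmetrization sums over the whole group, so the section divides by its
   order, which is invertible in characteristic zero.\<close>
 define c where "c = (of_nat (card ?BP) :: 'k)"
 have c: "c \<noteq> 0" using block_perms_nonempty[of p] by (simp only: c_def of_nat_eq_0_iff neq0_conv)
 define sec where "sec F = (\<Sum>z\<in>?F. frag_of (j (\<lambda>T. inverse c * F (z, T)), single z (1 :: 'k)))"
  for F :: "_ => 'k"
 have singleN: "single z (1 :: 'k) \<in> carrier N" if "z \<in> ?F" for z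
  using that by (auto simp: carN free_space_def single_def)
 have slice: "(\<lambda>T. inverse c * F (z, T)) \<in> ?V" if "F \<in> ?W" for F z
  using that by (intro specht_space2_scale) (simp add: diag_space_def)
 have phiW: "ph q \<in> ?W" if q: "q \<in> ?S" for q
 proof -
  obtain m f where mf: "q = (m, f)" "m \<in> carrier M" "f \<in> carrier N" using q by auto
  have "ph (m, f) (dact p h z, act2 h T) = ph (m, f) (z, T)" if h: "h \<in> ?BP" and z: "z \<in> ?F" for h z T
  proof -
   have "ph (m, f) (z, T) = (\<Sum>g\<in>?BP. f (dact p (gcomp g h) z) * i m (act2 (gcomp g h) T))"
    unfolding phi using z sum.reindex_bij_betw[OF bij_gcomp_right[OF h], of "\<lambda>g. f (dact p g z) * i m (act2 g T)"]
    by simp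
   also have "... = ph (m, f) (dact p h z, act2 h T)"
    unfolding phi using dact_full[OF h z] by (simp add: dact_gcomp[OF _ h z] act2_gcomp)
   finally show ?thesis ..
  qed
  moreover have "(\<lambda>T. ph (m, f) (z, T)) \<in> ?V" for z
  proof (cases "z \<in> ?F")
   case True
   have "(\<lambda>T. i m (act2 g T)) \<in> ?V" if "g \<in> ?BP" for g
    using specht_space2_act[OF iV[OF mf(2)]] that unfolding p_def by blast
   from specht_space2_sum[of ?BP "\<lambda>g T. i m (act2 g T)", OF this, of "\<lambda>g. f (dact p g z)"] show ?thesis
    using True by (simp add: phi)
  qed (simp add: phi specht_space2_zero)
  ultimately show ?thesis by (simp add: diag_space_def mf phi)
 qed
 have "\<exists>io. function_model io (tensor_product A M N act) ?W (diag_act dl ?F r)"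
 proof (rule tensor_product_iso[where ph = ph and sec = sec])
  show "ph q \<in> ?W" if "q \<in> ?S" for q by (rule phiW[OF that])
  show "0 \<in> ?W" by (simp add: diag_space_def specht_space2_zero)
  show "v - w \<in> ?W" if "v \<in> ?W" "w \<in> ?W" for v w
   using that specht_space2_diff[of "\<lambda>T. v (_, T)" lam1 lam2 "\<lambda>T. w (_, T)"] by (simp add: diag_space_def)
  show "Poly_Mapping.keys x \<subseteq> ?S \<and> frag_eval ph x = 0" if "x \<in> tensor_relations A M N" for x
   using relS[OF that] rel0[OF that] by (rule conjI)
  show "Poly_Mapping.keys (sec F) \<subseteq> ?S" if F: "F \<in> ?W" for F
  proof -
   have "Poly_Mapping.keys (\<Sum>z\<in>I. frag_of (j (\<lambda>T. inverse c * F (z, T)), single z (1 :: 'k))) \<subseteq> ?S"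
    if "I \<subseteq> ?F" for I
    using that
   proof (induction I rule: infinite_finite_induct)
    case (insert z I)
    have "(j (\<lambda>T. inverse c * F (z, T)), single z (1 :: 'k)) \<in> ?S"
     using jM[OF slice[OF F]] singleN insert by auto
    thus ?case using insert keys_add by (fastforce dest!: subsetD[OF keys_add])
   qed auto
   thus ?thesis unfolding sec_def by blast
  qed
  show "sec (v + w) - sec v - sec w \<in> ?R" if vw: "v \<in> ?W" "w \<in> ?W" for v w
  proof -
   have "frag_of (j (\<lambda>T. inverse c * (v + w) (z, T)), single z (1 :: 'k)) - frag_of (j (\<lambda>T. inverse c * v (z, T)), single z 1)
     - frag_of (j (\<lambda>T. inverse c * w (z, T)), single z 1) \<in> ?R" if z: "z \<in> ?F" for z
   proof -
    let ?a = "j (\<lambda>T. inverse c * v (z, T))" and ?b = "j (\<lambda>T. inverse c * w (z, T))"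
    have ab: "?a \<in> carrier M" "?b \<in> carrier M" using jM slice vw by blast+
    have "i (?a \<oplus>\<^bsub>M\<^esub> ?b) = (\<lambda>T. inverse c * (v + w) (z, T))"
     using i_add[OF ab] ij[OF slice[OF vw(1)]] ij[OF slice[OF vw(2)]] by (simp add: fun_eq_iff distrib_left)
    hence e: "j (\<lambda>T. inverse c * (v + w) (z, T)) = ?a \<oplus>\<^bsub>M\<^esub> ?b"
     using ji i_add[OF ab] by metis
    show ?thesis unfolding e
     by (rule generate.incl) (use ab singleN[OF z] in \<open>unfold tensor_relations_def, blast\<close>)
   qed
   thus ?thesis
    unfolding sec_def sum_subtractf[symmetric] by (intro Rc(3))
  qed
  show "sec (ph q) - frag_of q \<in> ?R" if q: "q \<in> ?S" for q
  proof -
   obtain m f where mf: "q = (m, f)" "m \<in> carrier M" "f \<in> carrier N" using q by auto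
   \<comment> \<open>\<open>b z\<close> is the element of the group algebra that takes
     \<open>m\<close> to the slice at \<open>z\<close> of \<open>ph (m, f)\<close>, divided by
     \<open>c\<close>. Moving it across the tensor sign and summing over \<open>z\<close> restores
     \<open>f\<close>, each value being counted \<open>c\<close> times.\<close>
   define b where "b z g = (if g \<in> ?BP then inverse c * f (dact p g z) else 0)" for z g
   have bA: "b z \<in> carrier A" for z
    by (simp add: A_def group_algebra_def free_space_def carrier_sym_group block_perms_eq b_def)
   have jb: "j (\<lambda>T. inverse c * ph (m, f) (z, T)) = b z \<odot>\<^bsub>M\<^esub> m" if z: "z \<in> ?F" for z
   proof -
    have "i (b z \<odot>\<^bsub>M\<^esub> m) = (\<lambda>T. inverse c * ph (m, f) (z, T))"
     using i_act[OF mf(2), of "b z"] z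
     by (simp add: fun_eq_iff gaV phi b_def sum_distrib_left mult_ac)
    thus ?thesis using ji i_act[OF mf(2)] by metis
   qed
   have sm: "b z \<odot>\<^bsub>N\<^esub> single z 1 \<in> carrier N" if "z \<in> ?F" for z using smNc singleN that by blast
   have total: "(\<Sum>z\<in>?F. b z \<odot>\<^bsub>N\<^esub> single z 1) = f"
   proof
    fix x
    show "(\<Sum>z\<in>?F. b z \<odot>\<^bsub>N\<^esub> single z 1) x = f x"
    proof (cases "x \<in> ?F")
     case x: True
     have "(\<Sum>z\<in>?F. b z \<odot>\<^bsub>N\<^esub> single z 1) x =
       (\<Sum>z\<in>?F. \<Sum>g\<in>?BP. b z g * single z 1 (dact p (ginv g) x))"
      unfolding sum_fun_apply using x by (intro sum.cong refl) (simp add: smN singleN)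
     also have "... = (\<Sum>g\<in>?BP. \<Sum>z\<in>?F. b z g * single z 1 (dact p (ginv g) x))" by (rule sum.swap)
     also have "... = (\<Sum>g\<in>?BP. inverse c * f x)"
     proof (rule sum.cong[OF refl])
      fix g assume g: "g \<in> ?BP"
      have "(\<Sum>z\<in>?F. b z g * single z 1 (dact p (ginv g) x)) =
        (\<Sum>z\<in>?F. if z = dact p (ginv g) x then b z g else 0)"
       by (intro sum.cong refl) (auto simp: single_def)
      also have "... = b (dact p (ginv g) x) g" using dact_full[OF ginv_closed[OF g] x] by simp
      also have "... = inverse c * f x" using g dact_ginv(2)[OF g x] by (simp add: b_def)
      finally show "(\<Sum>z\<in>?F. b z g * single z 1 (dact p (ginv g) x)) = inverse c * f x" .
     qed
     also have "... = f x" using c by (simp add: c_def)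
     finally show ?thesis .
    next
     case False
     hence "f x = 0" using mf(3) by (simp add: carN free_space_def)
     moreover have "(b z \<odot>\<^bsub>N\<^esub> single z 1) x = 0" if "z \<in> ?F" for z
      using False that by (simp add: smN singleN)
     ultimately show ?thesis by (simp add: sum_fun_apply)
    qed
   qed
   have 1: "frag_of (b z \<odot>\<^bsub>M\<^esub> m, single z 1) - frag_of (m, b z \<odot>\<^bsub>N\<^esub> single z 1) \<in> ?R" if z: "z \<in> ?F" for z
    by (rule generate.incl) (use bA[of z] mf(2) singleN[OF z] in \<open>unfold tensor_relations_def, blast\<close>)
   have 2: "(\<Sum>z\<in>?F. frag_of (m, b z \<odot>\<^bsub>N\<^esub> single z 1)) - frag_of (m, f) \<in> ?R"
    using sum_additive_mod[of ?R "carrier N" "\<lambda>n. frag_of (m, n)" ?F "\<lambda>z. b z \<odot>\<^bsub>N\<^esub> single z 1",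
      OF Rc(2) _ _ tensor_relation_additive(1)[OF mf(2), of _ N, unfolded addN] sm] plusN total by (simp add: carN free_space_def)
   have "sec (ph (m, f)) - frag_of (m, f) =
    (\<Sum>z\<in>?F. frag_of (b z \<odot>\<^bsub>M\<^esub> m, single z 1) - frag_of (m, b z \<odot>\<^bsub>N\<^esub> single z 1)) +
    ((\<Sum>z\<in>?F. frag_of (m, b z \<odot>\<^bsub>N\<^esub> single z 1)) - frag_of (m, f))"
    by (simp add: sec_def sum_subtractf jb)
   also have "... \<in> ?R" by (intro Rc(4) Rc(3) 1 2)
   finally show ?thesis by (simp add: mf)
  qed
  show "frag_eval ph (sec F) = F" if F: "F \<in> ?W" for F
  proof
   fix zT :: "diagram \<times> tab2"
   obtain x T where zT: "zT = (x, T)" by (cases zT)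
   show "frag_eval ph (sec F) zT = F zT"
   proof (cases "x \<in> ?F")
    case x: True
    have "frag_eval ph (sec F) (x, T) = (\<Sum>z\<in>?F. \<Sum>g\<in>?BP. single z 1 (dact p g x) * (inverse c * F (z, act2 g T)))"
     unfolding sec_def frag_eval_sum sum_fun_apply frag_eval_of phi using x
     by (simp add: ij[OF slice[OF F]])
    also have "... = (\<Sum>g\<in>?BP. \<Sum>z\<in>?F. single z 1 (dact p g x) * (inverse c * F (z, act2 g T)))"
     by (rule sum.swap)
    also have "... = (\<Sum>g\<in>?BP. inverse c * F (x, T))"
    proof (rule sum.cong[OF refl])
     fix g assume g: "g \<in> ?BP"
     have "(\<Sum>z\<in>?F. single z 1 (dact p g x) * (inverse c * F (z, act2 g T))) =
       (\<Sum>z\<in>?F. if z = dact p g x then inverse c * F (z, act2 g T) else 0)"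
      by (intro sum.cong refl) (auto simp: single_def)
     also have "... = inverse c * F (dact p g x, act2 g T)" using dact_full[OF g x] by simp
     also have "F (dact p g x, act2 g T) = F (x, T)" by (rule diag_spaceD(3)[OF F g x])
     finally show "(\<Sum>z\<in>?F. single z 1 (dact p g x) * (inverse c * F (z, act2 g T))) = inverse c * F (x, T)" .
    qed
    also have "... = F (x, T)" using c by (simp add: c_def)
    finally show ?thesis by (simp add: zT)
   next
    case False
    thus ?thesis using diag_spaceD(1)[OF F False]
     by (simp add: zT sec_def frag_eval_sum sum_fun_apply phi)
   qed
  qed
  show "Poly_Mapping.keys (act b q) \<subseteq> ?S \<and> frag_eval ph (act b q) = diag_act dl ?F r b (ph q)"
   if q: "q \<in> ?S" for b q
  proof -
   obtain m f where mf: "q = (m, f)" "m \<in> carrier M" "f \<in> carrier N" using q by auto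
   have "b \<odot>\<^bsub>N'\<^esub> f \<in> carrier N" unfolding smN' by (simp add: carN free_space_def dmul_def)
   moreover have "ph (m, b \<odot>\<^bsub>N'\<^esub> f) (z, T) = diag_act dl ?F r b (ph (m, f)) (z, T)" for z T
   proof (cases "z \<in> ?F")
    case z: True
    have "dmul dl ?F r b f (dact p g z) = dmul dl ?F r b (\<lambda>x. f (dact p g x)) z" if g: "g \<in> ?BP" for g
     by (rule dmul_dact[OF _ bij_dact[OF g] g z]) (use fullD in blast)
    hence "ph (m, b \<odot>\<^bsub>N'\<^esub> f) (z, T) =
      (\<Sum>g\<in>?BP. i m (act2 g T) * dmul dl ?F r b (\<lambda>x. f (dact p g x)) z)"
     using z by (simp add: phi smN' mult.commute)
    also have "... = dmul dl ?F r b (\<lambda>x. ph (m, f) (x, T)) z"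
     unfolding dmul_sum[symmetric] by (rule dmul_cong) (simp add: phi mult.commute)
    finally show ?thesis by (simp only: diag_act_dmul)
   qed (simp add: phi diag_act_dmul dmul_def)
   hence "ph (m, b \<odot>\<^bsub>N'\<^esub> f) = diag_act dl ?F r b (ph (m, f))" by (intro ext) auto
   ultimately show ?thesis using mf by (simp only: act_def prod.case frag_eval_of) simp
  qed
  show "diag_act dl ?F r b (v - w) = diag_act dl ?F r b v - diag_act dl ?F r b w" for b and v w :: "_ => 'k"
   by (rule ext) (auto simp: diag_act_dmul dmul_diff)
 qed
 thus ?thesis unfolding T .
qed

section \<open>Spans of diagrams as right modules\<close>

text \<open>The diagrams outside of such a set \<open>B\<close> span a submodule.\<close>

definition upclosed :: "diagram set => nat \<times> nat => nat \<times> nat => bool"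
 where "upclosed B p r \<longleftrightarrow> B \<subseteq> WD p r \<and>
  (\<forall>x\<in>WD p r. \<forall>y\<in>WD r r. diagram_comp x y \<in> B \<longrightarrow> x \<in> B)"

lemma upclosedD:
 assumes "upclosed B p r"
 shows "x \<in> B ==> x \<in> WD p r"
  "x \<in> WD p r ==> y \<in> WD r r ==> diagram_comp x y \<in> B ==> x \<in> B" "finite B"
 using assms finite_subset[OF _ finite_walled_diagrams] unfolding upclosed_def by blast+

lemma upclosed_full: "upclosed (full p r) p r"
 using top_edge_persists[of _ p r _ r] unfolding upclosed_def full_def by blast

lemma dmul_add_left: "dmul dl B r (\<lambda>y. a y + b y) f z = dmul dl B r a f z + dmul dl B r b f z"
 unfolding dmul_def by (auto simp: distrib_left sum.distrib[symmetric] intro!: sum.cong)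

text \<open>A product that lies in \<open>C\<close> has its first factor in \<open>C\<close>, so
  restricting functions from \<open>B\<close> to \<open>C\<close> commutes with the action.\<close>

lemma dmul_restrict:
 assumes B: "upclosed B p r" and C: "upclosed C p r" "C \<subseteq> B" and z: "z \<in> C"
 shows "dmul dl B r a f z = dmul dl C r a f z"
proof -
 have "(\<Sum>x\<in>B. \<Sum>y\<in>WD r r. if diagram_comp x y = z then dl ^ loops x y * (f x * a y) else 0) =
   (\<Sum>x\<in>C. \<Sum>y\<in>WD r r. if diagram_comp x y = z then dl ^ loops x y * (f x * a y) else 0)"
 proof (rule sum.mono_neutral_right[OF upclosedD(3)[OF B] C(2)], intro ballI sum.neutral)
  fix x y assume x: "x \<in> B - C" and y: "y \<in> WD r r"
  hence "diagram_comp x y \<noteq> z" using upclosedD(2)[OF C(1) upclosedD(1)[OF B] y, of x] z by blast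
  thus "(if diagram_comp x y = z then dl ^ loops x y * (f x * a y) else 0) = 0" by simp
 qed
 thus ?thesis using z C(2) by (simp add: dmul_def subset_iff)
qed

lemma sum_indicator_mult:
 fixes h :: "'x => 'k::semiring_0"
 shows "finite A ==> w \<in> A ==> (\<Sum>x\<in>A. if w = x then h x else 0) = h w"
 by simp

text \<open>Both sides expand to one sum over \<open>x\<close>, \<open>u\<close> and
  \<open>v\<close>, by associativity and the additivity \<open>loops_assoc\<close> of loop
  numbers.\<close>

lemma dmul_mult:
 assumes B: "upclosed B p r"
 shows "dmul dl B r (diagram_mult dl (WD r r) (WD r r) (WD r r) a b) f z =
  dmul dl B r b (dmul dl B r a f) z"
proof (cases "z \<in> B")
 case z: True
 let ?W = "WD r r"
 let ?T = "\<lambda>x u v. if diagram_comp (diagram_comp x u) v = z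
  then dl ^ (loops x u + loops (diagram_comp x u) v) * (f x * a u * b v) else 0"
 note Bw = upclosedD(1)[OF B]
 have "dmul dl B r (diagram_mult dl ?W ?W ?W a b) f z = (\<Sum>x\<in>B. \<Sum>u\<in>?W. \<Sum>v\<in>?W. ?T x u v)"
  unfolding dmul_def if_P[OF z]
 proof (rule sum.cong[OF refl])
  fix x assume x: "x \<in> B"
  have "(\<Sum>y\<in>?W. if diagram_comp x y = z then dl ^ loops x y * (f x * diagram_mult dl ?W ?W ?W a b y) else 0) =
    (\<Sum>y\<in>?W. \<Sum>u\<in>?W. \<Sum>v\<in>?W. if diagram_comp u v = y then
     (if diagram_comp x y = z then dl ^ loops x y * (f x * (dl ^ loops u v * (a u * b v))) else 0) else 0)"
  proof (rule sum.cong[OF refl])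
   fix y assume y: "y \<in> ?W"
   show "(if diagram_comp x y = z then dl ^ loops x y * (f x * diagram_mult dl ?W ?W ?W a b y) else 0) =
    (\<Sum>u\<in>?W. \<Sum>v\<in>?W. if diagram_comp u v = y then
     (if diagram_comp x y = z then dl ^ loops x y * (f x * (dl ^ loops u v * (a u * b v))) else 0) else 0)"
   proof (cases "diagram_comp x y = z")
    case True
    thus ?thesis unfolding if_P[OF True] diagram_mult_def if_P[OF y] sum_distrib_left
     by (intro sum.cong refl) simp
   next
    case False
    thus ?thesis unfolding if_not_P[OF False] by simp
   qed
  qed
  also have "... = (\<Sum>u\<in>?W. \<Sum>v\<in>?W. \<Sum>y\<in>?W. if diagram_comp u v = y then
     (if diagram_comp x y = z then dl ^ loops x y * (f x * (dl ^ loops u v * (a u * b v))) else 0) else 0)"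
   by (subst sum.swap) (intro sum.cong refl sum.swap)
  also have "... = (\<Sum>u\<in>?W. \<Sum>v\<in>?W. ?T x u v)"
  proof (intro sum.cong refl)
   fix u v assume uv: "u \<in> ?W" "v \<in> ?W"
   let ?h = "\<lambda>y. if diagram_comp x y = z then dl ^ loops x y * (f x * (dl ^ loops u v * (a u * b v))) else 0"
   have "(\<Sum>y\<in>?W. if diagram_comp u v = y then ?h y else 0) = ?h (diagram_comp u v)"
    by (rule sum_indicator_mult) (simp_all add: diagram_comp_walled(1)[OF uv])
   thus "(\<Sum>y\<in>?W. if diagram_comp u v = y then ?h y else 0) = ?T x u v"
    unfolding loops_assoc[OF Bw[OF x] uv] diagram_comp_assoc[OF Bw[OF x] uv]
    by (simp add: power_add mult_ac)
  qed
  finally show "(\<Sum>y\<in>?W. if diagram_comp x y = z then dl ^ loops x y * (f x * diagram_mult dl ?W ?W ?W a b y) else 0) =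
    (\<Sum>u\<in>?W. \<Sum>v\<in>?W. ?T x u v)" .
 qed
 moreover have "dmul dl B r b (dmul dl B r a f) z = (\<Sum>x\<in>B. \<Sum>u\<in>?W. \<Sum>v\<in>?W. ?T x u v)"
 proof -
  let ?S = "\<lambda>x u w v. if diagram_comp x u = w then
   (if diagram_comp w v = z then dl ^ loops w v * (dl ^ loops x u * (f x * a u) * b v) else 0) else 0"
  have "dmul dl B r b (dmul dl B r a f) z = (\<Sum>w\<in>B. \<Sum>v\<in>?W. \<Sum>x\<in>B. \<Sum>u\<in>?W. ?S x u w v)"
   unfolding dmul_def if_P[OF z]
  proof (intro sum.cong refl)
   fix w v assume w: "w \<in> B"
   show "(if diagram_comp w v = z then dl ^ loops w v * ((if w \<in> B then \<Sum>x\<in>B. \<Sum>u\<in>?W.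
     if diagram_comp x u = w then dl ^ loops x u * (f x * a u) else 0 else 0) * b v) else 0) =
    (\<Sum>x\<in>B. \<Sum>u\<in>?W. ?S x u w v)"
   proof (cases "diagram_comp w v = z")
    case True
    thus ?thesis unfolding if_P[OF True] if_P[OF w] sum_distrib_left sum_distrib_right
     by (intro sum.cong refl) simp
   next
    case False
    thus ?thesis unfolding if_not_P[OF False] by simp
   qed
  qed
  also have "... = (\<Sum>w\<in>B. \<Sum>x\<in>B. \<Sum>u\<in>?W. \<Sum>v\<in>?W. ?S x u w v)"
   by (rule sum.cong[OF refl], subst sum.swap) (intro sum.cong refl sum.swap)
  also have "... = (\<Sum>x\<in>B. \<Sum>u\<in>?W. \<Sum>v\<in>?W. \<Sum>w\<in>B. ?S x u w v)"
   by (subst sum.swap, rule sum.cong[OF refl], subst sum.swap) (intro sum.cong refl sum.swap)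
  also have "... = (\<Sum>x\<in>B. \<Sum>u\<in>?W. \<Sum>v\<in>?W. ?T x u v)"
  proof (intro sum.cong refl)
   fix x u v assume x: "x \<in> B" and uv: "u \<in> ?W" "v \<in> ?W"
   let ?h = "\<lambda>w. if diagram_comp w v = z then dl ^ loops w v * (dl ^ loops x u * (f x * a u) * b v) else 0"
   let ?w = "diagram_comp x u"
   have hT: "?h ?w = ?T x u v" by (simp add: power_add mult_ac)
   show "(\<Sum>w\<in>B. if ?w = w then ?h w else 0) = ?T x u v"
   proof (cases "?w \<in> B")
    case True
    have "(\<Sum>w\<in>B. if ?w = w then ?h w else 0) = ?h ?w"
     by (rule sum_indicator_mult) (simp_all add: True upclosedD(3)[OF B])
    thus ?thesis by (simp only: hT)
   next
    case False
    \<comment> \<open>An intermediate product outside \<open>B\<close> cannot return to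
      \<open>B\<close>, so truncating it to zero loses nothing.\<close>
    have "diagram_comp ?w v \<noteq> z"
     using upclosedD(2)[OF B diagram_comp_walled(1)[OF Bw[OF x] uv(1)] uv(2)] False z by blast
    moreover have "(\<Sum>w\<in>B. if ?w = w then ?h w else 0) = 0"
     using False by (intro sum.neutral) auto
    ultimately show ?thesis by (simp only: if_False)
   qed
  qed
  finally show ?thesis .
 qed
 ultimately show ?thesis by (simp only:)
qed (simp add: dmul_def)

lemma dmul_one:
 assumes B: "B \<subseteq> WD p r" and z: "z \<in> B"
 shows "dmul dl B r (single (identity_diagram r) 1) f z = f z"
proof -
 have fin: "finite B" using finite_subset[OF B] by simp
 have "dmul dl B r (single (identity_diagram r) 1) f z = (\<Sum>x\<in>B. if z = x then f x else 0)"
  unfolding dmul_def if_P[OF z]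
 proof (rule sum.cong[OF refl])
  fix x assume "x \<in> B"
  hence x: "x \<in> WD p r" using B by blast
  have "(\<Sum>y\<in>WD r r. if diagram_comp x y = z
    then dl ^ loops x y * (f x * single (identity_diagram r) 1 y) else 0) =
   (\<Sum>y\<in>WD r r. if identity_diagram r = y then
    (if diagram_comp x y = z then dl ^ loops x y * f x else 0) else 0)"
   by (intro sum.cong refl) (auto simp: single_def)
  also have "... = (if diagram_comp x (identity_diagram r) = z then dl ^ loops x (identity_diagram r) * f x else 0)"
   by (rule sum_indicator_mult) (simp_all add: identity_diagram_walled)
  finally show "(\<Sum>y\<in>WD r r. if diagram_comp x y = z
    then dl ^ loops x y * (f x * single (identity_diagram r) 1 y) else 0) = (if z = x then f x else 0)"
   by (simp only: diagram_comp_identity[OF x] power_0 mult_1_left eq_commute[of x z])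
 qed
 also have "... = f z" by (rule sum_indicator_mult[OF fin z])
 finally show ?thesis .
qed

lemma specht_space2_dmul:
 assumes "\<And>x. x \<in> B ==> (\<lambda>T. F (x, T)) \<in> specht_space2 lam1 lam2"
 shows "(\<lambda>T. dmul dl B r a (\<lambda>x. F (x, T)) z) \<in> specht_space2 lam1 lam2"
proof (cases "z \<in> B")
 case True
 have "(\<lambda>T. \<Sum>x\<in>B. (\<Sum>y\<in>WD r r. if diagram_comp x y = z then dl ^ loops x y * a y else 0) * F (x, T))
   \<in> specht_space2 lam1 lam2"
  using specht_space2_sum[of B "\<lambda>x T. F (x, T)"] assms by simp
 moreover have "dmul dl B r a (\<lambda>x. F (x, T)) z =
   (\<Sum>x\<in>B. (\<Sum>y\<in>WD r r. if diagram_comp x y = z then dl ^ loops x y * a y else 0) * F (x, T))" for T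
  unfolding dmul_def if_P[OF True] sum_distrib_right by (intro sum.cong refl) simp
 ultimately show ?thesis by (simp only:)
qed (simp add: dmul_def specht_space2_zero)

lemma diag_act_closed:
 assumes F: "F \<in> diag_space B p H lam1 lam2" and B: "B \<subseteq> WD p r" and H: "H \<subseteq> block_perms p"
  and bij: "\<And>g. g \<in> H ==> bij_betw (dact p g) B B"
 shows "diag_act dl B r a F \<in> diag_space B p H lam1 lam2"
 unfolding diag_space_def mem_Collect_eq diag_act_dmul
proof (intro conjI allI impI ballI)
 show "dmul dl B r a (\<lambda>x. F (x, T)) z = 0" if "z \<notin> B" for z T using that by (simp add: dmul_def)
 show "(\<lambda>T. dmul dl B r a (\<lambda>x. F (x, T)) z) \<in> specht_space2 lam1 lam2" for z
  by (rule specht_space2_dmul) (rule diag_spaceD(2)[OF F])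
 show "dmul dl B r a (\<lambda>x. F (x, act2 g T)) (dact p g z) = dmul dl B r a (\<lambda>x. F (x, T)) z"
  if g: "g \<in> H" and z: "z \<in> B" for g z T
  unfolding dmul_dact[OF B bij[OF g] subsetD[OF H g] z]
  by (rule dmul_cong) (rule diag_spaceD(3)[OF F g])
qed

lemma walled_brauer_simps:
 "carrier (walled_brauer dl r) = free_space (WD r r)"
 "a \<otimes>\<^bsub>walled_brauer dl r\<^esub> b =
  diagram_mult dl (WD r r) (WD r r) (WD r r) a b"
 "\<one>\<^bsub>walled_brauer dl r\<^esub> = single (identity_diagram r) 1" "\<zero>\<^bsub>walled_brauer dl r\<^esub> = 0"
 "a \<oplus>\<^bsub>walled_brauer dl r\<^esub> b = (\<lambda>y. a y + b y)"
 by (simp_all add: walled_brauer_def zero_fun_def)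

lemma right_action_diag_space:
 assumes B: "upclosed B p r" and H: "H \<subseteq> block_perms p"
  and bij: "\<And>g. g \<in> H ==> bij_betw (dact p g) B B"
 shows "right_action (walled_brauer dl r) (diag_act dl B r) (diag_space B p H lam1 lam2)"
proof (rule right_action.intro)
 let ?A = "walled_brauer dl r" and ?U = "diag_space B p H lam1 lam2"
 note w = walled_brauer_simps
 have Bw: "B \<subseteq> WD p r" using B by (simp add: upclosed_def)
 show "abelian_group ?A"
 proof (rule abelian_groupI)
  fix a assume "a \<in> carrier ?A"
  thus "\<exists>y\<in>carrier ?A. y \<oplus>\<^bsub>?A\<^esub> a = \<zero>\<^bsub>?A\<^esub>"
   by (intro bexI[of _ "- a"]) (auto simp: w free_space_def)
 qed (auto simp: w free_space_def add_ac)
 show "\<one>\<^bsub>?A\<^esub> \<in> carrier ?A"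
  by (auto simp: w free_space_def single_def identity_diagram_walled)
 show "a \<otimes>\<^bsub>?A\<^esub> b \<in> carrier ?A" for a b by (simp add: w free_space_def diagram_mult_def)
 show "0 \<in> ?U" by (simp add: diag_space_def specht_space2_zero)
 show "m - n \<in> ?U" if "m \<in> ?U" "n \<in> ?U" for m n
  using that by (simp add: diag_space_def specht_space2_diff)
 show "diag_act dl B r a m \<in> ?U" if "m \<in> ?U" for a m by (rule diag_act_closed[OF that Bw H bij])
 show "diag_act dl B r a (m + n) = diag_act dl B r a m + diag_act dl B r a n" for a m n
  by (simp add: fun_eq_iff diag_act_dmul dmul_add)
 show "diag_act dl B r (a \<oplus>\<^bsub>?A\<^esub> b) m = diag_act dl B r a m + diag_act dl B r b m" for a b m
  by (simp add: fun_eq_iff diag_act_dmul w dmul_add_left)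
 show "diag_act dl B r \<one>\<^bsub>?A\<^esub> m = m" if m: "m \<in> ?U" for m
 proof -
  have "dmul dl B r (single (identity_diagram r) 1) (\<lambda>x. m (x, T)) z = m (z, T)" for z T
   using dmul_one[OF Bw, of z dl "\<lambda>x. m (x, T)"] diag_spaceD(1)[OF m, of z T]
   by (cases "z \<in> B") (simp_all add: dmul_def)
  thus ?thesis by (intro ext) (metis diag_act_dmul surj_pair w(3))
 qed
 show "diag_act dl B r (a \<otimes>\<^bsub>?A\<^esub> b) m = diag_act dl B r b (diag_act dl B r a m)" for a b m
  by (simp add: fun_eq_iff diag_act_dmul w dmul_mult[OF B])
qed

section \<open>Bending the last bottom point\<close>

text \<open>The image of the full diagrams with one bottom point more under \<open>bend\<close>, see
  \<open>bij_bend\<close>. The exception at \<open>Suc p1\<close> records strands that joined the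
  bent point to a top point.\<close>

definition bent :: "nat => nat => nat \<times> nat => diagram set"
 where "bent p1 p2 r = {b \<in> WD (Suc p1, p2) r.
  \<forall>i j. {(0, i), (0, j)} \<in> b \<longrightarrow> i = Suc p1 \<or> j = Suc p1}"

lemma bentD: "b \<in> bent p1 p2 r ==> b \<in> WD (Suc p1, p2) r"
 by (simp add: bent_def)

lemma bent_top: "b \<in> bent p1 p2 r ==> {(0, i), (0, j)} \<in> b ==> i = Suc p1 \<or> j = Suc p1"
 by (simp add: bent_def)

lemma full_bent: "full (Suc p1, p2) r \<subseteq> bent p1 p2 r"
 by (auto simp: full_def bent_def)

lemma full_top: "d \<in> full p r ==> {(0, i), (0, j)} \<notin> d"
 by (simp add: full_def)

lemma bend_eq: "bend p1 n = (`) ((`) (bend_pt p1 n))"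
 by (simp add: bend_def fun_eq_iff)

lemma bij_bend_walled:
 "bij_betw (bend p1 (r1 + r2)) (WD (p1, p2) (r1, r2 + 1)) (WD (Suc p1, p2) (r1, r2))"
 unfolding bend_eq by (rule image_walled_bij[OF bend_pt_bij bend_pt_positive])

lemma bend_pt_top: "bend_pt p1 n (0, i) = (0, if i \<le> p1 then i else Suc i)"
 by (simp add: bend_pt_def)

lemma bend_bent_iff:
 assumes x: "x \<in> WD (p1, p2) (r1, r2 + 1)"
 shows "bend p1 (r1 + r2) x \<in> bent p1 p2 (r1, r2) \<longleftrightarrow> x \<in> full (p1, p2) (r1, r2 + 1)"
proof
 assume b: "bend p1 (r1 + r2) x \<in> bent p1 p2 (r1, r2)"
 have "{(0, i), (0, j)} \<notin> x" for i j
 proof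
  assume "{(0, i), (0, j)} \<in> x"
  from image_pair[OF this, of "bend_pt p1 (r1 + r2)"]
  have "{bend_pt p1 (r1 + r2) (0, i), bend_pt p1 (r1 + r2) (0, j)} \<in> bend p1 (r1 + r2) x"
   by (simp add: bend_def)
  from bent_top[OF b this[unfolded bend_pt_top]] show False by (auto split: if_splits)
 qed
 thus "x \<in> full (p1, p2) (r1, r2 + 1)" using x by (simp add: full_def)
next
 assume f: "x \<in> full (p1, p2) (r1, r2 + 1)"
 have "i = Suc p1 \<or> j = Suc p1" if e: "{(0, i), (0, j)} \<in> bend p1 (r1 + r2) x" for i j
 proof -
  obtain a b where ab: "(0, i) = bend_pt p1 (r1 + r2) a" "(0, j) = bend_pt p1 (r1 + r2) b" "{a, b} \<in> x"
   using e unfolding bend_def by (rule image_edge[OF x])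
  have "a = (0, snd a) ==> b = (0, snd b) ==> False" using full_top[OF f, of "snd a" "snd b"] ab(3) by simp
  hence "fst a \<noteq> 0 \<or> fst b \<noteq> 0" by (auto simp: prod_eq_iff)
  thus ?thesis using ab(1,2) by (auto simp: bend_pt_def split: if_splits prod.splits)
 qed
 thus "bend p1 (r1 + r2) x \<in> bent p1 p2 (r1, r2)" using bend_walled[OF x] by (simp add: bent_def)
qed

lemma bij_bend: "bij_betw (bend p1 (r1 + r2)) (full (p1, p2) (r1, r2 + 1)) (bent p1 p2 (r1, r2))"
 unfolding bij_betw_def
proof
 note b = bij_bend_walled[of p1 r1 r2 p2]
 show "inj_on (bend p1 (r1 + r2)) (full (p1, p2) (r1, r2 + 1))"
  by (rule inj_on_subset[OF bij_betw_imp_inj_on[OF b]]) (auto dest: fullD)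
 show "bend p1 (r1 + r2) ` full (p1, p2) (r1, r2 + 1) = bent p1 p2 (r1, r2)"
 proof (intro subset_antisym subsetI)
  fix z assume "z \<in> bend p1 (r1 + r2) ` full (p1, p2) (r1, r2 + 1)"
  then obtain x where x: "x \<in> full (p1, p2) (r1, r2 + 1)" "z = bend p1 (r1 + r2) x" by (rule imageE)
  show "z \<in> bent p1 p2 (r1, r2)" unfolding x(2) bend_bent_iff[OF fullD[OF x(1)]] by (rule x(1))
 next
  fix z assume z: "z \<in> bent p1 p2 (r1, r2)"
  hence "z \<in> bend p1 (r1 + r2) ` WD (p1, p2) (r1, r2 + 1)"
   using bij_betw_imp_surj_on[OF b] bentD[OF z] by simp
  then obtain x where x: "x \<in> WD (p1, p2) (r1, r2 + 1)" "z = bend p1 (r1 + r2) x" by blast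
  hence "x \<in> full (p1, p2) (r1, r2 + 1)" using z bend_bent_iff[OF x(1)] by simp
  thus "z \<in> bend p1 (r1 + r2) ` full (p1, p2) (r1, r2 + 1)" using x(2) by (rule rev_image_eqI)
 qed
qed

lemma block_perms_Suc: "g \<in> block_perms (p1, p2) ==> g \<in> block_perms (Suc p1, p2)"
 using perms_Suc by (auto simp: block_perms_eq)

lemma block_perm_fixed: "g \<in> block_perms (p1, p2) ==> block_perm (Suc p1, p2) g (Suc p1) = Suc p1"
 by (auto simp: block_perms_def block_perm_def permutes_not_in)

lemma bend_dact:
 assumes x: "x \<in> WD (p1, p2) (r1, r2 + 1)" and g: "g \<in> block_perms (p1, p2)"
 shows "bend p1 (r1 + r2) (dact (p1, p2) g x) = dact (Suc p1, p2) g (bend p1 (r1 + r2) x)"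
proof -
 have pt: "bend_pt p1 (r1 + r2) (top_act (p1, p2) g v) = top_act (Suc p1, p2) g (bend_pt p1 (r1 + r2) v)"
  if v: "v \<in> points (p1, p2) (r1, r2 + 1)" for v
  using v
 proof (cases rule: points_cases)
  case (top i)
  thus ?thesis using block_perm_cases[OF g, of i]
   by (cases "i \<le> p1") (auto simp: top_act_def bend_pt_def block_perm_def)
 next
  case (bottom i)
  thus ?thesis using block_perm_fixed[OF g] by (simp add: top_act_def bend_pt_def)
 qed
 show ?thesis unfolding bend_def dact_def image_image
  by (intro image_cong refl) (use pt walledD(1)[OF x] in blast)
qed

lemma upclosed_bent: "upclosed (bent p1 p2 r) (Suc p1, p2) r"
 using top_edge_persists[of _ "(Suc p1, p2)" r _ r] unfolding upclosed_def bent_def by blast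

lemma dact_bent:
 assumes g: "g \<in> block_perms (p1, p2)" and b: "b \<in> bent p1 p2 r"
 shows "dact (Suc p1, p2) g b \<in> bent p1 p2 r"
proof -
 note g' = block_perms_Suc[OF g]
 have "i = Suc p1 \<or> j = Suc p1" if e: "{(0, i), (0, j)} \<in> dact (Suc p1, p2) g b" for i j
  using dact_top_edge[OF g' bentD[OF b] e] b block_perm_fixed[OF g] unfolding bent_def by blast
 thus ?thesis using dact_walled[OF g' bentD[OF b]] by (simp add: bent_def)
qed

lemma bij_dact_bent:
 assumes g: "g \<in> block_perms (p1, p2)"
 shows "bij_betw (dact (Suc p1, p2) g) (bent p1 p2 r) (bent p1 p2 r)"
 by (rule bij_betw_byWitness[where f' = "dact (Suc p1, p2) (ginv g)"])
  (simp_all add: ginv_def dact_inv[OF block_perms_Suc[OF g] bentD] image_subset_iff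
   dact_bent[OF g] dact_bent[OF block_perms_closed(2)[OF g]])

lemma bent_edge:
 assumes b: "b \<in> bent p1 p2 r" "b \<notin> full (Suc p1, p2) r"
 obtains j where "{(0, Suc p1), (0, j)} \<in> b"
proof -
 obtain i j where ij: "{(0, i), (0, j)} \<in> b" using b(2) bentD[OF b(1)] unfolding full_def by blast
 hence "{(0, j), (0, i)} \<in> b" by (simp add: insert_commute)
 thus thesis using bent_top[OF b(1) ij] ij that by blast
qed

section \<open>Capped diagrams\<close>

lemma cap_edge: "{(0, Suc p1), (0, Suc (Suc (p1 + p2)))} \<in> cap p1 p2 d"
 by (simp add: cap_def)

lemma cap_edge_iff:
 assumes d: "d \<in> WD (p1, p2) s" and u: "u \<in> points (p1, p2) s"
 shows "{cap_pt p1 u, cap_pt p1 v} \<in> cap p1 p2 d \<longleftrightarrow> {u, v} \<in> d"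
proof
 assume "{cap_pt p1 u, cap_pt p1 v} \<in> cap p1 p2 d"
 moreover have "{cap_pt p1 u, cap_pt p1 v} \<noteq> {(0, Suc p1), (0, Suc (Suc (p1 + p2)))}"
  using cap_pt_points[OF u] by blast
 ultimately have "{cap_pt p1 u, cap_pt p1 v} \<in> (`) (cap_pt p1) ` d" by (simp add: cap_def)
 then obtain a b where "cap_pt p1 u = cap_pt p1 a" "cap_pt p1 v = cap_pt p1 b" "{a, b} \<in> d"
  by (rule image_edge[OF d])
 thus "{u, v} \<in> d" using injD[OF inj_cap_pt] by metis
next
 assume "{u, v} \<in> d"
 from image_pair[OF this, of "cap_pt p1"] show "{cap_pt p1 u, cap_pt p1 v} \<in> cap p1 p2 d" by (simp add: cap_def)
qed

lemma cap_inj: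
 assumes d: "d \<in> WD (p1, p2) s" and d': "d' \<in> WD (p1, p2) s"
  and eq: "cap p1 p2 d = cap p1 p2 d'"
 shows "d = d'"
proof (rule walled_eqI[OF d d'])
 fix u v assume e: "{u, v} \<in> d"
 have u: "u \<in> points (p1, p2) s" by (rule edge_in_points[OF d e])
 show "{u, v} \<in> d'" using e unfolding cap_edge_iff[OF d u, symmetric] eq cap_edge_iff[OF d' u] .
qed

text \<open>Deleting the cap leaves a matching of the remaining points, as neither end of the cap
  has another partner.\<close>

lemma cap_surj:
 assumes b: "b \<in> WD (Suc p1, Suc p2) s" and e: "{(0, Suc p1), (0, Suc (Suc (p1 + p2)))} \<in> b"
 obtains d where "d \<in> WD (p1, p2) s" "b = cap p1 p2 d"
proof -
 let ?P = "points (p1, p2) s"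
 define d where "d = {{u, v} | u v. u \<in> ?P \<and> v \<in> ?P \<and> {cap_pt p1 u, cap_pt p1 v} \<in> b}"
 have partner: "\<exists>v\<in>?P. {cap_pt p1 u, cap_pt p1 v} \<in> b" if u: "u \<in> ?P" for u
 proof -
  note cu = cap_pt_points[OF u]
  obtain w where w: "{cap_pt p1 u, w} \<in> b" using walled_partner_exists[OF b] cu by blast
  have "w \<noteq> (0, Suc p1)"
   using walled_partner[OF b e, of "cap_pt p1 u"] w cu by (auto simp: insert_commute)
  moreover have "w \<noteq> (0, Suc (Suc (p1 + p2)))"
   using walled_partner[OF b, of "(0, Suc (Suc (p1 + p2)))" "(0, Suc p1)" "cap_pt p1 u"] e w cu
   by (auto simp: insert_commute)
  moreover have "w \<in> points (Suc p1, Suc p2) s" using walled_pair[OF b w] by blast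
  ultimately show ?thesis using w unfolding cap_points by blast
 qed
 have dw: "d \<in> WD (p1, p2) s"
 proof (rule walledI)
  show "\<Union>d = ?P"
  proof (intro subset_antisym subsetI)
   fix u assume u: "u \<in> ?P"
   then obtain v where "v \<in> ?P" "{cap_pt p1 u, cap_pt p1 v} \<in> b" using partner by blast
   hence "{u, v} \<in> d" using u unfolding d_def by blast
   thus "u \<in> \<Union>d" by blast
  qed (auto simp: d_def)
  show "c = c'" if c: "c \<in> d" "c' \<in> d" "v \<in> c" "v \<in> c'" for c c' v
  proof -
   obtain w where w: "c = {v, w}" "{cap_pt p1 v, cap_pt p1 w} \<in> b"
    using c(1,3) unfolding d_def by (auto simp: insert_commute)
   obtain w' where w': "c' = {v, w'}" "{cap_pt p1 v, cap_pt p1 w'} \<in> b"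
    using c(2,4) unfolding d_def by (auto simp: insert_commute)
   have "cap_pt p1 w = cap_pt p1 w'" by (rule walled_partner[OF b w(2) w'(2)])
   thus ?thesis using w(1) w'(1) injD[OF inj_cap_pt] by metis
  qed
  fix c assume "c \<in> d"
  then obtain u v where c: "c = {u, v}" "u \<in> ?P" "v \<in> ?P" "{cap_pt p1 u, cap_pt p1 v} \<in> b"
   unfolding d_def by blast
  hence "positive (p1, p2) s u \<noteq> positive (p1, p2) s v"
   using walled_pair[OF b c(4)] unfolding cap_pt_positive[OF c(2)] cap_pt_positive[OF c(3)] by blast
  moreover have "c = {v, u}" using c(1) by blast
  ultimately show "\<exists>u v. c = {u, v} \<and> positive (p1, p2) s u \<and> \<not> positive (p1, p2) s v" using c(1) by blast
 qed
 have "cap p1 p2 d = b"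
 proof (rule walled_eqI[OF cap_walled[OF dw] b])
  fix x y assume "{x, y} \<in> cap p1 p2 d"
  then consider "{x, y} = {(0, Suc p1), (0, Suc (Suc (p1 + p2)))}" | "{x, y} \<in> (`) (cap_pt p1) ` d"
   unfolding cap_def by blast
  thus "{x, y} \<in> b"
  proof cases
   case 2
   then obtain u v where "{x, y} = cap_pt p1 ` {u, v}" "{cap_pt p1 u, cap_pt p1 v} \<in> b"
    unfolding d_def by blast
   thus ?thesis by simp
  qed (use e in simp)
 qed
 thus thesis using that dw by blast
qed

lemma cap_not_full: "cap p1 p2 d \<notin> full (Suc p1, Suc p2) s"
 using cap_edge[of p1 p2 d] by (auto simp: full_def)

lemma cap_bent_iff:
 assumes d: "d \<in> WD (p1, p2) s"
 shows "cap p1 p2 d \<in> bent p1 (Suc p2) s \<longleftrightarrow> d \<in> full (p1, p2) s"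
proof
 assume b: "cap p1 p2 d \<in> bent p1 (Suc p2) s"
 have "{(0, i), (0, j)} \<notin> d" for i j
 proof
  assume "{(0, i), (0, j)} \<in> d"
  hence "{cap_pt p1 (0, i), cap_pt p1 (0, j)} \<in> cap p1 p2 d"
   using cap_edge_iff[OF d edge_in_points[OF d]] by blast
  moreover have "cap_pt p1 (0, k) = (0, if k \<le> p1 then k else Suc k)" for k by (simp add: cap_pt_def)
  ultimately have "{(0, if i \<le> p1 then i else Suc i), (0, if j \<le> p1 then j else Suc j)} \<in> cap p1 p2 d"
   by (simp only:)
  from bent_top[OF b this] show False by (auto split: if_splits)
 qed
 thus "d \<in> full (p1, p2) s" using d by (simp add: full_def)
next
 assume f: "d \<in> full (p1, p2) s"
 have "i = Suc p1 \<or> j = Suc p1" if e: "{(0, i), (0, j)} \<in> cap p1 p2 d" for i j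
 proof (cases "{(0, i), (0, j)} = {(0 :: nat, Suc p1), (0, Suc (Suc (p1 + p2)))}")
  case False
  hence "{(0, i), (0, j)} \<in> (`) (cap_pt p1) ` d" using e by (simp add: cap_def)
  then obtain a b where ab: "(0, i) = cap_pt p1 a" "(0, j) = cap_pt p1 b" "{a, b} \<in> d"
   by (rule image_edge[OF d])
  hence "fst a = 0" "fst b = 0" by (auto simp: cap_pt_def split: prod.splits)
  hence "a = (0, snd a)" "b = (0, snd b)" by (simp_all add: prod_eq_iff)
  thus ?thesis using full_top[OF f, of "snd a" "snd b"] ab(3) by simp
 qed (auto simp: doubleton_eq_iff)
 thus "cap p1 p2 d \<in> bent p1 (Suc p2) s" using cap_walled[OF d] by (simp add: bent_def)
qed

lemma cap_bent: "d \<in> full (p1, p2) s ==> cap p1 p2 d \<in> bent p1 (Suc p2) s"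
 using cap_bent_iff fullD by blast

lemma block_perms_cap: "g \<in> block_perms (p1, p2) ==> g \<in> block_perms (p1, Suc p2)"
 using perms_Suc by (auto simp: block_perms_eq)

lemma cap_dact:
 assumes d: "d \<in> WD (p1, p2) s" and g: "g \<in> block_perms (p1, p2)"
 shows "dact (Suc p1, Suc p2) g (cap p1 p2 d) = cap p1 p2 (dact (p1, p2) g d)"
proof -
 have fix_last: "block_perm (Suc p1, Suc p2) g (Suc (Suc (p1 + p2))) = Suc (Suc (p1 + p2))"
  using g by (auto simp: block_perms_def block_perm_def permutes_not_in)
 have pt: "top_act (Suc p1, Suc p2) g (cap_pt p1 v) = cap_pt p1 (top_act (p1, p2) g v)"
  if v: "v \<in> points (p1, p2) s" for v
  using v
 proof (cases rule: points_cases)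
  case (top i)
  thus ?thesis using block_perm_cases[OF g, of i]
   by (cases "i \<le> p1") (auto simp: top_act_def cap_pt_def block_perm_def)
 qed (simp add: top_act_def cap_pt_def)
 have "(`) (top_act (Suc p1, Suc p2) g) ` (`) (cap_pt p1) ` d = (`) (cap_pt p1) ` (`) (top_act (p1, p2) g) ` d"
  unfolding image_image by (intro image_cong refl) (use pt walledD(1)[OF d] in blast)
 thus ?thesis
  using block_perm_fixed[OF block_perms_cap[OF g]] fix_last
  by (simp add: cap_def dact_def top_act_def)
qed

lemma id_block: "g \<in> perms p2 ==> (id, g) \<in> block_perms (p1, p2)"
 by (simp add: block_perms_eq perms_closed(3))

text \<open>The new top point is joined to a top point right of the wall, since signs differ. A
  transposition moves that partner to the last place, where the strand is a cap.\<close>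

lemma bent_decompose:
 assumes b: "b \<in> bent p1 p2 s" "b \<notin> full (Suc p1, p2) s"
 obtains q g d where "p2 = Suc q" "g \<in> perms p2" "d \<in> full (p1, q) s" "b = dact (Suc p1, p2) (id, g) (cap p1 q d)"
proof -
 obtain j where j: "{(0, Suc p1), (0, j)} \<in> b" using bent_edge[OF b] .
 have "Suc p1 < j" "j \<le> Suc p1 + p2"
  using walled_pair[OF bentD[OF b(1)] j] by (auto simp: points_def positive_def left_of_wall_def)
 then obtain k where k: "j = Suc p1 + k" "1 \<le> k" "k \<le> p2"
  by (intro that[of "j - Suc p1"]) simp_all
 then obtain q where q: "p2 = Suc q" by (cases p2) auto
 let ?t = "Transposition.transpose k p2"
 have t: "?t \<in> perms p2" using k by (simp add: perms_def permutes_swap_id)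
 note it = id_block[OF t, of "Suc p1"]
 let ?b = "dact (Suc p1, p2) (id, ?t) b"
 have bb: "?b \<in> bent p1 p2 s" by (rule dact_bent[OF id_block[OF t] b(1)])
 have "{top_act (Suc p1, p2) (id, ?t) (0, Suc p1), top_act (Suc p1, p2) (id, ?t) (0, j)} \<in> ?b"
  unfolding dact_def by (rule image_pair[OF j])
 hence e: "{(0, Suc p1), (0, Suc (Suc (p1 + q)))} \<in> ?b"
  using k q by (simp add: top_act_def block_perm_def)
 obtain d where d: "d \<in> WD (p1, q) s" "?b = cap p1 q d"
  using cap_surj[of ?b p1 q s] bentD[OF bb] e q by blast
 have "d \<in> full (p1, q) s" using cap_bent_iff[OF d(1)] bb d(2) q by simp
 moreover have "b = dact (Suc p1, p2) (id, ?t) (cap p1 q d)"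
  unfolding d(2)[symmetric] dact_comp[OF it it bentD[OF b(1)]]
  by (simp add: dact_id[OF bentD[OF b(1)]])
 ultimately show thesis using that q t by blast
qed

text \<open>The quotient permutation carries one capped diagram to another, so it fixes the end of
  the cap and restricts to the first \<open>q\<close> points.\<close>

lemma cap_coset:
 assumes d: "d \<in> WD (p1, q) s" "d' \<in> WD (p1, q) s"
  and gh: "g \<in> perms (Suc q)" "h \<in> perms (Suc q)"
  and eq: "dact (Suc p1, Suc q) (id, g) (cap p1 q d) = dact (Suc p1, Suc q) (id, h) (cap p1 q d')"
 shows "inv' h \<circ> g \<in> perms q" "d' = dact (p1, q) (id, inv' h \<circ> g) d"
proof -
 let ?m = "inv' h \<circ> g"
 have m: "?m \<in> perms (Suc q)" using gh by (simp add: perms_closed)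
 note c = cap_walled[OF d(1)] cap_walled[OF d(2)]
 note i = id_block[OF gh(1), of "Suc p1"] id_block[OF gh(2), of "Suc p1"]
 have "dact (Suc p1, Suc q) (inv' id, inv' h) (dact (Suc p1, Suc q) (id, g) (cap p1 q d)) = cap p1 q d'"
  unfolding eq using dact_inv(1)[OF i(2) c(2)] by simp
 hence mc: "dact (Suc p1, Suc q) (id, ?m) (cap p1 q d) = cap p1 q d'"
  using dact_comp[OF id_block[OF perms_closed(2)[OF gh(2)]] i(1) c(1)] by simp
 from image_pair[OF cap_edge[of p1 q d], of "top_act (Suc p1, Suc q) (id, ?m)"]
 have "{(0, Suc p1), (0, Suc p1 + ?m (Suc q))} \<in> cap p1 q d'"
  unfolding mc[symmetric] by (simp add: dact_def top_act_def block_perm_def)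
 from walled_partner[OF c(2) this cap_edge] have f: "?m (Suc q) = Suc q" by simp
 have "?m permutes {1..q}"
 proof (rule permutes_superset)
  show "?m permutes {1..Suc q}" using m by (simp add: perms_def)
  fix x assume "x \<in> {1..Suc q} - {1..q}"
  hence "x = Suc q" by auto
  thus "?m x = x" using f by (simp only:)
 qed
 thus mq: "?m \<in> perms q" by (simp add: perms_def)
 show "d' = dact (p1, q) (id, ?m) d"
  using mc cap_dact[OF d(1) id_block[OF mq]] cap_inj[OF dact_walled[OF id_block[OF mq] d(1)] d(2)] by simp
qed

text \<open>If a product with first factor \<open>x\<close> is capped, then either \<open>x\<close>
  is full, where \<open>f\<close> vanishes, or \<open>x\<close> already has a strand joining the new
  point to a top point. That strand persists in the product, so it is the cap itself.\<close>

lemma dmul_cap: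
 assumes f: "\<And>x. x \<in> full (Suc p1, Suc q) r ==> f x = 0" and z: "z \<in> full (p1, q) r"
 shows "dmul dl (bent p1 (Suc q) r) r a f (cap p1 q z) = dmul dl (full (p1, q) r) r a (\<lambda>x. f (cap p1 q x)) z"
proof -
 let ?B = "bent p1 (Suc q) r" and ?F = "full (p1, q) r" and ?W = "WD r r"
 let ?t = "\<lambda>x y. if diagram_comp x y = cap p1 q z then dl ^ loops x y * (f x * a y) else 0"
 have inj: "inj_on (cap p1 q) ?F" by (rule inj_onI) (rule cap_inj[OF fullD fullD])
 have sub: "cap p1 q ` ?F \<subseteq> ?B" using cap_bent by blast
 have "(\<Sum>x\<in>?B. \<Sum>y\<in>?W. ?t x y) = (\<Sum>x\<in>cap p1 q ` ?F. \<Sum>y\<in>?W. ?t x y)"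
 proof (rule sum.mono_neutral_right[OF upclosedD(3)[OF upclosed_bent] sub], intro ballI sum.neutral)
  fix x y assume x: "x \<in> ?B - cap p1 q ` ?F" and y: "y \<in> ?W"
  hence xB: "x \<in> ?B" by blast
  show "?t x y = 0"
  proof (cases "x \<in> full (Suc p1, Suc q) r")
   case False
   then obtain j where j: "{(0, Suc p1), (0, j)} \<in> x" using bent_edge[OF xB] by blast
   have "diagram_comp x y \<noteq> cap p1 q z"
   proof
    assume "diagram_comp x y = cap p1 q z"
    with top_edge_persists[OF bentD[OF xB] y j] have "{(0, Suc p1), (0, j)} \<in> cap p1 q z" by simp
    from walled_partner[OF cap_walled[OF fullD[OF z]] this cap_edge]
    have "{(0, Suc p1), (0, Suc (Suc (p1 + q)))} \<in> x" using j by simp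
    then obtain d where d: "d \<in> WD (p1, q) r" "x = cap p1 q d"
     by (rule cap_surj[OF bentD[OF xB]])
    thus False using x cap_bent_iff[OF d(1)] by blast
   qed
   thus ?thesis by simp
  qed (simp add: f)
 qed
 also have "... = (\<Sum>x\<in>?F. \<Sum>y\<in>?W. ?t (cap p1 q x) y)" by (simp add: sum.reindex[OF inj])
 also have "... = (\<Sum>x\<in>?F. \<Sum>y\<in>?W. if diagram_comp x y = z then dl ^ loops x y * (f (cap p1 q x) * a y) else 0)"
 proof (intro sum.cong refl)
  fix x y assume x: "x \<in> ?F" and y: "y \<in> ?W"
  have "cap p1 q (diagram_comp x y) = cap p1 q z \<longleftrightarrow> diagram_comp x y = z"
   using cap_inj[OF diagram_comp_walled(1)[OF fullD[OF x] y] fullD[OF z]] by blast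
  thus "?t (cap p1 q x) y = (if diagram_comp x y = z then dl ^ loops x y * (f (cap p1 q x) * a y) else 0)"
   by (simp add: cap_comp(1)[OF fullD[OF x] y] cap_comp(2)[OF fullD[OF x] y, symmetric])
 qed
 finally show ?thesis using z cap_bent[OF z] by (simp add: dmul_def)
qed

section \<open>Transport of the action along bending\<close>

lemma dmul_bend:
 fixes p1 p2 r1 r2 :: nat
 defines "u \<equiv> inv_into (full (p1, p2) (r1, r2 + 1)) (bend p1 (r1 + r2))"
 assumes z: "z \<in> full (p1, p2) (r1, r2 + 1)"
 shows "dmul dl (full (p1, p2) (r1, r2 + 1)) (r1, r2 + 1) (walled_brauer_incl (r1, r2) a) f z =
  dmul dl (bent p1 p2 (r1, r2)) (r1, r2) a (\<lambda>b. f (u b)) (bend p1 (r1 + r2) z)"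
proof -
 let ?n = "r1 + r2"
 let ?F = "full (p1, p2) (r1, r2 + 1)" and ?B = "bent p1 p2 (r1, r2)" and ?W = "WD (r1, r2) (r1, r2)"
 let ?W' = "WD (r1, r2 + 1) (r1, r2 + 1)"
 let ?a = "add_strand (r1, r2)"
 note bij = bij_bend[of p1 r1 r2 p2]
 have u: "u (bend p1 ?n x) = x" if "x \<in> ?F" for x
  using bij_betw_imp_inj_on[OF bij] that unfolding u_def by simp
 let ?T = "\<lambda>x y. if diagram_comp x (?a y) = z then dl ^ loops x (?a y) * (f x * a y) else 0"
 have "dmul dl ?B (r1, r2) a (\<lambda>b. f (u b)) (bend p1 ?n z) =
   (\<Sum>b\<in>?B. \<Sum>y\<in>?W. if diagram_comp b y = bend p1 ?n z then dl ^ loops b y * (f (u b) * a y) else 0)"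
  using bij_betw_apply[OF bij z] by (simp add: dmul_def)
 also have "... = (\<Sum>x\<in>?F. \<Sum>y\<in>?W. if diagram_comp (bend p1 ?n x) y = bend p1 ?n z
   then dl ^ loops (bend p1 ?n x) y * (f (u (bend p1 ?n x)) * a y) else 0)"
  by (rule sum.reindex_bij_betw[OF bij, symmetric])
 also have "... = (\<Sum>x\<in>?F. \<Sum>y\<in>?W. ?T x y)"
 proof (intro sum.cong refl)
  fix x y assume x: "x \<in> ?F" and y: "y \<in> ?W"
  note c = bend_comp[OF fullD[OF x] y]
  have a: "?a y \<in> ?W'" by (rule add_strand_walled[OF y refl])
  have "bend p1 ?n (diagram_comp x (?a y)) = bend p1 ?n z \<longleftrightarrow> diagram_comp x (?a y) = z"
   using inj_onD[OF bij_betw_imp_inj_on[OF bij_bend_walled]] diagram_comp_walled(1)[OF fullD[OF x] a]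
    fullD[OF z] by blast
  thus "(if diagram_comp (bend p1 ?n x) y = bend p1 ?n z
    then dl ^ loops (bend p1 ?n x) y * (f (u (bend p1 ?n x)) * a y) else 0) = ?T x y"
   unfolding c(1) u[OF x] c(2) by (simp only:)
 qed
 also have "... = dmul dl ?F (r1, r2 + 1) (walled_brauer_incl (r1, r2) a) f z"
  unfolding dmul_def if_P[OF z]
 proof (rule sum.cong[OF refl])
  fix x assume x: "x \<in> ?F"
  let ?h = "\<lambda>y Y. if diagram_comp x Y = z then dl ^ loops x Y * (f x * a y) else 0"
  have "(\<Sum>Y\<in>?W'. if diagram_comp x Y = z then dl ^ loops x Y * (f x * walled_brauer_incl (r1, r2) a Y) else 0) =
    (\<Sum>Y\<in>?W'. \<Sum>y\<in>?W. if ?a y = Y then ?h y Y else 0)"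
  proof (rule sum.cong[OF refl])
   fix Y
   show "(if diagram_comp x Y = z then dl ^ loops x Y * (f x * walled_brauer_incl (r1, r2) a Y) else 0) =
     (\<Sum>y\<in>?W. if ?a y = Y then ?h y Y else 0)"
   proof (cases "diagram_comp x Y = z")
    case True
    show ?thesis unfolding if_P[OF True] walled_brauer_incl_def linear_extension_def sum_distrib_left
     by (intro sum.cong refl) simp
   next
    case False
    show ?thesis unfolding if_not_P[OF False] by simp
   qed
  qed
  also have "... = (\<Sum>y\<in>?W. \<Sum>Y\<in>?W'. if ?a y = Y then ?h y Y else 0)" by (rule sum.swap)
  also have "... = (\<Sum>y\<in>?W. ?T x y)"
  proof (rule sum.cong[OF refl])
   fix y assume "y \<in> ?W"
   hence "?a y \<in> ?W'" by (rule add_strand_walled[OF _ refl])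
   thus "(\<Sum>Y\<in>?W'. if ?a y = Y then ?h y Y else 0) = ?T x y"
    by (intro sum_indicator_mult) simp_all
  qed
  finally show "(\<Sum>y\<in>?W. ?T x y) = (\<Sum>Y\<in>?W'. if diagram_comp x Y = z
    then dl ^ loops x Y * (f x * walled_brauer_incl (r1, r2) a Y) else 0)" by (rule sym)
 qed
 finally show ?thesis by (rule sym)
qed

text \<open>Only permutations of the old top points act: the new point is kept fixed, although the
  diagrams have \<open>Suc (sum_list lam1)\<close> top points on the left.\<close>

abbreviation bent_space ::
 "nat \<times> nat => nat list => nat list => (diagram \<times> tab2 => 'k::field_char_0) set"
 where "bent_space r lam1 lam2 \<equiv> diag_space (bent (sum_list lam1) (sum_list lam2) r)
  (Suc (sum_list lam1), sum_list lam2) (block_perms (sum_list lam1, sum_list lam2)) lam1 lam2"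

text \<open>Bending matches the diagrams bijectively, commutes with permutations of the old top
  points, and absorbs the strand added by the inclusion of algebras.\<close>

lemma bending_iso:
 fixes dl :: "'k::field_char_0" and lam1 lam2 :: "nat list" and r1 r2 :: nat
 defines "p1 \<equiv> sum_list lam1" and "p2 \<equiv> sum_list lam2"
 shows "\<exists>be. bij_betw be (infl_space (p1, p2) (r1, r2 + 1) lam1 lam2) (bent_space (r1, r2) lam1 lam2) \<and>
  (\<forall>F G. be (F + G) = be F + be G) \<and>
  (\<forall>a F. be (diag_act dl (full (p1, p2) (r1, r2 + 1)) (r1, r2 + 1) (walled_brauer_incl (r1, r2) a) F) =
   diag_act dl (bent p1 p2 (r1, r2)) (r1, r2) a (be F))"
proof -
 let ?b = "bend p1 (r1 + r2)"
 let ?F = "full (p1, p2) (r1, r2 + 1)" and ?B = "bent p1 p2 (r1, r2)"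
 let ?I = "infl_space (p1, p2) (r1, r2 + 1) lam1 lam2 :: (_ => 'k) set"
 let ?J = "bent_space (r1, r2) lam1 lam2 :: (_ => 'k) set"
 define u where "u = inv_into ?F ?b"
 note bij = bij_bend[of p1 r1 r2 p2]
 have u: "u (?b x) = x" if "x \<in> ?F" for x
  using bij_betw_imp_inj_on[OF bij] that unfolding u_def by simp
 have B: "\<exists>x\<in>?F. z = ?b x" if "z \<in> ?B" for z using that bij_betw_imp_surj_on[OF bij] by blast
 define be where "be F = (\<lambda>(z, T). if z \<in> ?B then F (u z, T) else 0)"
  for F :: "diagram \<times> tab2 => 'k"
 have beta: "be F (?b x, T) = F (x, T)" if "x \<in> ?F" for F x T
  using that bij_betw_apply[OF bij that] by (simp add: be_def u)
 have beta0: "be F (z, T) = 0" if "z \<notin> ?B" for F z T using that by (simp add: be_def)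
 have closed: "be F \<in> ?J" if F: "F \<in> ?I" for F
  unfolding diag_space_def mem_Collect_eq
 proof (intro conjI allI impI ballI, unfold p1_def[symmetric] p2_def[symmetric])
  show "be F (z, T) = 0" if "z \<notin> ?B" for z T by (rule beta0[OF that])
  show "(\<lambda>T. be F (z, T)) \<in> specht_space2 lam1 lam2" for z
   using diag_spaceD(2)[OF F, of "u z"] by (cases "z \<in> ?B") (simp_all add: be_def specht_space2_zero)
  show "be F (dact (Suc p1, p2) g z, act2 g T) = be F (z, T)"
   if g: "g \<in> block_perms (p1, p2)" and z: "z \<in> ?B" for g z T
  proof -
   obtain x where x: "x \<in> ?F" "z = ?b x" using B[OF z] by blast
   show ?thesis
    unfolding x(2) bend_dact[OF fullD[OF x(1)] g, symmetric] beta[OF x(1)] beta[OF dact_full[OF g x(1)]]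
    by (rule diag_spaceD(3)[OF F g x(1)])
  qed
 qed
 have "bij_betw be ?I ?J"
  unfolding bij_betw_def
 proof
  show "inj_on be ?I"
  proof (rule inj_onI)
   fix F G assume F: "F \<in> ?I" and G: "G \<in> ?I" and eq: "be F = be G"
   have "F (x, T) = G (x, T)" for x T
    using beta[of x F T] beta[of x G T] eq diag_spaceD(1)[OF F, of x T] diag_spaceD(1)[OF G, of x T]
    by (cases "x \<in> ?F") simp_all
   thus "F = G" by (intro ext) auto
  qed
  show "be ` ?I = ?J"
  proof (intro subset_antisym subsetI)
   fix G assume G: "G \<in> ?J"
   note G' = diag_spaceD[OF G, folded p1_def p2_def]
   define F where "F = (\<lambda>(x, T). if x \<in> ?F then G (?b x, T) else 0)"
   have "F \<in> ?I"
    unfolding diag_space_def mem_Collect_eq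
   proof (intro conjI allI impI ballI)
    show "F (x, T) = 0" if "x \<notin> ?F" for x T using that by (simp add: F_def)
    show "(\<lambda>T. F (x, T)) \<in> specht_space2 lam1 lam2" for x
     using G'(2)[of "?b x"] by (cases "x \<in> ?F") (simp_all add: F_def specht_space2_zero)
    show "F (dact (p1, p2) g x, act2 g T) = F (x, T)"
     if g: "g \<in> block_perms (p1, p2)" and x: "x \<in> ?F" for g x T
     using dact_full[OF g x] x G'(3)[OF g bij_betw_apply[OF bij x]]
     by (simp add: F_def bend_dact[OF fullD[OF x] g])
   qed
   moreover have "be F (z, T) = G (z, T)" for z T
   proof (cases "z \<in> ?B")
    case True
    then obtain x where x: "x \<in> ?F" "z = ?b x" using B by blast
    thus ?thesis unfolding x(2) beta[OF x(1)] by (simp add: F_def)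
   qed (simp add: beta0 G'(1))
   hence "be F = G" by (intro ext) auto
   ultimately show "G \<in> be ` ?I" by blast
  qed (use closed in blast)
 qed
 moreover have "be (F + G) = be F + be G" for F G by (auto simp: be_def fun_eq_iff)
 moreover have "be (diag_act dl ?F (r1, r2 + 1) (walled_brauer_incl (r1, r2) a) F) = diag_act dl ?B (r1, r2) a (be F)"
  for a F
 proof -
  have "be (diag_act dl ?F (r1, r2 + 1) (walled_brauer_incl (r1, r2) a) F) (z, T) = diag_act dl ?B (r1, r2) a (be F) (z, T)"
   for z T
  proof (cases "z \<in> ?B")
   case True
   then obtain x where x: "x \<in> ?F" "z = ?b x" using B by blast
   show ?thesis
    unfolding x(2) beta[OF x(1)] diag_act_dmul dmul_bend[OF x(1), folded u_def]
    by (rule dmul_cong) (simp add: be_def)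
  qed (simp add: beta0 diag_act_dmul dmul_def)
  thus ?thesis by (intro ext) auto
 qed
 ultimately show ?thesis by blast
qed

section \<open>The summands with a cell added\<close>

lemma specht_space_of_rat:
 assumes "\<And>S. (\<Sum>S'\<in>tabs lam. spk lam S S' * h S') = h S"
 shows "(\<lambda>S. of_rat (h S)) \<in> specht_space lam"
 unfolding specht_space_iff using assms by (simp add: of_rat_mult[symmetric] of_rat_sum[symmetric])

lemma up_setD:
 assumes "mu \<in> up_set lam"
 shows "is_partition mu" "sum_list mu = Suc (sum_list lam)"
 using assms adds_cell_sum_list by (auto simp: up_set_def)

lemma down_setD:
 assumes "nu \<in> down_set lam"
 shows "is_partition nu" "sum_list lam = Suc (sum_list nu)"
 using assms adds_cell_sum_list by (auto simp: down_set_def)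

lemma act2_pair [simp]: "act2 (g, h) (S, T) = (tab_act g S, tab_act h T)"
 by (simp add: act2_def)

lemma id_block_left: "g \<in> perms p1 ==> (g, id) \<in> block_perms (p1, p2)"
 by (simp add: block_perms_eq perms_closed(3))

lemma perms_zero: "id \<in> perms n" by (rule perms_closed(3))

lemma bij_ind_index:
 assumes h: "h \<in> perms (Suc (sum_list lam))"
 shows "bij_betw (\<lambda>y. (fst y \<circ> h, snd y)) (ind_index lam) (ind_index lam)"
 by (rule bij_betw_byWitness[where f' = "\<lambda>y. (fst y \<circ> inv' h, snd y)"])
  (use h in \<open>auto simp: ind_index_def perms_closed comp_assoc perms_inv\<close>)

text \<open>For a full \<open>b\<close>, sending \<open>(g, S)\<close> to the value of
  \<open>F\<close> at \<open>g b\<close> and \<open>(S, T2)\<close> gives an element of the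
  representation induced from the Specht module of \<open>lam1\<close>, because \<open>F\<close> is
  equivariant under permutations fixing the new point. Pairing it with \<open>ind_brk\<close>
  extracts the component at \<open>mu\<close>.\<close>

definition ind_part where
 "ind_part r lam1 lam2 mu F = (\<lambda>(b, T). if b \<in> full (Suc (sum_list lam1), sum_list lam2) r
  then \<Sum>y\<in>ind_index lam1. of_rat (ind_brk lam1 mu (fst T) y) *
   F (dact (Suc (sum_list lam1), sum_list lam2) (fst y, id) b, (snd y, snd T)) else (0 :: 'k::field_char_0))"

text \<open>The reconstruction formula of \<open>frame_expand\<close> at the identity permutation,
  where \<open>ind_brk\<close> reduces to \<open>brk\<close>; by \<open>ind_back_dact\<close> the
  other permutations follow. The function is extended by zero off the full diagrams.\<close>

definition ind_back where
 "ind_back r lam1 lam2 G = (\<lambda>(b, T). if b \<in> full (Suc (sum_list lam1), sum_list lam2) r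
  then \<Sum>mu\<in>up_set lam1. \<Sum>T1\<in>tabs mu. of_rat (brk lam1 mu (fst T) T1 / ind_const lam1 mu) *
   G mu (b, (T1, snd T)) else (0 :: 'k::field_char_0))"

context
 fixes dl :: "'k::field_char_0" and r :: "nat \<times> nat" and lam1 lam2 :: "nat list" and n1 n2 P Q
  and U :: "(diagram \<times> tab2 => 'k) set"
 defines n1: "n1 \<equiv> sum_list lam1" and n2: "n2 \<equiv> sum_list lam2"
  and P: "P \<equiv> (n1, n2)" and Q: "Q \<equiv> (Suc n1, n2)" and U: "U \<equiv> bent_space r lam1 lam2"
begin

lemma ind_full: "y \<in> ind_index lam1 ==> b \<in> full Q r ==> dact Q (fst y, id) b \<in> full Q r"
 "y \<in> ind_index lam1 ==> (fst y, id) \<in> block_perms Q"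
 unfolding Q by (auto simp: ind_index_def n1 id_block_left intro!: dact_full)

lemma full_in_bent: "b \<in> full Q r ==> b \<in> bent n1 n2 r"
 unfolding Q by (rule subsetD[OF full_bent])

lemma left_full: "g \<in> perms (Suc n1) ==> b \<in> full Q r ==> dact Q (g, id) b \<in> full Q r"
 unfolding Q by (rule dact_full[OF id_block_left])

lemma bent_spaceD:
 assumes "F \<in> U"
 shows "z \<notin> bent n1 n2 r ==> F (z, T) = 0"
  "(\<lambda>T1. F (z, (T1, T2))) \<in> specht_space lam1" "(\<lambda>T2. F (z, (T1, T2))) \<in> specht_space lam2"
  "g \<in> perms n1 ==> h \<in> perms n2 ==> z \<in> bent n1 n2 r ==>
   F (dact Q (g, h) z, (tab_act g T1, tab_act h T2)) = F (z, (T1, T2))"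
 using diag_spaceD(1,2)[OF assms[unfolded U]] diag_spaceD(3)[OF assms[unfolded U], of "(g, h)" z "(T1, T2)"]
 by (auto simp: n1 n2 Q specht_space2_def block_perms_eq)

lemma infl_spaceD:
 assumes "G \<in> infl_space q r mu1 mu2"
 shows "z \<notin> full q r ==> G (z, T) = 0"
  "(\<lambda>T1. G (z, (T1, T2))) \<in> specht_space mu1" "(\<lambda>T2. G (z, (T1, T2))) \<in> specht_space mu2"
  "g \<in> perms (fst q) ==> h \<in> perms (snd q) ==> z \<in> full q r ==>
   G (dact q (g, h) z, (tab_act g T1, tab_act h T2)) = G (z, (T1, T2))"
 using diag_spaceD(1,2)[OF assms] diag_spaceD(3)[OF assms, of "(g, h)" z "(T1, T2)"]
 by (auto simp: specht_space2_def block_perms_eq)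

lemma ind_part_eq: "b \<in> full Q r ==> ind_part r lam1 lam2 mu F (b, (T1, T2)) =
  (\<Sum>y\<in>ind_index lam1. of_rat (ind_brk lam1 mu T1 y) * F (dact Q (fst y, id) b, (snd y, T2)))"
 by (simp add: ind_part_def Q n1 n2)

lemma ind_part_zero: "b \<notin> full Q r ==> ind_part r lam1 lam2 mu F (b, T) = (0 :: 'k)"
 by (simp add: ind_part_def Q n1 n2)

lemma ind_part_closed:
 assumes F: "F \<in> U" and mu: "mu \<in> up_set lam1"
 shows "ind_part r lam1 lam2 mu F \<in> infl_space Q r mu lam2"
 unfolding diag_space_def mem_Collect_eq
proof (intro conjI allI impI ballI)
 note mu' = up_setD[OF mu]
 let ?G = "ind_part r lam1 lam2 mu F"
 show "?G (b, T) = 0" if "b \<notin> full Q r" for b T by (rule ind_part_zero[OF that])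
 show "(\<lambda>T. ?G (b, T)) \<in> specht_space2 mu lam2" for b
 proof (cases "b \<in> full Q r")
  case True
  have 1: "(\<lambda>T. of_rat (ind_brk lam1 mu T y) :: 'k) \<in> specht_space mu" for y
   by (rule specht_space_of_rat) (rule ind_brk_left[OF mu'])
  show ?thesis
   using specht_space_sum[of "ind_index lam1" "\<lambda>y T. of_rat (ind_brk lam1 mu T y)" mu
     "\<lambda>y. F (dact Q (fst y, id) b, (snd y, _))", OF 1]
    specht_space_sum[of "ind_index lam1" "\<lambda>y T2. F (dact Q (fst y, id) b, (snd y, T2))" lam2
     "\<lambda>y. of_rat (ind_brk lam1 mu _ y)", OF bent_spaceD(3)[OF F]]
   by (simp add: specht_space2_def ind_part_eq[OF True] mult.commute)
 qed (simp add: ind_part_zero specht_space2_zero)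
 show "?G (dact Q h b, act2 h T) = ?G (b, T)" if h: "h \<in> block_perms Q" and b: "b \<in> full Q r" for h b T
 proof -
  obtain h1 h2 where hh: "h = (h1, h2)" "h1 \<in> perms (Suc n1)" "h2 \<in> perms n2"
   using h by (cases h) (auto simp: block_perms_eq Q)
  obtain T1 T2 where T: "T = (T1, T2)" by (cases T)
  have "?G (dact Q h b, act2 h T) =
    (\<Sum>y\<in>ind_index lam1. of_rat (ind_brk lam1 mu T1 (fst y \<circ> h1, snd y)) * F (dact Q (fst y \<circ> h1, id) b, (snd y, T2)))"
   unfolding hh(1) T act2_pair ind_part_eq[OF dact_full[OF h[unfolded hh(1)] b]]
  proof (rule sum.cong[OF refl])
   fix y assume y: "y \<in> ind_index lam1"
   obtain g S where gS: "y = (g, S)" "g \<in> perms (Suc n1)" using y by (cases y) (auto simp: ind_index_def n1)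
   have gh: "g \<circ> h1 \<in> perms (Suc n1)" using gS hh by (simp add: perms_closed)
   note bw = fullD[OF b]
   have gb: "dact Q (g \<circ> h1, id) b \<in> bent n1 n2 r"
    by (rule full_in_bent[OF left_full[OF gh b]])
   have "dact Q (g, id) (dact Q (h1, h2) b) = dact Q (g \<circ> h1, h2) b"
    using dact_comp[OF _ _ bw, of "(g, id)" "(h1, h2)"] gS hh by (simp add: Q block_perms_eq perms_zero)
   also have "... = dact Q (id, h2) (dact Q (g \<circ> h1, id) b)"
    using dact_comp[OF _ _ bw, of "(id, h2)" "(g \<circ> h1, id)"] gh hh by (simp add: Q block_perms_eq perms_zero)
   finally have "F (dact Q (g, id) (dact Q (h1, h2) b), (S, tab_act h2 T2)) = F (dact Q (g \<circ> h1, id) b, (S, T2))"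
    using bent_spaceD(4)[OF F perms_zero hh(3) gb, of S T2] by simp
   moreover have "ind_brk lam1 mu (tab_act h1 T1) (g, S) = ind_brk lam1 mu T1 (g \<circ> h1, S)"
    using gS(2) gh by (simp add: ind_brk_def n1 tab_act_comp)
   ultimately show "of_rat (ind_brk lam1 mu (tab_act h1 T1) y) * F (dact Q (fst y, id) (dact Q (h1, h2) b), (snd y, tab_act h2 T2)) =
    of_rat (ind_brk lam1 mu T1 (fst y \<circ> h1, snd y)) * F (dact Q (fst y \<circ> h1, id) b, (snd y, T2))"
    by (simp add: gS(1))
  qed
  also have "... = ?G (b, T)"
   unfolding T ind_part_eq[OF b]
   using sum.reindex_bij_betw[OF bij_ind_index[OF hh(2)[unfolded n1]],
     of "\<lambda>y. of_rat (ind_brk lam1 mu T1 y) * F (dact Q (fst y, id) b, (snd y, T2))"] by simp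
  finally show ?thesis .
 qed
qed

text \<open>Restriction to full diagrams commutes with the action by \<open>dmul_restrict\<close>,
  and on full diagrams the larger group of relabellings commutes with it as well.\<close>

lemma ind_part_act:
 "ind_part r lam1 lam2 mu (diag_act dl (bent n1 n2 r) r a F) = diag_act dl (full Q r) r a (ind_part r lam1 lam2 mu F)"
proof -
 have "ind_part r lam1 lam2 mu (diag_act dl (bent n1 n2 r) r a F) (b, (T1, T2)) =
  diag_act dl (full Q r) r a (ind_part r lam1 lam2 mu F) (b, (T1, T2))" for b T1 T2
 proof (cases "b \<in> full Q r")
  case b: True
  have "ind_part r lam1 lam2 mu (diag_act dl (bent n1 n2 r) r a F) (b, (T1, T2)) =
   (\<Sum>y\<in>ind_index lam1. of_rat (ind_brk lam1 mu T1 y) *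
    dmul dl (full Q r) r a (\<lambda>x. F (dact Q (fst y, id) x, (snd y, T2))) b)"
   unfolding ind_part_eq[OF b] diag_act_dmul
  proof (intro sum.cong refl arg_cong2[of _ _ _ _ "(*)"])
   fix y assume y: "y \<in> ind_index lam1"
   show "dmul dl (bent n1 n2 r) r a (\<lambda>x. F (x, (snd y, T2))) (dact Q (fst y, id) b) =
    dmul dl (full Q r) r a (\<lambda>x. F (dact Q (fst y, id) x, (snd y, T2))) b"
    unfolding dmul_restrict[OF upclosed_bent[of n1 n2 r, folded Q] upclosed_full full_bent[of n1 n2 r, folded Q] ind_full(1)[OF y b]]
    by (rule dmul_dact[OF _ bij_dact[OF ind_full(2)[OF y]] ind_full(2)[OF y] b]) (use fullD in blast)
  qed
  also have "... = dmul dl (full Q r) r a (\<lambda>x. ind_part r lam1 lam2 mu F (x, (T1, T2))) b"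
   unfolding dmul_sum[symmetric] by (rule dmul_cong) (simp add: ind_part_eq)
  finally show ?thesis by (simp only: diag_act_dmul)
 qed (simp add: ind_part_zero diag_act_dmul dmul_def)
 thus ?thesis by (intro ext) auto
qed

text \<open>The values at the relabellings of \<open>b\<close> form an element of the induced
  representation, which \<open>frame_expand\<close> recovers from its components. Nothing is claimed
  about diagrams that are not full: the common kernel is \<open>cap_space\<close>.\<close>

lemma ind_part_injective:
 assumes part: "is_partition lam1" and F: "F \<in> U"
  and z: "\<And>mu. mu \<in> up_set lam1 ==> ind_part r lam1 lam2 mu F = 0" and b: "b \<in> full Q r"
 shows "F (b, T) = 0"
proof -
 obtain S T2 where T: "T = (S, T2)" by (cases T)
 show ?thesis
 proof (cases "S \<in> tabs lam1")
  case True
  define f where "f y = F (dact Q (fst y, id) b, (snd y, T2))" for y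
  have y: "(id, S) \<in> ind_index lam1" using True by (simp add: ind_index_def perms_zero)
  have "f (id, S) = (\<Sum>mu\<in>up_set lam1. \<Sum>T1\<in>tabs mu. of_rat (ind_brk lam1 mu T1 (id, S) / ind_const lam1 mu) *
    (\<Sum>y\<in>ind_index lam1. of_rat (ind_brk lam1 mu T1 y) * f y))"
  proof (rule frame_expand[where P = "ind_kernel lam1"])
   show "ind_kernel lam1 (id, S) z = (\<Sum>mu\<in>up_set lam1. \<Sum>T\<in>tabs mu.
     ind_brk lam1 mu T (id, S) * ind_brk lam1 mu T z / ind_const lam1 mu)"
    if "z \<in> ind_index lam1" for z
    by (rule ind_bessel(2)[OF part ind_dims[OF part] y that])
   show "(\<Sum>z\<in>ind_index lam1. of_rat (ind_kernel lam1 (id, S) z) * f z) = f (id, S)"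
   proof (rule ind_kernel_fixed[OF y])
    show "kapply (tabs lam1) (spk lam1) (\<lambda>S. f (g, S)) = (\<lambda>S. f (g, S))" for g
     using bent_spaceD(2)[OF F] by (simp add: f_def specht_space_def)
    show "f (s \<circ> g, tab_act s S) = f (g, S)"
     if s: "s \<in> perms (sum_list lam1)" and g: "g \<in> perms (Suc (sum_list lam1))" for s g S
    proof -
     have gb: "dact Q (g, id) b \<in> bent n1 n2 r"
      by (rule full_in_bent[OF left_full[OF g[folded n1] b]])
     have "dact Q (s, id) (dact Q (g, id) b) = dact Q (s \<circ> g, id) b"
      using dact_comp[OF _ _ fullD[OF b], of "(s, id)" "(g, id)"] g perms_Suc[OF s]
      by (simp add: Q n1 id_block_left)
     thus ?thesis
      using bent_spaceD(4)[OF F s[folded n1] perms_zero gb, of S T2] by (simp add: f_def)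
    qed
   qed
  qed
  also have "... = 0"
  proof (intro sum.neutral ballI)
   fix mu T1 assume "mu \<in> up_set lam1"
   from fun_cong[OF z[OF this], of "(b, (T1, T2))"]
   have "(\<Sum>y\<in>ind_index lam1. of_rat (ind_brk lam1 mu T1 y) * f y) = 0"
    by (simp add: ind_part_eq[OF b] f_def)
   thus "of_rat (ind_brk lam1 mu T1 (id, S) / ind_const lam1 mu) *
    (\<Sum>y\<in>ind_index lam1. of_rat (ind_brk lam1 mu T1 y) * f y) = 0" by simp
  qed
  finally show ?thesis using dact_id[OF fullD[OF b]] by (simp add: f_def T)
 qed (simp add: T specht_space_support[OF bent_spaceD(2)[OF F]])
qed

lemma ind_back_eq: "b \<in> full Q r ==> ind_back r lam1 lam2 G (b, (S, T2)) =
  (\<Sum>mu\<in>up_set lam1. \<Sum>T1\<in>tabs mu. of_rat (brk lam1 mu S T1 / ind_const lam1 mu) * G mu (b, (T1, T2)))"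
 by (simp add: ind_back_def Q n1 n2)

lemma ind_back_zero: "b \<notin> full Q r ==> ind_back r lam1 lam2 G (b, T) = (0 :: 'k)"
 by (simp add: ind_back_def Q n1 n2)

context
 fixes G :: "nat list => diagram \<times> tab2 => 'k"
 assumes part: "is_partition lam1" and G: "\<And>mu. mu \<in> up_set lam1 ==> G mu \<in> infl_space Q r mu lam2"
begin

lemma ind_back_dact:
 assumes b: "b \<in> full Q r" and g: "g \<in> perms (Suc n1)" and h: "h \<in> perms n2"
 shows "ind_back r lam1 lam2 G (dact Q (g, h) b, (S, tab_act h T2)) =
  (\<Sum>mu\<in>up_set lam1. \<Sum>T1\<in>tabs mu. of_rat (brk lam1 mu S (tab_act g T1) / ind_const lam1 mu) * G mu (b, (T1, T2)))"
proof -
 have gh: "(g, h) \<in> block_perms Q" using g h by (simp add: Q block_perms_eq)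
 show ?thesis unfolding ind_back_eq[OF dact_full[OF gh b]]
 proof (rule sum.cong[OF refl])
  fix mu assume mu: "mu \<in> up_set lam1"
  have "g permutes {1..sum_list mu}" using g up_setD(2)[OF mu] by (simp add: perms_def n1)
  note s = sum_tabs_act[OF this, of "\<lambda>T1. of_rat (brk lam1 mu S T1 / ind_const lam1 mu) *
   G mu (dact Q (g, h) b, (T1, tab_act h T2))", symmetric]
  show "(\<Sum>T1\<in>tabs mu. of_rat (brk lam1 mu S T1 / ind_const lam1 mu) * G mu (dact Q (g, h) b, (T1, tab_act h T2))) =
   (\<Sum>T1\<in>tabs mu. of_rat (brk lam1 mu S (tab_act g T1) / ind_const lam1 mu) * G mu (b, (T1, T2)))"
   unfolding s using infl_spaceD(4)[OF G[OF mu] _ _ b, of g h] g h by (simp add: Q)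
 qed
qed

lemma ind_back_closed: "ind_back r lam1 lam2 G \<in> U"
 unfolding U diag_space_def mem_Collect_eq
proof (intro conjI allI impI ballI, fold n1 n2, fold P Q)
 let ?F = "ind_back r lam1 lam2 G"
 show "?F (b, T) = 0" if "b \<notin> bent n1 n2 r" for b T
  using that full_in_bent by (intro ind_back_zero) blast
 show "(\<lambda>T. ?F (b, T)) \<in> specht_space2 lam1 lam2" for b
 proof (cases "b \<in> full Q r")
  case True
  have 1: "(\<lambda>S. of_rat (brk lam1 mu S T1 / c) :: 'k) \<in> specht_space lam1" for mu T1 c
   by (rule specht_space_of_rat) (simp add: sum_divide_distrib[symmetric] brk_left[OF part])
  have 2: "(\<lambda>S. \<Sum>T1\<in>tabs mu. G mu (b, (T1, T2)) * of_rat (brk lam1 mu S T1 / ind_const lam1 mu)) \<in> specht_space lam1"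
   for mu T2 by (rule specht_space_sum[OF 1])
  have 3: "(\<lambda>T2. \<Sum>T1\<in>tabs mu. of_rat (brk lam1 mu S T1 / ind_const lam1 mu) * G mu (b, (T1, T2))) \<in> specht_space lam2"
   if "mu \<in> up_set lam1" for mu S
   by (rule specht_space_sum) (rule infl_spaceD(3)[OF G[OF that]])
  show ?thesis
   using specht_space_sum[of "up_set lam1" "\<lambda>mu S. \<Sum>T1\<in>tabs mu. G mu (b, (T1, _)) * of_rat (brk lam1 mu S T1 / ind_const lam1 mu)" lam1 "\<lambda>_. 1", OF 2]
    specht_space_sum[of "up_set lam1" "\<lambda>mu T2. \<Sum>T1\<in>tabs mu. of_rat (brk lam1 mu _ T1 / ind_const lam1 mu) * G mu (b, (T1, T2))" lam2 "\<lambda>_. 1", OF 3]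
   by (simp add: specht_space2_def ind_back_eq[OF True] mult.commute)
 qed (simp add: ind_back_zero specht_space2_zero)
 show "?F (dact Q g b, act2 g T) = ?F (b, T)" if g: "g \<in> block_perms P" and b: "b \<in> bent n1 n2 r" for g b T
 proof -
  obtain h k where g': "g = (h, k)" "h \<in> perms n1" "k \<in> perms n2" using g by (cases g) (auto simp: block_perms_eq P)
  obtain S T2 where T: "T = (S, T2)" by (cases T)
  have gQ: "g \<in> block_perms Q" using g block_perms_Suc by (simp add: P Q)
  show ?thesis
  proof (cases "b \<in> full Q r")
   case True
   have "brk lam1 mu (tab_act h S) (tab_act h T1) = brk lam1 mu S T1" if "mu \<in> up_set lam1" for mu T1
    by (rule brk_equivariant[OF up_setD(2)[OF that]]) (use g'(2) in \<open>simp add: perms_def n1\<close>)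
   thus ?thesis
    unfolding g'(1) T act2_pair ind_back_dact[OF True perms_Suc[OF g'(2)] g'(3)] ind_back_eq[OF True]
    by (intro sum.cong refl) simp
  next
   case False
   have "dact Q g b \<notin> full Q r"
   proof
    assume "dact Q g b \<in> full Q r"
    hence "dact Q (inv' (fst g), inv' (snd g)) (dact Q g b) \<in> full Q r"
     by (rule dact_full[OF block_perms_closed(2)[OF gQ]])
    thus False using False dact_inv(1)[OF gQ, of b r] bentD[OF b] by (simp add: Q)
   qed
   thus ?thesis using False by (simp add: ind_back_zero)
  qed
 qed
qed

text \<open>By \<open>ind_back_dact\<close>, \<open>ind_back\<close> at a relabelled diagram is the
  synthesis with \<open>ind_brk\<close> in the form that \<open>frame_recover\<close>
  expects.\<close>

lemma ind_part_back:
 assumes mu: "mu \<in> up_set lam1"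
 shows "ind_part r lam1 lam2 mu (ind_back r lam1 lam2 G) = G mu"
proof -
 have "ind_part r lam1 lam2 mu (ind_back r lam1 lam2 G) (b, (T, T2)) = G mu (b, (T, T2))" for b T T2
 proof (cases "b \<in> full Q r")
  case b: True
  have "ind_part r lam1 lam2 mu (ind_back r lam1 lam2 G) (b, (T, T2)) =
   (\<Sum>y\<in>ind_index lam1. of_rat (ind_brk lam1 mu T y) * (\<Sum>nu\<in>up_set lam1. \<Sum>T1\<in>tabs nu.
    of_rat (ind_brk lam1 nu T1 y / ind_const lam1 nu) * G nu (b, (T1, T2))))"
   unfolding ind_part_eq[OF b]
  proof (rule sum.cong[OF refl])
   fix y assume "y \<in> ind_index lam1"
   hence y: "fst y \<in> perms (Suc n1)" by (auto simp: ind_index_def n1)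
   show "of_rat (ind_brk lam1 mu T y) * ind_back r lam1 lam2 G (dact Q (fst y, id) b, (snd y, T2)) =
    of_rat (ind_brk lam1 mu T y) * (\<Sum>nu\<in>up_set lam1. \<Sum>T1\<in>tabs nu.
    of_rat (ind_brk lam1 nu T1 y / ind_const lam1 nu) * G nu (b, (T1, T2)))"
    using ind_back_dact[OF b y perms_zero, of "snd y" T2] y by (simp add: ind_brk_def n1)
  qed
  also have "... = G mu (b, (T, T2))"
  proof (rule frame_recover[where p = "spk mu" and w = "\<lambda>mu T1. G mu (b, (T1, T2))"])
   show "finite (up_set lam1)" by (rule bij_addable_up(2)[OF part])
   show "(\<Sum>y\<in>ind_index lam1. ind_brk lam1 mu T y * ind_brk lam1 i T' y) = 0"
    if "i \<in> up_set lam1" "i \<noteq> mu" for i T'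
    using ind_schur(1)[OF part mu that(1)] that(2) by simp
   show "(\<Sum>T'\<in>tabs mu. of_rat (spk mu T T') * G mu (b, (T', T2))) = G mu (b, (T, T2))"
    using infl_spaceD(2)[OF G[OF mu]] by (simp add: specht_space_iff)
  qed (rule mu ind_schur(2,3)[OF part mu mu])+
  finally show ?thesis .
 qed (simp add: ind_part_zero infl_spaceD(1)[OF G[OF mu]])
 thus ?thesis by (intro ext) auto
qed

end

end

section \<open>The summands with a cell removed\<close>

text \<open>A function vanishing on full diagrams is determined by its values at capped ones. There
  only permutations of the points off the cap still act, so the Specht module of \<open>lam2\<close>
  is restricted to one point less and split by \<open>brk\<close>.\<close>

definition cap_part where
 "cap_part r lam1 lam2 nu K = (\<lambda>(d, T). if d \<in> full (sum_list lam1, sum_list nu) r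
  then \<Sum>T2\<in>tabs lam2. of_rat (brk nu lam2 (snd T) T2) * K (cap (sum_list lam1) (sum_list nu) d, (fst T, T2))
  else (0 :: 'k::field_char_0))"

text \<open>Synthesis in the restricted Specht module: the components at all \<open>nu\<close> are
  combined to the values that a function should take at capped diagrams.\<close>

definition cap_data where
 "cap_data lam2 G = (\<lambda>(d, T). \<Sum>nu\<in>down_set lam2. \<Sum>S\<in>tabs nu.
  of_rat (brk nu lam2 S (snd T) / restrict_const nu lam2) * (G nu (d, (fst T, S)) :: 'k::field_char_0))"

text \<open>Every element of \<open>bent p1 (Suc q) r\<close> that is not full is \<open>dact (Suc p1, Suc q) (id, g) (cap p1 q d)\<close>, where
 \<open>(g, d)\<close> is unique up to permutations of the first \<open>q\<close> points right of the wall.\<close>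

definition cap_back where
 "cap_back r lam1 lam2 q h = (\<lambda>(b, T). if b \<in> bent (sum_list lam1) (Suc q) r - full (Suc (sum_list lam1), Suc q) r
  then (let (g, d) = SOME (g, d). g \<in> perms (Suc q) \<and> d \<in> full (sum_list lam1, q) r \<and>
    b = dact (Suc (sum_list lam1), Suc q) (id, g) (cap (sum_list lam1) q d)
   in h (d, (fst T, tab_act (inv' g) (snd T)))) else (0 :: 'k::field_char_0))"

definition cap_space where
 "cap_space r lam1 lam2 = {F \<in> bent_space r lam1 lam2. \<forall>b\<in>full (Suc (sum_list lam1), sum_list lam2) r. \<forall>T. F (b, T) = 0}"

context
 fixes dl :: "'k::field_char_0" and r :: "nat \<times> nat" and lam1 lam2 :: "nat list" and n1 q :: nat and P Q
 assumes part: "is_partition lam2" and n2: "sum_list lam2 = Suc q"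
 defines n1: "n1 \<equiv> sum_list lam1" and P: "P \<equiv> (n1, q)" and Q: "Q \<equiv> (Suc n1, Suc q)"
begin

lemma cap_spaceD:
 assumes "(F :: _ => 'k) \<in> cap_space r lam1 lam2"
 shows "b \<in> full Q r ==> F (b, T) = 0" "F \<in> bent_space r lam1 lam2"
 using assms unfolding cap_space_def Q n1 n2 by blast+

lemma down_sum: "nu \<in> down_set lam2 ==> sum_list nu = q"
 using down_setD(2)[of nu lam2] n2 by simp

lemma cap_part_eq: "nu \<in> down_set lam2 ==> d \<in> full P r ==> cap_part r lam1 lam2 nu K (d, (T1, S)) =
  (\<Sum>T2\<in>tabs lam2. of_rat (brk nu lam2 S T2) * K (cap n1 q d, (T1, T2)))"
 by (simp add: cap_part_def P n1 down_sum)

lemma cap_part_zero: "nu \<in> down_set lam2 ==> d \<notin> full P r ==> cap_part r lam1 lam2 nu K (d, T) = (0 :: 'k)"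
 by (simp add: cap_part_def P n1 down_sum)

lemma brk_shift:
 assumes nu: "nu \<in> down_set lam2" and h: "h \<in> perms q"
 shows "brk nu lam2 (tab_act h S) (tab_act h T) = brk nu lam2 S T"
 by (rule brk_equivariant[OF down_setD(2)[OF nu]]) (use h down_sum[OF nu] in \<open>simp add: perms_def\<close>)

lemma cap_full_bent: "d \<in> full P r ==> cap n1 q d \<in> bent n1 (Suc q) r"
 unfolding P by (rule cap_bent)

lemma cap_part_closed:
 assumes K: "(K :: _ => 'k) \<in> bent_space r lam1 lam2" and nu: "nu \<in> down_set lam2"
 shows "cap_part r lam1 lam2 nu K \<in> infl_space P r lam1 nu"
 unfolding diag_space_def mem_Collect_eq
proof (intro conjI allI impI ballI)
 let ?G = "cap_part r lam1 lam2 nu K"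
 note KD = bent_spaceD[OF K, folded n1, unfolded n2, folded Q]
 note nu' = down_setD(1)[OF nu]
 show "?G (d, T) = 0" if "d \<notin> full P r" for d T by (rule cap_part_zero[OF nu that])
 show "(\<lambda>T. ?G (d, T)) \<in> specht_space2 lam1 nu" for d
 proof (cases "d \<in> full P r")
  case True
  have 1: "(\<lambda>S. of_rat (brk nu lam2 S T2) :: 'k) \<in> specht_space nu" for T2
   by (rule specht_space_of_rat) (rule brk_left[OF nu'])
  show ?thesis
   using specht_space_sum[of "tabs lam2" "\<lambda>T2 S. of_rat (brk nu lam2 S T2)" nu
     "\<lambda>T2. K (cap n1 q d, (_, T2))", OF 1]
    specht_space_sum[of "tabs lam2" "\<lambda>T2 T1. K (cap n1 q d, (T1, T2))" lam1
     "\<lambda>T2. of_rat (brk nu lam2 _ T2)", OF KD(2)]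
   by (simp add: specht_space2_def cap_part_eq[OF nu True] mult.commute)
 qed (simp add: cap_part_zero[OF nu] specht_space2_zero)
 show "?G (dact P g d, act2 g T) = ?G (d, T)" if g: "g \<in> block_perms P" and d: "d \<in> full P r" for g d T
 proof -
  obtain h k where g': "g = (h, k)" "h \<in> perms n1" "k \<in> perms q" using g by (cases g) (auto simp: block_perms_eq P)
  obtain T1 S where T: "T = (T1, S)" by (cases T)
  have c: "cap n1 q (dact P (h, k) d) = dact Q (h, k) (cap n1 q d)"
   using cap_dact[OF fullD[OF d[unfolded P]] g[unfolded g'(1) P]] by (simp add: P Q)
  have k': "k permutes {1..sum_list lam2}" using perms_Suc[OF g'(3)] by (simp add: perms_def n2)
  note s = sum_tabs_act[OF k', of "\<lambda>T2. of_rat (brk nu lam2 (tab_act k S) T2) *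
   K (dact Q (h, k) (cap n1 q d), (tab_act h T1, T2))", symmetric]
  show ?thesis
   unfolding g'(1) T act2_pair cap_part_eq[OF nu dact_full[OF g[unfolded g'(1)] d]] cap_part_eq[OF nu d] c s
   using KD(4)[OF g'(2) perms_Suc[OF g'(3)] cap_full_bent[OF d]]
   by (simp add: brk_shift[OF nu g'(3)])
 qed
qed

text \<open>Full diagrams may also multiply into capped ones; on \<open>cap_space\<close> they carry
  the value zero, as \<open>dmul_cap\<close> requires.\<close>

lemma cap_part_act:
 assumes K: "(K :: _ => 'k) \<in> cap_space r lam1 lam2" and nu: "nu \<in> down_set lam2"
 shows "cap_part r lam1 lam2 nu (diag_act dl (bent n1 (Suc q) r) r a K) =
  diag_act dl (full P r) r a (cap_part r lam1 lam2 nu K)"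
proof -
 have "cap_part r lam1 lam2 nu (diag_act dl (bent n1 (Suc q) r) r a K) (d, (T1, S)) =
  diag_act dl (full P r) r a (cap_part r lam1 lam2 nu K) (d, (T1, S))" for d T1 S
 proof (cases "d \<in> full P r")
  case d: True
  have "dmul dl (bent n1 (Suc q) r) r a (\<lambda>x. K (x, (T1, T2))) (cap n1 q d) =
   dmul dl (full P r) r a (\<lambda>x. K (cap n1 q x, (T1, T2))) d" for T2
   unfolding P by (rule dmul_cap) (use cap_spaceD(1)[OF K] d in \<open>simp_all add: P Q\<close>)
  hence "cap_part r lam1 lam2 nu (diag_act dl (bent n1 (Suc q) r) r a K) (d, (T1, S)) =
   (\<Sum>T2\<in>tabs lam2. of_rat (brk nu lam2 S T2) * dmul dl (full P r) r a (\<lambda>x. K (cap n1 q x, (T1, T2))) d)"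
   by (simp only: cap_part_eq[OF nu d] diag_act_dmul)
  also have "... = dmul dl (full P r) r a (\<lambda>x. cap_part r lam1 lam2 nu K (x, (T1, S))) d"
   unfolding dmul_sum[symmetric] by (rule dmul_cong) (simp add: cap_part_eq[OF nu])
  finally show ?thesis by (simp only: diag_act_dmul)
 qed (simp add: cap_part_zero[OF nu] diag_act_dmul dmul_def)
 thus ?thesis by (intro ext) auto
qed

text \<open>By \<open>frame_expand\<close> all values at capped diagrams vanish, and
  \<open>bent_decompose\<close> with equivariance spreads this to every bent diagram that is not
  full.\<close>

lemma cap_part_injective:
 assumes K: "(K :: _ => 'k) \<in> cap_space r lam1 lam2"
  and z: "\<And>nu. nu \<in> down_set lam2 ==> cap_part r lam1 lam2 nu K = 0"
 shows "K = 0"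
proof -
 note KD = bent_spaceD[OF cap_spaceD(2)[OF K], folded n1, unfolded n2, folded Q]
 have cap0: "K (cap n1 q d, (T1, T2)) = 0" if d: "d \<in> full P r" for d T1 T2
 proof (cases "T2 \<in> tabs lam2")
  case True
  define f where "f T2 = K (cap n1 q d, (T1, T2))" for T2
  have "f T2 = (\<Sum>nu\<in>down_set lam2. \<Sum>S\<in>tabs nu. of_rat (brk nu lam2 S T2 / restrict_const nu lam2) *
    (\<Sum>T\<in>tabs lam2. of_rat (brk nu lam2 S T) * f T))"
  proof (rule frame_expand[where P = "spk lam2"])
   show "spk lam2 T2 T = (\<Sum>nu\<in>down_set lam2. \<Sum>S\<in>tabs nu. brk nu lam2 S T2 * brk nu lam2 S T / restrict_const nu lam2)"
    if "T \<in> tabs lam2" for T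
    by (rule restrict_bessel(2)[OF part restrict_dims[OF part] True that]) (simp add: n2)
   show "(\<Sum>T\<in>tabs lam2. of_rat (spk lam2 T2 T) * f T) = f T2"
    using KD(3) by (simp add: f_def specht_space_iff)
  qed
  also have "... = 0"
  proof (intro sum.neutral ballI)
   fix nu S assume nu: "nu \<in> down_set lam2"
   from fun_cong[OF z[OF nu], of "(d, (T1, S))"]
   have "(\<Sum>T\<in>tabs lam2. of_rat (brk nu lam2 S T) * f T) = 0"
    by (simp add: cap_part_eq[OF nu d] f_def)
   thus "of_rat (brk nu lam2 S T2 / restrict_const nu lam2) *
    (\<Sum>T\<in>tabs lam2. of_rat (brk nu lam2 S T) * f T) = 0" by simp
  qed
  finally show ?thesis by (simp add: f_def)
 qed (simp add: specht_space_support[OF KD(3)])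
 have "K (b, (T1, T2)) = 0" for b T1 T2
 proof -
  consider "b \<notin> bent n1 (Suc q) r" | "b \<in> full Q r" | "b \<in> bent n1 (Suc q) r" "b \<notin> full (Suc n1, Suc q) r"
   by (auto simp: Q)
  thus ?thesis
  proof cases
   case 3
   then obtain q' g d where g: "Suc q = Suc q'" "g \<in> perms (Suc q)" "d \<in> full (n1, q') r"
    "b = dact (Suc n1, Suc q) (id, g) (cap n1 q' d)" by (rule bent_decompose)
   have d: "d \<in> full P r" using g(1,3) by (simp add: P)
   have "K (dact Q (id, g) (cap n1 q d), (tab_act id T1, tab_act g (tab_act (inv' g) T2))) =
     K (cap n1 q d, (T1, tab_act (inv' g) T2))"
    by (rule KD(4)[OF perms_zero g(2) cap_full_bent[OF d]])
   thus ?thesis using g cap0[OF d] by (simp add: Q tab_act_comp[symmetric] perms_inv)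
  qed (simp_all add: KD(1) cap_spaceD(1)[OF K])
 qed
 thus ?thesis by (intro ext) auto
qed

context
 fixes h :: "diagram \<times> tab2 => 'k"
 assumes hs: "\<And>d. d \<in> full P r ==> (\<lambda>T. h (d, T)) \<in> specht_space2 lam1 lam2"
  and hg: "\<And>g k d T1 T2. g \<in> perms n1 ==> k \<in> perms q ==> d \<in> full P r ==>
   h (dact P (g, k) d, (tab_act g T1, tab_act k T2)) = h (d, (T1, T2))"
begin

text \<open>The value does not depend on the chosen pair: by \<open>cap_coset\<close> two choices
  differ by a permutation of the first \<open>q\<close> points, under which \<open>h\<close> is
  equivariant.\<close>

lemma cap_back_dact:
 assumes g: "g \<in> perms (Suc q)" and d: "d \<in> full P r"
 shows "cap_back r lam1 lam2 q h (dact Q (id, g) (cap n1 q d), (T1, T2)) = h (d, (T1, tab_act (inv' g) T2))"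
proof -
 let ?b = "dact Q (id, g) (cap n1 q d)"
 have gb: "(id, g) \<in> block_perms (n1, Suc q)" using g by (rule id_block)
 have gQ: "(id, g) \<in> block_perms Q" unfolding Q using g by (rule id_block)
 have b: "?b \<in> bent n1 (Suc q) r" unfolding Q by (rule dact_bent[OF gb cap_full_bent[OF d]])
 have nf: "?b \<notin> full Q r"
 proof
  assume "?b \<in> full Q r"
  from dact_full[OF block_perms_closed(2)[OF gQ] this] have "cap n1 q d \<in> full Q r"
   using dact_inv(1)[OF gQ, of "cap n1 q d" r] bentD[OF cap_full_bent[OF d]] by (simp add: Q)
  thus False using cap_not_full unfolding Q by blast
 qed
 define Z where "Z = (\<lambda>(g', d'). g' \<in> perms (Suc q) \<and> d' \<in> full P r \<and> ?b = dact Q (id, g') (cap n1 q d'))"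
 obtain g' d' where s: "(SOME z. Z z) = (g', d')" by (cases "SOME z. Z z")
 have "Z (g, d)" using g d by (simp add: Z_def)
 hence "Z (g', d')" unfolding s[symmetric] by (rule someI)
 hence g': "g' \<in> perms (Suc q)" "d' \<in> full P r" "dact Q (id, g') (cap n1 q d') = ?b" by (simp_all add: Z_def)
 note c = cap_coset[OF fullD[OF g'(2)[unfolded P]] fullD[OF d[unfolded P]] g'(1) g g'(3)[unfolded Q]]
 have "h (d, (T1, tab_act (inv' g) T2)) =
   h (dact P (id, inv' g \<circ> g') d', (tab_act id T1, tab_act (inv' g \<circ> g') (tab_act (inv' g') T2)))"
  by (simp add: P c(2)[symmetric] tab_act_comp[symmetric] comp_assoc perms_inv[OF g'(1)])
 also have "... = h (d', (T1, tab_act (inv' g') T2))" by (rule hg[OF perms_zero c(1) g'(2)])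
 finally show ?thesis using b nf s
  by (simp add: cap_back_def n1[symmetric] P[symmetric] Q[symmetric] Z_def[symmetric])
qed

lemma cap_back_cap: "d \<in> full P r ==> cap_back r lam1 lam2 q h (cap n1 q d, T) = h (d, T)"
 using cap_back_dact[OF perms_zero, of d "fst T" "snd T"] dact_id[OF bentD[OF cap_full_bent], of d]
 by (simp add: Q)

lemma cap_back_zero:
 "b \<in> full Q r ==> cap_back r lam1 lam2 q h (b, T) = 0" "b \<notin> bent n1 (Suc q) r ==> cap_back r lam1 lam2 q h (b, T) = 0"
 by (simp_all add: cap_back_def Q n1)

lemma cap_back_closed: "cap_back r lam1 lam2 q h \<in> cap_space r lam1 lam2"
 unfolding cap_space_def diag_space_def mem_Collect_eq
proof (intro conjI allI impI ballI, unfold n1[symmetric] n2, fold Q)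
 let ?H = "cap_back r lam1 lam2 q h"
 show "?H (b, T) = 0" if "b \<notin> bent n1 (Suc q) r" for b T by (rule cap_back_zero(2)[OF that])
 show "?H (b, T) = 0" if "b \<in> full Q r" for b T by (rule cap_back_zero(1)[OF that])
 have dec: "\<exists>g d. g \<in> perms (Suc q) \<and> d \<in> full P r \<and> b = dact Q (id, g) (cap n1 q d)"
  if "b \<in> bent n1 (Suc q) r" "b \<notin> full Q r" for b
  using bent_decompose[of b n1 "Suc q" r] that unfolding P Q by (metis nat.inject)
 show "(\<lambda>T. ?H (b, T)) \<in> specht_space2 lam1 lam2" for b
 proof (cases "b \<in> bent n1 (Suc q) r \<and> b \<notin> full Q r")
  case True
  then obtain g d where g: "g \<in> perms (Suc q)" "d \<in> full P r" "b = dact Q (id, g) (cap n1 q d)" using dec by blast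
  have "(\<lambda>T. h (d, act2 (id, inv' g) T)) \<in> specht_space2 lam1 lam2"
   by (rule specht_space2_act[OF hs[OF g(2)]]) (simp add: id_block n2 perms_closed(2)[OF g(1)])
  moreover have "?H (b, T) = h (d, act2 (id, inv' g) T)" for T
   unfolding g(3) using cap_back_dact[OF g(1,2), of "fst T" "snd T"] by (simp add: act2_def)
  ultimately show ?thesis by (simp only:)
 next
  case False
  hence "?H (b, T) = 0" for T using cap_back_zero by blast
  thus ?thesis by (simp add: specht_space2_zero)
 qed
 show "?H (dact Q g b, act2 g T) = ?H (b, T)" if g: "g \<in> block_perms (n1, Suc q)" and b: "b \<in> bent n1 (Suc q) r"
  for g b T
 proof -
  obtain g1 g2 where gg: "g = (g1, g2)" "g1 \<in> perms n1" "g2 \<in> perms (Suc q)" using g by (cases g) (auto simp: block_perms_eq)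
  obtain T1 T2 where T: "T = (T1, T2)" by (cases T)
  have gQ: "g \<in> block_perms Q" using block_perms_Suc[OF g] by (simp add: Q)
  show ?thesis
  proof (cases "b \<in> full Q r")
   case True
   thus ?thesis by (simp add: cap_back_zero dact_full[OF gQ])
  next
   case False
   then obtain k d where k: "k \<in> perms (Suc q)" "d \<in> full P r" "b = dact Q (id, k) (cap n1 q d)" using dec[OF b] by blast
   have g1P: "(g1, id) \<in> block_perms P" using gg(2) by (simp add: P id_block_left)
   have cw: "cap n1 q d \<in> WD Q r" using bentD[OF cap_full_bent[OF k(2)]] by (simp add: Q)
   have kg: "g2 \<circ> k \<in> perms (Suc q)" using k gg by (simp add: perms_closed)
   have blocks: "(g1, g2) \<in> block_perms Q" "(id, k) \<in> block_perms Q" "(id, g2 \<circ> k) \<in> block_perms Q" "(g1, id) \<in> block_perms Q"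
    using gg(2,3) k(1) kg perms_Suc by (auto simp: block_perms_eq Q perms_zero)
   \<comment> \<open>\<open>g1\<close> moves inside the cap while \<open>g2\<close> is absorbed into
     the permutation \<open>k\<close>; they act on different sides of the wall and commute.\<close>
   have "dact Q g b = dact Q (id, g2 \<circ> k) (dact Q (g1, id) (cap n1 q d))"
    unfolding gg(1) k(3) dact_comp[OF blocks(1,2) cw] dact_comp[OF blocks(3,4) cw] by simp
   also have "dact Q (g1, id) (cap n1 q d) = cap n1 q (dact P (g1, id) d)"
    using cap_dact[OF fullD[OF k(2)[unfolded P]] g1P[unfolded P]] by (simp add: P Q)
   finally have e: "dact Q g b = dact Q (id, g2 \<circ> k) (cap n1 q (dact P (g1, id) d))" .
   have "?H (dact Q g b, act2 g T) =
     h (dact P (g1, id) d, (tab_act g1 T1, tab_act (inv' (g2 \<circ> k)) (tab_act g2 T2)))"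
    unfolding e by (simp only: gg(1) T act2_pair cap_back_dact[OF kg dact_full[OF g1P k(2)]])
   also have "tab_act (inv' (g2 \<circ> k)) (tab_act g2 T2) = tab_act (inv' k) T2"
   proof -
    have "inv' (g2 \<circ> k) = inv' k \<circ> inv' g2"
     using gg(3) k(1) by (simp add: perms_def permutes_bij o_inv_distrib)
    thus ?thesis using gg(3) by (simp add: tab_act_comp[symmetric] comp_assoc perms_inv)
   qed
   also have "h (dact P (g1, id) d, (tab_act g1 T1, tab_act (inv' k) T2)) = h (d, (T1, tab_act (inv' k) T2))"
    using hg[OF gg(2) perms_zero k(2), of T1 "tab_act (inv' k) T2"] by simp
   also have "... = ?H (b, T)" unfolding k(3) T cap_back_dact[OF k(1,2)] ..
   finally show ?thesis .
  qed
 qed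
qed

end

context
 fixes G :: "nat list => diagram \<times> tab2 => 'k"
 assumes G: "\<And>nu. nu \<in> down_set lam2 ==> G nu \<in> infl_space P r lam1 nu"
begin

lemma cap_data_space:
 "(\<lambda>T. cap_data lam2 G (d, T)) \<in> specht_space2 lam1 lam2"
proof -
 have 1: "(\<lambda>T2. of_rat (brk nu lam2 S T2 / c) :: 'k) \<in> specht_space lam2" for nu S c
 proof (rule specht_space_of_rat)
  fix T
  have "(\<Sum>T'\<in>tabs lam2. spk lam2 T T' * (brk nu lam2 S T' / c)) = (\<Sum>T'\<in>tabs lam2. brk nu lam2 S T' * spk lam2 T' T) / c"
   by (simp add: sum_divide_distrib spk_sym[of lam2 T] mult.commute)
  thus "(\<Sum>T'\<in>tabs lam2. spk lam2 T T' * (brk nu lam2 S T' / c)) = brk nu lam2 S T / c"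
   by (simp only: brk_right[OF part])
 qed
 have 2: "(\<lambda>T2. \<Sum>S\<in>tabs nu. G nu (d, (T1, S)) * of_rat (brk nu lam2 S T2 / restrict_const nu lam2)) \<in> specht_space lam2"
  for nu T1 by (rule specht_space_sum[OF 1])
 have 3: "(\<lambda>T1. \<Sum>S\<in>tabs nu. of_rat (brk nu lam2 S T2 / restrict_const nu lam2) * G nu (d, (T1, S))) \<in> specht_space lam1"
  if "nu \<in> down_set lam2" for nu T2
  by (rule specht_space_sum) (rule infl_spaceD(2)[OF G[OF that]])
 show ?thesis
  using specht_space_sum[of "down_set lam2" "\<lambda>nu T2. \<Sum>S\<in>tabs nu. G nu (d, (_, S)) * of_rat (brk nu lam2 S T2 / restrict_const nu lam2)" lam2 "\<lambda>_. 1", OF 2]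
   specht_space_sum[of "down_set lam2" "\<lambda>nu T1. \<Sum>S\<in>tabs nu. of_rat (brk nu lam2 S _ / restrict_const nu lam2) * G nu (d, (T1, S))" lam1 "\<lambda>_. 1", OF 3]
  by (simp add: specht_space2_def cap_data_def mult.commute)
qed

lemma cap_data_dact:
 assumes g: "g \<in> perms n1" and k: "k \<in> perms q" and d: "d \<in> full P r"
 shows "cap_data lam2 G (dact P (g, k) d, (tab_act g T1, tab_act k T2)) = cap_data lam2 G (d, (T1, T2))"
 unfolding cap_data_def prod.case fst_conv snd_conv
proof (rule sum.cong[OF refl])
 fix nu assume nu: "nu \<in> down_set lam2"
 have "k permutes {1..sum_list nu}" using k down_sum[OF nu] by (simp add: perms_def)
 note s = sum_tabs_act[OF this, of "\<lambda>S. of_rat (brk nu lam2 S (tab_act k T2) / restrict_const nu lam2) *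
  G nu (dact P (g, k) d, (tab_act g T1, S))", symmetric]
 show "(\<Sum>S\<in>tabs nu. of_rat (brk nu lam2 S (tab_act k T2) / restrict_const nu lam2) *
   G nu (dact P (g, k) d, (tab_act g T1, S))) =
  (\<Sum>S\<in>tabs nu. of_rat (brk nu lam2 S T2 / restrict_const nu lam2) * G nu (d, (T1, S)))"
  unfolding s brk_shift[OF nu k] using infl_spaceD(4)[OF G[OF nu] _ _ d, of g k] g k by (simp add: P)
qed

text \<open>\<open>cap_data\<close> prescribes the values at capped diagrams,
  \<open>cap_back\<close> spreads them by equivariance, and \<open>frame_recover\<close> reads the
  components off again.\<close>

lemma cap_part_surjective:
 "\<exists>H\<in>cap_space r lam1 lam2. \<forall>nu\<in>down_set lam2. cap_part r lam1 lam2 nu H = G nu"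
proof (intro bexI ballI)
 let ?H = "cap_back r lam1 lam2 q (cap_data lam2 G)"
 show "?H \<in> cap_space r lam1 lam2" by (rule cap_back_closed[OF cap_data_space cap_data_dact])
 fix nu assume nu: "nu \<in> down_set lam2"
 have "cap_part r lam1 lam2 nu ?H (d, (T1, S)) = G nu (d, (T1, S))" for d T1 S
 proof (cases "d \<in> full P r")
  case d: True
  have "cap_part r lam1 lam2 nu ?H (d, (T1, S)) = (\<Sum>T2\<in>tabs lam2. of_rat (brk nu lam2 S T2) *
   (\<Sum>i\<in>down_set lam2. \<Sum>S'\<in>tabs i. of_rat (brk i lam2 S' T2 / restrict_const i lam2) * G i (d, (T1, S'))))"
   by (simp only: cap_part_eq[OF nu d] cap_back_cap[OF cap_data_space cap_data_dact d])
    (simp add: cap_data_def)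
  also have "... = G nu (d, (T1, S))"
  proof (rule frame_recover[where p = "spk nu" and w = "\<lambda>i S. G i (d, (T1, S))"])
   show "finite (down_set lam2)" by (rule bij_removable_down(2)[OF part])
   show "(\<Sum>T\<in>tabs lam2. brk nu lam2 S T * brk i lam2 S' T) = 0"
    if "i \<in> down_set lam2" "i \<noteq> nu" for i S'
    using restrict_schur(1)[OF part nu that(1)] that(2) by simp
   show "(\<Sum>S'\<in>tabs nu. of_rat (spk nu S S') * G nu (d, (T1, S'))) = G nu (d, (T1, S))"
    using infl_spaceD(3)[OF G[OF nu]] by (simp add: specht_space_iff)
  qed (rule nu restrict_schur(2,3)[OF part nu nu])+
  finally show ?thesis .
 qed (simp add: cap_part_zero[OF nu] infl_spaceD(1)[OF G[OF nu]])
 thus "cap_part r lam1 lam2 nu ?H = G nu" by (intro ext) auto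
qed

end

end

section \<open>The branching rule\<close>

lemma ind_part_add: "ind_part r lam1 lam2 mu (F + G) = ind_part r lam1 lam2 mu F + ind_part r lam1 lam2 mu G"
 by (rule ext) (simp add: ind_part_def distrib_left sum.distrib split: prod.split)

lemma cap_part_add: "cap_part r lam1 lam2 nu (F + G) = cap_part r lam1 lam2 nu F + cap_part r lam1 lam2 nu G"
 by (rule ext) (simp add: cap_part_def distrib_left sum.distrib split: prod.split)

lemma right_action_bent:
 "right_action (walled_brauer dl r) (diag_act dl (bent (sum_list lam1) (sum_list lam2) r) r) (bent_space r lam1 lam2)"
 by (rule right_action_diag_space[OF upclosed_bent subsetI bij_dact_bent]) (rule block_perms_Suc)

text \<open>By \<open>dmul_restrict\<close> the values of a product at full diagrams depend only on
  the values at full diagrams.\<close>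

lemma cap_space_stable:
 fixes dl :: "'k::field_char_0"
 shows "right_action.stable (walled_brauer dl r) (diag_act dl (bent (sum_list lam1) (sum_list lam2) r) r)
  (bent_space r lam1 lam2) (cap_space r lam1 lam2)"
proof -
 let ?N = "cap_space r lam1 lam2 :: (_ => 'k) set"
 let ?B = "bent (sum_list lam1) (sum_list lam2) r" and ?Q = "(Suc (sum_list lam1), sum_list lam2)"
 interpret ra: right_action "walled_brauer dl r" "diag_act dl ?B r" "bent_space r lam1 lam2"
  by (rule right_action_bent)
 show ?thesis
  unfolding ra.stable_def
 proof (intro conjI ballI)
  show "?N \<subseteq> bent_space r lam1 lam2" by (auto simp: cap_space_def)
  show "0 \<in> ?N" using ra.X0 by (simp add: cap_space_def)
  show "m - n \<in> ?N" if "m \<in> ?N" "n \<in> ?N" for m n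
   using that ra.X_diff by (simp add: cap_space_def)
  fix a m assume a: "a \<in> carrier (walled_brauer dl r)" and m: "m \<in> ?N"
  have "diag_act dl ?B r a m (b, T) = 0" if b: "b \<in> full ?Q r" for b T
  proof -
   have "diag_act dl ?B r a m (b, T) = dmul dl (full ?Q r) r a (\<lambda>x. m (x, T)) b"
    unfolding diag_act_dmul by (rule dmul_restrict[OF upclosed_bent upclosed_full full_bent b])
   moreover have "m (x, T) = 0" if "x \<in> full ?Q r" for x using m that unfolding cap_space_def by blast
   hence "dmul dl (full ?Q r) r a (\<lambda>x. m (x, T)) b = dmul dl (full ?Q r) r a (\<lambda>x. 0) b"
    by (rule dmul_cong)
   moreover have "dmul dl (full ?Q r) r a (\<lambda>x. 0) b = 0" using dmul_sum[where I = "{} :: nat set"] by simp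
   ultimately show ?thesis by simp
  qed
  thus "diag_act dl ?B r a m \<in> ?N"
   using ra.act_closed[OF a] m by (simp add: cap_space_def)
 qed
qed

text \<open>Sizes tell the cases apart: a shape with one cell less than \<open>lam2\<close> differs
  from \<open>lam2\<close>.\<close>

lemma branching_set_cases:
 assumes "mu \<in> branching_set (lam1, lam2)"
 obtains (up) "fst mu \<in> up_set lam1" "snd mu = lam2"
  | (down) "fst mu = lam1" "snd mu \<in> down_set lam2" "snd mu \<noteq> lam2"
proof -
 have "nu \<noteq> lam2" if "nu \<in> down_set lam2" for nu using down_setD(2)[OF that] by auto
 thus thesis using assms that unfolding branching_set_def up_set_def down_set_def by auto
qed

lemma branching_setI:
 assumes "is_partition lam1" "is_partition lam2"
 shows "mu \<in> up_set lam1 ==> (mu, lam2) \<in> branching_set (lam1, lam2)"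
  "nu \<in> down_set lam2 ==> (lam1, nu) \<in> branching_set (lam1, lam2)"
 using assms by (auto simp: branching_set_def up_set_def down_set_def)

lemma finite_branching_set:
 assumes "is_partition lam1" "is_partition lam2"
 shows "finite (branching_set (lam1, lam2))"
proof (rule finite_subset)
 show "branching_set (lam1, lam2) \<subseteq> up_set lam1 \<times> {lam2} \<union> {lam1} \<times> down_set lam2"
  by (auto simp: branching_set_def up_set_def down_set_def)
 show "finite (up_set lam1 \<times> {lam2} \<union> {lam1} \<times> down_set lam2)"
  using bij_addable_up(2)[OF assms(1)] bij_removable_down(2)[OF assms(2)] by simp
qed

abbreviation infl_space' ::
 "nat \<times> nat => nat list \<times> nat list => (diagram \<times> tab2 => 'k::field_char_0) set"
 where "infl_space' r mu \<equiv> infl_space (sum_list (fst mu), sum_list (snd mu)) r (fst mu) (snd mu)"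

text \<open>The functions vanishing on full diagrams form a submodule, complemented by semisimplicity.  The
 summands that remove a cell are found by projecting to it.\<close>

lemma branching_map:
 fixes dl :: "'k::field_char_0" and r :: "nat \<times> nat" and lam1 lam2 :: "nat list"
 assumes part1: "is_partition lam1" and part2: "is_partition lam2"
  and ss: "semisimple_ring (walled_brauer dl r)"
 defines "U \<equiv> bent_space r lam1 lam2 :: (_ => 'k) set" and "BS \<equiv> branching_set (lam1, lam2)"
  and "act \<equiv> diag_act dl (bent (sum_list lam1) (sum_list lam2) r) r"
 obtains Xi where "\<And>mu F. mu \<in> BS ==> F \<in> U ==> Xi mu F \<in> infl_space' r mu"
  "\<And>mu F G. mu \<in> BS ==> F \<in> U ==> G \<in> U ==> Xi mu (F + G) = Xi mu F + Xi mu G"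
  "\<And>mu a F. mu \<in> BS ==> a \<in> carrier (walled_brauer dl r) ==> F \<in> U ==>
   Xi mu (act a F) = diag_act dl (full (sum_list (fst mu), sum_list (snd mu)) r) r a (Xi mu F)"
  "\<And>F G. F \<in> U ==> G \<in> U ==> (\<And>mu. mu \<in> BS ==> Xi mu F = Xi mu G) ==> F = G"
  "\<And>G. (\<And>mu. mu \<in> BS ==> G mu \<in> infl_space' r mu) ==> \<exists>F\<in>U. \<forall>mu\<in>BS. Xi mu F = G mu"
proof -
 let ?N = "cap_space r lam1 lam2 :: (_ => 'k) set"
 interpret ra: right_action "walled_brauer dl r" act U
  unfolding U_def act_def by (rule right_action_bent)
 have N: "ra.stable ?N" unfolding U_def act_def by (rule cap_space_stable)
 obtain s where s: "\<And>m. m \<in> U ==> s m \<in> ?N" "\<And>n. n \<in> ?N ==> s n = n"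
  "\<And>m n. m \<in> U ==> n \<in> U ==> s (m + n) = s m + s n"
  "\<And>a m. a \<in> carrier (walled_brauer dl r) ==> m \<in> U ==> s (act a m) = act a (s m)"
  using ra.semisimple_projection[OF ss N] by blast
 have NU: "?N \<subseteq> U" by (rule ra.stableD(1)[OF N])
 have N0: "F (b, T) = 0" if "F \<in> ?N" "b \<in> full (Suc (sum_list lam1), sum_list lam2) r" for F b T
  using that unfolding cap_space_def by blast
 \<comment> \<open>\<open>snd mu = lam2\<close> recognizes the summands that add a cell. For the
   others \<open>s\<close> first projects to the functions vanishing on full diagrams, where
   \<open>cap_part\<close> respects the action.\<close>
 define Xi where "Xi mu F = (if snd mu = lam2 then ind_part r lam1 lam2 (fst mu) F
  else cap_part r lam1 lam2 (snd mu) (s F))" for mu F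
 have xi_add: "Xi mu (F + G) = Xi mu F + Xi mu G" if "F \<in> U" "G \<in> U" for mu F G
  by (simp only: Xi_def s(3)[OF that] ind_part_add cap_part_add split: if_split) simp
 have kernel: "F = 0" if F: "F \<in> U" and z: "\<And>mu. mu \<in> BS ==> Xi mu F = 0" for F
 proof -
  have "F (b, T) = 0" if b: "b \<in> full (Suc (sum_list lam1), sum_list lam2) r" for b T
  proof (rule ind_part_injective[OF part1 F[unfolded U_def] _ b])
   fix mu assume "mu \<in> up_set lam1"
   from z[OF branching_setI(1)[OF part1 part2 this, folded BS_def]]
   show "ind_part r lam1 lam2 mu F = 0" by (simp add: Xi_def)
  qed
  hence FN: "F \<in> ?N" using F by (simp add: cap_space_def U_def)
  show "F = 0"
  proof (cases "sum_list lam2")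
   \<comment> \<open>With no top points right of the wall the new point has no possible partner at
     the top, so every bent diagram is full.\<close>
   case 0
   have "b \<in> full (Suc (sum_list lam1), sum_list lam2) r" if "b \<in> bent (sum_list lam1) (sum_list lam2) r" for b
    using bent_decompose[OF that] 0 by (metis nat.distinct(1))
   hence "F (b, T) = 0" for b T
    using N0[OF FN, of b T] diag_spaceD(1)[OF F[unfolded U_def], of b T] by blast
   thus ?thesis by (intro ext) auto
  next
   case (Suc q)
   show ?thesis
   proof (rule cap_part_injective[OF part2 Suc FN])
    fix nu assume nu: "nu \<in> down_set lam2"
    hence "nu \<noteq> lam2" using down_setD(2)[OF nu] by auto
    thus "cap_part r lam1 lam2 nu F = 0"
     using z[OF branching_setI(2)[OF part1 part2 nu, folded BS_def]] s(2)[OF FN] by (simp add: Xi_def)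
   qed
  qed
 qed
 show thesis
 proof (rule that[of Xi])
  show "Xi mu F \<in> infl_space' r mu" if mu: "mu \<in> BS" and F: "F \<in> U" for mu F
   using mu unfolding BS_def
  proof (cases rule: branching_set_cases)
   case up
   thus ?thesis
    using ind_part_closed[OF F[unfolded U_def] up(1)] up_setD(2)[OF up(1)] by (simp add: Xi_def)
  next
   case down
   have "s F \<in> bent_space r lam1 lam2" using s(1)[OF F] NU by (auto simp: U_def)
   from cap_part_closed[OF part2 down_setD(2)[OF down(2)] this down(2)]
   show ?thesis using down by (simp add: Xi_def)
  qed
  show "Xi mu (F + G) = Xi mu F + Xi mu G" if "F \<in> U" "G \<in> U" for mu F G by (rule xi_add[OF that])
  show "Xi mu (act a F) = diag_act dl (full (sum_list (fst mu), sum_list (snd mu)) r) r a (Xi mu F)"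
   if mu: "mu \<in> BS" and a: "a \<in> carrier (walled_brauer dl r)" and F: "F \<in> U" for mu a F
   using mu unfolding BS_def
  proof (cases rule: branching_set_cases)
   case up
   thus ?thesis
    by (simp add: Xi_def act_def ind_part_act up_setD(2)[OF up(1)])
  next
   case down
   note n = down_setD(2)[OF down(2)]
   from cap_part_act[OF part2 n s(1)[OF F] down(2), of dl a]
   show ?thesis using down s(4)[OF a F] by (simp add: Xi_def act_def n)
  qed
  show "F = G" if FG: "F \<in> U" "G \<in> U" and eq: "\<And>mu. mu \<in> BS ==> Xi mu F = Xi mu G" for F G
  proof -
   have d: "F - G \<in> U" by (rule ra.X_diff[OF FG])
   have "Xi mu (F - G) = 0" if "mu \<in> BS" for mu
    using xi_add[OF d FG(2), of mu] eq[OF that] by simp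
   hence "F - G = 0" by (rule kernel[OF d])
   thus ?thesis by simp
  qed
  show "\<exists>F\<in>U. \<forall>mu\<in>BS. Xi mu F = G mu" if G: "\<And>mu. mu \<in> BS ==> G mu \<in> infl_space' r mu" for G
  proof -
   have Gup: "G (mu, lam2) \<in> infl_space (Suc (sum_list lam1), sum_list lam2) r mu lam2" if "mu \<in> up_set lam1" for mu
    using G[OF branching_setI(1)[OF part1 part2 that, folded BS_def]] up_setD(2)[OF that] by simp
   define F0 where "F0 = ind_back r lam1 lam2 (\<lambda>mu. G (mu, lam2))"
   have F0: "F0 \<in> U" unfolding F0_def U_def by (rule ind_back_closed[OF part1 Gup])
   have F0': "ind_part r lam1 lam2 mu F0 = G (mu, lam2)" if "mu \<in> up_set lam1" for mu
    unfolding F0_def by (rule ind_part_back[OF part1 _ that]) (rule Gup)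
   have "\<exists>H\<in>?N. \<forall>nu\<in>down_set lam2. cap_part r lam1 lam2 nu H = G (lam1, nu)"
   proof (cases "sum_list lam2")
    case 0
    hence "nu \<notin> down_set lam2" for nu using down_setD(2)[of nu lam2] by (metis nat.distinct(1))
    thus ?thesis by (intro bexI[OF _ ra.stableD(2)[OF N]]) blast
   next
    case (Suc q)
    have "G (lam1, nu) \<in> infl_space (sum_list lam1, q) r lam1 nu" if "nu \<in> down_set lam2" for nu
     using G[OF branching_setI(2)[OF part1 part2 that, folded BS_def]] down_setD(2)[OF that] Suc by simp
    thus ?thesis by (rule cap_part_surjective[OF part2 Suc])
   qed
   then obtain H where H: "H \<in> ?N" "\<And>nu. nu \<in> down_set lam2 ==> cap_part r lam1 lam2 nu H = G (lam1, nu)" by blast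
   \<comment> \<open>Adding an element of \<open>?N\<close> leaves all components from
     \<open>ind_part\<close> unchanged, and this one corrects the projection of \<open>F0\<close> to
     \<open>H\<close>.\<close>
   define K where "K = H - s F0"
   have K: "K \<in> ?N" unfolding K_def by (rule ra.stableD(3)[OF N H(1) s(1)[OF F0]])
   have KU: "K \<in> U" using K NU by blast
   have "K (dact (Suc (sum_list lam1), sum_list lam2) (fst y, id) b, T) = 0"
    if "y \<in> ind_index lam1" "b \<in> full (Suc (sum_list lam1), sum_list lam2) r" for y b T
    by (rule N0[OF K ind_full(1)[OF that]])
   hence "ind_part r lam1 lam2 mu K = 0" for mu
    by (intro ext) (auto simp: ind_part_def intro!: sum.neutral)
   hence 1: "ind_part r lam1 lam2 mu (F0 + K) = ind_part r lam1 lam2 mu F0" for mu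
    by (simp only: ind_part_add add_0_right)
   have "s (F0 + K) = s F0 + K" by (simp only: s(3)[OF F0 KU] s(2)[OF K])
   hence 2: "s (F0 + K) = H" by (simp add: K_def)
   have "Xi mu (F0 + K) = G mu" if "mu \<in> BS" for mu
    using that unfolding BS_def
   proof (cases rule: branching_set_cases)
    case up
    thus ?thesis using F0'[OF up(1)] 1 by (cases mu) (simp add: Xi_def)
   next
    case down
    thus ?thesis using H(2)[OF down(2)] 2 by (cases mu) (simp add: Xi_def)
   qed
   thus ?thesis using ra.X_add[OF F0 KU] by blast
  qed
 qed
qed

theorem corollary9p3p2:
  fixes \<delta> :: "'k::field_char_0"
    and r1 r2 p1 p2 :: nat
    and lam1 lam2 :: "nat list"
  assumes "p1 \<le> r1" and "p2 \<le> r2"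
    and "semisimple_ring (walled_brauer \<delta> (r1, r2))"
    and "partition_of lam1 p1" and "partition_of lam2 p2"
  shows "module_iso (walled_brauer \<delta> (r1, r2))
    (restrict_scalars (walled_brauer_incl (r1, r2)) (U_module \<delta> (r1, r2 + 1) (lam1, lam2)))
    (direct_sum (branching_set (lam1, lam2)) (U_module \<delta> (r1, r2)))"
proof -
 let ?r = "(r1, r2)" and ?r' = "(r1, r2 + 1)"
 let ?BS = "branching_set (lam1, lam2)"
 let ?C = "U_module \<delta> ?r' (lam1, lam2)" and ?D = "U_module \<delta> ?r"
 let ?U = "bent_space ?r lam1 lam2 :: (_ => 'k) set"
 have part: "is_partition lam1" "is_partition lam2" using assms(4,5) by (simp_all add: partition_of_def)
 obtain i where im: "function_model i ?C (infl_space (sum_list lam1, sum_list lam2) ?r' lam1 lam2)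
   (diag_act \<delta> (full (sum_list lam1, sum_list lam2) ?r') ?r')"
  using U_module_iso[OF part, of \<delta> ?r'] by blast
 note i = function_modelD(1)[OF im] and i_add = function_modelD(2)[OF im] and i_act = function_modelD(3)[OF im]
 obtain be where b: "bij_betw be (infl_space (sum_list lam1, sum_list lam2) ?r' lam1 lam2) ?U"
  and b_add: "\<And>F G. be (F + G) = be F + be G"
  and b_act: "\<And>a F. be (diag_act \<delta> (full (sum_list lam1, sum_list lam2) ?r') ?r' (walled_brauer_incl ?r a) F) =
   diag_act \<delta> (bent (sum_list lam1) (sum_list lam2) ?r) ?r a (be F)"
  using bending_iso[of lam1 lam2 r1 r2 \<delta>] by blast
 \<comment> \<open>The function model followed by bending: the smaller algebra, acting through the
   inclusion, now acts directly on bent diagrams.\<close>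
 define k where "k u = be (i u)" for u
 have k: "bij_betw k (carrier ?C) ?U"
  using bij_betw_trans[OF i b] by (simp add: k_def[abs_def] comp_def)
 have "\<exists>j. function_model j (?D mu) (infl_space' ?r mu)
   (diag_act \<delta> (full (sum_list (fst mu), sum_list (snd mu)) ?r) ?r)" if "mu \<in> ?BS" for mu
 proof -
  have "is_partition (fst mu)" "is_partition (snd mu)" using that by (simp_all add: branching_set_def)
  from U_module_iso[OF this, of \<delta> ?r] show ?thesis unfolding prod.collapse .
 qed
 then obtain j where jm: "\<And>mu. mu \<in> ?BS ==> function_model (j mu) (?D mu) (infl_space' ?r mu)
   (diag_act \<delta> (full (sum_list (fst mu), sum_list (snd mu)) ?r) ?r)" by metis
 note j = function_modelD(1)[OF jm] and j_add = function_modelD(2)[OF jm] and j_act = function_modelD(3)[OF jm]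
 show ?thesis
 proof (rule branching_map[OF part assms(3)], goal_cases)
 case (1 Xi)
 note xi = 1(1) and xi_add = 1(2) and xi_act = 1(3) and xi_inj = 1(4) and xi_surj = 1(5)
 define l where "l mu = inv_into (carrier (?D mu)) (j mu)" for mu
 have l: "l mu w \<in> carrier (?D mu)" "j mu (l mu w) = w" if "mu \<in> ?BS" "w \<in> infl_space' ?r mu" for mu w
  using j[OF that(1)] that(2) unfolding l_def bij_betw_def by (auto simp: inv_into_into f_inv_into_f)
 have lj: "l mu c = d" if "mu \<in> ?BS" "d \<in> carrier (?D mu)" "j mu d = c" for mu c d
  using j[OF that(1)] that(2,3) unfolding l_def bij_betw_def by auto
 have kU: "k u \<in> ?U" if "u \<in> carrier ?C" for u using bij_betw_apply[OF k that] .
 \<comment> \<open>\<open>f u mu\<close> is the element of the summand at \<open>mu\<close> whose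
   function is \<open>Xi mu (k u)\<close>; the restricted abstraction makes \<open>f u\<close>
   extensional, as elements of \<open>direct_sum\<close> are.\<close>
 define f where "f u = (\<lambda>mu\<in>?BS. l mu (Xi mu (k u)))" for u
 have f_eq: "j mu (f u mu) = Xi mu (k u)" "f u mu \<in> carrier (?D mu)" if "mu \<in> ?BS" "u \<in> carrier ?C" for u mu
  using l[OF that(1) xi[OF that(1) kU[OF that(2)]]] that(1) by (simp_all add: f_def)
 have f_eqI: "f u mu = d" if "mu \<in> ?BS" "d \<in> carrier (?D mu)" "Xi mu (k u) = j mu d" for u mu d
  using lj[OF that(1,2)] that by (simp add: f_def)
 have f_car: "f u \<in> (\<Pi>\<^sub>E mu\<in>?BS. carrier (?D mu))" if "u \<in> carrier ?C" for u
  by (rule PiE_I) (use f_eq(2)[OF _ that] in blast, simp add: f_def)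
 \<comment> \<open>Over a finite index set the direct sum is the full product.\<close>
 have car: "carrier (direct_sum ?BS ?D) = (\<Pi>\<^sub>E mu\<in>?BS. carrier (?D mu))"
  using finite_branching_set[OF part] by (simp add: direct_sum_def)
 show ?thesis
  unfolding module_iso_def
 proof (intro bexI ballI)
  show "f \<in> iso (add_monoid (restrict_scalars (walled_brauer_incl ?r) ?C)) (add_monoid (direct_sum ?BS ?D))"
   unfolding iso_def hom_def mem_Collect_eq
  proof (intro conjI ballI funcsetI)
   let ?M = "add_monoid (restrict_scalars (walled_brauer_incl ?r) ?C)"
   have M: "carrier ?M = carrier ?C" "u \<otimes>\<^bsub>?M\<^esub> v = u \<oplus>\<^bsub>?C\<^esub> v" for u v by (simp_all add: restrict_scalars_def)
   show "f u \<in> carrier (add_monoid (direct_sum ?BS ?D))" if "u \<in> carrier ?M" for u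
    using f_car[OF that[unfolded M(1)]] by (simp add: car)
   show "f (u \<otimes>\<^bsub>?M\<^esub> v) = f u \<otimes>\<^bsub>add_monoid (direct_sum ?BS ?D)\<^esub> f v" if "u \<in> carrier ?M" "v \<in> carrier ?M" for u v
   proof -
    have uv: "u \<in> carrier ?C" "v \<in> carrier ?C" using that by (simp_all only: M(1))
    have "k (u \<oplus>\<^bsub>?C\<^esub> v) = k u + k v" using i_add[OF uv] by (simp add: k_def b_add)
    hence "f (u \<oplus>\<^bsub>?C\<^esub> v) mu = f u mu \<oplus>\<^bsub>?D mu\<^esub> f v mu" if "mu \<in> ?BS" for mu
     using j_add[OF that f_eq(2)[OF that uv(1)] f_eq(2)[OF that uv(2)]] xi_add[OF that kU[OF uv(1)] kU[OF uv(2)]]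
     by (intro f_eqI[OF that]) (simp_all only: f_eq(1)[OF that uv(1)] f_eq(1)[OF that uv(2)])
    thus ?thesis unfolding M(2) by (auto simp: direct_sum_def f_def fun_eq_iff)
   qed
   show "bij_betw f (carrier ?M) (carrier (add_monoid (direct_sum ?BS ?D)))"
    unfolding M(1) bij_betw_def
   proof
    show "inj_on f (carrier ?C)"
    proof (rule inj_onI)
     fix u v assume uv: "u \<in> carrier ?C" "v \<in> carrier ?C" and eq: "f u = f v"
     have "k u = k v"
     proof (rule xi_inj[OF kU[OF uv(1)] kU[OF uv(2)]])
      fix mu assume mu: "mu \<in> ?BS"
      show "Xi mu (k u) = Xi mu (k v)"
       unfolding f_eq(1)[OF mu uv(1), symmetric] f_eq(1)[OF mu uv(2), symmetric] eq by (rule refl)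
     qed
     thus "u = v" using bij_betw_imp_inj_on[OF k] uv by (simp add: inj_on_def)
    qed
    show "f ` carrier ?C = carrier (add_monoid (direct_sum ?BS ?D))"
    proof (intro subset_antisym subsetI)
     fix w assume "w \<in> f ` carrier ?C"
     then obtain u where "u \<in> carrier ?C" "w = f u" by blast
     thus "w \<in> carrier (add_monoid (direct_sum ?BS ?D))"
      using f_car[of u] by (simp add: car)
    next
     fix w assume "w \<in> carrier (add_monoid (direct_sum ?BS ?D))"
     hence w: "w \<in> (\<Pi>\<^sub>E mu\<in>?BS. carrier (?D mu))" by (simp add: car)
     have "j mu (w mu) \<in> infl_space' ?r mu" if "mu \<in> ?BS" for mu
      using bij_betw_apply[OF j[OF that]] PiE_mem[OF w that] by blast
     from xi_surj[OF this] obtain F where F: "F \<in> ?U" "\<And>mu. mu \<in> ?BS ==> Xi mu F = j mu (w mu)" by blast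
     have "F \<in> k ` carrier ?C" unfolding bij_betw_imp_surj_on[OF k] by (rule F(1))
     then obtain u where u: "u \<in> carrier ?C" "k u = F" by blast
     have "f u = w"
     proof (rule PiE_ext[OF _ w])
      show "f u \<in> (\<Pi>\<^sub>E mu\<in>?BS. carrier (?D mu))" by (rule f_car[OF u(1)])
      show "f u mu = w mu" if "mu \<in> ?BS" for mu
       using F(2)[OF that] u(2) PiE_mem[OF w that] by (intro f_eqI[OF that]) simp_all
     qed
     thus "w \<in> f ` carrier ?C" using u(1) by blast
    qed
   qed
  qed
  fix a m assume a: "a \<in> carrier (walled_brauer \<delta> ?r)"
   and "m \<in> carrier (restrict_scalars (walled_brauer_incl ?r) ?C)"
  hence m: "m \<in> carrier ?C" by (simp add: restrict_scalars_def)
  let ?m = "walled_brauer_incl ?r a \<odot>\<^bsub>?C\<^esub> m"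
  have "k ?m = diag_act \<delta> (bent (sum_list lam1) (sum_list lam2) ?r) ?r a (k m)"
   unfolding k_def conjunct2[OF i_act[OF m]] by (rule b_act)
  hence "f ?m mu = a \<odot>\<^bsub>?D mu\<^esub> f m mu" if "mu \<in> ?BS" for mu
   using j_act[OF that f_eq(2)[OF that m], of a] xi_act[OF that a kU[OF m]]
   by (intro f_eqI[OF that]) (simp_all add: f_eq(1)[OF that m])
  thus "f (a \<odot>\<^bsub>restrict_scalars (walled_brauer_incl ?r) ?C\<^esub> m) = a \<odot>\<^bsub>direct_sum ?BS ?D\<^esub> f m"
   by (auto simp: restrict_scalars_def direct_sum_def f_def fun_eq_iff)
 qed
 qed
qed

end
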